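(* Let $\Pi\subset\mathbb{R}_{\ge 0}^2$ be a polygon and let $r>1$ be the number of broken edges of $\Pi$. Then: (i) the ambient surface $S(\Pi)$ is orientable if and only if the parity of the segments of $\partial\Pi$ (the edges of $\Pi$) takes only two values; (ii) if $S(\Pi)$ is orientable, then $r$ is even and $S(\Pi)$ is the connected sum of $r/2-1$ tori (a sphere if $r=2$); (iii) if $S(\Pi)$ is not orientable, then it is the connected sum of $r-2$ projective planes.
   Context: Polygons. A segment is a straight segment in $\mathbb{R}^2$ with integer endpoints. A closed polygonal line is a finite cyclic union of segments, consecutive ones sharing an endpoint, the union of two consecutive segments never being a segment. A polygon is a (possibly non-convex) subset of $\mathbb{R}^2$ homeomorphic to a disk and bounded by a closed polygonal line; its edges are the segments of that line and its vertices are their endpoints. Parity. The parity of an integer point $(p_1,p_2)$ is $(p_1 \bmod 2, p_2 \bmod 2)\in(\mathbb{Z}/2)^2$. The integer points of a segment take exactly two parities; the parity of the segment is their sum (it is never $(0,0)$). The parity of a vertex of a polygon is the sum of the parities of the two segments underlying the edges meeting at it. A parity is even if it is $(0,0)$, odd otherwise. The vertices of odd parity divide the boundary of the polygon into connected components, whose closures are the broken edges of the polygon (if there is no vertex of odd parity, the whole boundary is the only broken edge). Ambient surface. For $a,b\in\{0,1\}$ let $\sigma_{a,b}(x,y)=((-1)^a x,(-1)^b y)$. Given a polygon $\Pi\subset\mathbb{R}_{\ge0}^2$, the ambient surface $S(\Pi)$ is the quotient of the disjoint union $\bigsqcup_{a,b\in\{0,1\}}\sigma_{a,b}\cdot\Pi$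 obtained as follows: for each copy $\sigma_{g,h}\cdot\Pi$ and each edge $e$ of $\Pi$ of (segment) parity $(c,d)$, every point $P\in\sigma_{g,h}\cdot e$ of this copy is identified with the point $\sigma_{a,b}(P)$ of the copy $\sigma_{a,b}\sigma_{g,h}\cdot\Pi$, where $(a,b)=(d,c)$ mod 2 is the unique nonzero pair with $ac+bd=0$ mod 2. $S(\Pi)$ is a surface without boundary. *)

theory Defs
  imports
    "HOL-Complex_Analysis.Complex_Analysis"
    "HOL-Library.Z2"
begin

section \<open>Lattice polygons\<close>

definition lattice_point :: "int \<times> int \<Rightarrow> real \<times> real" where
  "lattice_point p = (real_of_int (fst p), real_of_int (snd p))"

definition lattice_segment :: "(real \<times> real) set \<Rightarrow> bool" where
  "lattice_segment S \<longleftrightarrow>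
     (\<exists>p q. p \<noteq> q \<and> S = closed_segment (lattice_point p) (lattice_point q))"

text \<open>
  A closed polygonal line is given by the list of its vertices in cyclic order. Edge number i
  joins vertex number i to the next one, and edge number i + 1 starts where edge number i ends.
\<close>

definition edge :: "(int \<times> int) list \<Rightarrow> nat \<Rightarrow> (real \<times> real) set" where
  "edge vs i = closed_segment (lattice_point (vs ! (i mod length vs)))
                              (lattice_point (vs ! (Suc i mod length vs)))"

definition edges :: "(int \<times> int) list \<Rightarrow> (real \<times> real) set set" where
  "edges vs = edge vs ` {..<length vs}"

text \<open>
  \<^term>\<open>distinct vs\<close> says that the line is listed once around, not several times around.
\<close>

definition closed_polygonal_line :: "(int \<times> int) list \<Rightarrow> bool" where
  "closed_polygonal_line vs \<longleftrightarrow>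
     vs \<noteq> [] \<and> distinct vs \<and>
     (\<forall>i < length vs. lattice_segment (edge vs i)) \<and>
     (\<forall>i < length vs. \<not> lattice_segment (edge vs i \<union> edge vs (Suc i)))"

definition lattice_polygon :: "(real \<times> real) set \<Rightarrow> (int \<times> int) list \<Rightarrow> bool" where
  "lattice_polygon P vs \<longleftrightarrow>
     closed_polygonal_line vs \<and>
     P homeomorphic cball (0 :: real \<times> real) 1 \<and>
     frontier P = \<Union>(edges vs)"


section \<open>Parity and broken edges\<close>

definition parity :: "int \<times> int \<Rightarrow> bit \<times> bit" where
  "parity p = (of_int (fst p), of_int (snd p))"

text \<open>
  The sum ranges over the set of parities that occur on the segment, each parity counted once.
\<close>

definition segment_parity :: "(real \<times> real) set \<Rightarrow> bit \<times> bit" where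
  "segment_parity S = (\<Sum>c \<in> parity ` {p. lattice_point p \<in> S}. c)"

text \<open>
  Vertex number i + 1 (cyclically) is the common endpoint of the edges number i and i + 1.
\<close>

definition odd_vertices :: "(int \<times> int) list \<Rightarrow> (real \<times> real) set" where
  "odd_vertices vs =
     {lattice_point (vs ! (Suc i mod length vs)) | i.
        i < length vs \<and>
        segment_parity (edge vs i) + segment_parity (edge vs (Suc i)) \<noteq> (0, 0)}"

definition broken_edges :: "(real \<times> real) set \<Rightarrow> (int \<times> int) list \<Rightarrow> (real \<times> real) set set" where
  "broken_edges P vs = closure ` components (frontier P - odd_vertices vs)"


section \<open>Quotients and disjoint unions of spaces\<close>

definition quotient_topology :: "'a topology \<Rightarrow> ('a \<times> 'a) set \<Rightarrow> 'a set topology" where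
  "quotient_topology X R =
     topology (\<lambda>\<U>. \<U> \<subseteq> topspace X // R \<and> openin X (\<Union>\<U>))"

lemma openin_quotient_topology:
  assumes "equiv (topspace X) R"
  shows "openin (quotient_topology X R) \<U> \<longleftrightarrow> \<U> \<subseteq> topspace X // R \<and> openin X (\<Union>\<U>)"
proof -
  have "istopology (\<lambda>\<U>. \<U> \<subseteq> topspace X // R \<and> openin X (\<Union>\<U>))"
    unfolding istopology_def
  proof (intro conjI allI impI)
    fix S T
    assume S: "S \<subseteq> topspace X // R \<and> openin X (\<Union>S)"
      and T: "T \<subseteq> topspace X // R \<and> openin X (\<Union>T)"
    show "S \<inter> T \<subseteq> topspace X // R"
      using S by blast
    have "\<Union>(S \<inter> T) = \<Union>S \<inter> \<Union>T"
      using S T quotient_disj[OF assms] by blast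
    then show "openin X (\<Union>(S \<inter> T))"
      using S T by auto
  next
    fix \<K>
    assume K: "\<forall>K\<in>\<K>. K \<subseteq> topspace X // R \<and> openin X (\<Union>K)"
    then show "\<Union>\<K> \<subseteq> topspace X // R"
      by blast
    have "\<Union>(\<Union>\<K>) = \<Union>(Union ` \<K>)"
      by blast
    then show "openin X (\<Union>(\<Union>\<K>))"
      using K by (metis (no_types, lifting) imageE openin_Union)
  qed
  then show ?thesis
    by (simp add: quotient_topology_def)
qed

definition glue :: "'a topology \<Rightarrow> ('a \<times> 'a) set \<Rightarrow> 'a set topology" where
  "glue X r = quotient_topology X ((r \<union> r\<inverse>)\<^sup>* \<inter> topspace X \<times> topspace X)"

lemma equiv_glue: "equiv (topspace X) ((r \<union> r\<inverse>)\<^sup>* \<inter> topspace X \<times> topspace X)"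
proof -
  have "sym ((r \<union> r\<inverse>)\<^sup>*)"
    by (simp add: sym_Un_converse sym_rtrancl)
  then show ?thesis
    by (auto simp: equiv_def refl_on_def sym_def trans_def)
qed

definition disjoint_union :: "'a topology \<Rightarrow> 'b topology \<Rightarrow> ('a + 'b) topology" where
  "disjoint_union X Y =
     topology (\<lambda>U. U \<subseteq> topspace X <+> topspace Y \<and> openin X (Inl -` U) \<and> openin Y (Inr -` U))"

lemma openin_disjoint_union_iff:
  "openin (disjoint_union X Y) U \<longleftrightarrow>
     U \<subseteq> topspace X <+> topspace Y \<and> openin X (Inl -` U) \<and> openin Y (Inr -` U)"
proof -
  have "istopology (\<lambda>U. U \<subseteq> topspace X <+> topspace Y \<and> openin X (Inl -` U) \<and> openin Y (Inr -` U))"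
    unfolding istopology_def
    by (auto simp: vimage_Union)
  then show ?thesis
    by (simp add: disjoint_union_def)
qed


section \<open>The ambient surface\<close>

fun reflect :: "bit \<times> bit \<Rightarrow> real \<times> real \<Rightarrow> real \<times> real" where
  "reflect (a, b) (x, y) = (if a = 0 then x else - x, if b = 0 then y else - y)"

text \<open>
  A point of the disjoint union is a pair consisting of the index of a copy and a point of that
  copy. An edge of parity (c, d) is glued by means of (a, b) = (d, c), whence the swap.
\<close>

definition edge_gluing ::
  "(int \<times> int) list \<Rightarrow> (((bit \<times> bit) \<times> (real \<times> real)) \<times> ((bit \<times> bit) \<times> (real \<times> real))) set" where
  "edge_gluing vs =
     {((g, p), (prod.swap (segment_parity e) + g, reflect (prod.swap (segment_parity e)) p)) | g e p.
        e \<in> edges vs \<and> p \<in> reflect g ` e}"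

definition ambient_surface ::
  "(real \<times> real) set \<Rightarrow> (int \<times> int) list \<Rightarrow> ((bit \<times> bit) \<times> (real \<times> real)) set topology" where
  "ambient_surface P vs =
     glue (sum_topology (\<lambda>g. top_of_set (reflect g ` P)) UNIV) (edge_gluing vs)"


section \<open>Orientability\<close>

text \<open>
  A homeomorphism between open subsets of the plane preserves the orientation if it has local
  degree 1 everywhere, that is, if the image of every small circle, run through anticlockwise,
  winds once anticlockwise around the image of the centre.
\<close>

definition orientation_preserving_on :: "complex set \<Rightarrow> (complex \<Rightarrow> complex) \<Rightarrow> bool" where
  "orientation_preserving_on U f \<longleftrightarrow>
     (\<forall>z r. 0 < r \<and> cball z r \<subseteq> U \<longrightarrow> winding_number (f \<circ> circlepath z r) (f z) = 1)"

definition chart :: "'a topology \<Rightarrow> 'a set \<Rightarrow> ('a \<Rightarrow> complex) \<Rightarrow> bool" where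
  "chart X U \<phi> \<longleftrightarrow>
     openin X U \<and> open (\<phi> ` U) \<and> homeomorphic_map (subtopology X U) (top_of_set (\<phi> ` U)) \<phi>"

definition oriented_atlas :: "'a topology \<Rightarrow> ('a set \<times> ('a \<Rightarrow> complex)) set \<Rightarrow> bool" where
  "oriented_atlas X \<A> \<longleftrightarrow>
     (\<forall>(U, \<phi>) \<in> \<A>. chart X U \<phi>) \<and>
     (\<Union>(U, \<phi>) \<in> \<A>. U) = topspace X \<and>
     (\<forall>(U, \<phi>) \<in> \<A>. \<forall>(V, \<psi>) \<in> \<A>.
        orientation_preserving_on (\<phi> ` (U \<inter> V)) (\<psi> \<circ> inv_into U \<phi>))"

text \<open>Meaningful for surfaces without boundary only.\<close>

definition orientable :: "'a topology \<Rightarrow> bool" where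
  "orientable X \<longleftrightarrow> (\<exists>\<A>. oriented_atlas X \<A>)"


section \<open>Connected sums\<close>

text \<open>
  The interiors of a closed disc in Y and of a closed disc in Z are removed, and the two boundary
  circles are identified. The discs are given by parametrizations f and g, and the identification
  of the circles is the one induced by them; since every homeomorphism of the circle extends to the
  disc, every identification of the circles arises in this way.
\<close>

definition connected_sum :: "'a topology \<Rightarrow> 'b topology \<Rightarrow> 'c topology \<Rightarrow> bool" where
  "connected_sum Y Z X \<longleftrightarrow>
     (\<exists>f g. embedding_map (top_of_set (cball (0 :: complex) 1)) Y f \<and>
            embedding_map (top_of_set (cball (0 :: complex) 1)) Z g \<and>
            X homeomorphic_space
              glue (disjoint_union (subtopology Y (- f ` ball 0 1)) (subtopology Z (- g ` ball 0 1)))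
                   {(Inl (f u), Inr (g u)) | u. u \<in> sphere 0 1})"

text \<open>
  X is homeomorphic to the connected sum of n copies of M, the sphere being the empty connected sum.
  The intermediate sums live on the type of X; this is no restriction when that type has at
  least the cardinality of the continuum, because every surface then has a homeomorphic copy on it.
\<close>

inductive connected_sum_of_copies :: "'b topology \<Rightarrow> nat \<Rightarrow> 'a topology \<Rightarrow> bool" for M where
  empty: "X homeomorphic_space top_of_set (sphere (0 :: real ^ 3) 1)
            \<Longrightarrow> connected_sum_of_copies M 0 X"
| single: "X homeomorphic_space M \<Longrightarrow> connected_sum_of_copies M 1 X"
| step: "connected_sum_of_copies M n Y \<Longrightarrow> 1 \<le> n \<Longrightarrow> connected_sum Y M X
            \<Longrightarrow> connected_sum_of_copies M (Suc n) X"

definition torus :: "(complex \<times> complex) topology" where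
  "torus = top_of_set (sphere 0 1 \<times> sphere 0 1)"

definition projective_plane :: "(real ^ 3) set topology" where
  "projective_plane = glue (top_of_set (sphere 0 1)) {(x, - x) | x. x \<in> sphere 0 1}"

end

theory Submission
  imports Defs
begin

text \<open>
  The surface depends only on the cyclic word of the labels of the edges: boundary parametrizations
  extend to the discs by coning. Merging equal neighbouring letters turns the word into one whose
  neighbouring letters differ, and its length is then the number of broken edges. Cutting off a corner
  of the disc between the labels a and b exhibits the surface as a connected sum; the piece split off is a
  projective plane for the word b, a + b, a and a torus for the word b, a, b, a. Induction on the
  length gives the connected sums, starting from the sphere with the word b, a.

  At a corner the four copies fit together to a chart of the surface. With two labels, each copy can
  be given a sign that changes across every edge, so that the charts can be oriented coherently. With
  three labels a, b, a + b the sign of a copy would have to change under adding each of them, which is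
  impossible.
\<close>

section \<open>Quotient spaces\<close>

text \<open>The homeomorphisms between glued spaces start from a map on a compact disjoint union: a
  continuous surjection onto a Hausdorff space is a quotient map, and quotient maps with the same
  fibres have homeomorphic images. The fibres are described by a subgroup of (Z/2)^2 at each point,
  so that only the sets carrying a given label matter, not the single edges. To remove the
  reflections from the gluing, copy g is pulled back to the polygon; all gluings then fix the point
  and translate the index. The labels are the edge parities with the coordinates swapped. There are
  three nonzero elements, which is why an alternating word has two or three different letters and
  why two different letters always form a basis of the group. Two obstacles shape the rest. The
  polygonal line is not assumed to be simple, so its injectivity has to be derived from the boundary
  of P being a circle. And orientation is defined by winding numbers of images of circles, so a
  multiplicative local degree is needed before charts can be compared.\<close>

lemma topspace_quotient_topology:
  assumes "equiv (topspace X) R"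
  shows "topspace (quotient_topology X R) = topspace X // R"
proof -
  have "openin (quotient_topology X R) (topspace X // R)"
    by (simp add: openin_quotient_topology[OF assms] Union_quotient[OF assms])
  then show ?thesis
    using openin_quotient_topology[OF assms] by (metis openin_subset openin_topspace subset_antisym)
qed

lemma quotient_map_quotient_topology:
  assumes "equiv (topspace X) R"
  shows "quotient_map X (quotient_topology X R) (\<lambda>x. R `` {x})"
proof -
  have "{x \<in> topspace X. R `` {x} \<in> U} = \<Union>U" if "U \<subseteq> topspace X // R" for U
  proof (intro subset_antisym subsetI)
    fix x assume "x \<in> {x \<in> topspace X. R `` {x} \<in> U}"
    then show "x \<in> \<Union>U"
      using equiv_class_self[OF assms] by blast
  next
    fix x assume "x \<in> \<Union>U"
    then obtain C where C: "C \<in> U" "x \<in> C" by blast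
    with that have "C \<in> topspace X // R" by blast
    then obtain y where "y \<in> topspace X" "C = R `` {y}" by (auto elim: quotientE)
    with C have "C = R `` {x}" "x \<in> topspace X"
      using assms by (auto simp: equiv_class_eq_iff[OF assms] dest: equiv_class_eq)
    with C show "x \<in> {x \<in> topspace X. R `` {x} \<in> U}" by simp
  qed
  then show ?thesis
    unfolding quotient_map_def topspace_quotient_topology[OF assms]
    by (auto simp: openin_quotient_topology[OF assms] quotient_def)
qed

text \<open>Each map factors through the other one, and the two factors are mutually inverse because
  the quotient maps are surjective.\<close>

lemma homeomorphic_space_quotient_maps:
  assumes f: "quotient_map X Y f" and g: "quotient_map X Z g"
    and eq: "\<And>x y. \<lbrakk>x \<in> topspace X; y \<in> topspace X\<rbrakk> \<Longrightarrow> f x = f y \<longleftrightarrow> g x = g y"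
  shows "Y homeomorphic_space Z"
proof -
  obtain h where h: "continuous_map Y Z h" "\<And>x. x \<in> topspace X \<Longrightarrow> h (f x) = g x"
    using quotient_map_lift_exists[OF f quotient_imp_continuous_map[OF g]] eq by metis
  obtain k where k: "continuous_map Z Y k" "\<And>x. x \<in> topspace X \<Longrightarrow> k (g x) = f x"
    using quotient_map_lift_exists[OF g quotient_imp_continuous_map[OF f]] eq by metis
  have "homeomorphic_maps Y Z h k"
    unfolding homeomorphic_maps_def
    using h k quotient_imp_surjective_map[OF f] quotient_imp_surjective_map[OF g] by (metis imageE)
  then show ?thesis
    by (auto simp: homeomorphic_space_def)
qed

definition glue_map :: "'a topology \<Rightarrow> ('a \<times> 'a) set \<Rightarrow> 'a \<Rightarrow> 'a set" where
  "glue_map X r x = ((r \<union> r\<inverse>)\<^sup>* \<inter> topspace X \<times> topspace X) `` {x}"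

lemma quotient_map_glue: "quotient_map X (glue X r) (glue_map X r)"
  unfolding glue_def glue_map_def[abs_def]
  by (rule quotient_map_quotient_topology[OF equiv_glue])

lemma glue_map_eq_iff:
  assumes "x \<in> topspace X" "y \<in> topspace X"
  shows "glue_map X r x = glue_map X r y \<longleftrightarrow> (x, y) \<in> (r \<union> r\<inverse>)\<^sup>*"
  unfolding glue_map_def using eq_equiv_class_iff[OF equiv_glue assms] assms by simp

lemma topspace_glue: "topspace (glue X r) = glue_map X r ` topspace X"
  using quotient_imp_surjective_map[OF quotient_map_glue] by metis

lemma glue_homeomorphic_space:
  assumes "quotient_map X Y f"
    and "\<And>x y. \<lbrakk>x \<in> topspace X; y \<in> topspace X\<rbrakk> \<Longrightarrow> f x = f y \<longleftrightarrow> (x, y) \<in> (r \<union> r\<inverse>)\<^sup>*"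
  shows "glue X r homeomorphic_space Y"
  using homeomorphic_space_quotient_maps[OF quotient_map_glue assms(1)] assms(2) glue_map_eq_iff
  by metis

lemma respects_rtrancl_symcl:
  assumes "(x, y) \<in> (r \<union> r\<inverse>)\<^sup>*" and "\<And>x y. (x, y) \<in> r \<Longrightarrow> f x = f y"
  shows "f x = f y"
  using assms(1) by (induction rule: rtrancl_induct) (auto dest: assms(2))

text \<open>Such a map is closed: closed sets are compact, and so are their images. Openness of
  preimages then never has to be examined directly.\<close>

lemma quotient_map_compact_Hausdorff:
  assumes "continuous_map X Y f" "compact_space X" "Hausdorff_space Y" "f ` topspace X = topspace Y"
  shows "quotient_map X Y f"
  using assms by (intro continuous_closed_imp_quotient_map T1_Spaces.continuous_imp_closed_map)

section \<open>Sum topologies and disjoint unions\<close>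

lemma continuous_map_sum_topology:
  "continuous_map (sum_topology X I) Y f \<longleftrightarrow> (\<forall>i\<in>I. continuous_map (X i) Y (\<lambda>x. f (i, x)))"
proof
  assume f: "continuous_map (sum_topology X I) Y f"
  show "\<forall>i\<in>I. continuous_map (X i) Y (\<lambda>x. f (i, x))"
    using continuous_map_compose[OF continuous_map_component_injection f] by (auto simp: o_def)
next
  assume R: "\<forall>i\<in>I. continuous_map (X i) Y (\<lambda>x. f (i, x))"
  show "continuous_map (sum_topology X I) Y f"
    unfolding continuous_map
  proof (intro conjI allI impI)
    show "f ` topspace (sum_topology X I) \<subseteq> topspace Y"
      using R by (fastforce simp: continuous_map)
    fix U assume "openin Y U"
    have "{x. (i, x) \<in> {x \<in> topspace (sum_topology X I). f x \<in> U}} = {x \<in> topspace (X i). f (i, x) \<in> U}"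
      if "i \<in> I" for i using that by auto
    with \<open>openin Y U\<close> R show "openin (sum_topology X I) {x \<in> topspace (sum_topology X I). f x \<in> U}"
      by (auto simp: openin_sum_topology continuous_map)
  qed
qed

lemma compact_space_sum_topology:
  assumes "finite I" "\<And>i. i \<in> I \<Longrightarrow> compact_space (X i)"
  shows "compact_space (sum_topology X I)"
proof -
  have "compactin (sum_topology X I) (Pair i ` topspace (X i))" if "i \<in> I" for i
    using image_compactin[OF _ continuous_map_component_injection[OF that]] assms(2)[OF that]
    by (auto simp: compact_space_def)
  then have "compactin (sum_topology X I) (\<Union>i\<in>I. Pair i ` topspace (X i))"
    using assms(1) by (intro compactin_Union) auto
  also have "(\<Union>i\<in>I. Pair i ` topspace (X i)) = topspace (sum_topology X I)"
    by auto
  finally show ?thesis by (simp add: compact_space_def)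
qed

lemma Hausdorff_space_sum_topology:
  assumes "\<And>i. i \<in> I \<Longrightarrow> Hausdorff_space (X i)"
  shows "Hausdorff_space (sum_topology X I)"
  unfolding Hausdorff_space_def
proof (intro allI impI)
  fix p q assume "p \<in> topspace (sum_topology X I) \<and> q \<in> topspace (sum_topology X I) \<and> p \<noteq> q"
  then obtain i x j y where p: "p = (i, x)" "i \<in> I" "x \<in> topspace (X i)"
    and q: "q = (j, y)" "j \<in> I" "y \<in> topspace (X j)" and ne: "p \<noteq> q"
    by (cases p; cases q) auto
  have op: "openin (sum_topology X I) (Pair k ` U)" if "k \<in> I" "openin (X k) U" for k U
    using open_map_component_injection[OF that(1)] that(2) by (auto simp: open_map_def)
  show "\<exists>U V. openin (sum_topology X I) U \<and> openin (sum_topology X I) V \<and> p \<in> U \<and> q \<in> V \<and> disjnt U V"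
  proof (cases "i = j")
    case True
    then obtain U V where "openin (X i) U" "openin (X i) V" "x \<in> U" "y \<in> V" "disjnt U V"
      using assms[OF p(2)] p q ne unfolding Hausdorff_space_def by blast
    then show ?thesis
      using op p q True by (intro exI[of _ "Pair i ` U"] exI[of _ "Pair i ` V"]) (auto simp: disjnt_iff)
  next
    case False
    then show ?thesis
      using op p q by (intro exI[of _ "Pair i ` topspace (X i)"] exI[of _ "Pair j ` topspace (X j)"])
        (auto simp: disjnt_iff)
  qed
qed

lemma topspace_disjoint_union [simp]: "topspace (disjoint_union X Y) = topspace X <+> topspace Y"
proof -
  have "Inl -` (topspace X <+> topspace Y) = topspace X" "Inr -` (topspace X <+> topspace Y) = topspace Y"
    by auto
  then have "openin (disjoint_union X Y) (topspace X <+> topspace Y)"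
    by (simp add: openin_disjoint_union_iff)
  then show ?thesis
    by (metis openin_disjoint_union_iff openin_subset openin_topspace subset_antisym)
qed

lemma continuous_map_Inl: "continuous_map X (disjoint_union X Y) Inl"
  unfolding continuous_map openin_disjoint_union_iff
  by (auto simp: vimage_def intro: openin_subopen[THEN iffD2] elim!: back_subst[of "openin X"] dest: openin_subset)

lemma continuous_map_Inr: "continuous_map Y (disjoint_union X Y) Inr"
  unfolding continuous_map openin_disjoint_union_iff
  by (auto simp: vimage_def intro: openin_subopen[THEN iffD2] elim!: back_subst[of "openin Y"] dest: openin_subset)

lemma continuous_map_disjoint_union:
  assumes "continuous_map X Z (\<lambda>x. f (Inl x))" "continuous_map Y Z (\<lambda>y. f (Inr y))"
  shows "continuous_map (disjoint_union X Y) Z f"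
  unfolding continuous_map
proof (intro conjI allI impI)
  show "f ` topspace (disjoint_union X Y) \<subseteq> topspace Z"
    using assms by (auto simp: continuous_map)
  fix U assume U: "openin Z U"
  have "Inl -` {x \<in> topspace (disjoint_union X Y). f x \<in> U} = {x \<in> topspace X. f (Inl x) \<in> U}"
    "Inr -` {x \<in> topspace (disjoint_union X Y). f x \<in> U} = {x \<in> topspace Y. f (Inr x) \<in> U}"
    by auto
  with U assms show "openin (disjoint_union X Y) {x \<in> topspace (disjoint_union X Y). f x \<in> U}"
    by (auto simp: openin_disjoint_union_iff continuous_map)
qed

lemma compact_space_disjoint_union:
  assumes "compact_space X" "compact_space Y"
  shows "compact_space (disjoint_union X Y)"
proof -
  have "compactin (disjoint_union X Y) (Inl ` topspace X)" "compactin (disjoint_union X Y) (Inr ` topspace Y)"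
    using assms image_compactin[OF _ continuous_map_Inl] image_compactin[OF _ continuous_map_Inr]
    by (auto simp: compact_space_def)
  then have "compactin (disjoint_union X Y) (Inl ` topspace X \<union> Inr ` topspace Y)"
    by (rule compactin_Un)
  then show ?thesis by (simp add: compact_space_def Plus_def)
qed

section \<open>Surfaces glued from four copies of a disc\<close>

text \<open>Labels and copies are indexed by pairs of bits; splitting quantified pairs into bits
  would destroy the group notation.\<close>

declare split_paired_All [simp del] split_paired_Ex [simp del]

lemma bit_pair_add_self [simp]: "a + a = (0 :: bit \<times> bit)"
  by (cases a) (simp add: zero_prod_def)

lemma bit_pair_add_left_self [simp]: "a + (a + b) = (b :: bit \<times> bit)"
  by (metis bit_pair_add_self add.assoc add_0)

lemma bit_pair_add_eq_0_iff: "a + b = 0 \<longleftrightarrow> a = b" for a b :: "bit \<times> bit"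
  by (metis add_0_right bit_pair_add_self bit_pair_add_left_self)

lemma UNIV_bit_pair: "(UNIV :: (bit \<times> bit) set) = {0, (0, 1), (1, 0), (1, 1)}"
  by (auto simp: zero_prod_def)

lemma finite_bit_pair [simp]: "finite (S :: (bit \<times> bit) set)"
  by (rule finite_subset[OF subset_UNIV]) (simp add: UNIV_bit_pair)

text \<open>The three nonzero elements add up to zero. Hence two different labels generate the whole
  group, and the only possible third label is their sum.\<close>

lemma bit_pair_sum_of_distinct:
  fixes a b c :: "bit \<times> bit"
  assumes "a \<noteq> 0" "b \<noteq> 0" "c \<noteq> 0" "a \<noteq> b" "b \<noteq> c" "a \<noteq> c"
  shows "a + b = c"
proof -
  have cases: "x = 0 \<or> x = (0, 1) \<or> x = (1, 0) \<or> x = (1, 1)" for x :: "bit \<times> bit"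
    by (cases x) (auto simp: zero_prod_def)
  have sums: "(1, 0) + (0, 1) = (1 :: bit, 1 :: bit)" "(1, 0) + (1, 1) = (0 :: bit, 1 :: bit)"
    "(0, 1) + (1, 1) = (1 :: bit, 0 :: bit)"
    by simp_all
  show ?thesis
    using cases[of a] cases[of b] cases[of c] assms sums add.commute by metis
qed

text \<open>The gluing of the copies after each of them has been reflected back onto the disc, so
  that only the index moves.\<close>

definition mirror_rel :: "(bit \<times> bit \<Rightarrow> 'a set) \<Rightarrow> (((bit \<times> bit) \<times> 'a) \<times> ((bit \<times> bit) \<times> 'a)) set" where
  "mirror_rel F = {((g, p), (s + g, p)) | g s p. p \<in> F s}"

abbreviation four_copies :: "'a::topological_space set \<Rightarrow> ((bit \<times> bit) \<times> 'a) topology" where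
  "four_copies D \<equiv> sum_topology (\<lambda>_. top_of_set D) UNIV"

text \<open>The basic construction of Vinberg and Davis for the group (Z/2)^2 with mirrors
  \<open>F s\<close>. Working with the sets \<open>F s\<close> instead of a list of edges makes
  merging of equal neighbouring letters invisible.\<close>

definition mirror_space ::
  "'a::topological_space set \<Rightarrow> (bit \<times> bit \<Rightarrow> 'a set) \<Rightarrow> ((bit \<times> bit) \<times> 'a) set topology" where
  "mirror_space D F = glue (four_copies D) (mirror_rel F)"

definition mirror_map ::
  "'a::topological_space set \<Rightarrow> (bit \<times> bit \<Rightarrow> 'a set) \<Rightarrow> (bit \<times> bit) \<times> 'a \<Rightarrow> ((bit \<times> bit) \<times> 'a) set" where
  "mirror_map D F = glue_map (four_copies D) (mirror_rel F)"

text \<open>The subgroup generated by the labels of a point; sums of two labels suffice in a group of order four.\<close>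

definition mirror_group :: "(bit \<times> bit \<Rightarrow> 'a set) \<Rightarrow> 'a \<Rightarrow> (bit \<times> bit) set" where
  "mirror_group F p = {0} \<union> {s. p \<in> F s} \<union> {s + t | s t. p \<in> F s \<and> p \<in> F t}"

definition mirrored :: "'a::topological_space set \<Rightarrow> (bit \<times> bit \<Rightarrow> 'a set) \<Rightarrow> bool" where
  "mirrored D F \<longleftrightarrow> compact D \<and> (\<forall>s. closed (F s) \<and> F s \<subseteq> D)"

lemma topspace_four_copies [simp]: "topspace (four_copies D) = UNIV \<times> D"
  by auto

lemma zero_in_mirror_group [simp]: "0 \<in> mirror_group F p"
  by (simp add: mirror_group_def)

lemma mirror_group_cong: "{s. p \<in> F s} = {s. q \<in> G s} \<Longrightarrow> mirror_group F p = mirror_group G q"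
  unfolding mirror_group_def by blast

lemma mirror_group_label: "p \<in> F s \<Longrightarrow> s \<in> mirror_group F p"
  unfolding mirror_group_def by blast

lemma mirror_group_sum: "p \<in> F s \<Longrightarrow> p \<in> F t \<Longrightarrow> s + t \<in> mirror_group F p"
  unfolding mirror_group_def by blast

lemma mirror_group_cases:
  assumes "k \<in> mirror_group F p"
  obtains "k = 0" | "p \<in> F k" | u v where "k = u + v" "p \<in> F u" "p \<in> F v"
  using assms unfolding mirror_group_def by blast

text \<open>A sum of three labels reduces to at most two: equal labels cancel, and three different
  nonzero labels sum to zero. Hence the set is closed under adding labels, although it is written
  with at most two summands.\<close>

lemma mirror_group_closed:
  assumes "k \<in> mirror_group F p" "p \<in> F s"
  shows "k + s \<in> mirror_group F p"
  using assms(1)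
proof (cases rule: mirror_group_cases)
  case (3 u v)
  consider "u = 0" | "v = 0" | "s = 0" | "u = v" | "u = s" | "v = s"
    | "u \<noteq> 0" "v \<noteq> 0" "s \<noteq> 0" "u \<noteq> v" "u \<noteq> s" "v \<noteq> s"
    by blast
  then show ?thesis
  proof cases
    case 5
    then have "k + s = v" using 3 by (metis add.commute bit_pair_add_left_self)
    then show ?thesis using mirror_group_label[of p F v] 3 by metis
  next
    case 6
    then have "k + s = u" using 3 by (metis add.commute bit_pair_add_left_self)
    then show ?thesis using mirror_group_label[of p F u] 3 by metis
  next
    case 7
    then have "u + v = s" by (intro bit_pair_sum_of_distinct)
    then show ?thesis using 3 by simp
  qed (use 3 assms mirror_group_label mirror_group_sum in simp_all)
qed (use assms mirror_group_label mirror_group_sum in simp_all)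

text \<open>The classes are the cosets of the stabilizer of a point. One direction follows a chain
  of gluings, each of which adds a label of the fixed point to the index; for the other, two gluings
  suffice.\<close>

lemma mirror_rel_symcl_iff:
  "((g, p), (h, q)) \<in> (mirror_rel F \<union> (mirror_rel F)\<inverse>)\<^sup>* \<longleftrightarrow> p = q \<and> g + h \<in> mirror_group F p"
  (is "?l \<longleftrightarrow> ?r")
proof
  have *: "snd x = snd y \<and> fst x + fst y \<in> mirror_group F (snd x)"
    if "(x, y) \<in> (mirror_rel F \<union> (mirror_rel F)\<inverse>)\<^sup>*" for x y
    using that
  proof (induction rule: rtrancl_induct)
    case (step y z)
    \<comment> \<open>In characteristic two the reversed gluing step adds the same label
      again.\<close>
    have "\<exists>s. snd z = snd y \<and> snd y \<in> F s \<and> fst z = s + fst y"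
    proof -
      consider g s p where "y = (g, p)" "z = (s + g, p)" "p \<in> F s"
        | g s p where "z = (g, p)" "y = (s + g, p)" "p \<in> F s"
        using step.hyps(2) unfolding mirror_rel_def by blast
      then show ?thesis
      proof cases
        case 2
        then show ?thesis by (intro exI[of _ s]) simp
      qed auto
    qed
    then obtain s where s: "snd z = snd y" "snd y \<in> F s" "fst z = s + fst y"
      by blast
    then have eq: "fst x + fst z = (fst x + fst y) + s"
      by (simp add: ac_simps)
    have "fst x + fst y + s \<in> mirror_group F (snd x)"
      by (rule mirror_group_closed) (use s step.IH in auto)
    with eq s step.IH show ?case by metis
  qed auto
  show "?l \<Longrightarrow> ?r" by (drule *) auto
next
  have step: "((g, p), (s + g, p)) \<in> (mirror_rel F \<union> (mirror_rel F)\<inverse>)\<^sup>*" if "p \<in> F s" for g s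
  proof (rule r_into_rtrancl, rule UnI1)
    show "((g, p), (s + g, p)) \<in> mirror_rel F"
      unfolding mirror_rel_def using that by blast
  qed
  assume ?r
  then have q: "q = p" and k: "g + h \<in> mirror_group F p" by auto
  from k show ?l
  proof (cases rule: mirror_group_cases)
    case 1
    then show ?thesis using q by (simp add: bit_pair_add_eq_0_iff)
  next
    case 2
    have "g + h + g = h" by (simp add: ac_simps)
    then show ?thesis using step[OF 2, of g] q by metis
  next
    case (3 u v)
    have "u + (v + g) = g + h + g" using 3 by (simp add: ac_simps)
    also have "\<dots> = h" by (simp add: ac_simps)
    finally show ?thesis
      using rtrancl_trans[OF step[OF 3(3), of g] step[OF 3(2), of "v + g"]] q by metis
  qed
qed

lemma mirror_map_eq_iff:
  assumes "p \<in> D" "q \<in> D"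
  shows "mirror_map D F (g, p) = mirror_map D F (h, q) \<longleftrightarrow> p = q \<and> g + h \<in> mirror_group F p"
  unfolding mirror_map_def using assms
  by (simp add: glue_map_eq_iff mirror_rel_symcl_iff del: topspace_sum_topology)

lemma quotient_map_mirror_map: "quotient_map (four_copies D) (mirror_space D F) (mirror_map D F)"
  unfolding mirror_space_def mirror_map_def by (rule quotient_map_glue)

lemma topspace_mirror_space: "topspace (mirror_space D F) = mirror_map D F ` (UNIV \<times> D)"
  using quotient_imp_surjective_map[OF quotient_map_mirror_map] by (metis topspace_four_copies)

lemma compact_space_four_copies: "compact D \<Longrightarrow> compact_space (four_copies D)"
  by (rule compact_space_sum_topology) (simp_all add: compact_space_subtopology)

lemma Hausdorff_space_four_copies: "Hausdorff_space (four_copies (D :: 'a::metric_space set))"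
  by (intro Hausdorff_space_sum_topology Hausdorff_space_subtopology Hausdorff_space_euclidean)

text \<open>For fixed nonzero k this is a finite union of closed sets: k is a label itself or a sum
  s + (s + k) of two labels. It makes the projection closed and thereby the quotient
  Hausdorff.\<close>

lemma closed_mirror_group:
  assumes "mirrored D F"
  shows "closedin (top_of_set D) {p \<in> D. k \<in> mirror_group F p}"
proof (cases "k = 0")
  case False
  have "k \<in> mirror_group F p \<longleftrightarrow> p \<in> F k \<union> (\<Union>s. F s \<inter> F (s + k))" for p
  proof
    assume "k \<in> mirror_group F p"
    then show "p \<in> F k \<union> (\<Union>s. F s \<inter> F (s + k))"
    proof (cases rule: mirror_group_cases)
      case (3 u v)
      then have "p \<in> F u \<inter> F (u + k)" by simp
      then show ?thesis by (intro UnI2 UN_I[OF UNIV_I])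
    qed (use False in auto)
  next
    assume "p \<in> F k \<union> (\<Union>s. F s \<inter> F (s + k))"
    then consider "p \<in> F k" | s where "p \<in> F s" "p \<in> F (s + k)" by blast
    then show "k \<in> mirror_group F p"
    proof cases
      case (2 s)
      then have "s + (s + k) \<in> mirror_group F p" by (rule mirror_group_sum)
      then show ?thesis by simp
    qed (rule mirror_group_label)
  qed
  then have "{p \<in> D. k \<in> mirror_group F p} = D \<inter> (F k \<union> (\<Union>s. F s \<inter> F (s + k)))"
    by blast
  moreover have "closed (F k \<union> (\<Union>s. F s \<inter> F (s + k)))"
  proof (rule closed_Un)
    show "closed (F k)" using assms by (simp add: mirrored_def)
    show "closed (\<Union>s. F s \<inter> F (s + k))"
      using assms by (intro closed_UN finite_bit_pair ballI closed_Int) (simp_all add: mirrored_def)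
  qed
  ultimately show ?thesis
    by (simp add: closedin_closed_Int)
qed simp

text \<open>In copy g, the saturation of a closed set K is the union over the four copies h of the
  points of K in copy h whose stabilizer contains g + h.\<close>

lemma closed_map_mirror_map:
  assumes "mirrored D F"
  shows "closed_map (four_copies D) (mirror_space D F) (mirror_map D F)"
  unfolding closed_map_def
proof (intro allI impI)
  fix K assume K: "closedin (four_copies D) K"
  then have KD: "K \<subseteq> UNIV \<times> D" using closedin_subset by fastforce
  have Kh: "closedin (top_of_set D) {p. (h, p) \<in> K}" for h
    using K unfolding closedin_sum_topology by blast
  let ?L = "{x \<in> UNIV \<times> D. mirror_map D F x \<in> mirror_map D F ` K}"
  have eq: "{p. (g, p) \<in> ?L} = (\<Union>h. {p. (h, p) \<in> K} \<inter> {p \<in> D. g + h \<in> mirror_group F p})" for g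
  proof (intro set_eqI iffI)
    fix p assume "p \<in> {p. (g, p) \<in> ?L}"
    then obtain y where p: "p \<in> D" and y: "y \<in> K" "mirror_map D F (g, p) = mirror_map D F y"
      by blast
    obtain h q where "y = (h, q)" by (cases y)
    moreover have "q \<in> D" using y KD \<open>y = (h, q)\<close> by blast
    ultimately have "q = p" "g + h \<in> mirror_group F p"
      using y p mirror_map_eq_iff by metis+
    then show "p \<in> (\<Union>h. {p. (h, p) \<in> K} \<inter> {p \<in> D. g + h \<in> mirror_group F p})"
      using p y \<open>y = (h, q)\<close> by blast
  next
    fix p assume "p \<in> (\<Union>h. {p. (h, p) \<in> K} \<inter> {p \<in> D. g + h \<in> mirror_group F p})"
    then obtain h where h: "(h, p) \<in> K" "p \<in> D" "g + h \<in> mirror_group F p" by blast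
    then have "mirror_map D F (g, p) = mirror_map D F (h, p)"
      using mirror_map_eq_iff by metis
    then show "p \<in> {p. (g, p) \<in> ?L}" using h by blast
  qed
  have "closedin (top_of_set D) {p. (g, p) \<in> ?L}" for g
    unfolding eq
  proof (rule closedin_Union)
    show "finite (range (\<lambda>h. {p. (h, p) \<in> K} \<inter> {p \<in> D. g + h \<in> mirror_group F p}))"
      by (intro finite_imageI finite_bit_pair)
  qed (use Kh closed_mirror_group[OF assms] closedin_Int in blast)
  then have "closedin (four_copies D) ?L"
    unfolding closedin_sum_topology by auto
  moreover have "mirror_map D F ` K \<subseteq> topspace (mirror_space D F)"
    using KD unfolding topspace_mirror_space by blast
  ultimately show "closedin (mirror_space D F) (mirror_map D F ` K)"
    using quotient_map_mirror_map[of D F] unfolding quotient_map_closedin topspace_four_copies by blast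
qed

text \<open>The four copies form a normal space, and a closed continuous image of it with closed
  points is Hausdorff. This is the condition under which compactness turns surjections onto mirror
  spaces into quotient maps.\<close>

lemma Hausdorff_space_mirror_space:
  fixes D :: "'a::metric_space set"
  assumes "mirrored D F"
  shows "Hausdorff_space (mirror_space D F)"
proof (rule Hausdorff_normal_space_closed_continuous_map_image)
  show "normal_space (four_copies D)"
    using assms compact_space_four_copies Hausdorff_space_four_copies
    by (auto intro!: compact_Hausdorff_or_regular_imp_normal_space simp: mirrored_def)
  show "closed_map (four_copies D) (mirror_space D F) (mirror_map D F)"
    by (rule closed_map_mirror_map[OF assms])
  show "continuous_map (four_copies D) (mirror_space D F) (mirror_map D F)"
    using quotient_map_mirror_map quotient_imp_continuous_map by blast
  show "mirror_map D F ` topspace (four_copies D) = topspace (mirror_space D F)"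
    by (simp add: topspace_mirror_space)
  show "t1_space (mirror_space D F)"
    unfolding t1_space_closedin_singleton topspace_mirror_space
  proof safe
    fix g p assume "p \<in> D"
    then have "closedin (four_copies D) {(g, p)}"
      by (intro closedin_Hausdorff_singleton Hausdorff_space_four_copies) auto
    then show "closedin (mirror_space D F) {mirror_map D F (g, p)}"
      using closed_map_mirror_map[OF assms] unfolding closed_map_def by force
  qed
qed

text \<open>A recognition criterion: only continuity on each copy, surjectivity and the fibres have
  to be checked, while compactness takes care of the topology.\<close>

lemma mirror_space_homeomorphic:
  fixes D :: "'a::topological_space set"
  assumes "compact D" "Hausdorff_space Y"
    and "\<And>g. continuous_map (top_of_set D) Y (\<lambda>p. f (g, p))"
    and "f ` (UNIV \<times> D) = topspace Y"
    and "\<And>g h p q. \<lbrakk>p \<in> D; q \<in> D\<rbrakk> \<Longrightarrow> f (g, p) = f (h, q) \<longleftrightarrow> p = q \<and> g + h \<in> mirror_group F p"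
  shows "mirror_space D F homeomorphic_space Y"
  unfolding mirror_space_def
proof (rule glue_homeomorphic_space)
  show "quotient_map (four_copies D) Y f"
    by (rule quotient_map_compact_Hausdorff)
      (use assms in \<open>simp_all add: compact_space_four_copies continuous_map_sum_topology\<close>)
  fix x y assume "x \<in> topspace (four_copies D)" "y \<in> topspace (four_copies D)"
  then show "f x = f y \<longleftrightarrow> (x, y) \<in> (mirror_rel F \<union> (mirror_rel F)\<inverse>)\<^sup>*"
    by (cases x; cases y) (simp add: assms(5) mirror_rel_symcl_iff)
qed

lemma mirrored_homeomorphism:
  assumes "mirrored D F" "homeomorphism D D' h k" "\<And>s. F' s = h ` F s"
  shows "mirrored D' (F' :: _ \<Rightarrow> 'b::metric_space set)"
proof -
  have "compact (F s)" for s
    using assms(1) by (metis closed_Int_compact inf.absorb1 mirrored_def)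
  then have "compact (F' s)" for s
    using assms unfolding mirrored_def homeomorphism_def
    by (metis compact_continuous_image continuous_on_subset)
  moreover have "compact D'"
    using assms(1,2) unfolding mirrored_def homeomorphism_def by (metis compact_continuous_image)
  moreover have "F' s \<subseteq> D'" for s
    using assms unfolding mirrored_def homeomorphism_def by (metis image_mono)
  ultimately show ?thesis
    unfolding mirrored_def by (simp add: compact_imp_closed)
qed

lemma mirror_space_homeomorphism:
  fixes D :: "'a::topological_space set" and D' :: "'b::metric_space set"
  assumes "mirrored D F" "homeomorphism D D' h k" "\<And>s. F' s = h ` F s"
  shows "mirror_space D F homeomorphic_space mirror_space D' F'"
proof (rule mirror_space_homeomorphic[where f = "\<lambda>(g, p). mirror_map D' F' (g, h p)"])
  show "compact D" using assms(1) by (simp add: mirrored_def)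
  show "Hausdorff_space (mirror_space D' F')"
    by (intro Hausdorff_space_mirror_space mirrored_homeomorphism[OF assms])
  have hD: "h ` D = D'" and inj: "inj_on h D" and cont: "continuous_on D h"
    using assms(2) inj_on_inverseI[of D k h] unfolding homeomorphism_def by simp_all
  show "continuous_map (top_of_set D) (mirror_space D' F') (\<lambda>p. case (g, p) of (g, p) \<Rightarrow> mirror_map D' F' (g, h p))" for g
  proof -
    have "continuous_map (top_of_set D) (four_copies D') (Pair g \<circ> h)"
      by (rule continuous_map_compose[OF _ continuous_map_component_injection]) (use cont hD in auto)
    then have "continuous_map (top_of_set D) (mirror_space D' F') (mirror_map D' F' \<circ> (Pair g \<circ> h))"
      by (rule continuous_map_compose[OF _ quotient_imp_continuous_map[OF quotient_map_mirror_map]])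
    then show ?thesis by (simp add: o_def)
  qed
  show "(\<lambda>(g, p). mirror_map D' F' (g, h p)) ` (UNIV \<times> D) = topspace (mirror_space D' F')"
  proof -
    have "(\<lambda>(g, p). (g, h p)) ` (UNIV \<times> D) = UNIV \<times> D'"
      using hD by force
    moreover have "(\<lambda>(g, p). mirror_map D' F' (g, h p)) = mirror_map D' F' \<circ> (\<lambda>(g, p). (g, h p))"
      by (auto simp: fun_eq_iff)
    ultimately show ?thesis
      unfolding topspace_mirror_space by (metis image_comp)
  qed
  fix g g' p q assume pq: "p \<in> D" "q \<in> D"
  have "mirror_group F' (h p) = mirror_group F p"
  proof (rule mirror_group_cong)
    have "h p \<in> F' s \<longleftrightarrow> p \<in> F s" for s
      using assms(1,3) pq inj unfolding mirrored_def by (metis inj_on_image_mem_iff)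
    then show "{s. h p \<in> F' s} = {s. p \<in> F s}" by simp
  qed
  then show "(case (g, p) of (g, p) \<Rightarrow> mirror_map D' F' (g, h p)) =
      (case (g', q) of (g, p) \<Rightarrow> mirror_map D' F' (g, h p)) \<longleftrightarrow> p = q \<and> g + g' \<in> mirror_group F p"
    using pq hD by (simp add: mirror_map_eq_iff inj_on_eq_iff[OF inj] imageI[of _ D h, unfolded hD])
qed

section \<open>Local degree\<close>

text \<open>
  The circle of radius s about z is z + exp w for w on a vertical segment, so the local degree of f
  at z can be read off a logarithm of f (z + exp w) - f z on a left half-plane. In this form
  local constancy and multiplicativity are immediate.
\<close>

definition has_local_degree :: "(complex \<Rightarrow> complex) \<Rightarrow> complex \<Rightarrow> real \<Rightarrow> int \<Rightarrow> bool" where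
  "has_local_degree f z r d \<longleftrightarrow> 0 < r \<and>
     (\<exists>K. continuous_on {w. Re w \<le> ln r} K \<and>
          (\<forall>w. Re w \<le> ln r \<longrightarrow> f (z + exp w) = f z + exp (K w)) \<and>
          (\<forall>w. Re w \<le> ln r \<longrightarrow> K (w + 2 * of_real pi * \<i>) = K w + of_int d * (2 * of_real pi * \<i>)))"

lemma norm_exp_le_iff: "0 < r \<Longrightarrow> norm (exp w) \<le> r \<longleftrightarrow> Re w \<le> ln r"
  by (simp add: norm_exp_eq_Re ln_ge_iff)

lemma has_local_degree_mono:
  assumes "has_local_degree f z r d" "0 < s" "s \<le> r"
  shows "has_local_degree f z s d"
proof -
  have "ln s \<le> ln r" using assms by simp
  then have "{w::complex. Re w \<le> ln s} \<subseteq> {w. Re w \<le> ln r}" and "\<And>w. Re w \<le> ln s \<Longrightarrow> Re w \<le> ln r"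
    by auto
  with assms show ?thesis
    unfolding has_local_degree_def by (meson continuous_on_subset)
qed

lemma circlepath_exp: "0 < r \<Longrightarrow> circlepath z r t = z + exp (of_real (ln r) + 2 * of_real pi * \<i> * of_real t)"
  by (simp add: circlepath exp_add exp_of_real)

text \<open>Feeds \<open>continuous_discrete_range_constant\<close>: a continuous integer-valued
  function on a connected set is constant.\<close>

lemma norm_diff_Ints_ge_1:
  fixes x y :: complex
  assumes "x \<in> \<int>" "y \<in> \<int>" "x \<noteq> y"
  shows "1 \<le> norm (x - y)"
proof -
  obtain m n where "x = of_int m" "y = of_int n" using assms(1,2) by (auto elim!: Ints_cases)
  then have "norm (x - y) = \<bar>of_int (m - n)\<bar>" "m \<noteq> n"
    using assms(3) by (simp_all flip: of_int_diff add: norm_of_int)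
  then show ?thesis by linarith
qed

lemma exp_eq_imp_Ints:
  assumes "exp u = exp v"
  shows "(u - v) / (2 * of_real pi * \<i>) \<in> \<int>"
proof -
  obtain n :: int where "u = v + of_real (of_int (2 * n) * pi) * \<i>"
    using assms unfolding exp_eq by blast
  then have "(u - v) / (2 * of_real pi * \<i>) = of_int n" by simp
  then show ?thesis by simp
qed

text \<open>Any continuous logarithm computes the winding number, since it differs from the one
  provided by \<open>winding_number_as_continuous_log\<close> by an integer number of periods, which
  cannot jump along the interval.\<close>

lemma winding_number_exp_lift:
  assumes "continuous_on {0..1} q" and "\<And>t. t \<in> {0..1} \<Longrightarrow> p t = \<zeta> + exp (q t)"
    and "q 1 = q 0 + of_int d * (2 * of_real pi * \<i>)"
  shows "winding_number p \<zeta> = of_int d"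
proof -
  have "path p"
    unfolding path_def
    by (rule continuous_on_eq[of _ "\<lambda>t. \<zeta> + exp (q t)"]) (use assms(1,2) in \<open>auto intro!: continuous_intros\<close>)
  moreover have "\<zeta> \<notin> path_image p"
    using assms(2) by (auto simp: path_image_def)
  ultimately obtain q' where q': "path q'"
    "pathfinish q' - pathstart q' = 2 * of_real pi * \<i> * winding_number p \<zeta>"
    "\<And>t. t \<in> {0..1} \<Longrightarrow> p t = \<zeta> + exp (q' t)"
    by (rule winding_number_as_continuous_log) blast
  have int: "(q' t - q t) / (2 * of_real pi * \<i>) \<in> \<int>" if "t \<in> {0..1}" for t
    using assms(2)[OF that] q'(3)[OF that] by (intro exp_eq_imp_Ints) simp
  have "(\<lambda>t. (q' t - q t) / (2 * of_real pi * \<i>)) constant_on {0..1::real}"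
  proof (rule continuous_discrete_range_constant)
    show "connected {0..1::real}" by simp
    show "continuous_on {0..1} (\<lambda>t. (q' t - q t) / (2 * of_real pi * \<i>))"
      using assms(1) q'(1) by (auto intro!: continuous_intros simp: path_def)
    fix x :: real assume "x \<in> {0..1}"
    then show "\<exists>e>0. \<forall>y. y \<in> {0..1} \<and> (q' y - q y) / (2 * of_real pi * \<i>) \<noteq> (q' x - q x) / (2 * of_real pi * \<i>) \<longrightarrow>
        e \<le> norm ((q' y - q y) / (2 * of_real pi * \<i>) - (q' x - q x) / (2 * of_real pi * \<i>))"
      by (intro exI[of _ 1] conjI zero_less_one allI impI norm_diff_Ints_ge_1 int) auto
  qed
  then have "(q' 1 - q 1) / (2 * of_real pi * \<i>) = (q' 0 - q 0) / (2 * of_real pi * \<i>)"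
    unfolding constant_on_def by (elim exE) simp
  then have "q' 1 - q' 0 = of_int d * (2 * of_real pi * \<i>)"
    using assms(3) by (simp add: field_simps)
  then show ?thesis
    using q'(2) by (simp add: pathfinish_def pathstart_def)
qed

text \<open>Along the vertical segment from ln s to ln s + 2 pi i, the function K of the definition
  is a lift of the image of the circle.\<close>

lemma has_local_degree_winding_number:
  assumes "has_local_degree f z r d" "0 < s" "s \<le> r"
  shows "winding_number (f \<circ> circlepath z s) (f z) = of_int d"
proof -
  obtain K where K: "continuous_on {w. Re w \<le> ln s} K"
    "\<And>w. Re w \<le> ln s \<Longrightarrow> f (z + exp w) = f z + exp (K w)"
    "\<And>w. Re w \<le> ln s \<Longrightarrow> K (w + 2 * of_real pi * \<i>) = K w + of_int d * (2 * of_real pi * \<i>)"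
    using has_local_degree_mono[OF assms] by (auto simp: has_local_degree_def)
  show ?thesis
  proof (rule winding_number_exp_lift[where q = "\<lambda>t. K (of_real (ln s) + 2 * of_real pi * \<i> * of_real t)"])
    show "continuous_on {0..1} (\<lambda>t. K (of_real (ln s) + 2 * of_real pi * \<i> * of_real t))"
      by (rule continuous_on_compose2[OF K(1)]) (auto intro!: continuous_intros)
  qed (use K assms(2) in \<open>auto simp: circlepath_exp\<close>)
qed

lemma has_local_degree_unique:
  assumes "has_local_degree f z r d" "has_local_degree f z s e"
  shows "d = e"
proof -
  have "0 < r" "0 < s" using assms by (auto simp: has_local_degree_def)
  then show ?thesis
    using has_local_degree_winding_number[OF assms(1), of "min r s"]
      has_local_degree_winding_number[OF assms(2), of "min r s"] by simp
qed

text \<open>The logarithm is taken in the centre and in w simultaneously. Its domain is a product of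
  convex sets, hence contractible, and injectivity of f keeps the difference away from zero. The
  number of periods gained under w to w + 2 pi i is a continuous integer-valued function on this
  connected domain.\<close>

lemma has_local_degree_locally_constant:
  assumes r: "0 < r" "0 < e" and f: "continuous_on U f" "inj_on f U"
    and U: "\<And>z. z \<in> ball z0 e \<Longrightarrow> cball z r \<subseteq> U"
  shows "\<exists>d. \<forall>z\<in>ball z0 e. has_local_degree f z r d"
proof -
  let ?S = "ball z0 e \<times> {w. Re w \<le> ln r}"
  have conv: "convex {w. Re w \<le> ln r}"
    using convex_halfspace_Re_le by blast
  have inU: "z \<in> U" "z + exp w \<in> U" if "(z, w) \<in> ?S" for z w
    using U[of z] that r(1) norm_exp_le_iff[OF r(1), of w] by (auto simp: subset_iff dist_norm)
  obtain K where K: "continuous_on ?S K" "\<And>x. x \<in> ?S \<Longrightarrow> f (fst x + exp (snd x)) - f (fst x) = exp (K x)"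
  proof (rule continuous_logarithm_on_contractible[of ?S "\<lambda>x. f (fst x + exp (snd x)) - f (fst x)"])
    show "continuous_on ?S (\<lambda>x. f (fst x + exp (snd x)) - f (fst x))"
      using inU by (intro continuous_on_diff continuous_on_compose2[OF f(1)] continuous_intros) auto
    show "contractible ?S"
      by (intro convex_imp_contractible convex_Times conv) simp
    show "f (fst x + exp (snd x)) - f (fst x) \<noteq> 0" if "x \<in> ?S" for x
    proof -
      have "fst x \<in> U" "fst x + exp (snd x) \<in> U" using inU[of "fst x" "snd x"] that by auto
      moreover have "fst x + exp (snd x) \<noteq> fst x" by simp
      ultimately show ?thesis using f(2) by (metis eq_iff_diff_eq_0 inj_onD)
    qed
  qed blast
  define D where "D x = (K (fst x, snd x + 2 * of_real pi * \<i>) - K x) / (2 * of_real pi * \<i>)" for x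
  have int: "D x \<in> \<int>" if "x \<in> ?S" for x
  proof -
    have "(fst x, snd x + 2 * of_real pi * \<i>) \<in> ?S" using that by auto
    from K(2)[OF this] K(2)[OF that] have "exp (K (fst x, snd x + 2 * of_real pi * \<i>)) = exp (K x)"
      by (simp add: exp_add)
    then show ?thesis unfolding D_def by (rule exp_eq_imp_Ints)
  qed
  have "D constant_on ?S"
  proof (rule continuous_discrete_range_constant)
    show "connected ?S" by (intro connected_Times convex_connected conv) simp
    show "continuous_on ?S D"
      unfolding D_def using K(1)
      by (intro continuous_intros continuous_on_compose2[OF K(1)]) auto
    fix x assume "x \<in> ?S"
    then show "\<exists>e>0. \<forall>y. y \<in> ?S \<and> D y \<noteq> D x \<longrightarrow> e \<le> norm (D y - D x)"
      by (intro exI[of _ 1] conjI zero_less_one allI impI norm_diff_Ints_ge_1 int) auto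
  qed
  moreover have "(z0, of_real (ln r)) \<in> ?S" using r by simp
  ultimately obtain c where c: "\<And>x. x \<in> ?S \<Longrightarrow> D x = c"
    by (auto simp: constant_on_def)
  with int \<open>(z0, of_real (ln r)) \<in> ?S\<close> obtain n where "c = of_int n"
    by (metis Ints_cases)
  have "has_local_degree f z r n" if "z \<in> ball z0 e" for z
    unfolding has_local_degree_def
  proof (intro conjI exI[of _ "\<lambda>w. K (z, w)"] allI impI r)
    show "continuous_on {w. Re w \<le> ln r} (\<lambda>w. K (z, w))"
      using that by (intro continuous_on_compose2[OF K(1)] continuous_intros) auto
    fix w assume w: "Re w \<le> ln r"
    then show "f (z + exp w) = f z + exp (K (z, w))"
      using K(2)[of "(z, w)"] that by (simp add: algebra_simps)
    show "K (z, w + 2 * of_real pi * \<i>) = K (z, w) + of_int n * (2 * of_real pi * \<i>)"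
      using c[of "(z, w)"] w that \<open>c = of_int n\<close> by (simp add: D_def field_simps)
  qed
  then show ?thesis by blast
qed

text \<open>The preceding lemma needs discs of the same radius about all centres near z; compactness
  of the closed disc provides the room.\<close>

lemma has_local_degree_exists:
  assumes "0 < r" "cball z r \<subseteq> U" "continuous_on U f" "inj_on f U" "open U"
  shows "\<exists>d. has_local_degree f z r d"
proof -
  have "compact (cball z r)" by simp
  then obtain e where e: "0 < e" "\<And>x. x \<in> cball z r \<Longrightarrow> ball x e \<subseteq> U"
    using Lebesgue_number_lemma[of "cball z r" "{U}"] assms
    by (metis compact_subset_open_imp_ball_epsilon_subset UN_I subsetD subsetI)
  have "cball z' r \<subseteq> U" if z': "z' \<in> ball z e" for z'
  proof
    fix x assume "x \<in> cball z' r"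
    then have "x - z' + z \<in> cball z r" "x \<in> ball (x - z' + z) e"
      using z' by (auto simp: dist_norm norm_minus_commute)
    then show "x \<in> U" using e by blast
  qed
  then show ?thesis
    using has_local_degree_locally_constant[OF assms(1) e(1) assms(3,4)] e(1) by (metis centre_in_ball)
qed

text \<open>If t is so small that K maps its half-plane into that of L, then
  \<open>L \<circ> K\<close> is a logarithm for the composite. Under a period K gains d periods, and
  L turns each of them into e.\<close>

lemma has_local_degree_compose:
  assumes f: "has_local_degree f z r d" and g: "has_local_degree g (f z) s e"
    and cont: "isCont f z"
  shows "\<exists>t. has_local_degree (g \<circ> f) z t (e * d)"
proof -
  have "0 < r" "0 < s" using f g by (auto simp: has_local_degree_def)
  obtain t0 where t0: "0 < t0" "\<And>x. dist x z < t0 \<Longrightarrow> dist (f x) (f z) < s"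
    using cont \<open>0 < s\<close> unfolding continuous_at_eps_delta by metis
  define t where "t = min r (t0 / 2)"
  have t: "0 < t" "t \<le> r" "t < t0" using t0(1) \<open>0 < r\<close> by (auto simp: t_def)
  obtain K where K: "continuous_on {w. Re w \<le> ln t} K"
    "\<And>w. Re w \<le> ln t \<Longrightarrow> f (z + exp w) = f z + exp (K w)"
    "\<And>w. Re w \<le> ln t \<Longrightarrow> K (w + 2 * of_real pi * \<i>) = K w + of_int d * (2 * of_real pi * \<i>)"
    using has_local_degree_mono[OF f t(1,2)] by (auto simp: has_local_degree_def)
  obtain L where L: "continuous_on {w. Re w \<le> ln s} L"
    "\<And>w. Re w \<le> ln s \<Longrightarrow> g (f z + exp w) = g (f z) + exp (L w)"
    "\<And>w. Re w \<le> ln s \<Longrightarrow> L (w + 2 * of_real pi * \<i>) = L w + of_int e * (2 * of_real pi * \<i>)"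
    using g by (auto simp: has_local_degree_def)
  have nat: "L (w + of_nat n * (2 * of_real pi * \<i>)) = L w + of_int (e * int n) * (2 * of_real pi * \<i>)"
    if "Re w \<le> ln s" for w n
    using that
  proof (induction n)
    case (Suc n)
    have "w + of_nat (Suc n) * (2 * of_real pi * \<i>) = (w + of_nat n * (2 * of_real pi * \<i>)) + 2 * of_real pi * \<i>"
      by (simp add: algebra_simps)
    then have "L (w + of_nat (Suc n) * (2 * of_real pi * \<i>)) = L (w + of_nat n * (2 * of_real pi * \<i>)) + of_int e * (2 * of_real pi * \<i>)"
      by (simp only:) (rule L(3), use Suc.prems in simp)
    then show ?case using Suc by (simp add: algebra_simps)
  qed simp
  have int: "L (w + of_int n * (2 * of_real pi * \<i>)) = L w + of_int (e * n) * (2 * of_real pi * \<i>)"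
    if w: "Re w \<le> ln s" for w n
  proof (cases "0 \<le> n")
    case True
    then show ?thesis using nat[OF w, of "nat n"] by simp
  next
    case False
    let ?w = "w + of_int n * (2 * of_real pi * \<i>)"
    have "?w + of_nat (nat (- n)) * (2 * of_real pi * \<i>) = w"
      using False by (simp add: algebra_simps)
    \<comment> \<open>A negative number of periods is undone by a positive number, starting from the
      translated point.\<close>
    then show ?thesis using nat[of ?w "nat (- n)"] w False by (simp add: algebra_simps)
  qed
  have KL: "Re (K w) \<le> ln s" if "Re w \<le> ln t" for w
  proof -
    have "dist (z + exp w) z < t0"
      using that t norm_exp_le_iff[OF t(1), of w] by (simp add: dist_norm)
    from t0(2)[OF this] have "norm (exp (K w)) \<le> s" using K(2)[OF that] by (simp add: dist_norm)
    then show ?thesis using norm_exp_le_iff[OF \<open>0 < s\<close>] by blast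
  qed
  have "has_local_degree (g \<circ> f) z t (e * d)"
    unfolding has_local_degree_def
  proof (intro conjI exI[of _ "L \<circ> K"] allI impI t)
    show "continuous_on {w. Re w \<le> ln t} (L \<circ> K)"
      using KL by (intro continuous_on_compose K(1) continuous_on_subset[OF L(1)]) auto
    fix w assume w: "Re w \<le> ln t"
    show "(g \<circ> f) (z + exp w) = (g \<circ> f) z + exp ((L \<circ> K) w)"
      using K(2)[OF w] L(2)[OF KL[OF w]] by simp
    show "(L \<circ> K) (w + 2 * of_real pi * \<i>) = (L \<circ> K) w + of_int (e * d) * (2 * of_real pi * \<i>)"
      using K(3)[OF w] int[OF KL[OF w], of d] by simp
  qed
  then show ?thesis by blast
qed

lemma has_local_degree_id: "0 < r \<Longrightarrow> has_local_degree (\<lambda>x. x) z r 1"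
  unfolding has_local_degree_def by (auto intro!: exI[of _ "\<lambda>w. w"] continuous_intros)

lemma has_local_degree_cong:
  assumes "has_local_degree f z r d" "open U" "z \<in> U" "\<And>x. x \<in> U \<Longrightarrow> f x = g x"
  shows "\<exists>s. has_local_degree g z s d"
proof -
  obtain e where e: "0 < e" "cball z e \<subseteq> U"
    using assms(2,3) open_contains_cball by metis
  define s where "s = min r e"
  have s: "0 < s" "s \<le> r" "s \<le> e" using assms(1) e by (auto simp: s_def has_local_degree_def)
  have "g (z + exp w) = f (z + exp w)" if "Re w \<le> ln s" for w
    using norm_exp_le_iff[OF s(1), of w] that e s(3) assms(4) by (auto simp: subset_iff dist_norm)
  then have "has_local_degree g z s d"
    using has_local_degree_mono[OF assms(1) s(1,2)] assms(3,4) unfolding has_local_degree_def by simp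
  then show ?thesis by blast
qed

lemma local_degree_inverse:
  assumes "has_local_degree f z r d" "has_local_degree g (f z) s e" "isCont f z"
    "open U" "z \<in> U" "\<And>x. x \<in> U \<Longrightarrow> g (f x) = x"
  shows "e * d = 1"
proof -
  obtain t where "has_local_degree (g \<circ> f) z t (e * d)"
    using has_local_degree_compose[OF assms(1-3)] by blast
  then obtain t' where "has_local_degree (\<lambda>x. x) z t' (e * d)"
    using has_local_degree_cong[OF _ assms(4,5), of "g \<circ> f"] assms(6) by (metis comp_apply)
  then show ?thesis
    using has_local_degree_unique has_local_degree_id[of 1 z] by (metis zero_less_one)
qed

text \<open>By invariance of domain the inverse map lives on an open set and has a degree as well;
  the product of the two integers is 1.\<close>

lemma local_degree_cases:
  assumes "has_local_degree f z r d" "open U" "z \<in> U" "continuous_on U f" "inj_on f U"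
  shows "d = 1 \<or> d = - 1"
proof -
  have op: "open (f ` U)" using invariance_of_domain assms by blast
  obtain e where e: "0 < e" "cball (f z) e \<subseteq> f ` U"
    using op assms(3) open_contains_cball by (metis imageI)
  have "continuous_on (f ` U) (inv_into U f)"
    using assms by (intro continuous_on_inverse_open) simp_all
  moreover have "inj_on (inv_into U f) (f ` U)"
    by (rule inj_on_inv_into) simp
  ultimately obtain d' where "has_local_degree (inv_into U f) (f z) e d'"
    using has_local_degree_exists[OF e _ _ op] by blast
  moreover have "isCont f z" using assms(2-4) continuous_on_eq_continuous_at by blast
  ultimately have "d' * d = 1"
    using local_degree_inverse[OF assms(1) _ _ assms(2,3)] assms(5) by (metis inv_into_f_f)
  then show ?thesis by (metis mult.commute zmult_eq_1_iff)
qed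

text \<open>The degree at a point does not depend on the radius, so it is a locally constant
  function of the point, hence constant on a connected set.\<close>

lemma has_local_degree_constant:
  assumes "open U" "connected U" "continuous_on U f" "inj_on f U"
  obtains d where "d = 1 \<or> d = - 1" "\<And>z r. \<lbrakk>0 < r; cball z r \<subseteq> U\<rbrakk> \<Longrightarrow> has_local_degree f z r d"
proof (cases "U = {}")
  case False
  then obtain z0 where z0: "z0 \<in> U" by blast
  define P where "P d z \<longleftrightarrow> (\<exists>r. has_local_degree f z r d)" for d z
  have ex: "\<exists>d. P d z" if z: "z \<in> U" for z
    using has_local_degree_exists[of _ z U f] assms open_contains_cball z unfolding P_def by metis
  have unique: "P d z \<Longrightarrow> P e z \<Longrightarrow> d = e" for d e z
    using has_local_degree_unique unfolding P_def by metis
  have loc: "\<exists>V. open V \<and> z \<in> V \<and> V \<subseteq> U \<and> (\<exists>d. \<forall>x\<in>V. P d x)" if z: "z \<in> U" for z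
  proof -
    \<comment> \<open>Half of R serves twice, as the radius for the centres and as the radius of the
      discs about them, so that all discs stay in U.\<close>
    obtain R where R: "0 < R" "cball z R \<subseteq> U" using assms(1) z open_contains_cball by metis
    have "cball x (R / 2) \<subseteq> U" if "x \<in> ball z (R / 2)" for x
    proof -
      have "cball x (R / 2) \<subseteq> cball z R"
        using that by (auto simp: subset_iff) (smt (verit) dist_triangle2 dist_commute field_sum_of_halves)
      then show ?thesis using R by blast
    qed
    then obtain d where "\<forall>x\<in>ball z (R / 2). has_local_degree f x (R / 2) d"
      using has_local_degree_locally_constant[of "R / 2" "R / 2" U f z] R assms by auto
    moreover have "ball z (R / 2) \<subseteq> U" using R by (auto simp: subset_iff)
    ultimately show ?thesis
      using R by (intro exI[of _ "ball z (R / 2)"]) (auto simp: P_def)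
  qed
  obtain d where d: "P d z0" using ex z0 by blast
  have "P d z" if "z \<in> U" for z
  proof (rule connected_induction_simple[OF assms(2), of z0 z "P d"])
    fix a assume "a \<in> U"
    then obtain V d' where V: "open V" "a \<in> V" "V \<subseteq> U" "\<forall>x\<in>V. P d' x"
      using loc[of a] by blast
    then have "\<forall>x\<in>V. \<forall>y\<in>V. P d x \<longrightarrow> P d y"
      using unique by metis
    with V open_subset[of V U] show "\<exists>T. openin (top_of_set U) T \<and> a \<in> T \<and> (\<forall>x\<in>T. \<forall>y\<in>T. P d x \<longrightarrow> P d y)"
      by metis
  qed (use z0 that d in auto)
  moreover have "d = 1 \<or> d = - 1"
    using d local_degree_cases[OF _ assms(1) z0 assms(3,4)] unfolding P_def by blast
  moreover have "has_local_degree f z r d" if "P d z" "0 < r" "cball z r \<subseteq> U" for z r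
    using has_local_degree_exists[OF that(2,3) assms(3,4,1)] that(1) has_local_degree_unique
    unfolding P_def by metis
  ultimately show ?thesis
    using that by (metis centre_in_cball less_imp_le subsetD)
next
  case True
  then show ?thesis using that[of 1] by (metis centre_in_cball empty_iff less_imp_le subsetD)
qed

text \<open>The definition quantifies over all circles whose discs lie in U; since the degree is
  independent of the radius, one small circle about each centre decides.\<close>

lemma orientation_preserving_on_iff:
  assumes "open U" "continuous_on U f" "inj_on f U"
  shows "orientation_preserving_on U f \<longleftrightarrow> (\<forall>z\<in>U. \<exists>r. has_local_degree f z r 1)"
proof
  assume L: "orientation_preserving_on U f"
  show "\<forall>z\<in>U. \<exists>r. has_local_degree f z r 1"
  proof
    fix z assume "z \<in> U"
    then obtain r where r: "0 < r" "cball z r \<subseteq> U" using assms(1) open_contains_cball by metis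
    then obtain d where d: "has_local_degree f z r d"
      using has_local_degree_exists assms by metis
    then have "d = 1"
      using L r has_local_degree_winding_number[OF d r(1)] unfolding orientation_preserving_on_def
      by (metis of_int_eq_1_iff order_refl)
    then show "\<exists>r. has_local_degree f z r 1" using d by blast
  qed
next
  assume R: "\<forall>z\<in>U. \<exists>r. has_local_degree f z r 1"
  show "orientation_preserving_on U f"
    unfolding orientation_preserving_on_def
  proof (intro allI impI)
    fix z r assume r: "0 < r \<and> cball z r \<subseteq> U"
    then obtain d where d: "has_local_degree f z r d"
      using has_local_degree_exists assms by metis
    moreover have "z \<in> U" using r by auto
    ultimately have "d = 1" using R has_local_degree_unique by metis
    then show "winding_number (f \<circ> circlepath z r) (f z) = 1"
      using has_local_degree_winding_number[OF d] r by simp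
  qed
qed

section \<open>Discs with a labelled boundary\<close>

text \<open>Invariance of domain, applied to the map and to its inverse: the image of the interior
  is open.\<close>

lemma homeomorphism_frontier:
  fixes S T :: "'a::euclidean_space set"
  assumes "homeomorphism S T f g" "closed S" "closed T"
  shows "f ` interior S = interior T" "f ` frontier S = frontier T"
proof -
  have sub: "f ` interior S \<subseteq> interior T" if "homeomorphism S T f g" for S T :: "'a set" and f g
  proof (rule interior_maximal)
    have hom: "f ` S = T" "continuous_on S f" "inj_on f S"
      using that unfolding homeomorphism_def by (blast, blast, metis inj_on_inverseI)
    show "f ` interior S \<subseteq> T"
      using hom(1) interior_subset by blast
    show "open (f ` interior S)"
      by (intro invariance_of_domain continuous_on_subset[OF hom(2)] inj_on_subset[OF hom(3)] interior_subset open_interior)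
  qed
  have fg: "\<And>y. y \<in> T \<Longrightarrow> f (g y) = y" "inj_on f S" "f ` S = T"
    using assms(1) unfolding homeomorphism_def by (auto intro: inj_on_inverseI)
  have "interior T \<subseteq> f ` interior S"
  proof
    fix y assume y: "y \<in> interior T"
    then have "g y \<in> interior S"
      using sub[OF homeomorphism_symD[OF assms(1)]] by blast
    then show "y \<in> f ` interior S"
      using fg(1)[of y] y interior_subset by (metis imageI subsetD)
  qed
  then show int: "f ` interior S = interior T"
    using sub[OF assms(1)] by blast
  show "f ` frontier S = frontier T"
    using inj_on_image_set_diff[OF fg(2), of S "interior S"] assms(2,3) fg(3) int interior_subset[of S]
    by (simp add: frontier_def)
qed

text \<open>Radial extension. It preserves the norm, which gives continuity at the centre, the only
  point where the formula is singular.\<close>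

lemma homeomorphism_cball_extension:
  fixes \<eta> :: "'a::euclidean_space \<Rightarrow> 'a"
  assumes "homeomorphism (sphere 0 1) (sphere 0 1) \<eta> \<eta>'"
  obtains E E' where "homeomorphism (cball 0 1) (cball 0 1) E E'" "\<And>x. x \<in> sphere 0 1 \<Longrightarrow> E x = \<eta> x"
proof -
  have cont: "continuous_on (sphere 0 1) \<eta>" and im: "\<eta> ` sphere 0 1 = sphere 0 1" "\<eta>' ` sphere 0 1 = sphere 0 1"
    and inv: "\<And>x. x \<in> sphere 0 1 \<Longrightarrow> \<eta>' (\<eta> x) = x" "\<And>x. x \<in> sphere 0 1 \<Longrightarrow> \<eta> (\<eta>' x) = x"
    using assms unfolding homeomorphism_def by blast+
  have norm: "norm (\<eta> x) = 1" "norm (\<eta>' x) = 1" if "norm x = 1" for x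
    using imageI[of x "sphere 0 1" \<eta>] imageI[of x "sphere 0 1" \<eta>'] that unfolding im by simp_all
  have \<eta>: "\<eta>' (\<eta> x) = x" "\<eta> (\<eta>' x) = x" if "norm x = 1" for x
    using inv[of x] that by simp_all
  define E where "E z = norm z *\<^sub>R \<eta> (z /\<^sub>R norm z)" for z
  have unit: "norm (z /\<^sub>R norm z) = 1" if "z \<noteq> 0" for z :: 'a
    using that by simp
  have norm_E: "norm (E z) = norm z" for z
    using norm(1)[OF unit] by (cases "z = 0") (auto simp: E_def)
  have "continuous_on (cball 0 1) E"
    unfolding continuous_on_eq_continuous_within
  proof
    fix z :: 'a
    show "continuous (at z within cball 0 1) E"
    proof (cases "z = 0")
      case True
      have "(E \<longlongrightarrow> 0) (at 0)"
      proof (rule tendsto_norm_zero_cancel)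
        show "((\<lambda>z. norm (E z)) \<longlongrightarrow> 0) (at 0)"
          unfolding norm_E by (rule tendsto_norm_zero) (rule tendsto_ident_at)
      qed
      moreover have "E 0 = 0" by (simp add: E_def)
      ultimately have "isCont E z" unfolding isCont_def True by simp
      then show ?thesis by (rule continuous_at_imp_continuous_at_within)
    next
      case False
      have "(\<lambda>z. z /\<^sub>R norm z) ` (- {0 :: 'a}) \<subseteq> sphere 0 1"
      proof (rule image_subsetI)
        fix z :: 'a assume "z \<in> - {0}"
        then show "z /\<^sub>R norm z \<in> sphere 0 1" using unit[of z] by simp
      qed
      then have "continuous_on (- {0}) E"
        unfolding E_def by (intro continuous_intros continuous_on_compose2[OF cont]) auto
      moreover have "open (- {0 :: 'a})" by (rule open_Compl) simp
      ultimately have "isCont E z" using False continuous_on_eq_continuous_at by blast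
      then show ?thesis by (rule continuous_at_imp_continuous_at_within)
    qed
  qed
  moreover have "inj_on E (cball 0 1)"
  proof (rule inj_onI)
    fix x y assume eq: "E x = E y"
    then have n: "norm x = norm y" by (metis norm_E)
    show "x = y"
    proof (cases "x = 0")
      case False
      then have "y \<noteq> 0" using n by auto
      have "\<eta> (x /\<^sub>R norm x) = \<eta> (y /\<^sub>R norm y)"
        using eq n False \<open>y \<noteq> 0\<close> by (simp add: E_def)
      then have "x /\<^sub>R norm x = y /\<^sub>R norm y"
        using \<eta>(1)[OF unit[OF False]] \<eta>(1)[OF unit[OF \<open>y \<noteq> 0\<close>]] by metis
      then show ?thesis using n False \<open>y \<noteq> 0\<close> by simp
    qed (use n in auto)
  qed
  moreover have "E ` cball 0 1 = cball 0 1"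
  proof (intro subset_antisym subsetI)
    fix y :: 'a assume y: "y \<in> cball 0 1"
    show "y \<in> E ` cball 0 1"
    proof (cases "y = 0")
      case True
      then show ?thesis by (intro image_eqI[of _ _ 0]) (auto simp: E_def)
    next
      case False
      have "norm (norm y *\<^sub>R \<eta>' (y /\<^sub>R norm y)) = norm y"
        using norm(2)[OF unit[OF False]] by simp
      moreover have "E (norm y *\<^sub>R \<eta>' (y /\<^sub>R norm y)) = y"
        using False norm(2)[OF unit[OF False]] \<eta>(2)[OF unit[OF False]] by (simp add: E_def)
      ultimately show ?thesis using y by (intro image_eqI[of _ _ "norm y *\<^sub>R \<eta>' (y /\<^sub>R norm y)"]) auto
    qed
  qed (use norm_E in auto)
  ultimately obtain E' where "homeomorphism (cball 0 1) (cball 0 1) E E'"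
    using homeomorphism_compact[OF compact_cball] by metis
  moreover have "E x = \<eta> x" if "x \<in> sphere 0 1" for x
    using that by (simp add: E_def)
  ultimately show ?thesis using that by blast
qed

section \<open>Words read along the boundary of a disc\<close>

type_synonym plane = "real \<times> real"

definition closed_disc :: "plane set \<Rightarrow> bool" where
  "closed_disc D \<longleftrightarrow> D homeomorphic cball (0 :: plane) 1"

text \<open>The parameter spends one unit of time on each letter; a label may occur several times,
  so its trace is a union.\<close>

definition word_trace :: "(real \<Rightarrow> 'a) \<Rightarrow> 'l list \<Rightarrow> 'l \<Rightarrow> 'a set" where
  "word_trace \<gamma> w s = (\<Union>i\<in>{i. i < length w \<and> w ! i = s}. \<gamma> ` {real i..real i + 1})"

text \<open>Neither the starting point nor the direction of the curve is prescribed, and equal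
  neighbouring letters may be merged or split without changing F. So one and the same labelled disc
  is spelled by many words, and the most convenient one can be chosen.\<close>

definition spells_along ::
  "plane set \<Rightarrow> ('l \<Rightarrow> plane set) \<Rightarrow> 'l list \<Rightarrow> (real \<Rightarrow> plane) \<Rightarrow> bool" where
  "spells_along D F w \<gamma> \<longleftrightarrow> closed_disc D \<and> w \<noteq> [] \<and>
     continuous_on {0..real (length w)} \<gamma> \<and> inj_on \<gamma> {0..<real (length w)} \<and>
     \<gamma> (real (length w)) = \<gamma> 0 \<and> \<gamma> ` {0..real (length w)} = frontier D \<and> F = word_trace \<gamma> w"

definition spells :: "plane set \<Rightarrow> ('l \<Rightarrow> plane set) \<Rightarrow> 'l list \<Rightarrow> bool" where
  "spells D F w \<longleftrightarrow> (\<exists>\<gamma>. spells_along D F w \<gamma>)"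

lemma spellsI: "spells_along D F w \<gamma> \<Longrightarrow> spells D F w"
  unfolding spells_def by (rule exI[of "\<lambda>\<gamma>. spells_along D F w \<gamma>"])

lemma spellsE:
  assumes "spells D F w"
  obtains \<gamma> where "spells_along D F w \<gamma>"
  using assms unfolding spells_def by (elim exE)

lemma closed_disc_compact: "closed_disc D \<Longrightarrow> compact D"
  unfolding closed_disc_def using homeomorphic_compactness compact_cball by metis

lemma image_fun: "(\<lambda>x. f (g x)) ` S = f ` g ` S"
  by (simp add: image_image)

lemma word_trace_Nil [simp]: "word_trace \<gamma> [] s = {}"
  by (simp add: word_trace_def)

lemma word_trace_Cons: "word_trace \<gamma> (x # w) s = (if x = s then \<gamma> ` {0..1} else {}) \<union> word_trace (\<lambda>t. \<gamma> (t + 1)) w s"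
proof -
  have "{i. i < length (x # w) \<and> (x # w) ! i = s} = (if x = s then {0} else {}) \<union> Suc ` {i. i < length w \<and> w ! i = s}"
    by (auto simp: less_Suc_eq_0_disj)
  moreover have "\<gamma> ` {real (Suc i)..real (Suc i) + 1} = (\<lambda>t. \<gamma> (t + 1)) ` {real i..real i + 1}" for i
  proof -
    have "{real (Suc i)..real (Suc i) + 1} = (\<lambda>t. t + 1) ` {real i..real i + 1}"
      by (simp add: image_add_atLeastAtMost' add.commute)
    then show ?thesis by (simp only: image_fun[of \<gamma> "\<lambda>t. t + 1"])
  qed
  ultimately show ?thesis
    unfolding word_trace_def by simp
qed

lemma word_trace_cong: "(\<And>t. \<lbrakk>0 \<le> t; t \<le> real (length w)\<rbrakk> \<Longrightarrow> \<gamma> t = \<delta> t) \<Longrightarrow> word_trace \<gamma> w s = word_trace \<delta> w s"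
proof (induction w arbitrary: \<gamma> \<delta>)
  case (Cons x w)
  have "\<gamma> ` {0..1} = \<delta> ` {0..1}" using Cons.prems by (intro image_cong) auto
  moreover have "word_trace (\<lambda>t. \<gamma> (t + 1)) w s = word_trace (\<lambda>t. \<delta> (t + 1)) w s"
    using Cons.prems by (intro Cons.IH) auto
  ultimately show ?case by (simp add: word_trace_Cons)
qed simp

lemma word_trace_append: "word_trace \<gamma> (u @ v) s = word_trace \<gamma> u s \<union> word_trace (\<lambda>t. \<gamma> (t + real (length u))) v s"
  by (induction u arbitrary: \<gamma>) (simp_all add: word_trace_Cons Un_assoc add.assoc add.commute[of 1])

lemma word_trace_image: "word_trace (\<lambda>t. h (\<gamma> t)) w s = h ` word_trace \<gamma> w s"
  unfolding word_trace_def by (simp add: image_UN image_image)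

lemma word_trace_subset: "word_trace \<gamma> w s \<subseteq> \<gamma> ` {0..real (length w)}"
  unfolding word_trace_def by (fastforce intro: image_mono)

lemma spells_along_inj:
  assumes "spells_along D F w \<gamma>" "x \<in> {0..real (length w)}" "y \<in> {0..real (length w)}" "\<gamma> x = \<gamma> y" "x < y"
  shows "x = 0 \<and> y = real (length w)"
proof (cases "y = real (length w)")
  case True
  then have "\<gamma> x = \<gamma> 0" using assms by (simp add: spells_along_def)
  then have "x = 0"
    using assms True unfolding spells_along_def by (auto dest: inj_onD)
  then show ?thesis using True by simp
next
  case False
  then have "x = y"
    using assms unfolding spells_along_def by (auto dest: inj_onD)
  then show ?thesis using assms by simp
qed

lemma spells_along_eq_iff:
  assumes "spells_along D F w \<gamma>" "x \<in> {0..real (length w)}" "y \<in> {0..real (length w)}"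
  shows "\<gamma> x = \<gamma> y \<longleftrightarrow> x = y \<or> x = 0 \<and> y = real (length w) \<or> y = 0 \<and> x = real (length w)"
  using spells_along_inj[OF assms] spells_along_inj[OF assms(1,3,2)] assms(1)
  by (cases x y rule: linorder_cases) (auto simp: spells_along_def)

text \<open>Both curves identify exactly the two ends of the same interval, so each factors through
  the other one, which is a quotient map.\<close>

lemma spells_along_boundary_map:
  assumes \<gamma>: "spells_along D F w \<gamma>" and \<delta>: "spells_along D' F' w \<delta>"
  obtains \<theta> where "continuous_on (frontier D) \<theta>" "\<theta> ` frontier D = frontier D'"
    "\<And>t. t \<in> {0..real (length w)} \<Longrightarrow> \<theta> (\<gamma> t) = \<delta> t"
proof -
  let ?I = "{0..real (length w)}"
  have q: "quotient_map (top_of_set ?I) (top_of_set (frontier D)) \<gamma>"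
  proof (rule quotient_map_compact_Hausdorff)
    show "continuous_map (top_of_set ?I) (top_of_set (frontier D)) \<gamma>"
      using \<gamma> unfolding spells_along_def by auto
    show "compact_space (top_of_set ?I)" by (simp add: compact_space_subtopology)
    show "Hausdorff_space (top_of_set (frontier D))"
      by (intro Hausdorff_space_subtopology Hausdorff_space_euclidean)
    show "\<gamma> ` topspace (top_of_set ?I) = topspace (top_of_set (frontier D))"
      using \<gamma> by (simp add: spells_along_def)
  qed
  have c: "continuous_map (top_of_set ?I) (top_of_set (frontier D')) \<delta>"
    using \<delta> unfolding spells_along_def by auto
  have e: "\<delta> x = \<delta> y" if "x \<in> topspace (top_of_set ?I)" "y \<in> topspace (top_of_set ?I)" "\<gamma> x = \<gamma> y" for x y
    using that spells_along_eq_iff[OF \<gamma>] spells_along_eq_iff[OF \<delta>] by simp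
  obtain \<theta> where \<theta>: "continuous_map (top_of_set (frontier D)) (top_of_set (frontier D')) \<theta>"
    "\<theta> ` topspace (top_of_set (frontier D)) = \<delta> ` topspace (top_of_set ?I)"
    "\<And>x. x \<in> topspace (top_of_set ?I) \<Longrightarrow> \<theta> (\<gamma> x) = \<delta> x"
    using quotient_map_lift_exists[OF q c e] by blast
  have "\<delta> ` ?I = frontier D'" using \<delta> by (simp add: spells_along_def)
  show ?thesis
  proof (rule that)
    show "continuous_on (frontier D) \<theta>" using \<theta>(1) by (simp add: continuous_map_in_subtopology)
    show "\<theta> ` frontier D = frontier D'" using \<theta>(2) \<open>\<delta> ` ?I = frontier D'\<close> by simp
    show "\<theta> (\<gamma> t) = \<delta> t" if "t \<in> ?I" for t using \<theta>(3)[of t] that by simp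
  qed
qed

text \<open>The discs are only known to be homeomorphic to the round one, so the boundary map is
  first carried to the unit circle, extended there, and carried back. The control of the boundary
  curves is kept for locating points in corner charts.\<close>

lemma spells_along_homeomorphism:
  assumes \<gamma>: "spells_along D F w \<gamma>" and \<delta>: "spells_along D' F' w \<delta>"
  obtains h k where "homeomorphism D D' h k" "\<And>s. F' s = h ` F s"
    "\<And>t. t \<in> {0..real (length w)} \<Longrightarrow> h (\<gamma> t) = \<delta> t"
proof -
  let ?I = "{0..real (length w)}"
  have front: "\<gamma> ` ?I = frontier D" "\<delta> ` ?I = frontier D'" and discs: "closed_disc D" "closed_disc D'"
    using \<gamma> \<delta> by (auto simp: spells_along_def)
  obtain \<theta> where \<theta>: "continuous_on (frontier D) \<theta>" "\<theta> ` frontier D = frontier D'" "\<And>t. t \<in> ?I \<Longrightarrow> \<theta> (\<gamma> t) = \<delta> t"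
    using spells_along_boundary_map[OF \<gamma> \<delta>] by metis
  obtain \<theta>' where \<theta>': "continuous_on (frontier D') \<theta>'" "\<theta>' ` frontier D' = frontier D" "\<And>t. t \<in> ?I \<Longrightarrow> \<theta>' (\<delta> t) = \<gamma> t"
    using spells_along_boundary_map[OF \<delta> \<gamma>] by metis
  have hom\<theta>: "homeomorphism (frontier D) (frontier D') \<theta> \<theta>'"
    unfolding homeomorphism_def using \<theta> \<theta>' front by (metis imageE)
  obtain a a' where a: "homeomorphism D (cball (0 :: plane) 1) a a'"
    using discs(1) unfolding closed_disc_def homeomorphic_def by blast
  obtain b b' where b: "homeomorphism D' (cball (0 :: plane) 1) b b'"
    using discs(2) unfolding closed_disc_def homeomorphic_def by blast
  have cl: "closed D" "closed D'" using discs closed_disc_compact compact_imp_closed by blast+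
  have fr: "a ` frontier D = sphere 0 1" "b ` frontier D' = sphere 0 1"
    using homeomorphism_frontier(2)[OF a] homeomorphism_frontier(2)[OF b] cl by auto
  have sub: "frontier D \<subseteq> D" "frontier D' \<subseteq> D'" using cl by (simp_all add: frontier_subset_closed)
  have fa: "homeomorphism (frontier D) (sphere 0 1) a a'"
    by (rule homeomorphism_of_subsets[OF a sub(1) _ fr(1)]) auto
  have fb: "homeomorphism (frontier D') (sphere 0 1) b b'"
    by (rule homeomorphism_of_subsets[OF b sub(2) _ fr(2)]) auto
  have "homeomorphism (sphere 0 1) (sphere 0 1) (b \<circ> (\<theta> \<circ> a')) ((a \<circ> \<theta>') \<circ> b')"
    by (rule homeomorphism_compose[OF homeomorphism_compose[OF homeomorphism_symD[OF fa] hom\<theta>] fb])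
  then obtain E E' where E: "homeomorphism (cball 0 1) (cball 0 1) E E'"
    "\<And>x. x \<in> sphere 0 1 \<Longrightarrow> E x = (b \<circ> (\<theta> \<circ> a')) x"
    using homeomorphism_cball_extension by metis
  have h: "homeomorphism D D' (b' \<circ> (E \<circ> a)) ((a' \<circ> E') \<circ> b)"
    by (rule homeomorphism_compose[OF homeomorphism_compose[OF a E(1)] homeomorphism_symD[OF b]])
  have ht: "(b' \<circ> (E \<circ> a)) (\<gamma> t) = \<delta> t" if t: "t \<in> ?I" for t
  proof -
    have "\<gamma> t \<in> frontier D" using t front by blast
    then have "a (\<gamma> t) \<in> sphere 0 1" "a' (a (\<gamma> t)) = \<gamma> t"
      using fa unfolding homeomorphism_def by blast+
    then have "E (a (\<gamma> t)) = b (\<delta> t)" using E(2) \<theta>(3)[OF t] by simp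
    moreover have "b' (b (\<delta> t)) = \<delta> t" using fb t front unfolding homeomorphism_def by blast
    ultimately show ?thesis by simp
  qed
  have "F' s = (b' \<circ> (E \<circ> a)) ` F s" for s
  proof -
    have "F' s = word_trace \<delta> w s" "F s = word_trace \<gamma> w s" using \<gamma> \<delta> by (auto simp: spells_along_def)
    moreover have "word_trace \<delta> w s = word_trace (\<lambda>t. (b' \<circ> (E \<circ> a)) (\<gamma> t)) w s"
      using ht by (intro word_trace_cong) auto
    ultimately show ?thesis by (simp only: word_trace_image)
  qed
  with h ht show ?thesis using that by blast
qed

lemma spells_mirrored:
  assumes "spells D F w"
  shows "mirrored D F"
proof -
  obtain \<gamma> where \<gamma>: "spells_along D F w \<gamma>" using assms by (rule spellsE)
  have D: "compact D" using \<gamma> closed_disc_compact by (auto simp: spells_along_def)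
  have "closed (F s)" for s
  proof -
    have "compact (\<gamma> ` {real i..real i + 1})" if "i < length w" for i
    proof (rule compact_continuous_image)
      have "continuous_on {0..real (length w)} \<gamma>" using \<gamma> by (simp add: spells_along_def)
      then show "continuous_on {real i..real i + 1} \<gamma>"
        by (rule continuous_on_subset) (use that in auto)
    qed simp
    then have "compact (\<Union>i\<in>{i. i < length w \<and> w ! i = s}. \<gamma> ` {real i..real i + 1})"
      by (intro compact_UN) auto
    then show ?thesis using \<gamma> by (simp add: spells_along_def word_trace_def compact_imp_closed)
  qed
  moreover have "F s \<subseteq> D" for s
  proof -
    have "F s \<subseteq> frontier D" using \<gamma> word_trace_subset[of \<gamma> w s] by (simp add: spells_along_def)
    then show ?thesis using D by (meson compact_imp_closed frontier_subset_closed order_trans)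
  qed
  ultimately show ?thesis using D by (simp add: mirrored_def)
qed

lemma spells_unique:
  assumes "spells D F w" "spells D' F' w"
  shows "mirror_space D F homeomorphic_space mirror_space D' F'"
proof -
  obtain h k where "homeomorphism D D' h k" "\<And>s. F' s = h ` F s"
    using assms by (elim spellsE) (metis spells_along_homeomorphism)
  then show ?thesis
    using mirror_space_homeomorphism[OF spells_mirrored[OF assms(1)]] by blast
qed

section \<open>Merging, splitting and rotating words\<close>

lemma spells_along_reparametrize:
  assumes "spells_along D F w \<gamma>" "v \<noteq> []"
    and "continuous_on {0..real (length v)} \<phi>" "strict_mono_on {0..real (length v)} \<phi>"
    and "\<phi> 0 = 0" "\<phi> (real (length v)) = real (length w)"
    and "word_trace (\<lambda>t. \<gamma> (\<phi> t)) v = word_trace \<gamma> w"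
  shows "spells_along D F v (\<lambda>t. \<gamma> (\<phi> t))"
proof -
  let ?m = "real (length v)" and ?n = "real (length w)"
  have lt: "x < y \<Longrightarrow> 0 \<le> x \<Longrightarrow> y \<le> ?m \<Longrightarrow> \<phi> x < \<phi> y" for x y
    using strict_mono_onD[OF assms(4), of x y] by auto
  have inj: "inj_on \<phi> {0..?m}" using assms(4) strict_mono_on_imp_inj_on by blast
  have range: "\<phi> t \<in> {0..?n}" if "t \<in> {0..?m}" for t
    using lt[of 0 t] lt[of t ?m] that assms(5,6) by (cases "t = 0"; cases "t = ?m") auto
  have half: "\<phi> t \<in> {0..<?n}" if "t \<in> {0..<?m}" for t
    using range[of t] lt[of t ?m] that assms(6) by auto
  have im: "\<phi> ` {0..?m} = {0..?n}"
  proof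
    show "{0..?n} \<subseteq> \<phi> ` {0..?m}"
    proof
      fix y assume "y \<in> {0..?n}"
      then obtain x where "0 \<le> x" "x \<le> ?m" "\<phi> x = y"
        using IVT'[of \<phi> 0 y ?m] assms(3,5,6) by auto
      then show "y \<in> \<phi> ` {0..?m}" by auto
    qed
  qed (use range in blast)
  have "continuous_on {0..?m} (\<lambda>t. \<gamma> (\<phi> t))"
  proof (rule continuous_on_compose2[OF _ assms(3)])
    show "continuous_on {0..?n} \<gamma>" using assms(1) by (simp add: spells_along_def)
    show "\<phi> ` {0..?m} \<subseteq> {0..?n}" using im by simp
  qed
  moreover have "inj_on (\<lambda>t. \<gamma> (\<phi> t)) {0..<?m}"
  proof (rule inj_onI)
    fix x y assume xy: "x \<in> {0..<?m}" "y \<in> {0..<?m}" "\<gamma> (\<phi> x) = \<gamma> (\<phi> y)"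
    then have "\<phi> x = \<phi> y" using assms(1) half unfolding spells_along_def by (meson inj_onD)
    then show "x = y" using inj xy by (auto dest: inj_onD)
  qed
  moreover have "(\<lambda>t. \<gamma> (\<phi> t)) ` {0..?m} = \<gamma> ` {0..?n}"
    using im by (simp only: image_fun[of \<gamma> \<phi>])
  ultimately show ?thesis
    using assms unfolding spells_along_def by simp
qed

lemma spells_merge:
  assumes "spells D F (x # x # w)"
  shows "spells D F (x # w)"
proof -
  obtain \<gamma> where \<gamma>: "spells_along D F (x # x # w) \<gamma>" using assms by (rule spellsE)
  \<comment> \<open>Double speed on the first letter, which then covers two old letters, and unit
    speed afterwards; the two expressions agree at 1.\<close>
  define \<phi> :: "real \<Rightarrow> real" where "\<phi> t = min (2 * t) (t + 1)" for t
  have "spells_along D F (x # w) (\<lambda>t. \<gamma> (\<phi> t))"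
  proof (rule spells_along_reparametrize[OF \<gamma>])
    show "word_trace (\<lambda>t. \<gamma> (\<phi> t)) (x # w) = word_trace \<gamma> (x # x # w)"
    proof
      fix s
      have "word_trace (\<lambda>t. \<gamma> (\<phi> (t + 1))) w s = word_trace (\<lambda>t. \<gamma> (t + 2)) w s"
        by (intro word_trace_cong) (simp add: \<phi>_def add.commute)
      moreover have "(\<lambda>t. \<gamma> (\<phi> t)) ` {0..1} = \<gamma> ` {0..1} \<union> (\<lambda>t. \<gamma> (t + 1)) ` {0..1}"
      proof -
        have "\<phi> ` {0..1} = (\<lambda>t. 2 * t) ` {0..1}"
          by (intro image_cong) (auto simp: \<phi>_def)
        also have "\<dots> = {0..1} \<union> (\<lambda>t. t + 1) ` {0..1}"
          by (auto simp: image_mult_atLeastAtMost image_add_atLeastAtMost')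
        finally have "\<phi> ` {0..1} = {0..1} \<union> (\<lambda>t. t + 1) ` {0..1}" .
        then show ?thesis by (simp only: image_fun[of \<gamma> \<phi>] image_fun[of \<gamma> "\<lambda>t. t + 1"] image_Un)
      qed
      ultimately show "word_trace (\<lambda>t. \<gamma> (\<phi> t)) (x # w) s = word_trace \<gamma> (x # x # w) s"
        by (simp add: word_trace_Cons add.commute add.left_commute Un_assoc)
    qed
  qed (auto simp: \<phi>_def strict_mono_on_def intro!: continuous_intros)
  then show ?thesis by (rule spellsI)
qed

text \<open>Serves the corner charts, which need at least one letter besides the two that meet at
  the corner: in a word of length two, splitting a letter creates it. The cut u can be placed beyond
  a given point of the first letter.\<close>

lemma spells_along_subdivide:
  assumes \<gamma>: "spells_along D F (x # w) \<gamma>" and u: "0 < u" "u < 1"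
  obtains \<delta> where "spells_along D F (x # x # w) \<delta>" "\<delta> ` {0..<1} = \<gamma> ` {0..<u}"
proof -
  \<comment> \<open>Piecewise linear with slopes u, 1 - u and 1 and breaks at 1 and 2; written with
    \<open>max\<close>, its continuity is immediate.\<close>
  define \<phi> where "\<phi> t = u * t + (1 - 2 * u) * max 0 (t - 1) + u * max 0 (t - 2)" for t
  have \<phi>: "\<phi> t = (if t \<le> 1 then u * t else if t \<le> 2 then u + (1 - u) * (t - 1) else t - 1)" for t
    by (simp add: \<phi>_def algebra_simps)
  have \<phi>1: "\<phi> ` {0..1} = {0..u}"
  proof -
    have "\<phi> ` {0..1} = (\<lambda>t. u * t) ` {0..1}" by (intro image_cong) (auto simp: \<phi>)
    then show ?thesis using u by (simp add: image_mult_atLeastAtMost)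
  qed
  have \<phi>2: "(\<lambda>t. \<phi> (t + 1)) ` {0..1} = {u..1}"
  proof -
    have "(\<lambda>t. \<phi> (t + 1)) ` {0..1} = (\<lambda>t. (1 - u) * t + u) ` {0..1}"
      by (intro image_cong) (auto simp: \<phi>)
    then show ?thesis using u by (simp add: image_affinity_atLeastAtMost)
  qed
  have "spells_along D F (x # x # w) (\<lambda>t. \<gamma> (\<phi> t))"
  proof (rule spells_along_reparametrize[OF \<gamma>])
    show "word_trace (\<lambda>t. \<gamma> (\<phi> t)) (x # x # w) = word_trace \<gamma> (x # w)"
    proof
      fix s
      have "word_trace (\<lambda>t. \<gamma> (\<phi> (t + 2))) w s = word_trace (\<lambda>t. \<gamma> (t + 1)) w s"
        by (intro word_trace_cong) (simp add: \<phi> add.commute)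
      moreover have "(\<lambda>t. \<gamma> (\<phi> t)) ` {0..1} \<union> (\<lambda>t. \<gamma> (\<phi> (t + 1))) ` {0..1} = \<gamma> ` {0..1}"
      proof -
        have "{0..u} \<union> {u..1} = {0..1}" using u by auto
        then show ?thesis
          using \<phi>1 \<phi>2 by (simp only: image_fun[of \<gamma> \<phi>] image_fun[of \<gamma> "\<lambda>t. \<phi> (t + 1)"] flip: image_Un)
      qed
      ultimately show "word_trace (\<lambda>t. \<gamma> (\<phi> t)) (x # x # w) s = word_trace \<gamma> (x # w) s"
        by (simp add: word_trace_Cons add.commute add.left_commute) blast
    qed
    show "strict_mono_on {0..real (length (x # x # w))} \<phi>"
    proof (rule strict_mono_onI)
      fix a b :: real assume ab: "a < b"
      consider "b \<le> 1" | "a \<le> 1" "1 < b" "b \<le> 2" | "a \<le> 1" "2 < b" | "1 < a" "b \<le> 2"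
        | "1 < a" "a \<le> 2" "2 < b" | "2 < a"
        using ab by linarith
      then show "\<phi> a < \<phi> b"
      proof cases
        case 1
        then show ?thesis using ab u by (simp add: \<phi>)
      next
        case 2
        have "u * a \<le> u * 1" "0 < (1 - u) * (b - 1)"
          using 2 u by (auto intro!: mult_left_mono)
        then show ?thesis using 2 by (simp only: \<phi>) simp
      next
        case 3
        have "u * a \<le> u * 1"
          using 3 u by (intro mult_left_mono) auto
        moreover have "\<phi> a = u * a" "\<phi> b = b - 1" using 3 by (simp_all add: \<phi>)
        ultimately show ?thesis using 3 u by linarith
      next
        case 4
        have "(1 - u) * (a - 1) < (1 - u) * (b - 1)"
          using 4 ab u by (intro mult_strict_left_mono) auto
        then show ?thesis using 4 ab by (simp only: \<phi>) simp
      next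
        case 5
        have "(1 - u) * (a - 1) \<le> (1 - u) * 1"
          using 5 u by (intro mult_left_mono) auto
        then show ?thesis using 5 by (simp only: \<phi>) simp
      next
        case 6
        then show ?thesis using ab by (simp add: \<phi>)
      qed
    qed
    show "continuous_on {0..real (length (x # x # w))} \<phi>"
      unfolding \<phi>_def by (intro continuous_intros)
  qed (auto simp: \<phi>)
  moreover have "\<phi> ` {0..<1} = {0..<u}"
  proof (intro subset_antisym subsetI)
    fix y assume "y \<in> {0..<u}"
    then show "y \<in> \<phi> ` {0..<1}" using u by (intro image_eqI[of _ _ "y / u"]) (auto simp: \<phi>)
  qed (use u in \<open>auto simp: \<phi>\<close>)
  then have "(\<lambda>t. \<gamma> (\<phi> t)) ` {0..<1} = \<gamma> ` {0..<u}" by (simp only: image_fun[of \<gamma> \<phi>])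
  ultimately show ?thesis using that by blast
qed

lemma spells_along_rotate:
  assumes \<gamma>: "spells_along D F (x # w) \<gamma>"
  shows "spells_along D F (w @ [x]) (\<lambda>t. if t \<le> real (length w) then \<gamma> (t + 1) else \<gamma> (t - real (length w)))"
    (is "spells_along D F _ ?\<delta>")
proof -
  define m where "m = real (length w)"
  let ?\<delta> = "\<lambda>t. if t \<le> m then \<gamma> (t + 1) else \<gamma> (t - m)"
  have len: "real (length (x # w)) = m + 1" "real (length (w @ [x])) = m + 1" and m: "0 \<le> m"
    by (auto simp: m_def)
  have \<gamma>: "closed_disc D" "continuous_on {0..m + 1} \<gamma>" "inj_on \<gamma> {0..<m + 1}" "\<gamma> (m + 1) = \<gamma> 0"
    "\<gamma> ` {0..m + 1} = frontier D" "F = word_trace \<gamma> (x # w)"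
    using assms by (simp_all only: spells_along_def len)
  have cont: "continuous_on {0..m + 1} ?\<delta>"
  proof -
    have "continuous_on ({0..m} \<union> {m..m + 1}) ?\<delta>"
    proof (rule continuous_on_If)
      show "continuous_on {0..m} (\<lambda>t. \<gamma> (t + 1))" "continuous_on {m..m + 1} (\<lambda>t. \<gamma> (t - m))"
        using m by (auto intro!: continuous_on_compose2[OF \<gamma>(2)] continuous_intros)
    qed (use \<gamma>(4) in auto)
    moreover have "{0..m} \<union> {m..m + 1} = {0..m + 1}" using m by auto
    ultimately show ?thesis by simp
  qed
  have inj: "inj_on ?\<delta> {0..<m + 1}"
  proof (rule inj_onI)
    fix s t assume st: "s \<in> {0..<m + 1}" "t \<in> {0..<m + 1}" "?\<delta> s = ?\<delta> t"
    have *: "s = t" if "s \<in> {0..<m + 1}" "t \<in> {0..<m + 1}" "?\<delta> s = ?\<delta> t" "s \<le> t" for s t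
    proof -
      have eq: "u = v" if "u \<in> {0..<m + 1}" "v \<in> {0..<m + 1}" "\<gamma> u = \<gamma> v" for u v
        using \<gamma>(3) that by (auto dest: inj_onD)
      \<comment> \<open>This f maps the half-open interval into itself, since it sends m to 0 and
        not to m + 1; thus injectivity of the old curve applies.\<close>
      define f where "f u = (if u < m then u + 1 else u - m)" for u
      have top: "?\<delta> u = \<gamma> (f u)" for u
        using \<gamma>(4) by (auto simp: f_def)
      have "f s = f t"
      proof (rule eq)
        show "\<gamma> (f s) = \<gamma> (f t)" using that(3) unfolding top .
      qed (use that m in \<open>simp_all add: f_def\<close>)
      then show ?thesis using that(1,2,4) by (simp add: f_def split: if_splits)
    qed
    show "s = t" using *[of s t] *[of t s] st by (cases "s \<le> t") auto
  qed
  have im: "?\<delta> ` {0..m + 1} = frontier D"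
  proof -
    have "?\<delta> ` {0..m + 1} = ?\<delta> ` ({0..m} \<union> {m..m + 1})"
      using m by (intro arg_cong[where f = "image _"]) auto
    also have "\<dots> = ?\<delta> ` {0..m} \<union> ?\<delta> ` {m..m + 1}" by blast
    also have "?\<delta> ` {0..m} = \<gamma> ` {1..m + 1}"
      by (simp add: image_fun[of \<gamma> "\<lambda>t. t + 1"] image_add_atLeastAtMost')
    also have "?\<delta> ` {m..m + 1} = (\<lambda>t. \<gamma> (t - m)) ` {m..m + 1}"
      using \<gamma>(4) by (intro image_cong) auto
    also have "\<dots> = \<gamma> ` {0..1}"
      by (simp add: image_fun[of \<gamma> "\<lambda>t. t - m"])
    also have "\<gamma> ` {1..m + 1} \<union> \<gamma> ` {0..1} = \<gamma> ` ({0..1} \<union> {1..m + 1})" by blast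
    also have "{0..1} \<union> {1..m + 1} = {0..m + 1}" using m by auto
    finally show ?thesis using \<gamma>(5) by simp
  qed
  have tr: "F = word_trace ?\<delta> (w @ [x])"
  proof
    fix s
    have "word_trace ?\<delta> w s = word_trace (\<lambda>t. \<gamma> (t + 1)) w s"
      by (intro word_trace_cong) (simp add: m_def)
    moreover have "(\<lambda>t. ?\<delta> (t + m)) ` {0..1} = \<gamma> ` {0..1}"
      using \<gamma>(4) by (intro image_cong) (auto simp: add.commute)
    ultimately show "F s = word_trace ?\<delta> (w @ [x]) s"
      unfolding \<gamma>(6) by (simp add: word_trace_append word_trace_Cons flip: m_def) blast
  qed
  have ends: "?\<delta> (m + 1) = ?\<delta> 0" using m by auto
  have "spells_along D F (w @ [x]) ?\<delta>"
    unfolding spells_along_def len by (intro conjI \<gamma>(1) cont inj ends im tr) simp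
  then show ?thesis unfolding m_def .
qed

lemma spells_rotate: "spells D F (u @ v) \<Longrightarrow> spells D F (v @ u)"
proof (induction u arbitrary: v)
  case (Cons x u)
  then have "spells D F (x # (u @ v))" by simp
  then obtain \<gamma> where "spells_along D F (x # (u @ v)) \<gamma>" by (rule spellsE)
  then have "spells D F ((u @ v) @ [x])" by (rule spells_along_rotate[THEN spellsI])
  then have "spells D F (u @ (v @ [x]))" by simp
  from Cons.IH[OF this] show ?case by simp
qed simp

section \<open>Model discs\<close>

text \<open>The word spread evenly over the unit interval, for words placed on a single side of a
  model polygon.\<close>

definition word_fractions :: "'l list \<Rightarrow> 'l \<Rightarrow> real set" where
  "word_fractions w s =
     (\<Union>i\<in>{i. i < length w \<and> w ! i = s}. {real i / real (length w)..(real i + 1) / real (length w)})"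

text \<open>
  H is the half-open trace of a path from A to B, without the end point B, and G s is the part of
  the path labelled s. This makes the conditions for joining paths disjointness conditions.
\<close>

definition boundary_path ::
  "(real \<Rightarrow> plane) \<Rightarrow> plane \<Rightarrow> plane \<Rightarrow> 'l list \<Rightarrow> plane set \<Rightarrow> ('l \<Rightarrow> plane set) \<Rightarrow> bool" where
  "boundary_path \<gamma> A B w H G \<longleftrightarrow>
     continuous_on {0..real (length w)} \<gamma> \<and> inj_on \<gamma> {0..<real (length w)} \<and> \<gamma> 0 = A \<and>
     \<gamma> (real (length w)) = B \<and> \<gamma> ` {0..<real (length w)} = H \<and> word_trace \<gamma> w = G"

definition boundary_piece ::
  "plane \<Rightarrow> plane \<Rightarrow> 'l list \<Rightarrow> plane set \<Rightarrow> ('l \<Rightarrow> plane set) \<Rightarrow> bool" where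
  "boundary_piece A B w H G \<longleftrightarrow> (\<exists>\<gamma>. boundary_path \<gamma> A B w H G)"

lemma word_fractions_subset: "word_fractions w s \<subseteq> {0..1}"
proof
  fix t assume "t \<in> word_fractions w s"
  then obtain i where i: "i < length w" "real i / real (length w) \<le> t" "t \<le> (real i + 1) / real (length w)"
    by (auto simp: word_fractions_def)
  have "real i + 1 \<le> real (length w)" using i(1) by linarith
  then have "0 \<le> real i / real (length w)" "(real i + 1) / real (length w) \<le> 1"
    by (simp_all add: divide_le_eq_1)
  then show "t \<in> {0..1}" unfolding atLeastAtMost_iff using i by linarith
qed

lemma word_fractions_single [simp]: "word_fractions [x] s = (if x = s then {0..1} else {})"
  by (auto simp: word_fractions_def)

text \<open>Needed for the inner side of the trapezoid, which the boundary curve traverses against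
  the direction in which its word is laid out.\<close>

lemma word_fractions_rev: "word_fractions (rev w) s = (\<lambda>t. 1 - t) ` word_fractions w s"
proof -
  have sub: "(\<lambda>t. 1 - t) ` word_fractions w s \<subseteq> word_fractions (rev w) s" for w :: "'a list"
  proof (rule image_subsetI)
    fix t assume "t \<in> word_fractions w s"
    then obtain i where i: "i < length w" "w ! i = s"
      "real i / real (length w) \<le> t" "t \<le> (real i + 1) / real (length w)"
      by (auto simp: word_fractions_def)
    define j where "j = length w - Suc i"
    have j: "j < length (rev w)" "rev w ! j = s" "real j = real (length w) - real i - 1"
      using i by (auto simp: j_def rev_nth of_nat_diff)
    have n: "0 < real (length w)" using i(1) by (cases w) auto
    have "real j / real (length w) \<le> 1 - t" "1 - t \<le> (real j + 1) / real (length w)"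
      using i(3,4) unfolding j(3) pos_divide_le_eq[OF n] pos_le_divide_eq[OF n]
      by (simp_all add: left_diff_distrib)
    then show "1 - t \<in> word_fractions (rev w) s"
      using j(1,2) unfolding word_fractions_def by auto
  qed
  have "word_fractions (rev w) s = (\<lambda>t. 1 - t) ` (\<lambda>t. 1 - t) ` word_fractions (rev w) s"
    by (simp add: image_image)
  also have "\<dots> \<subseteq> (\<lambda>t. 1 - t) ` word_fractions w s"
    using sub[of "rev w"] by (intro image_mono) simp
  finally show ?thesis using sub[of w] by blast
qed

lemma boundary_piece_path:
  assumes "w \<noteq> []" "continuous_on {0..1} p" "inj_on p {0..<1}"
  shows "boundary_piece (p 0) (p 1) w (p ` {0..<1}) (\<lambda>s. p ` word_fractions w s)"
  unfolding boundary_piece_def boundary_path_def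
proof (intro exI[of _ "\<lambda>t. p (t / real (length w))"] conjI)
  let ?n = "real (length w)"
  have n: "0 < ?n" using assms(1) by simp
  show "continuous_on {0..?n} (\<lambda>t. p (t / ?n))"
    using n by (intro continuous_on_compose2[OF assms(2)] continuous_intros) (auto simp: field_simps)
  show "inj_on (\<lambda>t. p (t / ?n)) {0..<?n}"
  proof (rule inj_onI)
    fix x y assume xy: "x \<in> {0..<?n}" "y \<in> {0..<?n}" "p (x / ?n) = p (y / ?n)"
    then have "x / ?n = y / ?n" using n by (intro inj_onD[OF assms(3)]) auto
    then show "x = y" using n by simp
  qed
  have "(\<lambda>t. t / ?n) ` {0..<?n} = {0..<1}"
  proof (intro subset_antisym subsetI)
    fix y :: real assume "y \<in> {0..<1}"
    then show "y \<in> (\<lambda>t. t / ?n) ` {0..<?n}" using n by (intro image_eqI[of _ _ "y * ?n"]) auto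
  qed (use n in auto)
  then show "(\<lambda>t. p (t / ?n)) ` {0..<?n} = p ` {0..<1}"
    by (simp only: image_fun[of p "\<lambda>t. t / ?n"])
  show "word_trace (\<lambda>t. p (t / ?n)) w = (\<lambda>s. p ` word_fractions w s)"
  proof
    fix s
    have "(\<lambda>t. t / ?n) ` {real i..real i + 1} = {real i / ?n..(real i + 1) / ?n}" for i
    proof (intro subset_antisym subsetI)
      fix y assume "y \<in> {real i / ?n..(real i + 1) / ?n}"
      then show "y \<in> (\<lambda>t. t / ?n) ` {real i..real i + 1}"
        using n by (intro image_eqI[of _ _ "y * ?n"]) (auto simp: field_simps)
    qed (use n in \<open>auto simp: divide_right_mono\<close>)
    then show "word_trace (\<lambda>t. p (t / ?n)) w s = p ` word_fractions w s"
      unfolding word_trace_def word_fractions_def by (simp only: image_fun[of p "\<lambda>t. t / ?n"] image_UN)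
  qed
qed (use assms(1) in simp_all)

lemma boundary_piece_linepath:
  assumes "w \<noteq> []" "A \<noteq> B"
  shows "boundary_piece A B w (linepath A B ` {0..<1}) (\<lambda>s. linepath A B ` word_fractions w s)"
proof -
  have "inj_on (linepath A B) {0..<1}"
    by (rule inj_on_subset[OF inj_on_linepath[OF assms(2)]]) auto
  from boundary_piece_path[OF assms(1) continuous_on_linepath this] show ?thesis
    by (simp add: linepath_0' linepath_1')
qed

lemma boundary_path_join:
  assumes "boundary_path \<gamma> A B u H G" "boundary_piece B C v H' G'" "H \<inter> H' = {}"
  obtains \<epsilon> where "boundary_path \<epsilon> A C (u @ v) (H \<union> H') (\<lambda>s. G s \<union> G' s)"
    "\<And>t. t \<le> real (length u) \<Longrightarrow> \<epsilon> t = \<gamma> t"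
proof -
  let ?m = "real (length u)" and ?n = "real (length v)"
  have \<gamma>: "continuous_on {0..?m} \<gamma>" "inj_on \<gamma> {0..<?m}" "\<gamma> 0 = A" "\<gamma> ?m = B"
      "\<gamma> ` {0..<?m} = H" "word_trace \<gamma> u = G"
    using assms(1) unfolding boundary_path_def by blast+
  obtain \<delta> where \<delta>: "continuous_on {0..?n} \<delta>" "inj_on \<delta> {0..<?n}" "\<delta> 0 = B" "\<delta> ?n = C"
      "\<delta> ` {0..<?n} = H'" "word_trace \<delta> v = G'"
    using assms(2) unfolding boundary_piece_def boundary_path_def by blast
  define \<epsilon> where "\<epsilon> t = (if t \<le> ?m then \<gamma> t else \<delta> (t - ?m))" for t
  have ge: "\<epsilon> t = \<delta> (t - ?m)" if "?m \<le> t" for t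
    using that \<gamma>(4) \<delta>(3) by (auto simp: \<epsilon>_def)
  have "continuous_on ({0..?m} \<union> {?m..?m + ?n}) \<epsilon>"
    unfolding \<epsilon>_def
  proof (rule continuous_on_If)
    show "continuous_on {?m..?m + ?n} (\<lambda>t. \<delta> (t - ?m))"
      by (intro continuous_on_compose2[OF \<delta>(1)] continuous_intros) auto
  qed (use \<gamma> \<delta> in auto)
  moreover have "{0..?m} \<union> {?m..?m + ?n} = {0..?m + ?n}" by auto
  ultimately have cont: "continuous_on {0..?m + ?n} \<epsilon>" by simp
  have im: "\<epsilon> ` {0..<?m} = H" "\<epsilon> ` {?m..<?m + ?n} = H'"
  proof -
    have "\<epsilon> ` {0..<?m} = \<gamma> ` {0..<?m}" by (intro image_cong) (auto simp: \<epsilon>_def)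
    then show "\<epsilon> ` {0..<?m} = H" using \<gamma>(5) by simp
    have "\<epsilon> ` {?m..<?m + ?n} = (\<lambda>t. \<delta> (t - ?m)) ` {?m..<?m + ?n}" by (intro image_cong) (auto simp: ge)
    moreover have "(\<lambda>t. t - ?m) ` {?m..<?m + ?n} = {0..<?n}"
    proof (intro subset_antisym subsetI)
      fix y assume "y \<in> {0..<?n}"
      then show "y \<in> (\<lambda>t. t - ?m) ` {?m..<?m + ?n}" by (intro image_eqI[of _ _ "y + ?m"]) auto
    qed auto
    ultimately have "\<epsilon> ` {?m..<?m + ?n} = \<delta> ` {0..<?n}"
      by (simp only: image_fun[of \<delta> "\<lambda>t. t - ?m"])
    then show "\<epsilon> ` {?m..<?m + ?n} = H'" using \<delta>(5) by simp
  qed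
  have split: "{0..<?m + ?n} = {0..<?m} \<union> {?m..<?m + ?n}" by auto
  have "inj_on \<epsilon> {0..<?m}"
    by (rule inj_on_cong[THEN iffD1, OF _ \<gamma>(2)]) (simp add: \<epsilon>_def)
  moreover have "inj_on \<epsilon> {?m..<?m + ?n}"
  proof (rule inj_onI)
    fix x y assume xy: "x \<in> {?m..<?m + ?n}" "y \<in> {?m..<?m + ?n}" "\<epsilon> x = \<epsilon> y"
    then have "x - ?m = y - ?m" by (intro inj_onD[OF \<delta>(2)]) (auto simp: ge)
    then show "x = y" by simp
  qed
  ultimately have inj: "inj_on \<epsilon> {0..<?m + ?n}"
    unfolding split using im assms(3) by (subst inj_on_Un) blast
  have tr: "word_trace \<epsilon> (u @ v) = (\<lambda>s. G s \<union> G' s)"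
  proof
    fix s
    have "word_trace \<epsilon> u s = word_trace \<gamma> u s" by (rule word_trace_cong) (simp add: \<epsilon>_def)
    moreover have "word_trace (\<lambda>t. \<epsilon> (t + ?m)) v s = word_trace \<delta> v s" by (rule word_trace_cong) (simp add: ge)
    ultimately show "word_trace \<epsilon> (u @ v) s = G s \<union> G' s" using \<gamma>(6) \<delta>(6) by (simp add: word_trace_append)
  qed
  have len: "real (length (u @ v)) = ?m + ?n" by simp
  have "\<epsilon> 0 = A" "\<epsilon> (?m + ?n) = C" using \<gamma>(3) \<delta>(4) ge[of "?m + ?n"] by (simp_all add: \<epsilon>_def)
  then have "boundary_path \<epsilon> A C (u @ v) (H \<union> H') (\<lambda>s. G s \<union> G' s)"
    unfolding boundary_path_def len using cont inj im tr by (simp add: split image_Un)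
  then show ?thesis using that[of \<epsilon>] by (simp add: \<epsilon>_def)
qed

lemma boundary_piece_join:
  assumes "boundary_piece A B u H G" "boundary_piece B C v H' G'" "H \<inter> H' = {}"
  shows "boundary_piece A C (u @ v) (H \<union> H') (\<lambda>s. G s \<union> G' s)"
proof -
  obtain \<gamma> where "boundary_path \<gamma> A B u H G" using assms(1) unfolding boundary_piece_def by blast
  from boundary_path_join[OF this assms(2,3)] show ?thesis unfolding boundary_piece_def by blast
qed

lemma boundary_path_spells_along:
  assumes "boundary_path \<gamma> A A w H G" "w \<noteq> []" "closed_disc D" "H = frontier D"
  shows "spells_along D G w \<gamma>"
proof -
  let ?n = "real (length w)"
  have \<gamma>: "continuous_on {0..?n} \<gamma>" "inj_on \<gamma> {0..<?n}" "\<gamma> 0 = A" "\<gamma> ?n = A"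
      "\<gamma> ` {0..<?n} = H" "word_trace \<gamma> w = G"
    using assms(1) unfolding boundary_path_def by blast+
  have "0 < ?n" using assms(2) by simp
  then have "{0..?n} = insert ?n {0..<?n}" "0 \<in> {0..<?n}" by auto
  then have "\<gamma> ` {0..?n} = H" using \<gamma>(3,4,5) by (metis image_insert imageI insert_absorb)
  then show ?thesis
    using \<gamma> assms by (simp add: spells_along_def)
qed

lemma boundary_piece_spells:
  assumes "boundary_piece A A w H G" "w \<noteq> []" "closed_disc D" "H = frontier D"
  shows "spells D G w"
  using assms boundary_path_spells_along spellsI unfolding boundary_piece_def by metis

lemma closed_disc_convex:
  assumes "convex D" "compact D" "interior D \<noteq> {}"
  shows "closed_disc D"
  unfolding closed_disc_def by (rule homeomorphic_convex_compact_cball[OF assms]) simp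

section \<open>Polygonal discs cut out by half-planes\<close>

definition polyhedral :: "(plane \<times> real) list \<Rightarrow> plane set" where
  "polyhedral L = {z. \<forall>x\<in>set L. fst x \<bullet> z \<le> snd x}"

lemma polyhedral_Cons: "polyhedral (x # L) = {z. fst x \<bullet> z \<le> snd x} \<inter> polyhedral L"
  by (auto simp: polyhedral_def)

lemma polyhedral_convex_closed: "convex (polyhedral L)" "closed (polyhedral L)"
proof -
  show "convex (polyhedral L)"
  proof (induction L)
    case (Cons x L)
    then show ?case unfolding polyhedral_Cons by (intro convex_Int convex_halfspace_le)
  qed (simp add: polyhedral_def)
  show "closed (polyhedral L)"
  proof (induction L)
    case (Cons x L)
    then show ?case unfolding polyhedral_Cons by (intro closed_Int closed_halfspace_le)
  qed (simp add: polyhedral_def)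
qed

lemma interior_polyhedral:
  "(\<And>x. x \<in> set L \<Longrightarrow> fst x \<noteq> 0) \<Longrightarrow> interior (polyhedral L) = {z. \<forall>x\<in>set L. fst x \<bullet> z < snd x}"
proof (induction L)
  case (Cons x L)
  then show ?case
    unfolding polyhedral_Cons interior_Int by (auto simp: interior_halfspace_le)
qed (simp add: polyhedral_def)

lemma polyhedral_disc:
  assumes "\<And>x. x \<in> set L \<Longrightarrow> fst x \<noteq> 0" "\<And>x. x \<in> set L \<Longrightarrow> fst x \<bullet> z0 < snd x"
    and "polyhedral L \<subseteq> cbox p q"
  shows "closed_disc (polyhedral L)" "frontier (polyhedral L) = {z \<in> polyhedral L. \<exists>x\<in>set L. fst x \<bullet> z = snd x}"
proof -
  have int: "interior (polyhedral L) = {z. \<forall>x\<in>set L. fst x \<bullet> z < snd x}"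
    by (rule interior_polyhedral) (rule assms(1))
  have "bounded (polyhedral L)"
    using assms(3) bounded_cbox bounded_subset by blast
  then have "compact (polyhedral L)"
    using polyhedral_convex_closed(2) compact_eq_bounded_closed by blast
  moreover have "z0 \<in> interior (polyhedral L)" unfolding int using assms(2) by blast
  ultimately show "closed_disc (polyhedral L)"
    using closed_disc_convex[OF polyhedral_convex_closed(1)] by blast
  show "frontier (polyhedral L) = {z \<in> polyhedral L. \<exists>x\<in>set L. fst x \<bullet> z = snd x}"
    unfolding frontier_def int using polyhedral_convex_closed(2)[of L]
    by (auto simp: polyhedral_def order.order_iff_strict)
qed

text \<open>Here \<tau> recovers the parameter from the point, and P describes the line. Images of
  parameter sets thereby become conditions on the coordinates.\<close>

lemma linepath_image:
  assumes "\<And>t. P (linepath A B t)" "\<And>t. \<tau> (linepath A B t) = t" "\<And>z. P z \<Longrightarrow> linepath A B (\<tau> z) = z"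
  shows "linepath A B ` S = {z. P z \<and> \<tau> z \<in> S}"
proof (intro subset_antisym subsetI)
  fix z assume "z \<in> {z. P z \<and> \<tau> z \<in> S}"
  then show "z \<in> linepath A B ` S" using assms(3)[of z] by (intro image_eqI[of _ _ "\<tau> z"]) simp_all
qed (use assms(1,2) in auto)

lemma linepath_Pair: "linepath (a, b) (c, d) t = ((1 - t) * a + t * c, (1 - t) * b + t * d)" for a b c d :: real
  by (simp add: linepath_def)

text \<open>The side length 2 puts the line x + y = 1, along which the corner at the origin will be
  cut off, halfway to the hypotenuse.\<close>

definition triangle :: "plane set" where
  "triangle = {z. 0 \<le> fst z \<and> 0 \<le> snd z \<and> fst z + snd z \<le> 2}"

text \<open>The legs carry b and a, and u is laid out on the hypotenuse from (2, 0) to (0, 2); so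
  the origin is a corner between a and b with all other letters on the opposite side.\<close>

definition triangle_labels :: "'l \<Rightarrow> 'l \<Rightarrow> 'l list \<Rightarrow> 'l \<Rightarrow> plane set" where
  "triangle_labels b a u s =
     {z \<in> triangle. snd z = 0 \<and> s = b \<or> fst z = 0 \<and> s = a \<or>
                    fst z + snd z = 2 \<and> snd z / 2 \<in> word_fractions u s}"

lemma triangle_polyhedral: "triangle = polyhedral [((- 1, 0), 0), ((0, - 1), 0), ((1, 1), 2)]"
  by (auto simp: triangle_def polyhedral_def inner_prod_def)

lemma triangle_disc:
  "closed_disc triangle" "frontier triangle = {z \<in> triangle. fst z = 0 \<or> snd z = 0 \<or> fst z + snd z = 2}"
proof -
  let ?L = "[((- 1, 0), 0), ((0, - 1), 0), ((1, 1), 2)] :: (plane \<times> real) list"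
  have "triangle \<subseteq> cbox (0, 0) (2, 2)"
    by (auto simp: triangle_def cbox_Pair_eq)
  then have bd: "polyhedral ?L \<subseteq> cbox (0, 0) (2, 2)" by (simp only: triangle_polyhedral)
  show "closed_disc triangle"
    unfolding triangle_polyhedral by (rule polyhedral_disc(1)[OF _ _ bd, of "(1/2, 1/2)"]) (auto simp: zero_prod_def)
  show "frontier triangle = {z \<in> triangle. fst z = 0 \<or> snd z = 0 \<or> fst z + snd z = 2}"
    unfolding triangle_polyhedral
    by (subst polyhedral_disc(2)[OF _ _ bd, of "(1/2, 1/2)"]) (auto simp: zero_prod_def inner_prod_def)
qed

text \<open>The second conclusion keeps the first letter, without its end, off the hypotenuse. This
  will place boundary points in the domain of the corner chart.\<close>

lemma triangle_spells_along:
  assumes "u \<noteq> []"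
  obtains \<gamma> where "spells_along triangle (triangle_labels b a u) (b # u @ [a]) \<gamma>"
    "\<And>t. t \<in> {0..<1} \<Longrightarrow> snd (\<gamma> t) = 0 \<and> 0 \<le> fst (\<gamma> t) \<and> fst (\<gamma> t) < 2"
proof -
  have L1: "linepath (0, 0) (2, 0) ` S = {z :: plane. snd z = 0 \<and> fst z / 2 \<in> S}" for S
    by (rule linepath_image) (auto simp: linepath_Pair)
  have L2: "linepath (2, 0) (0, 2) ` S = {z :: plane. fst z + snd z = 2 \<and> snd z / 2 \<in> S}" for S
    by (rule linepath_image) (auto simp: linepath_Pair prod_eq_iff)
  have L3: "linepath (0, 2) (0, 0) ` S = {z :: plane. fst z = 0 \<and> 1 - snd z / 2 \<in> S}" for S
    by (rule linepath_image) (auto simp: linepath_Pair prod_eq_iff field_simps)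
  have p1: "boundary_piece (0, 0) (2, 0) [b] (linepath (0, 0) (2, 0) ` {0..<1}) (\<lambda>s. linepath (0, 0) (2, 0) ` word_fractions [b] s)"
   and p2: "boundary_piece (2, 0) (0, 2) u (linepath (2, 0) (0, 2) ` {0..<1}) (\<lambda>s. linepath (2, 0) (0, 2) ` word_fractions u s)"
   and p3: "boundary_piece (0, 2) (0, 0) [a] (linepath (0, 2) (0, 0) ` {0..<1}) (\<lambda>s. linepath (0, 2) (0, 0) ` word_fractions [a] s)"
    using assms by (intro boundary_piece_linepath; simp)+
  obtain \<gamma>1 where \<gamma>1: "boundary_path \<gamma>1 (0, 0) (2, 0) [b] (linepath (0, 0) (2, 0) ` {0..<1}) (\<lambda>s. linepath (0, 0) (2, 0) ` word_fractions [b] s)"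
    using p1 unfolding boundary_piece_def by blast
  have "{z :: plane. fst z + snd z = 2 \<and> snd z / 2 \<in> {0..<1}} \<inter> {z. fst z = 0 \<and> 1 - snd z / 2 \<in> {0..<1}} = {}"
    by auto
  note p23 = boundary_piece_join[OF p2 p3, unfolded L2 L3, OF this]
  have "{z :: plane. snd z = 0 \<and> fst z / 2 \<in> {0..<1}} \<inter>
      ({z. fst z + snd z = 2 \<and> snd z / 2 \<in> {0..<1}} \<union> {z. fst z = 0 \<and> 1 - snd z / 2 \<in> {0..<1}}) = {}"
    by auto
  from boundary_path_join[OF \<gamma>1[unfolded L1] p23 this]
  obtain \<gamma> where \<gamma>: "boundary_path \<gamma> (0, 0) (0, 0) ([b] @ (u @ [a])) ({z. snd z = 0 \<and> fst z / 2 \<in> {0..<1}} \<union>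
        ({z. fst z + snd z = 2 \<and> snd z / 2 \<in> {0..<1}} \<union> {z. fst z = 0 \<and> 1 - snd z / 2 \<in> {0..<1}}))
      (\<lambda>s. {z. snd z = 0 \<and> fst z / 2 \<in> word_fractions [b] s} \<union>
      ({z. fst z + snd z = 2 \<and> snd z / 2 \<in> word_fractions u s} \<union> {z. fst z = 0 \<and> 1 - snd z / 2 \<in> word_fractions [a] s}))"
    "\<And>t. t \<le> real (length [b]) \<Longrightarrow> \<gamma> t = \<gamma>1 t"
    by blast
  have start: "snd (\<gamma> t) = 0 \<and> 0 \<le> fst (\<gamma> t) \<and> fst (\<gamma> t) < 2" if "t \<in> {0..<1}" for t
  proof -
    have "\<gamma>1 t \<in> {z. snd z = 0 \<and> fst z / 2 \<in> {0..<1}}"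
      using \<gamma>1 that unfolding boundary_path_def L1 by auto
    then show ?thesis using \<gamma>(2)[of t] that by simp
  qed
  have "spells_along triangle (\<lambda>s. {z. snd z = 0 \<and> fst z / 2 \<in> word_fractions [b] s} \<union>
      ({z. fst z + snd z = 2 \<and> snd z / 2 \<in> word_fractions u s} \<union> {z. fst z = 0 \<and> 1 - snd z / 2 \<in> word_fractions [a] s}))
      ([b] @ (u @ [a])) \<gamma>"
  proof (rule boundary_path_spells_along[OF \<gamma>(1) _ triangle_disc(1)])
    show "{z. snd z = 0 \<and> fst z / 2 \<in> {0..<1}} \<union> ({z. fst z + snd z = 2 \<and> snd z / 2 \<in> {0..<1}} \<union> {z. fst z = 0 \<and> 1 - snd z / 2 \<in> {0..<1}}) = frontier triangle"
      unfolding triangle_disc(2) unfolding triangle_def set_eq_iff Un_iff mem_Collect_eq atLeastLessThan_iff by (smt (verit) field_sum_of_halves)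
  qed (auto)
  moreover have "(\<lambda>s. {z. snd z = 0 \<and> fst z / 2 \<in> word_fractions [b] s} \<union>
      ({z. fst z + snd z = 2 \<and> snd z / 2 \<in> word_fractions u s} \<union> {z. fst z = 0 \<and> 1 - snd z / 2 \<in> word_fractions [a] s})) = triangle_labels b a u"
  proof (intro ext set_eqI)
    fix s and z :: plane
    have "0 \<le> snd z / 2 \<and> snd z / 2 \<le> 1" if "snd z / 2 \<in> word_fractions u s"
      using that word_fractions_subset[of u s] by auto
    then show "z \<in> {z. snd z = 0 \<and> fst z / 2 \<in> word_fractions [b] s} \<union>
      ({z. fst z + snd z = 2 \<and> snd z / 2 \<in> word_fractions u s} \<union> {z. fst z = 0 \<and> 1 - snd z / 2 \<in> word_fractions [a] s})
       \<longleftrightarrow> z \<in> triangle_labels b a u s"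
      unfolding triangle_labels_def triangle_def word_fractions_single by auto
  qed
  ultimately have "spells_along triangle (triangle_labels b a u) (b # u @ [a]) \<gamma>" by simp
  then show ?thesis using start by (rule that)
qed

lemma triangle_spells: "u \<noteq> [] \<Longrightarrow> spells triangle (triangle_labels b a u) (b # u @ [a])"
  by (metis triangle_spells_along spellsI)

text \<open>The bound 1 / 2 is the reciprocal of 2: the inner side is the image of the hypotenuse x
  + y = 2 under an inversion that replaces x + y by its reciprocal.\<close>

definition trapezoid :: "plane set" where
  "trapezoid = {z. 0 \<le> fst z \<and> 0 \<le> snd z \<and> 1 / 2 \<le> fst z + snd z \<and> fst z + snd z \<le> 2}"

text \<open>On the inner side v runs from (1 / 2, 0) to (0, 1 / 2), parallel to its position on the
  hypotenuse of the second triangle. A curve around the trapezoid meets this side in the opposite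
  direction, whence \<open>rev v\<close> in the boundary word.\<close>

definition trapezoid_labels :: "'l \<Rightarrow> 'l \<Rightarrow> 'l list \<Rightarrow> 'l list \<Rightarrow> 'l \<Rightarrow> plane set" where
  "trapezoid_labels b a u v s =
     {z \<in> trapezoid. snd z = 0 \<and> s = b \<or> fst z = 0 \<and> s = a \<or>
                     fst z + snd z = 2 \<and> snd z / 2 \<in> word_fractions u s \<or>
                     fst z + snd z = 1 / 2 \<and> 2 * snd z \<in> word_fractions v s}"

lemma trapezoid_polyhedral:
  "trapezoid = polyhedral [((- 1, 0), 0), ((0, - 1), 0), ((- 1, - 1), - 1 / 2), ((1, 1), 2)]"
  by (auto simp: trapezoid_def polyhedral_def inner_prod_def)

lemma trapezoid_disc:
  "closed_disc trapezoid"
  "frontier trapezoid = {z \<in> trapezoid. fst z = 0 \<or> snd z = 0 \<or> fst z + snd z = 1 / 2 \<or> fst z + snd z = 2}"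
proof -
  let ?L = "[((- 1, 0), 0), ((0, - 1), 0), ((- 1, - 1), - 1 / 2), ((1, 1), 2)] :: (plane \<times> real) list"
  have "trapezoid \<subseteq> cbox (0, 0) (2, 2)"
    by (auto simp: trapezoid_def cbox_Pair_eq)
  then have bd: "polyhedral ?L \<subseteq> cbox (0, 0) (2, 2)" by (simp only: trapezoid_polyhedral)
  show "closed_disc trapezoid"
    unfolding trapezoid_polyhedral by (rule polyhedral_disc(1)[OF _ _ bd, of "(1/2, 1/2)"]) (auto simp: zero_prod_def)
  show "frontier trapezoid = {z \<in> trapezoid. fst z = 0 \<or> snd z = 0 \<or> fst z + snd z = 1 / 2 \<or> fst z + snd z = 2}"
    unfolding trapezoid_polyhedral
    by (subst polyhedral_disc(2)[OF _ _ bd, of "(1/2, 1/2)"]) (auto simp: zero_prod_def inner_prod_def)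
qed

lemma trapezoid_spells:
  assumes "u \<noteq> []" "v \<noteq> []"
  shows "spells trapezoid (trapezoid_labels b a u v) (b # u @ [a] @ rev v)"
proof -
  have L1: "linepath (1 / 2, 0) (2, 0) ` S = {z :: plane. snd z = 0 \<and> (fst z - 1 / 2) * (2 / 3) \<in> S}" for S
    by (rule linepath_image) (auto simp: linepath_Pair prod_eq_iff field_simps)
  have L2: "linepath (2, 0) (0, 2) ` S = {z :: plane. fst z + snd z = 2 \<and> snd z / 2 \<in> S}" for S
    by (rule linepath_image) (auto simp: linepath_Pair prod_eq_iff)
  have L3: "linepath (0, 2) (0, 1 / 2) ` S = {z :: plane. fst z = 0 \<and> (2 - snd z) * (2 / 3) \<in> S}" for S
    by (rule linepath_image) (auto simp: linepath_Pair prod_eq_iff field_simps)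
  have L4: "linepath (0, 1 / 2) (1 / 2, 0) ` S = {z :: plane. fst z + snd z = 1 / 2 \<and> 1 - 2 * snd z \<in> S}" for S
    by (rule linepath_image) (auto simp: linepath_Pair prod_eq_iff field_simps)
  have p1: "boundary_piece (1 / 2, 0) (2, 0) [b] (linepath (1 / 2, 0) (2, 0) ` {0..<1}) (\<lambda>s. linepath (1 / 2, 0) (2, 0) ` word_fractions [b] s)"
   and p2: "boundary_piece (2, 0) (0, 2) u (linepath (2, 0) (0, 2) ` {0..<1}) (\<lambda>s. linepath (2, 0) (0, 2) ` word_fractions u s)"
   and p3: "boundary_piece (0, 2) (0, 1 / 2) [a] (linepath (0, 2) (0, 1 / 2) ` {0..<1}) (\<lambda>s. linepath (0, 2) (0, 1 / 2) ` word_fractions [a] s)"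
   and p4: "boundary_piece (0, 1 / 2) (1 / 2, 0) (rev v) (linepath (0, 1 / 2) (1 / 2, 0) ` {0..<1})
        (\<lambda>s. linepath (0, 1 / 2) (1 / 2, 0) ` word_fractions (rev v) s)"
    using assms by (intro boundary_piece_linepath; simp)+
  note pieces = boundary_piece_join[OF p1 boundary_piece_join[OF p2 boundary_piece_join[OF p3 p4]], unfolded L1 L2 L3 L4]
  let ?G = "\<lambda>s. {z :: plane. snd z = 0 \<and> (fst z - 1 / 2) * (2 / 3) \<in> word_fractions [b] s} \<union>
      ({z. fst z + snd z = 2 \<and> snd z / 2 \<in> word_fractions u s} \<union>
      ({z. fst z = 0 \<and> (2 - snd z) * (2 / 3) \<in> word_fractions [a] s} \<union>
       {z. fst z + snd z = 1 / 2 \<and> 1 - 2 * snd z \<in> word_fractions (rev v) s}))"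
  have "spells trapezoid ?G ([b] @ (u @ ([a] @ rev v)))"
  proof (rule boundary_piece_spells[OF pieces _ trapezoid_disc(1)])
    show "{z. snd z = 0 \<and> (fst z - 1 / 2) * (2 / 3) \<in> {0..<1}} \<union>
      ({z. fst z + snd z = 2 \<and> snd z / 2 \<in> {0..<1}} \<union>
      ({z. fst z = 0 \<and> (2 - snd z) * (2 / 3) \<in> {0..<1}} \<union>
       {z. fst z + snd z = 1 / 2 \<and> 1 - 2 * snd z \<in> {0..<1}})) = frontier trapezoid"
      (is "?H = _")
    proof (intro set_eqI iffI)
      fix z assume "z \<in> ?H"
      then show "z \<in> frontier trapezoid"
        unfolding trapezoid_disc(2) unfolding trapezoid_def Un_iff mem_Collect_eq atLeastLessThan_iff
        by (elim disjE conjE) simp_all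
    next
      fix z assume z: "z \<in> frontier trapezoid"
      then consider "snd z = 0" "fst z \<noteq> 2" | "fst z = 0" "snd z \<noteq> 1 / 2"
        | "fst z + snd z = 1 / 2" "snd z \<noteq> 0" | "fst z + snd z = 2" "fst z \<noteq> 0"
        unfolding trapezoid_disc(2) by fastforce
      then show "z \<in> ?H"
        using z unfolding trapezoid_disc(2) unfolding trapezoid_def Un_iff mem_Collect_eq atLeastLessThan_iff
        by cases simp_all
    qed
  qed (auto)
  moreover have "?G = trapezoid_labels b a u v"
  proof (intro ext set_eqI)
    fix s and z :: plane
    have u: "0 \<le> snd z / 2 \<and> snd z / 2 \<le> 1" if "snd z / 2 \<in> word_fractions u s"
      using that word_fractions_subset[of u s] by auto
    have v: "0 \<le> 2 * snd z \<and> 2 * snd z \<le> 1" if "2 * snd z \<in> word_fractions v s"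
      using that word_fractions_subset[of v s] by auto
    have r: "1 - 2 * snd z \<in> word_fractions (rev v) s \<longleftrightarrow> 2 * snd z \<in> word_fractions v s"
      by (auto simp: word_fractions_rev image_iff)
    have ba: "(fst z - 1 / 2) * (2 / 3) \<in> word_fractions [b] s \<longleftrightarrow> s = b \<and> 1 / 2 \<le> fst z \<and> fst z \<le> 2"
      "(2 - snd z) * (2 / 3) \<in> word_fractions [a] s \<longleftrightarrow> s = a \<and> 1 / 2 \<le> snd z \<and> snd z \<le> 2"
      by auto
    show "z \<in> ?G s \<longleftrightarrow> z \<in> trapezoid_labels b a u v s"
      unfolding trapezoid_labels_def trapezoid_def Un_iff mem_Collect_eq r ba
    proof (rule iffI, goal_cases)
      case 1
      then show ?case using u v by (elim disjE conjE) simp_all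
    next
      case 2
      then show ?case by (elim conjE disjE) simp_all
    qed
  qed
  ultimately show ?thesis by simp
qed

section \<open>Corner charts\<close>

text \<open>For a basis a, b this is the character of (Z/2)^2 with value -1 at a and 1 at b.\<close>

definition flip :: "bit \<times> bit \<Rightarrow> bit \<times> bit \<Rightarrow> bit \<times> bit \<Rightarrow> real" where
  "flip a b g = (if g = a \<or> g = a + b then - 1 else 1)"

text \<open>Places the copy g of a corner in one of the four quadrants. The side on the second axis
  carries a, so that the label a changes the sign of the first coordinate.\<close>

definition turn :: "bit \<times> bit \<Rightarrow> bit \<times> bit \<Rightarrow> bit \<times> bit \<Rightarrow> plane \<Rightarrow> plane" where
  "turn a b g z = (flip a b g * fst z, flip b a g * snd z)"

text \<open>The copy whose quadrant contains w. Points on the axes are assigned to the nonnegative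
  side; any choice would do, as the copies are glued there.\<close>

definition corner_sign :: "bit \<times> bit \<Rightarrow> bit \<times> bit \<Rightarrow> plane \<Rightarrow> bit \<times> bit" where
  "corner_sign a b w = (if fst w < 0 then a else 0) + (if snd w < 0 then b else 0)"

definition corner_fold :: "plane \<Rightarrow> plane" where
  "corner_fold w = (\<bar>fst w\<bar>, \<bar>snd w\<bar>)"

definition open_diamond :: "plane set" where
  "open_diamond = {w. \<bar>fst w\<bar> + \<bar>snd w\<bar> < 2}"

definition half_open_triangle :: "plane set" where
  "half_open_triangle = {z. 0 \<le> fst z \<and> 0 \<le> snd z \<and> fst z + snd z < 2}"

text \<open>A corner of D at which an edge labelled a (on the second axis) meets an edge labelled b.\<close>

definition corner :: "plane set \<Rightarrow> (bit \<times> bit \<Rightarrow> plane set) \<Rightarrow> bit \<times> bit \<Rightarrow> bit \<times> bit \<Rightarrow> (plane \<Rightarrow> plane) \<Rightarrow> bool" where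
  "corner D F a b h \<longleftrightarrow> mirrored D F \<and> a \<noteq> 0 \<and> b \<noteq> 0 \<and> a \<noteq> b \<and> (\<exists>k. homeomorphism triangle D h k) \<and>
     (\<forall>z\<in>half_open_triangle. \<forall>s. h z \<in> F s \<longleftrightarrow> s = b \<and> snd z = 0 \<or> s = a \<and> fst z = 0)"

text \<open>It runs from the diamond to the surface, so it is the inverse of a chart in the sense of
  \<open>chart\<close>.\<close>

definition corner_chart ::
  "plane set \<Rightarrow> (bit \<times> bit \<Rightarrow> plane set) \<Rightarrow> bit \<times> bit \<Rightarrow> bit \<times> bit \<Rightarrow> (plane \<Rightarrow> plane) \<Rightarrow> plane \<Rightarrow> ((bit \<times> bit) \<times> plane) set" where
  "corner_chart D F a b h w = mirror_map D F (corner_sign a b w, h (corner_fold w))"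

lemma bit_pair_basis_cases:
  fixes a b g :: "bit \<times> bit"
  assumes "a \<noteq> 0" "b \<noteq> 0" "a \<noteq> b"
  obtains "g = 0" | "g = a" | "g = b" | "g = a + b"
  using bit_pair_sum_of_distinct[of a b g] assms by metis

lemma bit_pair_basis_neq:
  fixes a b :: "bit \<times> bit"
  assumes "a \<noteq> 0" "b \<noteq> 0" "a \<noteq> b"
  shows "a + b \<noteq> 0" "a + b \<noteq> a" "a + b \<noteq> b"
  using assms by (auto simp: bit_pair_add_eq_0_iff)

lemma flip_alt:
  assumes "a \<noteq> 0" "b \<noteq> 0" "a \<noteq> b"
  shows "flip a b g = (if g = 0 \<or> g = b then 1 else - 1)"
  using bit_pair_basis_cases[OF assms, of g] assms bit_pair_basis_neq[OF assms]
  unfolding flip_def by metis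

text \<open>The kernel of the character is {0, b}, and two elements have the same sign exactly if
  they lie in the same coset.\<close>

lemma flip_eq_iff:
  assumes "a \<noteq> 0" "b \<noteq> 0" "a \<noteq> b"
  shows "flip a b g = flip a b h \<longleftrightarrow> g + h = 0 \<or> g + h = b"
proof -
  have sums: "a + b + a = b" by (simp add: ac_simps)
  consider "g = 0" | "g = b" | "g \<noteq> 0" "g \<noteq> b" "g = a \<or> g = a + b"
    using bit_pair_basis_cases[OF assms, of g] by metis
  then have "((g = 0 \<or> g = b) \<longleftrightarrow> (h = 0 \<or> h = b)) \<longleftrightarrow> g + h = 0 \<or> g + h = b"
  proof cases
    case 2
    then show ?thesis by (auto simp: bit_pair_add_eq_0_iff)
  next
    case 3
    consider "h = 0" | "h = b" | "h \<noteq> 0" "h \<noteq> b" "h = a \<or> h = a + b"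
      using bit_pair_basis_cases[OF assms, of h] by metis
    then show ?thesis
    proof cases
      case 1
      then show ?thesis using 3 by simp
    next
      case 2
      then show ?thesis using 3 by (simp add: bit_pair_add_eq_0_iff)
    next
      case h: 3
      then have "g + h = 0 \<or> g + h = b"
        using 3(3) sums bit_pair_add_self bit_pair_add_left_self by metis
      then show ?thesis using 3 h by simp
    qed
  qed simp
  then show ?thesis unfolding flip_alt[OF assms] by auto
qed

lemma flip_cases: "flip a b g = 1 \<or> flip a b g = - 1"
  by (simp add: flip_def)

lemma abs_flip [simp]: "\<bar>flip a b g\<bar> = 1" "flip a b g * flip a b g = 1" "flip a b g * (flip a b g * x) = x"
  by (simp_all add: flip_def)

lemma corner_fold_turn: "0 \<le> fst z \<Longrightarrow> 0 \<le> snd z \<Longrightarrow> corner_fold (turn a b g z) = z"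
  by (simp add: corner_fold_def turn_def abs_mult)

lemma turn_turn [simp]: "turn a b g (turn a b g z) = z"
  by (simp add: turn_def)

lemma turn_corner_fold:
  assumes "a \<noteq> 0" "b \<noteq> 0" "a \<noteq> b"
  shows "turn a b (corner_sign a b w) (corner_fold w) = w"
proof -
  note ne = assms assms(3)[symmetric] bit_pair_basis_neq[OF assms]
  have "flip a b (corner_sign a b w) = (if fst w < 0 then - 1 else 1)"
    unfolding flip_alt[OF assms] corner_sign_def by (cases "fst w < 0"; cases "snd w < 0") (simp_all add: ne)
  moreover have "flip b a (corner_sign a b w) = (if snd w < 0 then - 1 else 1)"
    unfolding flip_alt[OF assms(2,1) assms(3)[symmetric]] corner_sign_def
    by (cases "fst w < 0"; cases "snd w < 0") (simp_all add: ne)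
  ultimately show ?thesis
    by (simp add: turn_def corner_fold_def prod_eq_iff)
qed

lemma turn_eq_iff:
  assumes "a \<noteq> 0" "b \<noteq> 0" "a \<noteq> b" and z: "0 \<le> fst z" "0 \<le> snd z" "0 \<le> fst z'" "0 \<le> snd z'"
  shows "turn a b g z = turn a b g' z' \<longleftrightarrow>
    z = z' \<and> (fst z = 0 \<or> g + g' = 0 \<or> g + g' = b) \<and> (snd z = 0 \<or> g + g' = 0 \<or> g + g' = a)"
proof -
  have "z = z'" if "turn a b g z = turn a b g' z'"
    using that corner_fold_turn[OF z(1,2)] corner_fold_turn[OF z(3,4)] by metis
  moreover have "turn a b g z = turn a b g' z \<longleftrightarrow>
      (fst z = 0 \<or> flip a b g = flip a b g') \<and> (snd z = 0 \<or> flip b a g = flip b a g')"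
    by (auto simp: turn_def)
  ultimately show ?thesis
    using flip_eq_iff[OF assms(1-3), of g g'] flip_eq_iff[OF assms(2,1) assms(3)[symmetric], of g g'] by metis
qed

lemma continuous_on_turn: "continuous_on S (turn a b g)"
  unfolding turn_def by (intro continuous_intros)

lemma sums_of_two:
  fixes a b k :: "'a::comm_monoid_add"
  shows "k \<in> {s + t | s t. (s = b \<and> P \<or> s = a \<and> Q) \<and> (t = b \<and> P \<or> t = a \<and> Q)} \<longleftrightarrow>
    k = b + b \<and> P \<or> k = a + a \<and> Q \<or> k = a + b \<and> P \<and> Q"
  by (auto simp: add.commute)

text \<open>The stabilizer is one of the four coordinate subgroups for the basis a, b. The condition
  is split into two coordinate conditions in order to match the agreement of signs in
  \<open>turn_eq_iff\<close> and in the model surfaces.\<close>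

lemma mirror_group_two_labels:
  assumes ab: "a \<noteq> 0" "b \<noteq> 0" "a \<noteq> b" and labels: "\<And>s. p \<in> F s \<longleftrightarrow> s = b \<and> P \<or> s = a \<and> Q"
  shows "k \<in> mirror_group F p \<longleftrightarrow> (Q \<or> k = 0 \<or> k = b) \<and> (P \<or> k = 0 \<or> k = a)"
proof -
  note ne = ab ab(3)[symmetric] bit_pair_basis_neq[OF ab] bit_pair_basis_neq[OF ab, symmetric]
  have "mirror_group F p = {0} \<union> {s. s = b \<and> P \<or> s = a \<and> Q} \<union>
      {s + t | s t. (s = b \<and> P \<or> s = a \<and> Q) \<and> (t = b \<and> P \<or> t = a \<and> Q)}"
    unfolding mirror_group_def labels ..
  also have "k \<in> \<dots> \<longleftrightarrow> k = 0 \<or> k = b \<and> P \<or> k = a \<and> Q \<or> k = a + b \<and> Q \<and> P"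
    unfolding Un_iff singleton_iff sums_of_two bit_pair_add_self by blast
  also have "\<dots> \<longleftrightarrow> (Q \<or> k = 0 \<or> k = b) \<and> (P \<or> k = 0 \<or> k = a)"
    by (cases rule: bit_pair_basis_cases[OF ab, of k]) (auto simp: ne)
  finally show ?thesis .
qed

locale corner_at =
  fixes D F a b h
  assumes corner: "corner D F a b h"
begin

lemma ab: "a \<noteq> 0" "b \<noteq> 0" "a \<noteq> b"
  and mirr: "mirrored D F"
  and label_iff: "z \<in> half_open_triangle \<Longrightarrow> h z \<in> F s \<longleftrightarrow> s = b \<and> snd z = 0 \<or> s = a \<and> fst z = 0"
  using corner unfolding corner_def by auto

lemma h: "continuous_on triangle h" "inj_on h triangle" "h ` triangle = D"
proof -
  obtain k where "homeomorphism triangle D h k"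
    using corner unfolding corner_def by blast
  then show "continuous_on triangle h" "inj_on h triangle" "h ` triangle = D"
    unfolding homeomorphism_def by (blast, metis inj_on_inverseI, blast)
qed

lemma half_open_triangle_subset: "half_open_triangle \<subseteq> triangle"
  by (auto simp: half_open_triangle_def triangle_def)

lemma mirror_group_corner:
  assumes "z \<in> half_open_triangle"
  shows "k \<in> mirror_group F (h z) \<longleftrightarrow> (fst z = 0 \<or> k = 0 \<or> k = b) \<and> (snd z = 0 \<or> k = 0 \<or> k = a)"
  using mirror_group_two_labels[OF ab label_iff[OF assms]] .

text \<open>Gluing the four copies of a corner along its two labels makes the same identifications
  as reflecting one quadrant in the two axes. This is why four corners close up to a disc.\<close>

lemma mirror_map_eq_turn_iff:
  assumes "z \<in> half_open_triangle" "z' \<in> half_open_triangle"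
  shows "mirror_map D F (g, h z) = mirror_map D F (g', h z') \<longleftrightarrow> turn a b g z = turn a b g' z'"
proof -
  have T: "z \<in> triangle" "z' \<in> triangle" using assms half_open_triangle_subset by auto
  then have "h z \<in> D" "h z' \<in> D" using h(3) by auto
  then have "mirror_map D F (g, h z) = mirror_map D F (g', h z') \<longleftrightarrow> z = z' \<and> g + g' \<in> mirror_group F (h z)"
    using inj_on_eq_iff[OF h(2) T] by (simp add: mirror_map_eq_iff)
  also have "\<dots> \<longleftrightarrow> turn a b g z = turn a b g' z'"
    using mirror_group_corner[OF assms(1), of "g + g'"] assms
    by (subst turn_eq_iff[OF ab]) (auto simp: half_open_triangle_def)
  finally show ?thesis .
qed

lemma corner_fold_mem: "w \<in> open_diamond \<Longrightarrow> corner_fold w \<in> half_open_triangle"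
  by (simp add: open_diamond_def half_open_triangle_def corner_fold_def)

lemma turn_mem: "z \<in> half_open_triangle \<Longrightarrow> turn a b g z \<in> open_diamond"
  by (simp add: open_diamond_def half_open_triangle_def turn_def abs_mult)

lemma corner_chart_turn:
  assumes "z \<in> half_open_triangle"
  shows "corner_chart D F a b h (turn a b g z) = mirror_map D F (g, h z)"
proof -
  have "corner_fold (turn a b g z) \<in> half_open_triangle"
    by (intro corner_fold_mem turn_mem assms)
  then show ?thesis
    unfolding corner_chart_def using mirror_map_eq_turn_iff[OF _ assms] turn_corner_fold[OF ab] by metis
qed

definition region :: "((bit \<times> bit) \<times> plane) set set" where
  "region = mirror_map D F ` (UNIV \<times> h ` half_open_triangle)"

lemma region_saturated:
  assumes "p \<in> D" "mirror_map D F (g, p) \<in> region"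
  shows "p \<in> h ` half_open_triangle"
proof -
  obtain g' z where z: "z \<in> half_open_triangle" "mirror_map D F (g, p) = mirror_map D F (g', h z)"
    using assms(2) unfolding region_def by blast
  then have "h z \<in> D" using half_open_triangle_subset h(3) by blast
  then have "p = h z" using z(2) assms(1) by (simp add: mirror_map_eq_iff)
  then show ?thesis using z(1) by blast
qed

lemma openin_half_open: "openin (top_of_set D) (h ` half_open_triangle)"
proof -
  obtain k where k: "homeomorphism triangle D h k" using corner unfolding corner_def by blast
  have "openin (top_of_set triangle) half_open_triangle"
  proof -
    have "half_open_triangle = triangle \<inter> {z. fst z + snd z < 2}"
      by (auto simp: half_open_triangle_def triangle_def)
    moreover have "open {z :: plane. fst z + snd z < 2}"
      by (intro open_Collect_less continuous_intros)
    ultimately show ?thesis by (metis openin_open_Int)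
  qed
  then show ?thesis using homeomorphism_imp_open_map[OF k] by blast
qed

lemma openin_region: "openin (mirror_space D F) region"
proof -
  have eq: "{x \<in> topspace (four_copies D). mirror_map D F x \<in> region} = UNIV \<times> h ` half_open_triangle"
  proof (intro subset_antisym subsetI)
    fix x assume x: "x \<in> {x \<in> topspace (four_copies D). mirror_map D F x \<in> region}"
    obtain g p where "x = (g, p)" by (cases x)
    with x region_saturated[of p g] show "x \<in> UNIV \<times> h ` half_open_triangle"
      by simp
  next
    fix x assume "x \<in> (UNIV :: (bit \<times> bit) set) \<times> h ` half_open_triangle"
    then show "x \<in> {x \<in> topspace (four_copies D). mirror_map D F x \<in> region}"
      unfolding region_def topspace_four_copies using half_open_triangle_subset h(3) by blast
  qed
  have op: "openin (four_copies D) (UNIV \<times> h ` half_open_triangle)"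
    using openin_half_open by (simp add: openin_disjoint_union)
  have sub: "region \<subseteq> topspace (mirror_space D F)"
    unfolding region_def topspace_mirror_space using half_open_triangle_subset h(3) by blast
  have iff: "openin (four_copies D) {x \<in> topspace (four_copies D). mirror_map D F x \<in> U} \<longleftrightarrow>
      openin (mirror_space D F) U" if "U \<subseteq> topspace (mirror_space D F)" for U
    using quotient_map_mirror_map[of D F] that unfolding quotient_map_def by blast
  show ?thesis using iff[OF sub] op unfolding eq by blast
qed

text \<open>Compactness is only available on the closed triangle and the closed diamond. The result
  is restricted afterwards to the open diamond, whose preimage is saturated; the same detour is used
  for the region in the surface.\<close>

lemma quotient_map_turn:
  "quotient_map (four_copies half_open_triangle) (top_of_set open_diamond) (\<lambda>(g, z). turn a b g z)"
proof -
  define C where "C = {w :: plane. \<bar>fst w\<bar> + \<bar>snd w\<bar> \<le> 2}"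
  have im: "(\<lambda>(g, z). turn a b g z) ` (UNIV \<times> triangle) = C"
  proof (intro subset_antisym subsetI)
    fix w assume "w \<in> C"
    then have "corner_fold w \<in> triangle" by (simp add: C_def corner_fold_def triangle_def)
    then show "w \<in> (\<lambda>(g, z). turn a b g z) ` (UNIV \<times> triangle)"
      using turn_corner_fold[OF ab, of w] by (intro image_eqI[of _ _ "(corner_sign a b w, corner_fold w)"]) simp_all
  next
    fix w assume "w \<in> (\<lambda>(g, z). turn a b g z) ` (UNIV \<times> triangle)"
    then obtain g z where "w = turn a b g z" "z \<in> triangle" by auto
    then show "w \<in> C" by (simp add: C_def turn_def triangle_def abs_mult)
  qed
  have Q: "quotient_map (four_copies triangle) (top_of_set C) (\<lambda>(g, z). turn a b g z)"
  proof (rule quotient_map_compact_Hausdorff)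
    show "continuous_map (four_copies triangle) (top_of_set C) (\<lambda>(g, z). turn a b g z)"
      unfolding continuous_map_sum_topology using im continuous_on_turn
      by (auto simp: continuous_map_in_subtopology)
    show "compact_space (four_copies triangle)"
      by (intro compact_space_four_copies closed_disc_compact triangle_disc(1))
    show "Hausdorff_space (top_of_set C)"
      by (intro Hausdorff_space_subtopology Hausdorff_space_euclidean)
  qed (simp add: im)
  have sub: "{x \<in> topspace (four_copies triangle). (\<lambda>(g, z). turn a b g z) x \<in> open_diamond} = UNIV \<times> half_open_triangle"
    by (auto simp: open_diamond_def half_open_triangle_def triangle_def turn_def abs_mult)
  have "openin (top_of_set C) open_diamond"
  proof -
    have "open_diamond = C \<inter> {w. \<bar>fst w\<bar> + \<bar>snd w\<bar> < 2}"
      by (auto simp: open_diamond_def C_def)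
    moreover have "open {w :: plane. \<bar>fst w\<bar> + \<bar>snd w\<bar> < 2}"
      by (intro open_Collect_less continuous_intros)
    ultimately show ?thesis by (metis openin_open_Int)
  qed
  with quotient_map_restriction[OF Q sub]
  have "quotient_map (subtopology (four_copies triangle) (UNIV \<times> half_open_triangle))
      (subtopology (top_of_set C) open_diamond) (\<lambda>(g, z). turn a b g z)"
    by blast
  moreover have "subtopology (four_copies triangle) (UNIV \<times> half_open_triangle) = four_copies half_open_triangle"
    unfolding subtopology_sum_topology subtopology_subtopology
    using half_open_triangle_subset by (simp add: Int_absorb1)
  moreover have "subtopology (top_of_set C) open_diamond = top_of_set open_diamond"
    unfolding subtopology_subtopology by (simp add: Int_absorb1 open_diamond_def C_def subset_iff)
  ultimately show ?thesis by simp
qed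

lemma quotient_map_region:
  "quotient_map (four_copies half_open_triangle) (subtopology (mirror_space D F) region) (\<lambda>(g, z). mirror_map D F (g, h z))"
proof -
  have Q: "quotient_map (four_copies triangle) (mirror_space D F) (\<lambda>(g, z). mirror_map D F (g, h z))"
  proof (rule quotient_map_compact_Hausdorff)
    have "continuous_map (top_of_set triangle) (mirror_space D F) (mirror_map D F \<circ> (Pair g \<circ> h))" for g
    proof (rule continuous_map_compose[OF _ quotient_imp_continuous_map[OF quotient_map_mirror_map]])
      show "continuous_map (top_of_set triangle) (four_copies D) (Pair g \<circ> h)"
        by (rule continuous_map_compose[OF _ continuous_map_component_injection]) (use h in auto)
    qed
    then show "continuous_map (four_copies triangle) (mirror_space D F) (\<lambda>(g, z). mirror_map D F (g, h z))"
      unfolding continuous_map_sum_topology by (simp add: o_def)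
    show "compact_space (four_copies triangle)"
      by (intro compact_space_four_copies closed_disc_compact triangle_disc(1))
    show "Hausdorff_space (mirror_space D F)" by (rule Hausdorff_space_mirror_space[OF mirr])
    have "(\<lambda>(g, z). (g, h z)) ` (UNIV \<times> triangle) = UNIV \<times> D"
      using h(3) by force
    moreover have "(\<lambda>(g, z). mirror_map D F (g, h z)) = mirror_map D F \<circ> (\<lambda>(g, z). (g, h z))"
      by (auto simp: fun_eq_iff)
    ultimately show "(\<lambda>(g, z). mirror_map D F (g, h z)) ` topspace (four_copies triangle) = topspace (mirror_space D F)"
      unfolding topspace_mirror_space topspace_four_copies by (metis image_comp)
  qed
  have "h z \<in> h ` half_open_triangle \<longleftrightarrow> z \<in> half_open_triangle" if "z \<in> triangle" for z
    using inj_on_image_mem_iff[OF h(2) that half_open_triangle_subset] .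
  moreover have "h z \<in> D" if "z \<in> triangle" for z using that h(3) by blast
  ultimately have "mirror_map D F (g, h z) \<in> region \<longleftrightarrow> z \<in> half_open_triangle" if "z \<in> triangle" for g z
    using region_saturated[of "h z" g] that unfolding region_def by blast
  then have sub: "{x \<in> topspace (four_copies triangle). (\<lambda>(g, z). mirror_map D F (g, h z)) x \<in> region} = UNIV \<times> half_open_triangle"
    using half_open_triangle_subset by auto
  from quotient_map_restriction[OF Q sub] openin_region
  have "quotient_map (subtopology (four_copies triangle) (UNIV \<times> half_open_triangle))
      (subtopology (mirror_space D F) region) (\<lambda>(g, z). mirror_map D F (g, h z))"
    by blast
  moreover have "subtopology (four_copies triangle) (UNIV \<times> half_open_triangle) = four_copies half_open_triangle"
    unfolding subtopology_sum_topology subtopology_subtopology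
    using half_open_triangle_subset by (simp add: Int_absorb1)
  ultimately show ?thesis by simp
qed

text \<open>The diamond and the region are both quotients of the four half-open triangles with the
  same fibres, and the chart is the induced map between them.\<close>

lemma homeomorphic_map_corner_chart:
  "homeomorphic_map (top_of_set open_diamond) (subtopology (mirror_space D F) region) (corner_chart D F a b h)"
proof -
  have comp: "(corner_chart D F a b h \<circ> (\<lambda>(g, z). turn a b g z)) x = (\<lambda>(g, z). mirror_map D F (g, h z)) x"
    if "x \<in> topspace (four_copies half_open_triangle)" for x
    using that corner_chart_turn by (cases x) auto
  have Q: "quotient_map (four_copies half_open_triangle) (subtopology (mirror_space D F) region)
      (corner_chart D F a b h \<circ> (\<lambda>(g, z). turn a b g z))"
    by (rule quotient_map_eq[OF quotient_map_region]) (use comp in metis)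
  have cont: "continuous_map (top_of_set open_diamond) (subtopology (mirror_space D F) region) (corner_chart D F a b h)"
    by (rule continuous_compose_quotient_map[OF quotient_map_turn quotient_imp_continuous_map[OF Q]])
  have "quotient_map (top_of_set open_diamond) (subtopology (mirror_space D F) region) (corner_chart D F a b h)"
    by (rule quotient_map_from_composition[OF quotient_imp_continuous_map[OF quotient_map_turn] cont Q])
  moreover have "inj_on (corner_chart D F a b h) open_diamond"
  proof (rule inj_onI)
    fix w w' assume w: "w \<in> open_diamond" "w' \<in> open_diamond" "corner_chart D F a b h w = corner_chart D F a b h w'"
    have "turn a b (corner_sign a b w) (corner_fold w) = turn a b (corner_sign a b w') (corner_fold w')"
      using w(3) mirror_map_eq_turn_iff[OF corner_fold_mem[OF w(1)] corner_fold_mem[OF w(2)]]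
      unfolding corner_chart_def by blast
    then show "w = w'" by (simp add: turn_corner_fold[OF ab])
  qed
  ultimately show ?thesis
    using injective_quotient_map[of "corner_chart D F a b h" "top_of_set open_diamond"]
    by (simp add: homeomorphic_map_def)
qed

end

section \<open>Connected sums at a corner\<close>

lemma corner_triangle:
  assumes "u \<noteq> []" "a \<noteq> 0" "b \<noteq> 0" "a \<noteq> b"
  shows "corner triangle (triangle_labels b a u) a b (\<lambda>z. z)"
  unfolding corner_def
proof (intro conjI assms ballI allI)
  show "mirrored triangle (triangle_labels b a u)"
    by (rule spells_mirrored[OF triangle_spells[OF assms(1)]])
  show "\<exists>k. homeomorphism triangle triangle (\<lambda>z. z) k"
    by (rule exI[of _ "\<lambda>z. z"]) (simp add: homeomorphism_def)
  show "z \<in> triangle_labels b a u s \<longleftrightarrow> s = b \<and> snd z = 0 \<or> s = a \<and> fst z = 0" if "z \<in> half_open_triangle" for z s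
    using that unfolding triangle_labels_def half_open_triangle_def triangle_def by auto
qed

text \<open>Connected sums ask for discs parametrized by the complex unit disc. The diamond of
  radius 1 lies inside the domain of a corner chart, which has radius 2, and its boundary folds to
  the line x + y = 1.\<close>

lemma complex_disc_diamond:
  obtains d :: "complex \<Rightarrow> plane" where "continuous_on (cball 0 1) d" "inj_on d (cball 0 1)"
    "d ` ball 0 1 = {w. \<bar>fst w\<bar> + \<bar>snd w\<bar> < 1}" "d ` sphere 0 1 = {w. \<bar>fst w\<bar> + \<bar>snd w\<bar> = 1}"
proof -
  define L :: "(plane \<times> real) list" where "L = [((1, 1), 1), ((1, - 1), 1), ((- 1, 1), 1), ((- 1, - 1), 1)]"
  have L: "polyhedral L = {w. \<bar>fst w\<bar> + \<bar>snd w\<bar> \<le> 1}"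
    unfolding polyhedral_def L_def by (auto simp: inner_prod_def)
  have "fst x \<noteq> 0" "fst x \<bullet> (0 :: plane) < snd x" if "x \<in> set L" for x
    using that by (auto simp: L_def zero_prod_def)
  moreover have "polyhedral L \<subseteq> cbox (- 1, - 1) (1, 1)"
    unfolding L by (auto simp: cbox_Pair_eq)
  ultimately have disc: "closed_disc (polyhedral L)"
    using polyhedral_disc(1)[of L 0] by blast
  have "interior (polyhedral L) = {z. \<forall>x\<in>set L. fst x \<bullet> z < snd x}"
    by (rule interior_polyhedral) (auto simp: L_def zero_prod_def)
  moreover have "x + y < 1 \<and> x - y < 1 \<and> y - x < 1 \<and> - x - y < 1 \<longleftrightarrow> \<bar>x\<bar> + \<bar>y\<bar> < 1" for x y :: real
    by (cases "0 \<le> x"; cases "0 \<le> y") auto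
  ultimately have int: "interior (polyhedral L) = {w. \<bar>fst w\<bar> + \<bar>snd w\<bar> < 1}"
    by (simp add: L_def inner_prod_def)
  have "cball (0 :: plane) 1 homeomorphic polyhedral L"
    using disc unfolding closed_disc_def by (rule homeomorphic_sym[THEN iffD1])
  then obtain k k' where hom: "homeomorphism (cball (0 :: plane) 1) (polyhedral L) k k'"
    unfolding homeomorphic_def by blast
  have closed: "closed (polyhedral L)" by (rule polyhedral_convex_closed)
  have k: "k ` ball 0 1 = {w. \<bar>fst w\<bar> + \<bar>snd w\<bar> < 1}" "k ` sphere 0 1 = frontier (polyhedral L)"
    using homeomorphism_frontier[OF hom] closed int by simp_all
  have front: "frontier (polyhedral L) = {w. \<bar>fst w\<bar> + \<bar>snd w\<bar> = 1}"
    unfolding frontier_def int using closed by (auto simp: L)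
  define c :: "complex \<Rightarrow> plane" where "c z = (Re z, Im z)" for z
  have norm_c: "norm (c z) = norm z" for z by (simp add: c_def norm_prod_def cmod_def)
  have surj: "c (Complex (fst w) (snd w)) = w" for w by (simp add: c_def)
  have c_image: "c ` {z. P (norm z)} = {w :: plane. P (norm w)}" for P
  proof (intro subset_antisym subsetI)
    fix w :: plane assume "w \<in> {w. P (norm w)}"
    then have "Complex (fst w) (snd w) \<in> {z. P (norm z)}" using norm_c[of "Complex (fst w) (snd w)"] surj by simp
    then show "w \<in> c ` {z. P (norm z)}" using surj[of w] by (metis imageI)
  qed (use norm_c in force)
  have c: "c ` ball 0 1 = ball 0 1" "c ` sphere 0 1 = sphere 0 1" "c ` cball 0 1 = cball 0 1"
    using c_image[of "\<lambda>r. r < 1"] c_image[of "\<lambda>r. r = 1"] c_image[of "\<lambda>r. r \<le> 1"]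
    by (simp_all add: ball_def sphere_def cball_def)
  have "continuous_on (cball 0 1) (k \<circ> c)"
  proof (rule continuous_on_compose)
    show "continuous_on (cball 0 1) c" unfolding c_def by (intro continuous_intros)
    show "continuous_on (c ` cball 0 1) k" using hom unfolding c homeomorphism_def by blast
  qed
  moreover have "inj_on (k \<circ> c) (cball 0 1)"
  proof (rule comp_inj_on)
    show "inj_on c (cball 0 1)" by (auto simp: inj_on_def c_def complex_eq_iff)
    show "inj_on k (c ` cball 0 1)" using hom unfolding c homeomorphism_def by (metis inj_on_inverseI)
  qed
  moreover have "(k \<circ> c) ` ball 0 1 = {w. \<bar>fst w\<bar> + \<bar>snd w\<bar> < 1}"
    "(k \<circ> c) ` sphere 0 1 = {w. \<bar>fst w\<bar> + \<bar>snd w\<bar> = 1}"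
    unfolding image_comp[symmetric] c using k front by simp_all
  ultimately show ?thesis using that by blast
qed

context corner_at
begin

lemma embedding_map_corner_disc:
  assumes d: "continuous_on (cball 0 1) d" "inj_on d (cball (0 :: complex) 1)" "d ` cball 0 1 \<subseteq> open_diamond"
  shows "embedding_map (top_of_set (cball 0 1)) (mirror_space D F) (corner_chart D F a b h \<circ> d)"
proof (rule continuous_imp_embedding_map)
  have hom: "continuous_map (top_of_set open_diamond) (subtopology (mirror_space D F) region) (corner_chart D F a b h)"
    "inj_on (corner_chart D F a b h) open_diamond"
    using homeomorphic_map_corner_chart by (simp_all add: homeomorphic_map_def continuous_map_from_subtopology
        homeomorphic_eq_everything_map flip: homeomorphic_map_def)
  show "continuous_map (top_of_set (cball 0 1)) (mirror_space D F) (corner_chart D F a b h \<circ> d)"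
  proof (rule continuous_map_compose)
    show "continuous_map (top_of_set (cball 0 1)) (top_of_set open_diamond) d"
      using d by (auto simp: continuous_map_in_subtopology)
    show "continuous_map (top_of_set open_diamond) (mirror_space D F) (corner_chart D F a b h)"
      using hom(1) by (simp add: continuous_map_in_subtopology)
  qed
  show "inj_on (corner_chart D F a b h \<circ> d) (topspace (top_of_set (cball 0 1)))"
    using comp_inj_on[OF d(2)] inj_on_subset[OF hom(2) d(3)] by simp
  show "compact_space (top_of_set (cball (0 :: complex) 1))" by (simp add: compact_space_subtopology)
  show "Hausdorff_space (mirror_space D F)" by (rule Hausdorff_space_mirror_space[OF mirr])
qed

end

definition cut_triangle :: "plane set" where
  "cut_triangle = {z \<in> triangle. 1 \<le> fst z + snd z}"

lemma compact_cut_triangle: "compact cut_triangle"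
proof -
  have "cut_triangle = triangle \<inter> {z. 1 \<le> fst z + snd z}" by (auto simp: cut_triangle_def)
  moreover have "closed {z :: plane. 1 \<le> fst z + snd z}"
    by (intro closed_Collect_le continuous_intros)
  ultimately show ?thesis
    using closed_disc_compact[OF triangle_disc(1)] by (metis compact_Int_closed)
qed

text \<open>Rescales along rays through the origin so that x + y becomes its reciprocal. The axes,
  and with them the labels a and b, are preserved, and the line x + y = 1 is fixed
  pointwise.\<close>

definition inversion :: "plane \<Rightarrow> plane" where
  "inversion z = z /\<^sub>R (fst z + snd z)\<^sup>2"

lemma fst_snd_inversion: "fst (inversion z) = fst z / (fst z + snd z)\<^sup>2" "snd (inversion z) = snd z / (fst z + snd z)\<^sup>2"
  by (simp_all add: inversion_def field_simps)

lemma inversion_sum: "fst (inversion z) + snd (inversion z) = 1 / (fst z + snd z)"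
  unfolding fst_snd_inversion add_divide_distrib[symmetric]
  by (cases "fst z + snd z = 0") (simp_all add: power2_eq_square)

lemma inversion_inversion: "fst z + snd z \<noteq> 0 \<Longrightarrow> inversion (inversion z) = z"
  unfolding inversion_def[of "inversion z"] inversion_sum by (simp add: inversion_def power_divide)

lemma inversion_fixed: "fst z + snd z = 1 \<Longrightarrow> inversion z = z"
  by (simp add: inversion_def)

text \<open>
  Passing from the triangle to the trapezoid cuts off the corner. The part of the trapezoid below the
  line x + y = 1 is the image of another triangle without its corner under the inversion at that line.
\<close>

lemma mirror_space_connected_sum:
  fixes a b :: "bit \<times> bit"
  assumes ab: "a \<noteq> 0" "b \<noteq> 0" "a \<noteq> b" and uv: "u \<noteq> []" "v \<noteq> []"
  shows "connected_sum (mirror_space triangle (triangle_labels b a u)) (mirror_space triangle (triangle_labels b a v))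
    (mirror_space trapezoid (trapezoid_labels b a u v))"
proof -
  define Fu where "Fu = triangle_labels b a u"
  define Fv where "Fv = triangle_labels b a v"
  define G where "G = trapezoid_labels b a u v"
  define Y where "Y = mirror_space triangle Fu"
  define M where "M = mirror_space triangle Fv"
  define X where "X = mirror_space trapezoid G"
  interpret Y: corner_at triangle Fu a b "\<lambda>z. z"
    unfolding Fu_def by (rule corner_at.intro) (rule corner_triangle[OF uv(1) ab])
  interpret M: corner_at triangle Fv a b "\<lambda>z. z"
    unfolding Fv_def by (rule corner_at.intro) (rule corner_triangle[OF uv(2) ab])
  have mirrG: "mirrored trapezoid G"
    unfolding G_def by (rule spells_mirrored[OF trapezoid_spells[OF uv]])
  obtain d :: "complex \<Rightarrow> plane" where d: "continuous_on (cball 0 1) d" "inj_on d (cball 0 1)"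
    "d ` ball 0 1 = {w. \<bar>fst w\<bar> + \<bar>snd w\<bar> < 1}" "d ` sphere 0 1 = {w. \<bar>fst w\<bar> + \<bar>snd w\<bar> = 1}"
    by (rule complex_disc_diamond)
  have d_open: "d ` cball 0 1 \<subseteq> open_diamond"
  proof -
    have "cball (0 :: complex) 1 = ball 0 1 \<union> sphere 0 1" by auto
    then show ?thesis using d(3,4) by (auto simp: image_Un open_diamond_def)
  qed
  \<comment> \<open>Both discs use the same d, so that points of the two circles to be identified
    are represented by the same copy and the same point of the triangle.\<close>
  define f where "f = corner_chart triangle Fu a b (\<lambda>z. z) \<circ> d"
  define g where "g = corner_chart triangle Fv a b (\<lambda>z. z) \<circ> d"
  have emb: "embedding_map (top_of_set (cball 0 1)) Y f" "embedding_map (top_of_set (cball 0 1)) M g"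
    unfolding f_def g_def Y_def M_def
    by (rule Y.embedding_map_corner_disc[OF d(1,2) d_open], rule M.embedding_map_corner_disc[OF d(1,2) d_open])
  have sub: "cut_triangle \<subseteq> triangle" "cut_triangle \<subseteq> trapezoid" "inversion ` cut_triangle \<subseteq> trapezoid"
  proof -
    show "cut_triangle \<subseteq> triangle" "cut_triangle \<subseteq> trapezoid"
      by (auto simp: cut_triangle_def triangle_def trapezoid_def)
    show "inversion ` cut_triangle \<subseteq> trapezoid"
    proof (rule image_subsetI)
      fix z assume "z \<in> cut_triangle"
      then have z: "0 \<le> fst z" "0 \<le> snd z" "1 \<le> fst z + snd z" "fst z + snd z \<le> 2"
        by (auto simp: cut_triangle_def triangle_def)
      then show "inversion z \<in> trapezoid"
        unfolding trapezoid_def mem_Collect_eq inversion_sum unfolding fst_snd_inversion by (auto simp: field_simps)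
    qed
  qed
  \<comment> \<open>On the part with x + y at least 1 the inner side of the trapezoid is out of
    reach.\<close>
  have groupY: "mirror_group G z = mirror_group Fu z" if "z \<in> cut_triangle" for z
  proof (rule mirror_group_cong)
    have "z \<in> G s \<longleftrightarrow> z \<in> Fu s" for s
      using that unfolding G_def Fu_def trapezoid_labels_def triangle_labels_def cut_triangle_def triangle_def trapezoid_def
      by auto
    then show "{s. z \<in> G s} = {s. z \<in> Fu s}" by simp
  qed
  \<comment> \<open>The inversion carries the hypotenuse to the inner side, and there
    \<open>2 * snd (inversion z)\<close> equals \<open>snd z / 2\<close>, so that the word v has the
    same position on both.\<close>
  have groupM: "mirror_group G (inversion z) = mirror_group Fv z" if "z \<in> cut_triangle" for z
  proof (rule mirror_group_cong)
    have z: "0 \<le> fst z" "0 \<le> snd z" "1 \<le> fst z + snd z" "fst z + snd z \<le> 2"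
      using that by (auto simp: cut_triangle_def triangle_def)
    have inv: "inversion z \<in> trapezoid" using sub(3) that by blast
    have s0: "fst (inversion z) = 0 \<longleftrightarrow> fst z = 0" "snd (inversion z) = 0 \<longleftrightarrow> snd z = 0"
      using z(3) by (auto simp: fst_snd_inversion)
    have s1: "1 / (fst z + snd z) \<noteq> 2" "1 / (fst z + snd z) = 1 / 2 \<longleftrightarrow> fst z + snd z = 2"
      using z(3) by (auto simp: field_simps)
    have s2: "2 * snd (inversion z) \<in> word_fractions v s \<longleftrightarrow> snd z / 2 \<in> word_fractions v s"
      if "fst z + snd z = 2" for s
      using that by (simp add: fst_snd_inversion)
    have "inversion z \<in> G s \<longleftrightarrow> z \<in> Fv s" for s
      unfolding G_def Fv_def trapezoid_labels_def triangle_labels_def mem_Collect_eq inversion_sum s0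
      using inv that sub(1) s1 s2[of s] by auto
    then show "{s. inversion z \<in> G s} = {s. z \<in> Fv s}" by simp
  qed
  define \<pi>Y where "\<pi>Y = mirror_map triangle Fu"
  define \<pi>M where "\<pi>M = mirror_map triangle Fv"
  define \<pi>X where "\<pi>X = mirror_map trapezoid G"
  \<comment> \<open>In the four copies the removed open disc is the corner x + y < 1.\<close>
  have disc: "corner_chart triangle Fx a b (\<lambda>z. z) ` {w. \<bar>fst w\<bar> + \<bar>snd w\<bar> < 1} =
      mirror_map triangle Fx ` (UNIV \<times> {z \<in> triangle. fst z + snd z < 1})"
    if "corner_at triangle Fx a b (\<lambda>z. z)" for Fx
  proof -
    interpret Fx: corner_at triangle Fx a b "\<lambda>z. z" by (rule that)
    show ?thesis
    proof (intro subset_antisym subsetI)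
      fix x assume "x \<in> corner_chart triangle Fx a b (\<lambda>z. z) ` {w. \<bar>fst w\<bar> + \<bar>snd w\<bar> < 1}"
      then obtain w where w: "\<bar>fst w\<bar> + \<bar>snd w\<bar> < 1" "x = mirror_map triangle Fx (corner_sign a b w, corner_fold w)"
        unfolding corner_chart_def by blast
      then have "corner_fold w \<in> {z \<in> triangle. fst z + snd z < 1}"
        by (simp add: corner_fold_def triangle_def)
      with w(2) show "x \<in> mirror_map triangle Fx ` (UNIV \<times> {z \<in> triangle. fst z + snd z < 1})" by blast
    next
      fix x assume "x \<in> mirror_map triangle Fx ` (UNIV \<times> {z \<in> triangle. fst z + snd z < 1})"
      then obtain k z where z: "z \<in> triangle" "fst z + snd z < 1" "x = mirror_map triangle Fx (k, z)" by blast
      then have "z \<in> half_open_triangle" by (simp add: triangle_def half_open_triangle_def)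
      from Fx.corner_chart_turn[OF this, of k] have "x = corner_chart triangle Fx a b (\<lambda>z. z) (turn a b k z)"
        using z(3) by simp
      moreover have "turn a b k z \<in> {w. \<bar>fst w\<bar> + \<bar>snd w\<bar> < 1}"
        using z by (simp add: turn_def abs_mult triangle_def)
      ultimately show "x \<in> corner_chart triangle Fx a b (\<lambda>z. z) ` {w. \<bar>fst w\<bar> + \<bar>snd w\<bar> < 1}" by blast
    qed
  qed
  \<comment> \<open>Gluing never moves a point of the triangle, so nothing below the cut is
    identified with a point on or above it.\<close>
  have complement: "topspace (mirror_space triangle Fx) - mirror_map triangle Fx ` (UNIV \<times> {z \<in> triangle. fst z + snd z < 1})
      = mirror_map triangle Fx ` (UNIV \<times> cut_triangle)" for Fx :: "bit \<times> bit \<Rightarrow> plane set"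
  proof -
    have T: "UNIV \<times> triangle = UNIV \<times> {z \<in> triangle. fst z + snd z < 1} \<union> (UNIV :: (bit \<times> bit) set) \<times> cut_triangle"
      by (auto simp: cut_triangle_def)
    have "mirror_map triangle Fx (k, z) \<noteq> mirror_map triangle Fx (k', z')"
      if "z \<in> triangle" "fst z + snd z < 1" "z' \<in> cut_triangle" for k k' z z'
      using that sub(1) mirror_map_eq_iff[of z triangle z' Fx k k'] by (auto simp: cut_triangle_def)
    then have "mirror_map triangle Fx ` (UNIV \<times> {z \<in> triangle. fst z + snd z < 1}) \<inter>
        mirror_map triangle Fx ` (UNIV \<times> cut_triangle) = {}"
      by blast
    then show ?thesis unfolding topspace_mirror_space T image_Un by blast
  qed
  define Y' where "Y' = subtopology Y (- f ` ball 0 1)"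
  define M' where "M' = subtopology M (- g ` ball 0 1)"
  have topY: "topspace Y' = \<pi>Y ` (UNIV \<times> cut_triangle)"
    using complement[of Fu] disc[OF Y.corner_at_axioms] d(3)
    unfolding Y'_def \<pi>Y_def Y_def f_def topspace_subtopology image_comp[symmetric] by (simp add: Diff_eq)
  have topM: "topspace M' = \<pi>M ` (UNIV \<times> cut_triangle)"
    using complement[of Fv] disc[OF M.corner_at_axioms] d(3)
    unfolding M'_def \<pi>M_def M_def g_def topspace_subtopology image_comp[symmetric] by (simp add: Diff_eq)
  have cont_mirror: "continuous_map (four_copies cut_triangle) (mirror_space D' F') (\<lambda>(k, z). mirror_map D' F' (k, i z))"
    if "continuous_on cut_triangle i" "i ` cut_triangle \<subseteq> D'" for D' F' and i :: "plane \<Rightarrow> plane"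
  proof -
    have "continuous_map (top_of_set cut_triangle) (mirror_space D' F') (mirror_map D' F' \<circ> (Pair k \<circ> i))" for k
    proof (rule continuous_map_compose[OF _ quotient_imp_continuous_map[OF quotient_map_mirror_map]])
      show "continuous_map (top_of_set cut_triangle) (four_copies D') (Pair k \<circ> i)"
        by (rule continuous_map_compose[OF _ continuous_map_component_injection]) (use that in auto)
    qed
    then show ?thesis unfolding continuous_map_sum_topology by (simp add: o_def)
  qed
  have comp4: "compact_space (four_copies cut_triangle)"
    by (rule compact_space_four_copies[OF compact_cut_triangle])
  have qY: "quotient_map (four_copies cut_triangle) Y' \<pi>Y"
  proof (rule quotient_map_compact_Hausdorff[OF _ comp4])
    show "continuous_map (four_copies cut_triangle) Y' \<pi>Y"
      using cont_mirror[of "\<lambda>z. z" triangle Fu] sub(1) topY unfolding Y'_def continuous_map_in_subtopology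
      by (auto simp: Y_def \<pi>Y_def)
    show "Hausdorff_space Y'"
      unfolding Y'_def Y_def by (intro Hausdorff_space_subtopology Hausdorff_space_mirror_space Y.mirr)
  qed (simp add: topY)
  have qM: "quotient_map (four_copies cut_triangle) M' \<pi>M"
  proof (rule quotient_map_compact_Hausdorff[OF _ comp4])
    show "continuous_map (four_copies cut_triangle) M' \<pi>M"
      using cont_mirror[of "\<lambda>z. z" triangle Fv] sub(1) topM unfolding M'_def continuous_map_in_subtopology
      by (auto simp: M_def \<pi>M_def)
    show "Hausdorff_space M'"
      unfolding M'_def M_def by (intro Hausdorff_space_subtopology Hausdorff_space_mirror_space M.mirr)
  qed (simp add: topM)
  have eqY: "\<pi>Y (k, z) = \<pi>Y (k', z') \<longleftrightarrow> \<pi>X (k, z) = \<pi>X (k', z')"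
    if "z \<in> cut_triangle" "z' \<in> cut_triangle" for k k' z z'
    unfolding \<pi>X_def \<pi>Y_def using that sub groupY by (simp add: mirror_map_eq_iff subset_iff)
  have nonzero: "fst z + snd z \<noteq> 0" if "z \<in> cut_triangle" for z
    using that by (auto simp: cut_triangle_def)
  have eqM: "\<pi>M (k, z) = \<pi>M (k', z') \<longleftrightarrow> \<pi>X (k, inversion z) = \<pi>X (k', inversion z')"
    if z: "z \<in> cut_triangle" "z' \<in> cut_triangle" for k k' z z'
  proof -
    have "inversion z = inversion z' \<longleftrightarrow> z = z'"
      using inversion_inversion[OF nonzero] z by metis
    moreover have "inversion z \<in> trapezoid" "inversion z' \<in> trapezoid" "z \<in> triangle" "z' \<in> triangle"
      using z sub by auto
    ultimately show ?thesis
      unfolding \<pi>X_def \<pi>M_def using groupM[OF z(1)] by (simp add: mirror_map_eq_iff)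
  qed
  have cont_inv: "continuous_on cut_triangle inversion"
    unfolding inversion_def using nonzero by (intro continuous_intros) simp
  have cX: "continuous_map (four_copies cut_triangle) X (\<lambda>(k, z). \<pi>X (k, z))"
    "continuous_map (four_copies cut_triangle) X (\<lambda>(k, z). \<pi>X (k, inversion z))"
    unfolding X_def \<pi>X_def by (intro cont_mirror sub cont_inv continuous_on_id; simp add: sub)+
  obtain \<psi>Y where \<psi>Y: "continuous_map Y' X \<psi>Y" "\<And>k z. z \<in> cut_triangle \<Longrightarrow> \<psi>Y (\<pi>Y (k, z)) = \<pi>X (k, z)"
  proof -
    have "(\<lambda>(k, z). \<pi>X (k, z)) x = (\<lambda>(k, z). \<pi>X (k, z)) y"
      if "x \<in> topspace (four_copies cut_triangle)" "y \<in> topspace (four_copies cut_triangle)" "\<pi>Y x = \<pi>Y y" for x y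
      using that eqY by (cases x; cases y) simp
    from qY cX(1) this show ?thesis
    proof (rule quotient_map_lift_exists)
      fix \<psi> assume "continuous_map Y' X \<psi>"
        "\<And>x. x \<in> topspace (four_copies cut_triangle) \<Longrightarrow> \<psi> (\<pi>Y x) = (\<lambda>(k, z). \<pi>X (k, z)) x"
      then show ?thesis using that[of \<psi>] by simp
    qed
  qed
  obtain \<psi>M where \<psi>M: "continuous_map M' X \<psi>M" "\<And>k z. z \<in> cut_triangle \<Longrightarrow> \<psi>M (\<pi>M (k, z)) = \<pi>X (k, inversion z)"
  proof -
    have "(\<lambda>(k, z). \<pi>X (k, inversion z)) x = (\<lambda>(k, z). \<pi>X (k, inversion z)) y"
      if "x \<in> topspace (four_copies cut_triangle)" "y \<in> topspace (four_copies cut_triangle)" "\<pi>M x = \<pi>M y" for x y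
      using that eqM by (cases x; cases y) simp
    from qM cX(2) this show ?thesis
    proof (rule quotient_map_lift_exists)
      fix \<psi> assume "continuous_map M' X \<psi>"
        "\<And>x. x \<in> topspace (four_copies cut_triangle) \<Longrightarrow> \<psi> (\<pi>M x) = (\<lambda>(k, z). \<pi>X (k, inversion z)) x"
      then show ?thesis using that[of \<psi>] by simp
    qed
  qed
  let ?r = "{(Inl (f u), Inr (g u)) | u. u \<in> sphere 0 1}"
  \<comment> \<open>The gluing of the connected sum is indexed by points u of a circle, the fibres
    by copies and points on the cut; this fact and the next one translate between the two
    descriptions.\<close>
  have fg: "\<exists>z k. z \<in> cut_triangle \<and> fst z + snd z = 1 \<and> f u = \<pi>Y (k, z) \<and> g u = \<pi>M (k, z)" if "u \<in> sphere 0 1" for u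
  proof (intro exI conjI)
    have "\<bar>fst (d u)\<bar> + \<bar>snd (d u)\<bar> = 1" using d(4) that by blast
    then show "corner_fold (d u) \<in> cut_triangle" "fst (corner_fold (d u)) + snd (corner_fold (d u)) = 1"
      by (simp_all add: corner_fold_def cut_triangle_def triangle_def)
    show "f u = \<pi>Y (corner_sign a b (d u), corner_fold (d u))" "g u = \<pi>M (corner_sign a b (d u), corner_fold (d u))"
      by (simp_all add: f_def g_def \<pi>Y_def \<pi>M_def corner_chart_def)
  qed
  have gf: "\<exists>u\<in>sphere 0 1. f u = \<pi>Y (k, z) \<and> g u = \<pi>M (k, z)" if "z \<in> cut_triangle" "fst z + snd z = 1" for k z
  proof -
    have "\<bar>fst (turn a b k z)\<bar> + \<bar>snd (turn a b k z)\<bar> = 1"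
      using that by (simp add: turn_def abs_mult cut_triangle_def triangle_def)
    then obtain u where u: "u \<in> sphere 0 1" "d u = turn a b k z" using d(4) by (metis (mono_tags, lifting) imageE mem_Collect_eq)
    have "z \<in> half_open_triangle" using that by (simp add: half_open_triangle_def cut_triangle_def triangle_def)
    then have "f u = \<pi>Y (k, z)" "g u = \<pi>M (k, z)"
      using Y.corner_chart_turn M.corner_chart_turn by (simp_all add: f_def g_def \<pi>Y_def \<pi>M_def u(2))
    with u(1) show ?thesis by blast
  qed
  define \<psi> where "\<psi> = case_sum \<psi>Y \<psi>M"
  \<comment> \<open>If z is the inversion of z', the sums of their coordinates are reciprocal and
    both at least 1, hence both equal to 1. So the two parts of the trapezoid meet only along the
    cut.\<close>
  have glued: "\<pi>X (k, z) = \<pi>X (k', inversion z') \<longleftrightarrow> z = z' \<and> fst z + snd z = 1 \<and> \<pi>M (k, z) = \<pi>M (k', z)"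
    if z: "z \<in> cut_triangle" "z' \<in> cut_triangle" for k k' z z'
  proof
    assume "z = z' \<and> fst z + snd z = 1 \<and> \<pi>M (k, z) = \<pi>M (k', z)"
    then show "\<pi>X (k, z) = \<pi>X (k', inversion z')"
      using eqM[OF z(1) z(1), of k k'] inversion_fixed[of z] by metis
  next
    assume eq: "\<pi>X (k, z) = \<pi>X (k', inversion z')"
    then have zz: "z = inversion z'" using z sub by (auto simp: \<pi>X_def mirror_map_eq_iff subset_iff image_subset_iff)
    then have "fst z + snd z = 1 / (fst z' + snd z')" by (simp add: inversion_sum)
    moreover have "1 \<le> fst z + snd z" "1 \<le> fst z' + snd z'" using z by (auto simp: cut_triangle_def)
    ultimately have "fst z' + snd z' = 1" by (simp add: le_divide_eq)
    then have "z = z'" "fst z + snd z = 1" "inversion z = z" using zz inversion_fixed by auto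
    then show "z = z' \<and> fst z + snd z = 1 \<and> \<pi>M (k, z) = \<pi>M (k', z)"
      using eq eqM[OF z(1) z(1), of k k'] by simp
  qed
  have "glue (disjoint_union Y' M') ?r homeomorphic_space X"
  proof (rule glue_homeomorphic_space)
    show "quotient_map (disjoint_union Y' M') X \<psi>"
    proof (rule quotient_map_compact_Hausdorff)
      show "continuous_map (disjoint_union Y' M') X \<psi>"
        by (rule continuous_map_disjoint_union) (use \<psi>Y(1) \<psi>M(1) in \<open>simp_all add: \<psi>_def\<close>)
      have "compact_space Y'" "compact_space M'"
        using comp4 image_compactin[OF _ quotient_imp_continuous_map[OF qY]] image_compactin[OF _ quotient_imp_continuous_map[OF qM]]
          quotient_imp_surjective_map[OF qY] quotient_imp_surjective_map[OF qM] unfolding compact_space_def by metis+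
      then show "compact_space (disjoint_union Y' M')" by (rule compact_space_disjoint_union)
      show "Hausdorff_space X" unfolding X_def by (rule Hausdorff_space_mirror_space[OF mirrG])
      show "\<psi> ` topspace (disjoint_union Y' M') = topspace X"
      proof (intro subset_antisym subsetI)
        fix x assume "x \<in> topspace X"
        then obtain k z where z: "z \<in> trapezoid" "x = \<pi>X (k, z)"
          unfolding X_def topspace_mirror_space \<pi>X_def by blast
        show "x \<in> \<psi> ` topspace (disjoint_union Y' M')"
        proof (cases "1 \<le> fst z + snd z")
          case True
          then have "z \<in> cut_triangle" using z(1) by (simp add: cut_triangle_def trapezoid_def triangle_def)
          then have "Inl (\<pi>Y (k, z)) \<in> topspace (disjoint_union Y' M')" "\<psi> (Inl (\<pi>Y (k, z))) = x"
            using z(2) \<psi>Y(2) topY by (auto simp: \<psi>_def)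
          then show ?thesis by (metis imageI)
        next
          case False
          have "inversion z \<in> cut_triangle"
            unfolding cut_triangle_def triangle_def mem_Collect_eq inversion_sum unfolding fst_snd_inversion
            using z(1) False by (auto simp: trapezoid_def field_simps)
          moreover have "inversion (inversion z) = z" using z(1) by (intro inversion_inversion) (auto simp: trapezoid_def)
          ultimately have "Inr (\<pi>M (k, inversion z)) \<in> topspace (disjoint_union Y' M')" "\<psi> (Inr (\<pi>M (k, inversion z))) = x"
            using z(2) \<psi>M(2) topM by (auto simp: \<psi>_def)
          then show ?thesis by (metis imageI)
        qed
      next
        fix x assume "x \<in> \<psi> ` topspace (disjoint_union Y' M')"
        then show "x \<in> topspace X"
          using \<psi>Y(1) \<psi>M(1) by (auto simp: \<psi>_def continuous_map_def)
      qed
    qed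
    fix x y assume xy: "x \<in> topspace (disjoint_union Y' M')" "y \<in> topspace (disjoint_union Y' M')"
    have repr: "(\<exists>k z. z \<in> cut_triangle \<and> x = Inl (\<pi>Y (k, z)) \<and> \<psi> x = \<pi>X (k, z)) \<or>
        (\<exists>k z. z \<in> cut_triangle \<and> x = Inr (\<pi>M (k, z)) \<and> \<psi> x = \<pi>X (k, inversion z))"
      if "x \<in> topspace (disjoint_union Y' M')" for x
    proof (cases x)
      case (Inl p)
      then have "p \<in> \<pi>Y ` (UNIV \<times> cut_triangle)" using that topY by auto
      then obtain k z where "z \<in> cut_triangle" "p = \<pi>Y (k, z)" by blast
      then show ?thesis
        using Inl \<psi>Y(2) by (intro disjI1 exI[of _ k] exI[of _ z]) (simp add: \<psi>_def)
    next
      case (Inr p)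
      then have "p \<in> \<pi>M ` (UNIV \<times> cut_triangle)" using that topM by auto
      then obtain k z where "z \<in> cut_triangle" "p = \<pi>M (k, z)" by blast
      then show ?thesis
        using Inr \<psi>M(2) by (intro disjI2 exI[of _ k] exI[of _ z]) (simp add: \<psi>_def)
    qed
    have glue1: "(Inl (\<pi>Y (k, z)), Inr (\<pi>M (k', z'))) \<in> ?r"
      if "z \<in> cut_triangle" "z' \<in> cut_triangle" "\<pi>X (k, z) = \<pi>X (k', inversion z')" for k k' z z'
      using glued[OF that(1,2)] gf[OF that(1), of k] that(3) by (metis (mono_tags, lifting) mem_Collect_eq)
    show "\<psi> x = \<psi> y \<longleftrightarrow> (x, y) \<in> (?r \<union> ?r\<inverse>)\<^sup>*"
    proof
      assume "(x, y) \<in> (?r \<union> ?r\<inverse>)\<^sup>*"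
      then show "\<psi> x = \<psi> y"
      proof (rule respects_rtrancl_symcl)
        fix p q :: "((bit \<times> bit) \<times> plane) set + ((bit \<times> bit) \<times> plane) set"
        assume "(p, q) \<in> ?r"
        then obtain u where u: "u \<in> sphere 0 1" "p = Inl (f u)" "q = Inr (g u)" by blast
        obtain k z where "z \<in> cut_triangle" "fst z + snd z = 1" "f u = \<pi>Y (k, z)" "g u = \<pi>M (k, z)"
          using fg[OF u(1)] by blast
        then show "\<psi> p = \<psi> q" using u \<psi>Y(2) \<psi>M(2) inversion_fixed by (simp add: \<psi>_def)
      qed
    next
      assume eq: "\<psi> x = \<psi> y"
      from repr[OF xy(1)] show "(x, y) \<in> (?r \<union> ?r\<inverse>)\<^sup>*"
      proof (elim disjE exE conjE)
        fix k z assume x: "z \<in> cut_triangle" "x = Inl (\<pi>Y (k, z))" "\<psi> x = \<pi>X (k, z)"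
        from repr[OF xy(2)] show ?thesis
        proof (elim disjE exE conjE)
          fix k' z' assume y: "z' \<in> cut_triangle" "y = Inl (\<pi>Y (k', z'))" "\<psi> y = \<pi>X (k', z')"
          then have "x = y" using x eqY eq by metis
          then show ?thesis by simp
        next
          fix k' z' assume y: "z' \<in> cut_triangle" "y = Inr (\<pi>M (k', z'))" "\<psi> y = \<pi>X (k', inversion z')"
          then have "(x, y) \<in> ?r"
            unfolding x(2) y(2) by (intro glue1 x(1) y(1)) (use x(3) y(3) eq in simp)
          then show ?thesis by (intro r_into_rtrancl UnI1)
        qed
      next
        fix k z assume x: "z \<in> cut_triangle" "x = Inr (\<pi>M (k, z))" "\<psi> x = \<pi>X (k, inversion z)"
        from repr[OF xy(2)] show ?thesis
        proof (elim disjE exE conjE)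
          fix k' z' assume y: "z' \<in> cut_triangle" "y = Inl (\<pi>Y (k', z'))" "\<psi> y = \<pi>X (k', z')"
          then have "(y, x) \<in> ?r"
            unfolding x(2) y(2) by (intro glue1 x(1) y(1)) (use x(3) y(3) eq in simp)
          then show ?thesis by (intro r_into_rtrancl UnI2 converseI)
        next
          fix k' z' assume y: "z' \<in> cut_triangle" "y = Inr (\<pi>M (k', z'))" "\<psi> y = \<pi>X (k', inversion z')"
          then have "x = y" using x eqM eq by metis
          then show ?thesis by simp
        qed
      qed
    qed
  qed
  then have "X homeomorphic_space glue (disjoint_union Y' M') ?r"
    by (rule homeomorphic_space_sym[THEN iffD1])
  then show ?thesis
    using emb unfolding connected_sum_def Y'_def M'_def Y_def M_def X_def Fu_def Fv_def G_def by blast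
qed

section \<open>The sphere, the torus and the projective plane\<close>

lemma cos_pi_eq_iff:
  assumes "0 \<le> x" "x \<le> 1" "0 \<le> y" "y \<le> 1"
  shows "cos (pi * x) = cos (pi * y) \<longleftrightarrow> x = y"
proof -
  have "pi * x \<le> pi" "pi * y \<le> pi" using assms pi_gt_zero by (simp_all add: mult_left_le)
  then show ?thesis using cos_inj_pi[of "pi * x" "pi * y"] assms by auto
qed

text \<open>The two signs parametrize the upper and the lower half of the circle, which meet where
  the sine vanishes, that is at the parameters 0 and 1.\<close>

lemma cis_signed_eq_iff:
  assumes x: "0 \<le> x" "x \<le> 1" "0 \<le> y" "y \<le> 1" and e: "e = 1 \<or> e = - 1" "e' = 1 \<or> e' = (- 1 :: real)"
  shows "cis (pi * (e * x)) = cis (pi * (e' * y)) \<longleftrightarrow> x = y \<and> (x = 0 \<or> x = 1 \<or> e = e')"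
proof -
  have c: "cos (pi * (e * x)) = cos (pi * x)" "sin (pi * (e * x)) = e * sin (pi * x)" if "e = 1 \<or> e = - 1" for e x
    using that by auto
  have "sin (pi * x) = 0 \<longleftrightarrow> x = 0 \<or> x = 1"
  proof -
    have "0 < sin (pi * x)" if "x \<noteq> 0" "x \<noteq> 1"
    proof (rule sin_gt_zero)
      have "0 < x" "x < 1" using that x by auto
      then show "0 < pi * x" "pi * x < pi" by simp_all
    qed
    then show ?thesis by force
  qed
  then show ?thesis
    unfolding complex_eq_iff cis.sel c(1)[OF e(1)] c(1)[OF e(2)] c(2)[OF e(1)] c(2)[OF e(2)] cos_pi_eq_iff[OF x]
    by auto
qed

definition unit_square :: "plane set" where
  "unit_square = {z. 0 \<le> fst z \<and> fst z \<le> 1 \<and> 0 \<le> snd z \<and> snd z \<le> 1}"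

definition square_labels :: "'l \<Rightarrow> 'l \<Rightarrow> 'l \<Rightarrow> plane set" where
  "square_labels b a s = {z \<in> unit_square. (snd z = 0 \<or> snd z = 1) \<and> s = b \<or> (fst z = 0 \<or> fst z = 1) \<and> s = a}"

lemma square_disc:
  "closed_disc unit_square" "frontier unit_square = {z \<in> unit_square. fst z = 0 \<or> fst z = 1 \<or> snd z = 0 \<or> snd z = 1}"
proof -
  let ?L = "[((- 1, 0), 0), ((1, 0), 1), ((0, - 1), 0), ((0, 1), 1)] :: (plane \<times> real) list"
  have eq: "unit_square = polyhedral ?L"
    by (auto simp: unit_square_def polyhedral_def inner_prod_def)
  have "unit_square \<subseteq> cbox (0, 0) (1, 1)"
    by (auto simp: unit_square_def cbox_Pair_eq)
  then have bd: "polyhedral ?L \<subseteq> cbox (0, 0) (1, 1)" by (simp only: eq)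
  show "closed_disc unit_square"
    unfolding eq by (rule polyhedral_disc(1)[OF _ _ bd, of "(1/2, 1/2)"]) (auto simp: zero_prod_def)
  show "frontier unit_square = {z \<in> unit_square. fst z = 0 \<or> fst z = 1 \<or> snd z = 0 \<or> snd z = 1}"
    unfolding eq
    by (subst polyhedral_disc(2)[OF _ _ bd, of "(1/2, 1/2)"]) (auto simp: zero_prod_def inner_prod_def)
qed

lemma square_spells: "spells unit_square (square_labels b a) [b, a, b, a]"
proof -
  have L1: "linepath (0, 0) (1, 0) ` S = {z :: plane. snd z = 0 \<and> fst z \<in> S}" for S
    by (rule linepath_image) (auto simp: linepath_Pair prod_eq_iff)
  have L2: "linepath (1, 0) (1, 1) ` S = {z :: plane. fst z = 1 \<and> snd z \<in> S}" for S
    by (rule linepath_image) (auto simp: linepath_Pair prod_eq_iff)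
  have L3: "linepath (1, 1) (0, 1) ` S = {z :: plane. snd z = 1 \<and> 1 - fst z \<in> S}" for S
    by (rule linepath_image) (auto simp: linepath_Pair prod_eq_iff)
  have L4: "linepath (0, 1) (0, 0) ` S = {z :: plane. fst z = 0 \<and> 1 - snd z \<in> S}" for S
    by (rule linepath_image) (auto simp: linepath_Pair prod_eq_iff)
  have p: "boundary_piece (0, 0) (1, 0) [b] (linepath (0, 0) (1, 0) ` {0..<1}) (\<lambda>s. linepath (0, 0) (1, 0) ` word_fractions [b] s)"
    "boundary_piece (1, 0) (1, 1) [a] (linepath (1, 0) (1, 1) ` {0..<1}) (\<lambda>s. linepath (1, 0) (1, 1) ` word_fractions [a] s)"
    "boundary_piece (1, 1) (0, 1) [b] (linepath (1, 1) (0, 1) ` {0..<1}) (\<lambda>s. linepath (1, 1) (0, 1) ` word_fractions [b] s)"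
    "boundary_piece (0, 1) (0, 0) [a] (linepath (0, 1) (0, 0) ` {0..<1}) (\<lambda>s. linepath (0, 1) (0, 0) ` word_fractions [a] s)"
    by (intro boundary_piece_linepath; simp)+
  note pieces = boundary_piece_join[OF p(1) boundary_piece_join[OF p(2) boundary_piece_join[OF p(3,4)]], unfolded L1 L2 L3 L4]
  let ?G = "\<lambda>s. {z :: plane. snd z = 0 \<and> fst z \<in> word_fractions [b] s} \<union> ({z. fst z = 1 \<and> snd z \<in> word_fractions [a] s} \<union>
      ({z. snd z = 1 \<and> 1 - fst z \<in> word_fractions [b] s} \<union> {z. fst z = 0 \<and> 1 - snd z \<in> word_fractions [a] s}))"
  have "spells unit_square ?G ([b] @ ([a] @ ([b] @ [a])))"
  proof (rule boundary_piece_spells[OF pieces _ square_disc(1)])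
    show "{z. snd z = 0 \<and> fst z \<in> {0..<1}} \<union> ({z. fst z = 1 \<and> snd z \<in> {0..<1}} \<union>
      ({z. snd z = 1 \<and> 1 - fst z \<in> {0..<1}} \<union> {z. fst z = 0 \<and> 1 - snd z \<in> {0..<1}})) = frontier unit_square"
      unfolding square_disc(2) unfolding unit_square_def by auto
  qed auto
  moreover have "?G = square_labels b a"
  proof (intro ext set_eqI)
    fix s and z :: plane
    show "z \<in> ?G s \<longleftrightarrow> z \<in> square_labels b a s"
      unfolding square_labels_def unit_square_def by auto
  qed
  ultimately show ?thesis by simp
qed

lemma flip_corner_sign:
  assumes "a \<noteq> 0" "b \<noteq> 0" "a \<noteq> b"
  shows "flip a b (corner_sign a b w) * \<bar>fst w\<bar> = fst w" "flip b a (corner_sign a b w) * \<bar>snd w\<bar> = snd w"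
  using turn_corner_fold[OF assms, of w] by (auto simp: turn_def corner_fold_def prod_eq_iff)

lemma continuous_map_top_of_set: "continuous_on S f \<Longrightarrow> f ` S \<subseteq> T \<Longrightarrow> continuous_map (top_of_set S) (top_of_set T) f"
  by (auto simp: continuous_map_in_subtopology)

lemma cis_Arg_norm_1:
  assumes "norm z = 1"
  shows "cis (Arg z) = z"
proof -
  have "z \<noteq> 0" using assms by auto
  then show ?thesis using cis_Arg[of z] assms by (simp add: sgn_eq)
qed

text \<open>Each side of the square is doubled to a circle by its own character, and the surface is
  the product of the two circles.\<close>

lemma mirror_space_torus:
  fixes a b :: "bit \<times> bit"
  assumes ab: "a \<noteq> 0" "b \<noteq> 0" "a \<noteq> b"
  shows "mirror_space unit_square (square_labels b a) homeomorphic_space torus"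
proof (rule mirror_space_homeomorphic)
  define f where "f = (\<lambda>x :: (bit \<times> bit) \<times> plane. (cis (pi * (flip a b (fst x) * fst (snd x))), cis (pi * (flip b a (fst x) * snd (snd x)))))"
  show "compact unit_square" by (rule closed_disc_compact[OF square_disc(1)])
  show "Hausdorff_space torus"
    unfolding torus_def by (intro Hausdorff_space_subtopology Hausdorff_space_euclidean)
  show "continuous_map (top_of_set unit_square) torus (\<lambda>p. f (g, p))" for g
    unfolding torus_def
  proof (rule continuous_map_top_of_set)
    show "continuous_on unit_square (\<lambda>p. f (g, p))"
      unfolding f_def fst_conv snd_conv by (intro continuous_intros continuous_on_cis)
  qed (auto simp: f_def)
  show "f ` (UNIV \<times> unit_square) = topspace torus"
  proof (intro subset_antisym subsetI)
    fix y assume "y \<in> topspace torus"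
    then have y: "norm (fst y) = 1" "norm (snd y) = 1" by (auto simp: torus_def)
    \<comment> \<open>Arguments divided by pi lie in [-1, 1]; their signs give the copy and their
      absolute values the point of the square.\<close>
    define w where "w = (Arg (fst y) / pi, Arg (snd y) / pi)"
    have cis: "cis (pi * fst w) = fst y" "cis (pi * snd w) = snd y"
      using y cis_Arg_norm_1 by (simp_all add: w_def)
    have "\<bar>fst w\<bar> \<le> 1" "\<bar>snd w\<bar> \<le> 1"
      using Arg_bounded[of "fst y"] Arg_bounded[of "snd y"] by (auto simp: w_def abs_le_iff field_simps)
    then have "corner_fold w \<in> unit_square" by (simp add: corner_fold_def unit_square_def)
    moreover have "f (corner_sign a b w, corner_fold w) = y"
      unfolding f_def fst_conv snd_conv corner_fold_def flip_corner_sign[OF ab] cis by simp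
    ultimately show "y \<in> f ` (UNIV \<times> unit_square)" by (metis SigmaI UNIV_I imageI)
  qed (auto simp: f_def torus_def)
  fix g h p q assume pq: "p \<in> unit_square" "q \<in> unit_square"
  have pq': "0 \<le> fst p" "fst p \<le> 1" "0 \<le> snd p" "snd p \<le> 1" "0 \<le> fst q" "fst q \<le> 1" "0 \<le> snd q" "snd q \<le> 1"
    using pq by (auto simp: unit_square_def)
  have group: "g + h \<in> mirror_group (square_labels b a) p \<longleftrightarrow>
      ((fst p = 0 \<or> fst p = 1) \<or> g + h = 0 \<or> g + h = b) \<and> ((snd p = 0 \<or> snd p = 1) \<or> g + h = 0 \<or> g + h = a)"
    by (rule mirror_group_two_labels[OF ab]) (use pq in \<open>auto simp: square_labels_def\<close>)
  have "f (g, p) = f (h, q) \<longleftrightarrow> cis (pi * (flip a b g * fst p)) = cis (pi * (flip a b h * fst q)) \<and>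
      cis (pi * (flip b a g * snd p)) = cis (pi * (flip b a h * snd q))"
    by (simp add: f_def)
  also have "\<dots> \<longleftrightarrow> (fst p = fst q \<and> (fst p = 0 \<or> fst p = 1 \<or> flip a b g = flip a b h)) \<and>
      (snd p = snd q \<and> (snd p = 0 \<or> snd p = 1 \<or> flip b a g = flip b a h))"
    using cis_signed_eq_iff[OF pq'(1,2,5,6) flip_cases flip_cases] cis_signed_eq_iff[OF pq'(3,4,7,8) flip_cases flip_cases] by simp
  also have "\<dots> \<longleftrightarrow> p = q \<and> g + h \<in> mirror_group (square_labels b a) p"
    unfolding group flip_eq_iff[OF ab] flip_eq_iff[OF ab(2,1) ab(3)[symmetric]] prod_eq_iff by blast
  finally show "f (g, p) = f (h, q) \<longleftrightarrow> p = q \<and> g + h \<in> mirror_group (square_labels b a) p" .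
qed

section \<open>The sphere as an octahedron\<close>

definition vec3 :: "real \<Rightarrow> real \<Rightarrow> real \<Rightarrow> real ^ 3" where
  "vec3 x y z = x *\<^sub>R axis 1 1 + y *\<^sub>R axis 2 1 + z *\<^sub>R axis 3 1"

text \<open>Its spheres are octahedra, onto which the copies of a polygonal disc can be mapped by
  linear coordinates and signs; radial projection then yields the round sphere.\<close>

definition norm1 :: "real ^ 3 \<Rightarrow> real" where
  "norm1 v = \<bar>v $ 1\<bar> + \<bar>v $ 2\<bar> + \<bar>v $ 3\<bar>"

lemma vec3_nth [simp]: "vec3 x y z $ 1 = x" "vec3 x y z $ 2 = y" "vec3 x y z $ 3 = z"
  by (simp_all add: vec3_def axis_def)

lemma vec3_eq_iff: "v = w \<longleftrightarrow> v $ 1 = w $ 1 \<and> v $ 2 = w $ 2 \<and> v $ 3 = w $ (3 :: 3)"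
  by (simp add: vec_eq_iff forall_3)

lemma norm1_scale: "norm1 (c *\<^sub>R v) = \<bar>c\<bar> * norm1 v"
  by (simp add: norm1_def abs_mult algebra_simps)

lemma norm1_pos: "v \<noteq> 0 \<Longrightarrow> 0 < norm1 v"
  by (auto simp: norm1_def vec3_eq_iff)

lemma normalize_eq_iff:
  assumes "norm1 v = c" "norm1 w = c" "0 < c"
  shows "v /\<^sub>R norm v = w /\<^sub>R norm w \<longleftrightarrow> v = w"
proof
  have nz: "v \<noteq> 0" "w \<noteq> 0" using assms by (auto simp: norm1_def)
  assume eq: "v /\<^sub>R norm v = w /\<^sub>R norm w"
  have "v = norm v *\<^sub>R (v /\<^sub>R norm v)" using nz by simp
  then have v: "v = (norm v / norm w) *\<^sub>R w" unfolding eq by (simp add: divide_inverse)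
  then have "c = (norm v / norm w) * c" using assms norm1_scale[of "norm v / norm w" w] by simp
  then have "norm v / norm w = 1" using assms(3) by (metis less_irrefl mult_cancel_right1)
  then show "v = w" using v by (metis scaleR_one)
qed simp

text \<open>The explicit multiple is recorded because the projective plane needs the sign of a
  coordinate of w.\<close>

lemma normalize_surj:
  assumes "norm v = 1" "0 < c"
  obtains w where "norm1 w = c" "w /\<^sub>R norm w = v" "w = (c / norm1 v) *\<^sub>R v"
proof
  have n: "0 < norm1 v" using assms by (intro norm1_pos) auto
  show "norm1 ((c / norm1 v) *\<^sub>R v) = c" unfolding norm1_scale using n assms by simp
  show "((c / norm1 v) *\<^sub>R v) /\<^sub>R norm ((c / norm1 v) *\<^sub>R v) = v" using n assms by simp
qed simp

definition half_diamond :: "plane set" where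
  "half_diamond = {z. 0 \<le> snd z \<and> \<bar>fst z\<bar> + snd z \<le> 1}"

definition half_diamond_labels :: "'l \<Rightarrow> 'l \<Rightarrow> 'l \<Rightarrow> plane set" where
  "half_diamond_labels b a s = {z \<in> half_diamond. snd z = 0 \<and> s = b \<or> \<bar>fst z\<bar> + snd z = 1 \<and> s = a}"

lemma half_diamond_disc:
  "closed_disc half_diamond" "frontier half_diamond = {z \<in> half_diamond. snd z = 0 \<or> \<bar>fst z\<bar> + snd z = 1}"
proof -
  let ?L = "[((0, - 1), 0), ((1, 1), 1), ((- 1, 1), 1)] :: (plane \<times> real) list"
  have eq: "half_diamond = polyhedral ?L"
    by (auto simp: half_diamond_def polyhedral_def inner_prod_def)
  have "half_diamond \<subseteq> cbox (- 1, 0) (1, 1)"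
    by (auto simp: half_diamond_def cbox_Pair_eq)
  then have bd: "polyhedral ?L \<subseteq> cbox (- 1, 0) (1, 1)" by (simp only: eq)
  show "closed_disc half_diamond"
    unfolding eq by (rule polyhedral_disc(1)[OF _ _ bd, of "(0, 1/2)"]) (auto simp: zero_prod_def)
  have "frontier half_diamond = {z \<in> half_diamond. snd z = 0 \<or> fst z + snd z = 1 \<or> - fst z + snd z = 1}"
    unfolding eq
    by (subst polyhedral_disc(2)[OF _ _ bd, of "(0, 1/2)"]) (auto simp: zero_prod_def inner_prod_def)
  also have "\<dots> = {z \<in> half_diamond. snd z = 0 \<or> \<bar>fst z\<bar> + snd z = 1}"
    by (auto simp: half_diamond_def)
  finally show "frontier half_diamond = {z \<in> half_diamond. snd z = 0 \<or> \<bar>fst z\<bar> + snd z = 1}" .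
qed

lemma half_diamond_spells: "spells half_diamond (half_diamond_labels b a) [b, a]"
proof -
  have L1: "linepath (- 1, 0) (1, 0) ` S = {z :: plane. snd z = 0 \<and> (fst z + 1) / 2 \<in> S}" for S
    by (rule linepath_image) (auto simp: linepath_Pair prod_eq_iff field_simps)
  have L2: "linepath (1, 0) (0, 1) ` S = {z :: plane. fst z + snd z = 1 \<and> snd z \<in> S}" for S
    by (rule linepath_image) (auto simp: linepath_Pair prod_eq_iff)
  have L3: "linepath (0, 1) (- 1, 0) ` S = {z :: plane. snd z - fst z = 1 \<and> - fst z \<in> S}" for S
    by (rule linepath_image) (auto simp: linepath_Pair prod_eq_iff)
  have p: "boundary_piece (- 1, 0) (1, 0) [b] (linepath (- 1, 0) (1, 0) ` {0..<1}) (\<lambda>s. linepath (- 1, 0) (1, 0) ` word_fractions [b] s)"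
    "boundary_piece (1, 0) (0, 1) [a] (linepath (1, 0) (0, 1) ` {0..<1}) (\<lambda>s. linepath (1, 0) (0, 1) ` word_fractions [a] s)"
    "boundary_piece (0, 1) (- 1, 0) [a] (linepath (0, 1) (- 1, 0) ` {0..<1}) (\<lambda>s. linepath (0, 1) (- 1, 0) ` word_fractions [a] s)"
    by (intro boundary_piece_linepath; simp)+
  note pieces = boundary_piece_join[OF p(1) boundary_piece_join[OF p(2,3)], unfolded L1 L2 L3]
  let ?G = "\<lambda>s. {z :: plane. snd z = 0 \<and> (fst z + 1) / 2 \<in> word_fractions [b] s} \<union>
      ({z. fst z + snd z = 1 \<and> snd z \<in> word_fractions [a] s} \<union> {z. snd z - fst z = 1 \<and> - fst z \<in> word_fractions [a] s})"
  have "spells half_diamond ?G ([b] @ ([a] @ [a]))"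
  proof (rule boundary_piece_spells[OF pieces _ half_diamond_disc(1)])
    show "{z. snd z = 0 \<and> (fst z + 1) / 2 \<in> {0..<1}} \<union>
      ({z. fst z + snd z = 1 \<and> snd z \<in> {0..<1}} \<union> {z. snd z - fst z = 1 \<and> - fst z \<in> {0..<1}}) = frontier half_diamond"
      unfolding half_diamond_disc(2) unfolding half_diamond_def by auto
  qed auto
  moreover have "?G = half_diamond_labels b a"
  proof (intro ext set_eqI)
    fix s and z :: plane
    show "z \<in> ?G s \<longleftrightarrow> z \<in> half_diamond_labels b a s"
      unfolding half_diamond_labels_def half_diamond_def by auto
  qed
  ultimately have "spells half_diamond (half_diamond_labels b a) ([b] @ [a, a])" by simp
  \<comment> \<open>Both upper sides carry a, so the word obtained is b, a, a; the equal letters are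
    rotated to the front, where they can be merged.\<close>
  then have "spells half_diamond (half_diamond_labels b a) ([a, a] @ [b])" by (rule spells_rotate)
  then have "spells half_diamond (half_diamond_labels b a) ([a] @ [b])" using spells_merge[of _ _ a "[b]"] by simp
  from spells_rotate[OF this] show ?thesis by simp
qed

lemma signed_eq_iff:
  fixes x y :: real
  assumes "0 \<le> x" "0 \<le> y" "e = 1 \<or> e = - 1" "e' = 1 \<or> e' = - 1"
  shows "e * x = e' * y \<longleftrightarrow> x = y \<and> (x = 0 \<or> e = e')"
  using assms by auto

text \<open>The half diamond is the projection of a quarter of the octahedron. The second and third
  coordinates vanish exactly on the sides labelled b and a, and those labels change their
  signs.\<close>

lemma mirror_space_sphere:
  fixes a b :: "bit \<times> bit"
  assumes ab: "a \<noteq> 0" "b \<noteq> 0" "a \<noteq> b"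
  shows "mirror_space half_diamond (half_diamond_labels b a) homeomorphic_space top_of_set (sphere (0 :: real ^ 3) 1)"
proof (rule mirror_space_homeomorphic)
  define v where "v x = vec3 (fst (snd x)) (flip b a (fst x) * snd (snd x)) (flip a b (fst x) * (1 - \<bar>fst (snd x)\<bar> - snd (snd x)))"
    for x :: "(bit \<times> bit) \<times> plane"
  define f where "f x = v x /\<^sub>R norm (v x)" for x
  have norm1: "norm1 (v (g, p)) = 1" if "p \<in> half_diamond" for g p
    using that by (simp add: norm1_def v_def abs_mult half_diamond_def)
  then have nz: "v (g, p) \<noteq> 0" if "p \<in> half_diamond" for g p
    using norm1[OF that, of g] by (auto simp: norm1_def)
  have fS: "f (g, p) \<in> sphere 0 1" if "p \<in> half_diamond" for g p
    using nz[OF that, of g] by (simp add: f_def)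
  show "compact half_diamond" by (rule closed_disc_compact[OF half_diamond_disc(1)])
  show "Hausdorff_space (top_of_set (sphere (0 :: real ^ 3) 1))"
    by (intro Hausdorff_space_subtopology Hausdorff_space_euclidean)
  show "continuous_map (top_of_set half_diamond) (top_of_set (sphere 0 1)) (\<lambda>p. f (g, p))" for g
  proof (rule continuous_map_top_of_set)
    have "continuous_on half_diamond (\<lambda>p. v (g, p))"
      unfolding v_def vec3_def fst_conv snd_conv by (intro continuous_intros)
    then show "continuous_on half_diamond (\<lambda>p. f (g, p))"
      unfolding f_def using nz by (intro continuous_intros) auto
  qed (use fS in blast)
  show "f ` (UNIV \<times> half_diamond) = topspace (top_of_set (sphere 0 1))"
  proof (intro subset_antisym subsetI)
    fix y :: "real ^ 3" assume "y \<in> topspace (top_of_set (sphere 0 1))"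
    then have "norm y = 1" by simp
    then obtain w where w: "norm1 w = 1" "w /\<^sub>R norm w = y" by (rule normalize_surj[of _ 1]) auto
    have "(w $ 1, \<bar>w $ 2\<bar>) \<in> half_diamond" using w(1) by (simp add: half_diamond_def norm1_def)
    moreover have "v (corner_sign a b (w $ 3, w $ 2), (w $ 1, \<bar>w $ 2\<bar>)) = w"
    proof -
      have "1 - \<bar>w $ 1\<bar> - \<bar>w $ 2\<bar> = \<bar>w $ 3\<bar>" using w(1) by (simp add: norm1_def)
      then show ?thesis
        using flip_corner_sign[OF ab, of "(w $ 3, w $ 2)"] by (simp add: v_def vec3_eq_iff)
    qed
    ultimately show "y \<in> f ` (UNIV \<times> half_diamond)"
      using w(2) by (intro image_eqI[of _ _ "(corner_sign a b (w $ 3, w $ 2), (w $ 1, \<bar>w $ 2\<bar>))"]) (simp_all add: f_def)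
  qed (use fS in auto)
  fix g h p q assume pq: "p \<in> half_diamond" "q \<in> half_diamond"
  have pq': "0 \<le> snd p" "0 \<le> snd q" "0 \<le> 1 - \<bar>fst p\<bar> - snd p" "0 \<le> 1 - \<bar>fst q\<bar> - snd q"
    using pq by (auto simp: half_diamond_def)
  have group: "g + h \<in> mirror_group (half_diamond_labels b a) p \<longleftrightarrow>
      (1 - \<bar>fst p\<bar> - snd p = 0 \<or> g + h = 0 \<or> g + h = b) \<and> (snd p = 0 \<or> g + h = 0 \<or> g + h = a)"
    by (rule mirror_group_two_labels[OF ab]) (use pq in \<open>auto simp: half_diamond_labels_def\<close>)
  have "f (g, p) = f (h, q) \<longleftrightarrow> v (g, p) = v (h, q)"
    unfolding f_def using normalize_eq_iff[OF norm1[OF pq(1)] norm1[OF pq(2)]] by simp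
  also have "\<dots> \<longleftrightarrow> fst p = fst q \<and> (snd p = snd q \<and> (snd p = 0 \<or> flip b a g = flip b a h)) \<and>
     (1 - \<bar>fst p\<bar> - snd p = 1 - \<bar>fst q\<bar> - snd q \<and> (1 - \<bar>fst p\<bar> - snd p = 0 \<or> flip a b g = flip a b h))"
    unfolding vec3_eq_iff v_def vec3_nth fst_conv snd_conv signed_eq_iff[OF pq'(1,2) flip_cases flip_cases]
      signed_eq_iff[OF pq'(3,4) flip_cases flip_cases] ..
  also have "\<dots> \<longleftrightarrow> p = q \<and> g + h \<in> mirror_group (half_diamond_labels b a) p"
    unfolding group flip_eq_iff[OF ab] flip_eq_iff[OF ab(2,1) ab(3)[symmetric]] prod_eq_iff by metis
  finally show "f (g, p) = f (h, q) \<longleftrightarrow> p = q \<and> g + h \<in> mirror_group (half_diamond_labels b a) p" .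
qed

section \<open>The projective plane as half of an octahedron\<close>

lemma rtrancl_antipodal:
  "(x, y) \<in> ({(x, - x) | x. x \<in> S} \<union> {(x, - x) | x. x \<in> S}\<inverse>)\<^sup>* \<Longrightarrow> y = x \<or> y = - (x :: 'a::real_vector)"
  by (induction rule: rtrancl_induct) auto

text \<open>No point carries all three labels, so any stabilizer is covered by the case of two
  labels for a suitable basis. In the formula either k itself or, on the side labelled a + b, its
  translate by a + b satisfies the condition for the labels a and b; the second case will be the
  antipodal identification.\<close>

lemma mirror_group_three_labels:
  assumes ab: "a \<noteq> 0" "b \<noteq> 0" "a \<noteq> b" and PQR: "\<not> (P \<and> Q \<and> R)"
    and labels: "\<And>s. p \<in> F s \<longleftrightarrow> s = b \<and> P \<or> s = a \<and> Q \<or> s = a + b \<and> R"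
  shows "k \<in> mirror_group F p \<longleftrightarrow> (Q \<or> k = 0 \<or> k = b) \<and> (P \<or> k = 0 \<or> k = a) \<or>
    R \<and> (Q \<or> k + (a + b) = 0 \<or> k + (a + b) = b) \<and> (P \<or> k + (a + b) = 0 \<or> k + (a + b) = a)"
proof -
  note nab = bit_pair_basis_neq[OF ab]
  note ne = ab ab(3)[symmetric] nab nab[symmetric]
  have sums: "a + (a + b) = b" "b + (a + b) = a" "(a + b) + (a + b) = 0" by (simp_all add: ac_simps)
  consider "\<not> R" | "R" "\<not> P" | "R" "\<not> Q" using PQR by blast
  then show ?thesis
  proof cases
    case 1
    then show ?thesis using mirror_group_two_labels[OF ab, of p F P Q k] labels by simp
  next
    case 2
    have "p \<in> F s \<longleftrightarrow> s = a + b \<and> R \<or> s = a \<and> Q" for s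
      using labels 2 by blast
    from mirror_group_two_labels[OF ab(1) nab(1) nab(2)[symmetric] this]
    have "k \<in> mirror_group F p \<longleftrightarrow> Q \<or> k = 0 \<or> k = a + b" using 2 by simp
    then show ?thesis
      using 2 by (cases rule: bit_pair_basis_cases[OF ab, of k]) (simp_all add: ne sums)
  next
    case 3
    have "p \<in> F s \<longleftrightarrow> s = b \<and> P \<or> s = a + b \<and> R" for s
      using labels 3 by blast
    from mirror_group_two_labels[OF nab(1) ab(2) nab(3) this]
    have "k \<in> mirror_group F p \<longleftrightarrow> P \<or> k = 0 \<or> k = a + b" using 3 by simp
    then show ?thesis
      using 3 by (cases rule: bit_pair_basis_cases[OF ab, of k]) (simp_all add: ne sums)
  qed
qed

text \<open>Both characters take the value -1 at a + b, so adding a + b acts on the first two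
  coordinates as the antipodal map.\<close>

lemma flip_add_sum:
  assumes "a \<noteq> 0" "b \<noteq> 0" "a \<noteq> b"
  shows "flip a b (g + (a + b)) = - flip a b g" "flip b a (g + (a + b)) = - flip b a g"
proof -
  have "g + (a + b) = 0 \<longleftrightarrow> g = a + b" by (rule bit_pair_add_eq_0_iff)
  moreover have "g + (a + b) = b \<longleftrightarrow> g = a" "g + (a + b) = a \<longleftrightarrow> g = b"
    by (metis add.assoc add.commute bit_pair_add_left_self)+
  ultimately have "g + (a + b) = 0 \<or> g + (a + b) = b \<longleftrightarrow> \<not> (g = 0 \<or> g = b)"
    "g + (a + b) = 0 \<or> g + (a + b) = a \<longleftrightarrow> \<not> (g = 0 \<or> g = a)"
    using bit_pair_basis_cases[OF assms, of g] assms bit_pair_basis_neq[OF assms] by metis+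
  then show "flip a b (g + (a + b)) = - flip a b g" "flip b a (g + (a + b)) = - flip b a g"
    unfolding flip_alt[OF assms] flip_alt[OF assms(2,1) assms(3)[symmetric]] by simp_all
qed

lemma Hausdorff_space_glue:
  assumes "compact_space X" "Hausdorff_space X"
    and saturated: "\<And>K. closedin X K \<Longrightarrow> closedin X {x \<in> topspace X. glue_map X r x \<in> glue_map X r ` K}"
  shows "Hausdorff_space (glue X r)"
proof (rule Hausdorff_normal_space_closed_continuous_map_image)
  show "normal_space X"
    using assms(1,2) by (intro compact_Hausdorff_or_regular_imp_normal_space) simp_all
  show closed: "closed_map X (glue X r) (glue_map X r)"
    unfolding closed_map_def
  proof (intro allI impI)
    fix K assume K: "closedin X K"
    then have "glue_map X r ` K \<subseteq> topspace (glue X r)"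
      unfolding topspace_glue by (intro image_mono closedin_subset)
    then show "closedin (glue X r) (glue_map X r ` K)"
      using saturated[OF K] quotient_map_glue[of X r] unfolding quotient_map_closedin by blast
  qed
  show "continuous_map X (glue X r) (glue_map X r)"
    by (rule quotient_imp_continuous_map[OF quotient_map_glue])
  show "glue_map X r ` topspace X = topspace (glue X r)"
    by (simp add: topspace_glue)
  show "t1_space (glue X r)"
    unfolding t1_space_closedin_singleton topspace_glue
  proof (rule ballI)
    fix y assume "y \<in> glue_map X r ` topspace X"
    then obtain x where x: "x \<in> topspace X" "y = glue_map X r x" by blast
    then have "closedin X {x}" using assms(2) by (intro closedin_Hausdorff_singleton)
    then show "closedin (glue X r) {y}" using closed x unfolding closed_map_def by force
  qed
qed

text \<open>The four copies of the triangle form the upper half of an octahedron, with third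
  coordinate 2 - x - y. The hypotenuse becomes the equator, and there the label a + b glues
  antipodal points.\<close>

lemma mirror_space_projective_plane:
  fixes a b :: "bit \<times> bit"
  assumes ab: "a \<noteq> 0" "b \<noteq> 0" "a \<noteq> b"
  shows "mirror_space triangle (triangle_labels b a [a + b]) homeomorphic_space projective_plane"
proof (rule mirror_space_homeomorphic)
  let ?S = "sphere (0 :: real ^ 3) 1"
  let ?r = "{(x, - x) | x. x \<in> ?S}"
  define v where "v x = vec3 (flip a b (fst x) * fst (snd x)) (flip b a (fst x) * snd (snd x)) (2 - fst (snd x) - snd (snd x))"
    for x :: "(bit \<times> bit) \<times> plane"
  define n where "n x = v x /\<^sub>R norm (v x)" for x
  define f where "f x = glue_map (top_of_set ?S) ?r (n x)" for x
  have norm1: "norm1 (v (g, p)) = 2" if "p \<in> triangle" for g p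
    using that by (simp add: norm1_def v_def abs_mult triangle_def)
  then have nz: "v (g, p) \<noteq> 0" if "p \<in> triangle" for g p
    using norm1[OF that, of g] by (auto simp: norm1_def)
  then have nS: "n (g, p) \<in> ?S" if "p \<in> triangle" for g p
    using nz[OF that, of g] by (simp add: n_def)
  have antipodal: "glue_map (top_of_set ?S) ?r x = glue_map (top_of_set ?S) ?r y \<longleftrightarrow> y = x \<or> y = - x"
    if "x \<in> ?S" "y \<in> ?S" for x y
  proof -
    have "(x, y) \<in> (?r \<union> ?r\<inverse>)\<^sup>*" if "y = x \<or> y = - x"
      using that \<open>x \<in> ?S\<close> by auto
    then show ?thesis
      using that rtrancl_antipodal[of x y ?S] by (subst glue_map_eq_iff) auto
  qed
  show "compact triangle" by (rule closed_disc_compact[OF triangle_disc(1)])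
  show "Hausdorff_space projective_plane"
    unfolding projective_plane_def
  proof (rule Hausdorff_space_glue)
    show "compact_space (top_of_set ?S)" by (simp add: compact_space_subtopology)
    show "Hausdorff_space (top_of_set ?S)"
      by (intro Hausdorff_space_subtopology Hausdorff_space_euclidean)
    fix K assume "closedin (top_of_set ?S) K"
    then have K: "closed K" "K \<subseteq> ?S"
      using closedin_closed_trans[of ?S K] closedin_subset[of "top_of_set ?S" K] by auto
    have "{x \<in> topspace (top_of_set ?S). glue_map (top_of_set ?S) ?r x \<in> glue_map (top_of_set ?S) ?r ` K} = K \<union> uminus ` K"
    proof (intro subset_antisym subsetI)
      fix x assume "x \<in> {x \<in> topspace (top_of_set ?S). glue_map (top_of_set ?S) ?r x \<in> glue_map (top_of_set ?S) ?r ` K}"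
      then obtain y where "x \<in> ?S" "y \<in> K" "glue_map (top_of_set ?S) ?r x = glue_map (top_of_set ?S) ?r y" by auto
      then have "y = x \<or> y = - x" using antipodal[of x y] K(2) by blast
      then show "x \<in> K \<union> uminus ` K" using \<open>y \<in> K\<close> by force
    next
      fix x assume "x \<in> K \<union> uminus ` K"
      then obtain y where y: "y \<in> K" "y = x \<or> y = - x" by force
      then have "y \<in> ?S" "x \<in> ?S" using K(2) by auto
      then have "glue_map (top_of_set ?S) ?r x = glue_map (top_of_set ?S) ?r y" using antipodal[of x y] y by blast
      then show "x \<in> {x \<in> topspace (top_of_set ?S). glue_map (top_of_set ?S) ?r x \<in> glue_map (top_of_set ?S) ?r ` K}"
        using \<open>x \<in> ?S\<close> y(1) by auto
    qed
    moreover have "closed (K \<union> uminus ` K)" using K(1) by (intro closed_Un closed_negations)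
    moreover have "K \<union> uminus ` K \<subseteq> ?S" using K(2) by auto
    ultimately show "closedin (top_of_set ?S) {x \<in> topspace (top_of_set ?S). glue_map (top_of_set ?S) ?r x \<in> glue_map (top_of_set ?S) ?r ` K}"
      by (simp add: closed_subset)
  qed
  show "continuous_map (top_of_set triangle) projective_plane (\<lambda>p. f (g, p))" for g
  proof -
    have "continuous_map (top_of_set triangle) (top_of_set ?S) (\<lambda>p. n (g, p))"
    proof (rule continuous_map_top_of_set)
      have "continuous_on triangle (\<lambda>p. v (g, p))"
        unfolding v_def vec3_def fst_conv snd_conv by (intro continuous_intros)
      then show "continuous_on triangle (\<lambda>p. n (g, p))"
        unfolding n_def using nz by (intro continuous_intros) auto
    qed (use nS in blast)
    from continuous_map_compose[OF this quotient_imp_continuous_map[OF quotient_map_glue[of _ ?r]]]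
    show ?thesis unfolding projective_plane_def by (simp add: o_def f_def)
  qed
  show "f ` (UNIV \<times> triangle) = topspace projective_plane"
  proof (intro subset_antisym subsetI)
    fix y assume "y \<in> topspace projective_plane"
    then obtain x where x: "x \<in> ?S" "y = glue_map (top_of_set ?S) ?r x"
      unfolding projective_plane_def topspace_glue by auto
    \<comment> \<open>A point of the projective plane has a representative in the closed upper half,
      which is what the copies cover.\<close>
    define x' where "x' = (if 0 \<le> x $ 3 then x else - x)"
    have x': "norm x' = 1" "0 \<le> x' $ 3" "y = glue_map (top_of_set ?S) ?r x'"
      using x antipodal[of x x'] by (auto simp: x'_def)
    obtain w where w: "norm1 w = 2" "w /\<^sub>R norm w = x'" "w = (2 / norm1 x') *\<^sub>R x'"
      using normalize_surj[OF x'(1), of 2] by auto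
    have "0 < norm1 x'" using x'(1) by (intro norm1_pos) auto
    then have w3: "0 \<le> w $ 3" using x'(2) by (simp add: w(3))
    have "(\<bar>w $ 1\<bar>, \<bar>w $ 2\<bar>) \<in> triangle" using w(1) by (simp add: triangle_def norm1_def)
    moreover have "v (corner_sign a b (w $ 1, w $ 2), (\<bar>w $ 1\<bar>, \<bar>w $ 2\<bar>)) = w"
      using flip_corner_sign[OF ab, of "(w $ 1, w $ 2)"] w(1) w3 by (simp add: v_def vec3_eq_iff norm1_def)
    ultimately show "y \<in> f ` (UNIV \<times> triangle)"
      using w(2) x'(3) by (intro image_eqI[of _ _ "(corner_sign a b (w $ 1, w $ 2), (\<bar>w $ 1\<bar>, \<bar>w $ 2\<bar>))"])
        (simp_all add: f_def n_def)
  next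
    fix y assume "y \<in> f ` (UNIV \<times> triangle)"
    then obtain g p where "p \<in> triangle" "y = f (g, p)" by blast
    then show "y \<in> topspace projective_plane"
      unfolding projective_plane_def topspace_glue f_def using nS by auto
  qed
  fix g h p q assume pq: "p \<in> triangle" "q \<in> triangle"
  have pq': "0 \<le> fst p" "0 \<le> fst q" "0 \<le> snd p" "0 \<le> snd q" "fst p + snd p \<le> 2" "fst q + snd q \<le> 2"
    using pq by (auto simp: triangle_def)
  have group: "g + h \<in> mirror_group (triangle_labels b a [a + b]) p \<longleftrightarrow>
      (fst p = 0 \<or> g + h = 0 \<or> g + h = b) \<and> (snd p = 0 \<or> g + h = 0 \<or> g + h = a) \<or>
      fst p + snd p = 2 \<and> (fst p = 0 \<or> g + h + (a + b) = 0 \<or> g + h + (a + b) = b) \<and>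
      (snd p = 0 \<or> g + h + (a + b) = 0 \<or> g + h + (a + b) = a)"
    by (rule mirror_group_three_labels[OF ab]) (use pq in \<open>auto simp: triangle_labels_def triangle_def\<close>)
  have flips: "flip a b g = flip a b h \<longleftrightarrow> g + h = 0 \<or> g + h = b" "flip b a g = flip b a h \<longleftrightarrow> g + h = 0 \<or> g + h = a"
    "flip a b g = - flip a b h \<longleftrightarrow> g + h + (a + b) = 0 \<or> g + h + (a + b) = b"
    "flip b a g = - flip b a h \<longleftrightarrow> g + h + (a + b) = 0 \<or> g + h + (a + b) = a"
  proof -
    note eq = flip_eq_iff[OF ab] flip_eq_iff[OF ab(2,1) ab(3)[symmetric]]
    show "flip a b g = flip a b h \<longleftrightarrow> g + h = 0 \<or> g + h = b" "flip b a g = flip b a h \<longleftrightarrow> g + h = 0 \<or> g + h = a"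
      by (rule eq)+
    show "flip a b g = - flip a b h \<longleftrightarrow> g + h + (a + b) = 0 \<or> g + h + (a + b) = b"
      "flip b a g = - flip b a h \<longleftrightarrow> g + h + (a + b) = 0 \<or> g + h + (a + b) = a"
      using eq(1)[of g "h + (a + b)", unfolded flip_add_sum[OF ab]] eq(2)[of g "h + (a + b)", unfolded flip_add_sum[OF ab]]
      unfolding add.assoc by blast+
  qed
  have minus: "- v (h, q) = vec3 (- flip a b h * fst q) (- flip b a h * snd q) (fst q + snd q - 2)"
    "norm1 (- v (h, q)) = 2" "norm (- v (h, q)) = norm (v (h, q))"
    using norm1[OF pq(2), of h] by (auto simp: v_def vec3_eq_iff norm1_def)
  have neg_cases: "- flip a b h = 1 \<or> - flip a b h = - 1" for a b h using flip_cases[of a b h] by auto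
  have "f (g, p) = f (h, q) \<longleftrightarrow> n (g, p) = n (h, q) \<or> n (g, p) = - n (h, q)"
    unfolding f_def antipodal[OF nS[OF pq(1)] nS[OF pq(2)]] by (metis minus_minus)
  also have "n (g, p) = n (h, q) \<longleftrightarrow> v (g, p) = v (h, q)"
    unfolding n_def using normalize_eq_iff[OF norm1[OF pq(1)] norm1[OF pq(2)]] by simp
  also have "n (g, p) = - n (h, q) \<longleftrightarrow> v (g, p) = - v (h, q)"
    unfolding n_def using normalize_eq_iff[OF norm1[OF pq(1), of g] minus(2)] by simp
  also have "v (g, p) = v (h, q) \<longleftrightarrow> p = q \<and> (fst p = 0 \<or> flip a b g = flip a b h) \<and> (snd p = 0 \<or> flip b a g = flip b a h)"
    unfolding vec3_eq_iff v_def vec3_nth fst_conv snd_conv signed_eq_iff[OF pq'(1,2) flip_cases flip_cases]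
      signed_eq_iff[OF pq'(3,4) flip_cases flip_cases] prod_eq_iff by auto
  \<comment> \<open>Both third coordinates are nonnegative, so antipodal images force both to
    vanish: p and q lie on the hypotenuse.\<close>
  also have "v (g, p) = - v (h, q) \<longleftrightarrow> p = q \<and> fst p + snd p = 2 \<and>
      (fst p = 0 \<or> flip a b g = - flip a b h) \<and> (snd p = 0 \<or> flip b a g = - flip b a h)"
    unfolding vec3_eq_iff minus(1) unfolding v_def vec3_nth fst_conv snd_conv
      signed_eq_iff[OF pq'(1,2) flip_cases neg_cases] signed_eq_iff[OF pq'(3,4) flip_cases neg_cases] prod_eq_iff
    using pq'(5,6) by auto
  finally show "f (g, p) = f (h, q) \<longleftrightarrow> p = q \<and> g + h \<in> mirror_group (triangle_labels b a [a + b]) p"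
    unfolding group flips by blast
qed

section \<open>Orientability\<close>

lemma orientation_preserving_on_cong:
  assumes "\<And>x. x \<in> U \<Longrightarrow> f x = g x"
  shows "orientation_preserving_on U f \<longleftrightarrow> orientation_preserving_on U g"
proof -
  have "f \<circ> circlepath z r = g \<circ> circlepath z r \<and> f z = g z" if "0 < r" "cball z r \<subseteq> U" for z r
  proof -
    have "circlepath z r t \<in> cball z r" for t
      using that(1) by (simp add: circlepath dist_norm norm_mult)
    then show ?thesis using that assms by (auto simp: fun_eq_iff subset_iff)
  qed
  then show ?thesis unfolding orientation_preserving_on_def by metis
qed

lemma chartD:
  assumes "chart X U \<phi>"
  shows "openin X U" "open (\<phi> ` U)" "inj_on \<phi> U" "continuous_map (subtopology X U) euclidean \<phi>"
    "homeomorphic_map (subtopology X U) (top_of_set (\<phi> ` U)) \<phi>" "U \<subseteq> topspace X"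
proof -
  show *: "openin X U" "open (\<phi> ` U)" "homeomorphic_map (subtopology X U) (top_of_set (\<phi> ` U)) \<phi>"
    using assms by (simp_all add: chart_def)
  then show U: "U \<subseteq> topspace X" by (simp add: openin_subset)
  have "inj_on \<phi> (topspace (subtopology X U))"
    using *(3) by (simp add: homeomorphic_eq_everything_map)
  then show "inj_on \<phi> U" using U by (simp add: Int_absorb1)
  show "continuous_map (subtopology X U) euclidean \<phi>"
    using homeomorphic_imp_continuous_map[OF *(3)] by (simp add: continuous_map_in_subtopology)
qed

lemma chart_open_image:
  assumes "chart X U \<phi>" "openin X V" "V \<subseteq> U"
  shows "open (\<phi> ` V)"
proof -
  have "openin (subtopology X U) V"
    using assms(2,3) chartD(1)[OF assms(1)] by (simp add: openin_open_subtopology)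
  then have "openin (top_of_set (\<phi> ` U)) (\<phi> ` V)"
    using homeomorphic_imp_open_map[OF chartD(5)[OF assms(1)]] by (simp add: open_map_def)
  then show ?thesis
    using chartD(2)[OF assms(1)] by (simp add: openin_open_eq)
qed

text \<open>Restricted to the overlap, \<phi> is a quotient map onto its image, so the transition
  map inherits continuity from \<psi>.\<close>

lemma chart_transition:
  assumes \<phi>: "chart X U \<phi>" and \<psi>: "chart X V \<psi>"
  shows "open (\<phi> ` (U \<inter> V))" "continuous_on (\<phi> ` (U \<inter> V)) (\<psi> \<circ> inv_into U \<phi>)"
    "inj_on (\<psi> \<circ> inv_into U \<phi>) (\<phi> ` (U \<inter> V))"
    "\<And>x. x \<in> U \<inter> V \<Longrightarrow> (\<psi> \<circ> inv_into U \<phi>) (\<phi> x) = \<psi> x"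
proof -
  show "open (\<phi> ` (U \<inter> V))"
    using chart_open_image[OF \<phi>, of "U \<inter> V"] chartD(1)[OF \<phi>] chartD(1)[OF \<psi>] by (simp add: openin_Int)
  show eq: "(\<psi> \<circ> inv_into U \<phi>) (\<phi> x) = \<psi> x" if "x \<in> U \<inter> V" for x
    using chartD(3)[OF \<phi>] that by simp
  show "inj_on (\<psi> \<circ> inv_into U \<phi>) (\<phi> ` (U \<inter> V))"
  proof (rule inj_onI)
    fix x y assume "x \<in> \<phi> ` (U \<inter> V)" "y \<in> \<phi> ` (U \<inter> V)" "(\<psi> \<circ> inv_into U \<phi>) x = (\<psi> \<circ> inv_into U \<phi>) y"
    then obtain p q where pq: "p \<in> U \<inter> V" "q \<in> U \<inter> V" "x = \<phi> p" "y = \<phi> q" "\<psi> p = \<psi> q"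
      using eq by auto
    then have "p = q" using chartD(3)[OF \<psi>] by (auto dest: inj_onD)
    then show "x = y" using pq by simp
  qed
  show "continuous_on (\<phi> ` (U \<inter> V)) (\<psi> \<circ> inv_into U \<phi>)"
  proof -
    have "homeomorphic_map (subtopology (subtopology X U) (U \<inter> V)) (subtopology (top_of_set (\<phi> ` U)) (\<phi> ` (U \<inter> V))) \<phi>"
    proof (rule homeomorphic_map_subtopologies_alt[OF chartD(5)[OF \<phi>]])
      show "\<phi> x \<in> \<phi> ` (U \<inter> V) \<longleftrightarrow> x \<in> U \<inter> V" if "x \<in> topspace (subtopology X U)" for x
        using chartD(3)[OF \<phi>] that by (auto dest: inj_onD)
    qed
    moreover have "subtopology (subtopology X U) (U \<inter> V) = subtopology X (U \<inter> V)"
      by (simp add: subtopology_subtopology Int_assoc[symmetric])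
    moreover have "subtopology (top_of_set (\<phi> ` U)) (\<phi> ` (U \<inter> V)) = top_of_set (\<phi> ` (U \<inter> V))"
      unfolding subtopology_subtopology by (intro arg_cong[where f = top_of_set]) auto
    ultimately have "quotient_map (subtopology X (U \<inter> V)) (top_of_set (\<phi> ` (U \<inter> V))) \<phi>"
      by (simp add: homeomorphic_map_def)
    moreover have "continuous_map (subtopology X (U \<inter> V)) euclidean ((\<psi> \<circ> inv_into U \<phi>) \<circ> \<phi>)"
    proof (rule continuous_map_eq)
      show "continuous_map (subtopology X (U \<inter> V)) euclidean \<psi>"
        using continuous_map_from_subtopology[OF chartD(4)[OF \<psi>], of U] by (simp add: subtopology_subtopology Int_commute)
      show "\<psi> x = ((\<psi> \<circ> inv_into U \<phi>) \<circ> \<phi>) x" if "x \<in> topspace (subtopology X (U \<inter> V))" for x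
        using eq[of x] that by simp
    qed
    ultimately show ?thesis
      using continuous_compose_quotient_map by fastforce
  qed
qed

lemma oriented_atlasD:
  assumes "oriented_atlas X \<A>"
  shows "(U, \<phi>) \<in> \<A> \<Longrightarrow> chart X U \<phi>"
    and "\<lbrakk>(U, \<phi>) \<in> \<A>; (V, \<psi>) \<in> \<A>\<rbrakk> \<Longrightarrow> orientation_preserving_on (\<phi> ` (U \<inter> V)) (\<psi> \<circ> inv_into U \<phi>)"
    and "x \<in> topspace X \<Longrightarrow> \<exists>U \<phi>. (U, \<phi>) \<in> \<A> \<and> x \<in> U"
proof -
  have A: "\<forall>(U, \<phi>) \<in> \<A>. chart X U \<phi>" "(\<Union>(U, \<phi>) \<in> \<A>. U) = topspace X"
    "\<forall>(U, \<phi>) \<in> \<A>. \<forall>(V, \<psi>) \<in> \<A>. orientation_preserving_on (\<phi> ` (U \<inter> V)) (\<psi> \<circ> inv_into U \<phi>)"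
    using assms by (simp_all add: oriented_atlas_def)
  show "(U, \<phi>) \<in> \<A> \<Longrightarrow> chart X U \<phi>" using bspec[OF A(1), of "(U, \<phi>)"] by simp
  show "\<lbrakk>(U, \<phi>) \<in> \<A>; (V, \<psi>) \<in> \<A>\<rbrakk> \<Longrightarrow> orientation_preserving_on (\<phi> ` (U \<inter> V)) (\<psi> \<circ> inv_into U \<phi>)"
    using bspec[OF A(3), of "(U, \<phi>)"] by (auto dest: bspec[of \<A> _ "(V, \<psi>)"])
  assume "x \<in> topspace X"
  then obtain p where "p \<in> \<A>" "x \<in> (case p of (U, \<phi>) \<Rightarrow> U)" unfolding A(2)[symmetric] by blast
  then show "\<exists>U \<phi>. (U, \<phi>) \<in> \<A> \<and> x \<in> U" by (cases p) auto
qed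

lemma oriented_atlasI:
  assumes "\<And>U \<phi>. (U, \<phi>) \<in> \<A> \<Longrightarrow> chart X U \<phi>" "(\<Union>(U, \<phi>) \<in> \<A>. U) = topspace X"
    and "\<And>U \<phi> V \<psi>. \<lbrakk>(U, \<phi>) \<in> \<A>; (V, \<psi>) \<in> \<A>\<rbrakk> \<Longrightarrow> orientation_preserving_on (\<phi> ` (U \<inter> V)) (\<psi> \<circ> inv_into U \<phi>)"
  shows "oriented_atlas X \<A>"
  using assms unfolding oriented_atlas_def by auto

text \<open>Charts are transported by the inverse homeomorphism, which cancels in the transition
  maps.\<close>

lemma orientable_homeomorphic:
  assumes "X homeomorphic_space Y" "orientable X"
  shows "orientable Y"
proof -
  obtain f g where fg: "homeomorphic_maps X Y f g" using assms(1) by (auto simp: homeomorphic_space_def)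
  then have f: "homeomorphic_map X Y f" and g: "homeomorphic_map Y X g"
    using homeomorphic_maps_map by metis+
  have gf: "\<And>x. x \<in> topspace X \<Longrightarrow> g (f x) = x" and fgx: "\<And>y. y \<in> topspace Y \<Longrightarrow> f (g y) = y"
    using fg by (simp_all add: homeomorphic_maps_def)
  obtain \<A> where A: "oriented_atlas X \<A>" using assms(2) by (auto simp: orientable_def)
  define \<B> where "\<B> = (\<lambda>(U, \<phi>). (f ` U, \<phi> \<circ> g)) ` \<A>"
  have chA: "chart X U \<phi>" if "(U, \<phi>) \<in> \<A>" for U \<phi>
    using oriented_atlasD(1)[OF A that] .
  have im: "(\<phi> \<circ> g) ` (f ` U) = \<phi> ` U" if "U \<subseteq> topspace X" for U and \<phi> :: "'a \<Rightarrow> complex"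
    using gf that by (force simp: image_iff)
  have chB: "chart Y (f ` U) (\<phi> \<circ> g)" if "(U, \<phi>) \<in> \<A>" for U \<phi>
  proof -
    note ch = chA[OF that]
    note U = chartD(6)[OF ch]
    have "homeomorphic_map (subtopology Y (f ` U)) (subtopology X U) g"
    proof (rule homeomorphic_map_subtopologies_alt[OF g])
      show "\<And>x. \<lbrakk>x \<in> topspace Y; g x \<in> topspace X\<rbrakk> \<Longrightarrow> g x \<in> U \<longleftrightarrow> x \<in> f ` U"
        using gf fgx U by (metis image_iff subsetD)
    qed
    from homeomorphic_map_compose[OF this chartD(5)[OF ch]]
    show ?thesis unfolding chart_def im[OF U]
      using chartD(1,2)[OF ch] homeomorphic_imp_open_map[OF f] by (simp add: open_map_def)
  qed
  have "oriented_atlas Y \<B>"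
  proof (rule oriented_atlasI)
    show "chart Y U \<phi>" if "(U, \<phi>) \<in> \<B>" for U \<phi> using chB that unfolding \<B>_def by auto
    have "(\<Union>(U, \<phi>)\<in>\<B>. U) = f ` (\<Union>(U, \<phi>)\<in>\<A>. U)" unfolding \<B>_def by auto
    also have "(\<Union>(U, \<phi>)\<in>\<A>. U) = topspace X" using A by (simp add: oriented_atlas_def)
    finally show "(\<Union>(U, \<phi>)\<in>\<B>. U) = topspace Y" using homeomorphic_imp_surjective_map[OF f] by simp
  next
    fix U' \<phi>' V' \<psi>' assume "(U', \<phi>') \<in> \<B>" "(V', \<psi>') \<in> \<B>"
    then obtain U \<phi> V \<psi> where x: "U' = f ` U" "\<phi>' = \<phi> \<circ> g" "(U, \<phi>) \<in> \<A>"
      and y: "V' = f ` V" "\<psi>' = \<psi> \<circ> g" "(V, \<psi>) \<in> \<A>"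
      unfolding \<B>_def by auto
    note ch = chA[OF x(3)] chA[OF y(3)]
    note sub = chartD(6)[OF ch(1)] chartD(6)[OF ch(2)]
    have inj: "inj_on f (topspace X)" using homeomorphic_imp_injective_map[OF f] .
    then have Int: "f ` U \<inter> f ` V = f ` (U \<inter> V)" using inj_on_image_Int[OF inj sub] by simp
    have imI: "(\<phi> \<circ> g) ` (f ` U \<inter> f ` V) = \<phi> ` (U \<inter> V)" unfolding Int using im[of "U \<inter> V" \<phi>] sub by blast
    have "((\<psi> \<circ> g) \<circ> inv_into (f ` U) (\<phi> \<circ> g)) z = (\<psi> \<circ> inv_into U \<phi>) z" if "z \<in> \<phi> ` (U \<inter> V)" for z
    proof -
      note z = that
      obtain p where p: "p \<in> U \<inter> V" "z = \<phi> p" using z by blast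
      then have "(\<phi> \<circ> g) (f p) = z" "f p \<in> f ` U \<inter> f ` V" using gf sub by auto
      then have "((\<psi> \<circ> g) \<circ> inv_into (f ` U) (\<phi> \<circ> g)) z = (\<psi> \<circ> g) (f p)"
        using chart_transition(4)[OF chB[OF x(3)] chB[OF y(3)], of "f p"] by simp
      also have "\<dots> = \<psi> p" using gf sub p(1) by auto
      also have "\<dots> = (\<psi> \<circ> inv_into U \<phi>) z" using chart_transition(4)[OF ch p(1)] p(2) by simp
      finally show ?thesis .
    qed
    moreover have "orientation_preserving_on (\<phi> ` (U \<inter> V)) (\<psi> \<circ> inv_into U \<phi>)"
      by (rule oriented_atlasD(2)[OF A x(3) y(3)])
    ultimately have "orientation_preserving_on (\<phi> ` (U \<inter> V)) ((\<psi> \<circ> g) \<circ> inv_into (f ` U) (\<phi> \<circ> g))"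
      using orientation_preserving_on_cong by metis
    then show "orientation_preserving_on (\<phi>' ` (U' \<inter> V')) (\<psi>' \<circ> inv_into U' \<phi>')"
      unfolding x(1,2) y(1,2) imI .
  qed
  then show ?thesis by (auto simp: orientable_def)
qed

text \<open>A connected injectively parametrized piece of an oriented surface has a sign, the local
  degree of a chart after K. Changing the chart composes with a transition map of degree 1, and in a
  fixed chart the degree is locally constant in z.\<close>

lemma oriented_atlas_sign:
  assumes A: "oriented_atlas X \<A>" and W: "open W" "connected W" "W \<noteq> {}"
    and K: "continuous_map (top_of_set W) X K" "inj_on K W"
  obtains \<sigma> where "\<sigma> = 1 \<or> \<sigma> = (- 1 :: int)"
    "\<And>U \<phi> z. \<lbrakk>(U, \<phi>) \<in> \<A>; z \<in> W; K z \<in> U\<rbrakk> \<Longrightarrow> \<exists>r. has_local_degree (\<phi> \<circ> K) z r \<sigma>"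
    "\<And>z. z \<in> W \<Longrightarrow> \<exists>U \<phi>. (U, \<phi>) \<in> \<A> \<and> K z \<in> U"
proof -
  have chA: "chart X U \<phi>" if "(U, \<phi>) \<in> \<A>" for U \<phi>
    using oriented_atlasD(1)[OF A that] .
  have cover: "\<exists>U \<phi>. (U, \<phi>) \<in> \<A> \<and> K z \<in> U" if "z \<in> W" for z
  proof -
    have "K z \<in> topspace X" using K(1) that by (auto simp: continuous_map_def)
    then show ?thesis by (rule oriented_atlasD(3)[OF A])
  qed
  have dom: "open {z \<in> W. K z \<in> U}" if "openin X U" for U
  proof -
    have "openin (top_of_set W) {z \<in> topspace (top_of_set W). K z \<in> U}"
      using K(1) that by (simp add: continuous_map)
    then show ?thesis using W(1) openin_open_eq by fastforce
  qed
  have loc: "continuous_on {z \<in> W. K z \<in> U} (\<phi> \<circ> K)" "inj_on (\<phi> \<circ> K) {z \<in> W. K z \<in> U}" if "(U, \<phi>) \<in> \<A>" for U \<phi>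
  proof -
    note ch = chA[OF that]
    have "continuous_map (top_of_set {z \<in> W. K z \<in> U}) (subtopology X U) K"
      unfolding continuous_map_in_subtopology
      using continuous_map_from_subtopology_mono[OF K(1), of "{z \<in> W. K z \<in> U}"] by auto
    from continuous_map_compose[OF this chartD(4)[OF ch]]
    show "continuous_on {z \<in> W. K z \<in> U} (\<phi> \<circ> K)" by simp
    show "inj_on (\<phi> \<circ> K) {z \<in> W. K z \<in> U}"
      using chartD(3)[OF ch] K(2) by (auto simp: inj_on_def)
  qed
  have ex: "\<exists>r d. has_local_degree (\<phi> \<circ> K) z r d" if "(U, \<phi>) \<in> \<A>" "z \<in> W" "K z \<in> U" for U \<phi> z
  proof -
    note z = that(2,3)
    have o: "open {z \<in> W. K z \<in> U}" by (rule dom[OF chartD(1)[OF chA[OF that(1)]]])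
    obtain r where "0 < r" "cball z r \<subseteq> {z \<in> W. K z \<in> U}"
      using o z open_contains_cball by (metis (mono_tags, lifting) mem_Collect_eq)
    then show ?thesis using has_local_degree_exists[OF _ _ loc[OF that(1)] o] by blast
  qed
  have change: "\<exists>r. has_local_degree (\<psi> \<circ> K) z r d"
    if "(U, \<phi>) \<in> \<A>" "(V, \<psi>) \<in> \<A>" "z \<in> W" "K z \<in> U" "K z \<in> V" "has_local_degree (\<phi> \<circ> K) z r d" for U \<phi> V \<psi> z r d
  proof -
    note ch = chA[OF that(1)] chA[OF that(2)]
    let ?\<tau> = "\<psi> \<circ> inv_into U \<phi>"
    have "orientation_preserving_on (\<phi> ` (U \<inter> V)) ?\<tau>"
      by (rule oriented_atlasD(2)[OF A that(1,2)])
    then have all: "\<forall>z\<in>\<phi> ` (U \<inter> V). \<exists>r. has_local_degree ?\<tau> z r 1"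
      by (rule orientation_preserving_on_iff[OF chart_transition(1-3)[OF ch], THEN iffD1])
    have "(\<phi> \<circ> K) z \<in> \<phi> ` (U \<inter> V)" using that(4,5) by simp
    from bspec[OF all this] obtain s where s: "has_local_degree ?\<tau> ((\<phi> \<circ> K) z) s 1" by (elim exE)
    have o: "open {z \<in> W. K z \<in> U}" by (rule dom[OF chartD(1)[OF ch(1)]])
    have "isCont (\<phi> \<circ> K) z" using loc(1)[OF that(1)] o that(3,4) continuous_on_eq_continuous_at by blast
    from has_local_degree_compose[OF that(6) s this] obtain t where t: "has_local_degree (?\<tau> \<circ> (\<phi> \<circ> K)) z t (1 * d)" by blast
    have "open {z \<in> W. K z \<in> U \<inter> V}"
      by (rule dom) (use chartD(1)[OF ch(1)] chartD(1)[OF ch(2)] in auto)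
    from has_local_degree_cong[OF t this, of "\<psi> \<circ> K"] show ?thesis
      using that(3-5) chart_transition(4)[OF ch] by auto
  qed
  define P where "P d z \<longleftrightarrow> (\<exists>U \<phi> r. (U, \<phi>) \<in> \<A> \<and> K z \<in> U \<and> has_local_degree (\<phi> \<circ> K) z r d)" for d z
  have all: "\<exists>r. has_local_degree (\<phi> \<circ> K) z r d" if "P d z" "(U, \<phi>) \<in> \<A>" "z \<in> W" "K z \<in> U" for d z U \<phi>
    using that change unfolding P_def by blast
  have uniq: "d = e" if "P d z" "P e z" "z \<in> W" for d e z
  proof -
    note P = that(1)
    obtain U \<phi> r where "(U, \<phi>) \<in> \<A>" "K z \<in> U" "has_local_degree (\<phi> \<circ> K) z r d" using P unfolding P_def by blast
    moreover from this obtain s where "has_local_degree (\<phi> \<circ> K) z s e" using all[OF \<open>P e z\<close>] \<open>z \<in> W\<close> by blast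
    ultimately show ?thesis using has_local_degree_unique by blast
  qed
  obtain z0 where z0: "z0 \<in> W" using W(3) by blast
  obtain \<sigma> where \<sigma>: "P \<sigma> z0" using cover[OF z0] ex z0 unfolding P_def by blast
  have const: "P \<sigma> z" if "z \<in> W" for z
  proof (rule connected_induction_simple[OF W(2), of z0 z "P \<sigma>"])
    fix a assume a: "a \<in> W"
    then obtain U \<phi> where U: "(U, \<phi>) \<in> \<A>" "K a \<in> U" using cover by blast
    let ?V = "{z \<in> W. K z \<in> U}"
    have o: "open ?V" by (rule dom[OF chartD(1)[OF chA[OF U(1)]]])
    obtain R where R: "0 < R" "cball a R \<subseteq> ?V" using o a U(2) open_contains_cball by (metis (mono_tags, lifting) mem_Collect_eq)
    have "cball x (R / 2) \<subseteq> ?V" if "x \<in> ball a (R / 2)" for x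
    proof -
      have "cball x (R / 2) \<subseteq> cball a R"
        using that by (auto simp: subset_iff) (smt (verit) dist_triangle2 dist_commute field_sum_of_halves)
      then show ?thesis using R by blast
    qed
    then obtain d where d: "\<forall>x\<in>ball a (R / 2). has_local_degree (\<phi> \<circ> K) x (R / 2) d"
      using has_local_degree_locally_constant[of "R / 2" "R / 2" ?V "\<phi> \<circ> K" a] R(1) loc[OF U(1)] by auto
    have ball: "ball a (R / 2) \<subseteq> ?V" using R by (auto simp: subset_iff)
    then have "P d x" if "x \<in> ball a (R / 2)" for x
      using d U(1) that unfolding P_def by blast
    then have "\<forall>x\<in>ball a (R / 2). \<forall>y\<in>ball a (R / 2). P \<sigma> x \<longrightarrow> P \<sigma> y"
      using uniq ball by blast
    moreover have "openin (top_of_set W) (ball a (R / 2))" using ball by (intro open_subset) auto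
    moreover have "a \<in> ball a (R / 2)" using R(1) by simp
    ultimately show "\<exists>T. openin (top_of_set W) T \<and> a \<in> T \<and> (\<forall>x\<in>T. \<forall>y\<in>T. P \<sigma> x \<longrightarrow> P \<sigma> y)" by metis
  qed (use z0 that \<sigma> in auto)
  have "\<sigma> = 1 \<or> \<sigma> = - 1"
  proof -
    obtain U \<phi> r where U: "(U, \<phi>) \<in> \<A>" "K z0 \<in> U" "has_local_degree (\<phi> \<circ> K) z0 r \<sigma>" using \<sigma> unfolding P_def by blast
    then show ?thesis
      using local_degree_cases[OF U(3) dom[OF chartD(1)[OF chA[OF U(1)]]] _ loc[OF U(1)]] z0 by blast
  qed
  then show ?thesis using that[of \<sigma>] all const cover by blast
qed

section \<open>Complex coordinates on the triangle and the diamond\<close>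

definition to_complex :: "plane \<Rightarrow> complex" where
  "to_complex w = Complex (fst w) (snd w)"

definition of_complex :: "complex \<Rightarrow> plane" where
  "of_complex z = (Re z, Im z)"

definition in_complex :: "(plane \<Rightarrow> plane) \<Rightarrow> complex \<Rightarrow> complex" where
  "in_complex f z = to_complex (f (of_complex z))"

definition complex_diamond :: "complex set" where
  "complex_diamond = {z. \<bar>Re z\<bar> + \<bar>Im z\<bar> < 2}"

definition inner_triangle :: "plane set" where
  "inner_triangle = {z. 0 < fst z \<and> 0 < snd z \<and> fst z + snd z < 2}"

definition complex_triangle :: "complex set" where
  "complex_triangle = {z. 0 < Re z \<and> 0 < Im z \<and> Re z + Im z < 2}"

lemma to_of_complex [simp]: "to_complex (of_complex z) = z" "of_complex (to_complex w) = w"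
  by (simp_all add: to_complex_def of_complex_def)

lemma continuous_of_complex: "continuous_on S of_complex"
  unfolding of_complex_def by (intro continuous_intros)

lemma continuous_to_complex: "continuous_on S to_complex"
proof -
  have "to_complex = (\<lambda>w. of_real (fst w) + \<i> * of_real (snd w))"
    by (simp add: fun_eq_iff to_complex_def complex_eq_iff)
  moreover have "continuous_on S (\<lambda>w :: plane. of_real (fst w) + \<i> * of_real (snd w))"
    by (intro continuous_intros)
  ultimately show ?thesis by (simp only:)
qed

lemma of_complex_mem:
  "of_complex z \<in> open_diamond \<longleftrightarrow> z \<in> complex_diamond" "to_complex w \<in> complex_diamond \<longleftrightarrow> w \<in> open_diamond"
  "of_complex z \<in> inner_triangle \<longleftrightarrow> z \<in> complex_triangle" "to_complex w \<in> complex_triangle \<longleftrightarrow> w \<in> inner_triangle"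
  by (simp_all add: open_diamond_def complex_diamond_def of_complex_def to_complex_def inner_triangle_def complex_triangle_def)

lemma open_complex_diamond: "open complex_diamond" and connected_complex_diamond: "connected complex_diamond"
proof -
  show "open complex_diamond"
    unfolding complex_diamond_def by (intro open_Collect_less continuous_intros)
  have "convex {z. \<bar>Re z\<bar> + \<bar>Im z\<bar> < 2}"
  proof (rule convexI)
    fix x y :: complex and u v :: real
    assume xy: "x \<in> {z. \<bar>Re z\<bar> + \<bar>Im z\<bar> < 2}" "y \<in> {z. \<bar>Re z\<bar> + \<bar>Im z\<bar> < 2}" and uv: "0 \<le> u" "0 \<le> v" "u + v = 1"
    have "\<bar>u * Re x + v * Re y\<bar> \<le> u * \<bar>Re x\<bar> + v * \<bar>Re y\<bar>" "\<bar>u * Im x + v * Im y\<bar> \<le> u * \<bar>Im x\<bar> + v * \<bar>Im y\<bar>"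
      using uv by (auto intro!: order_trans[OF abs_triangle_ineq] simp: abs_mult)
    moreover have "u * (\<bar>Re x\<bar> + \<bar>Im x\<bar>) + v * (\<bar>Re y\<bar> + \<bar>Im y\<bar>) < 2"
      using convex_bound_lt[of "\<bar>Re x\<bar> + \<bar>Im x\<bar>" 2 "\<bar>Re y\<bar> + \<bar>Im y\<bar>" u v] xy uv by simp
    ultimately show "u *\<^sub>R x + v *\<^sub>R y \<in> {z. \<bar>Re z\<bar> + \<bar>Im z\<bar> < 2}"
      by (simp add: distrib_left)
  qed
  then show "connected complex_diamond"
    unfolding complex_diamond_def by (rule convex_connected)
qed

lemma open_complex_triangle: "open complex_triangle" and connected_complex_triangle: "connected complex_triangle"
proof -
  have eq: "complex_triangle = {z. 0 < Re z} \<inter> ({z. 0 < Im z} \<inter> {z. Re z + Im z < 2})"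
    by (auto simp: complex_triangle_def)
  have "{z. Re z + Im z < 2} = {z. Complex 1 1 \<bullet> z < 2}"
    by (simp add: inner_complex_def)
  then have "convex {z. Re z + Im z < 2}" by (simp only: convex_halfspace_lt)
  then have "convex complex_triangle"
    unfolding eq by (intro convex_Int convex_halfspace_Re_gt convex_halfspace_Im_gt)
  then show "connected complex_triangle" by (rule convex_connected)
  show "open complex_triangle"
    unfolding eq by (intro open_Int open_Collect_less continuous_intros)
qed

lemma interior_triangle: "interior triangle = inner_triangle"
proof -
  have "interior triangle = triangle - frontier triangle"
    using closed_disc_compact[OF triangle_disc(1)] interior_subset[of triangle]
    unfolding frontier_def by (simp add: compact_imp_closed double_diff)
  also have "\<dots> = inner_triangle"
    unfolding triangle_disc(2)
  proof (intro subset_antisym subsetI)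
    fix z assume "z \<in> triangle - {z \<in> triangle. fst z = 0 \<or> snd z = 0 \<or> fst z + snd z = 2}"
    then have "0 \<le> fst z" "0 \<le> snd z" "fst z + snd z \<le> 2" "fst z \<noteq> 0" "snd z \<noteq> 0" "fst z + snd z \<noteq> 2"
      by (auto simp: triangle_def)
    then show "z \<in> inner_triangle" by (simp add: inner_triangle_def)
  qed (simp add: triangle_def inner_triangle_def)
  finally show ?thesis .
qed

lemma inner_triangle_subset: "inner_triangle \<subseteq> half_open_triangle" "inner_triangle \<subseteq> triangle"
  by (auto simp: inner_triangle_def half_open_triangle_def triangle_def)

section \<open>Degrees of reflections and of homeomorphisms of the triangle\<close>

lemma has_local_degree_scale: "c \<noteq> 0 \<Longrightarrow> 0 < r \<Longrightarrow> has_local_degree (\<lambda>z. c * z) z r 1"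
  unfolding has_local_degree_def
  by (auto intro!: exI[of _ "\<lambda>w. w + Ln c"] continuous_intros simp: exp_add algebra_simps)

text \<open>Conjugation commutes with the exponential and reverses the period 2 pi i.\<close>

lemma has_local_degree_scale_cnj: "c \<noteq> 0 \<Longrightarrow> 0 < r \<Longrightarrow> has_local_degree (\<lambda>z. c * cnj z) z r (- 1)"
  unfolding has_local_degree_def
  by (auto intro!: exI[of _ "\<lambda>w. cnj w + Ln c"] continuous_intros simp: exp_add exp_cnj algebra_simps)

text \<open>The product of the two characters, which is the determinant of
  \<open>turn a b g\<close>.\<close>

definition flip_sign :: "bit \<times> bit \<Rightarrow> bit \<times> bit \<Rightarrow> bit \<times> bit \<Rightarrow> int" where
  "flip_sign a b g = (if flip a b g = flip b a g then 1 else - 1)"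

lemma flip_sign_cases: "flip_sign a b g = 1 \<or> flip_sign a b g = - 1"
  by (simp add: flip_sign_def)

lemma has_local_degree_turn: "0 < r \<Longrightarrow> has_local_degree (in_complex (turn a b g)) z r (flip_sign a b g)"
proof -
  assume r: "0 < r"
  have nz: "of_real (flip a b g) \<noteq> (0 :: complex)" using flip_cases[of a b g] by auto
  show ?thesis
  proof (cases "flip a b g = flip b a g")
    case True
    then have "in_complex (turn a b g) = (\<lambda>z. of_real (flip a b g) * z)"
      by (simp add: fun_eq_iff in_complex_def turn_def to_complex_def of_complex_def complex_eq_iff)
    then show ?thesis using has_local_degree_scale[OF nz r] True by (simp only: flip_sign_def if_True simp_thms)
  next
    case False
    then have "flip b a g = - flip a b g" using flip_cases[of a b g] flip_cases[of b a g] by auto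
    then have "in_complex (turn a b g) = (\<lambda>z. of_real (flip a b g) * cnj z)"
      by (simp add: fun_eq_iff in_complex_def turn_def to_complex_def of_complex_def complex_eq_iff)
    then show ?thesis using has_local_degree_scale_cnj[OF nz r] False by (simp only: flip_sign_def if_False)
  qed
qed

text \<open>The degree is taken in the open triangle, which every homeomorphism of the closed
  triangle preserves.\<close>

definition triangle_degree :: "(plane \<Rightarrow> plane) \<Rightarrow> int \<Rightarrow> bool" where
  "triangle_degree h d \<longleftrightarrow> (\<forall>z\<in>complex_triangle. \<exists>r. has_local_degree (in_complex h) z r d)"

lemma in_complex_homeomorphism:
  assumes "homeomorphism triangle triangle h k"
  shows "continuous_on complex_triangle (in_complex h)" "inj_on (in_complex h) complex_triangle"
    "in_complex h ` complex_triangle = complex_triangle" "h ` inner_triangle = inner_triangle"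
proof -
  have h: "continuous_on triangle h" "inj_on h triangle"
    using assms unfolding homeomorphism_def by (blast, metis inj_on_inverseI)
  show im: "h ` inner_triangle = inner_triangle"
    using homeomorphism_frontier(1)[OF assms] closed_disc_compact[OF triangle_disc(1)]
    by (simp add: interior_triangle compact_imp_closed)
  have sub: "of_complex ` complex_triangle \<subseteq> triangle"
    using of_complex_mem(3) inner_triangle_subset(2) by blast
  have "continuous_on complex_triangle (to_complex \<circ> (h \<circ> of_complex))"
    by (intro continuous_on_compose continuous_of_complex continuous_to_complex continuous_on_subset[OF h(1) sub])
  then show "continuous_on complex_triangle (in_complex h)" by (simp add: in_complex_def[abs_def] o_def)
  show "inj_on (in_complex h) complex_triangle"
  proof (rule inj_onI)
    fix x y assume xy: "x \<in> complex_triangle" "y \<in> complex_triangle" "in_complex h x = in_complex h y"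
    then have "h (of_complex x) = h (of_complex y)" by (metis in_complex_def to_of_complex(2))
    then have "of_complex x = of_complex y" using h(2) sub xy(1,2) by (meson image_subset_iff inj_onD)
    then show "x = y" by (metis to_of_complex(1))
  qed
  have tri: "complex_triangle = to_complex ` inner_triangle"
  proof (intro subset_antisym subsetI)
    fix z assume "z \<in> complex_triangle"
    then show "z \<in> to_complex ` inner_triangle" by (intro image_eqI[of _ _ "of_complex z"]) (simp_all add: of_complex_mem)
  qed (auto simp: of_complex_mem)
  show "in_complex h ` complex_triangle = complex_triangle"
  proof -
    have "in_complex h ` to_complex ` inner_triangle = to_complex ` h ` inner_triangle"
      by (simp add: image_image in_complex_def)
    then show ?thesis unfolding tri im .
  qed
qed

lemma triangle_degree_exists:
  assumes "homeomorphism triangle triangle h k"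
  shows "\<exists>d. (d = 1 \<or> d = - 1) \<and> triangle_degree h d"
proof -
  note c = in_complex_homeomorphism[OF assms]
  obtain d where d: "d = 1 \<or> d = - 1" "\<And>z r. \<lbrakk>0 < r; cball z r \<subseteq> complex_triangle\<rbrakk> \<Longrightarrow> has_local_degree (in_complex h) z r d"
    using has_local_degree_constant[OF open_complex_triangle connected_complex_triangle c(1,2)] by blast
  have "triangle_degree h d"
    unfolding triangle_degree_def
  proof
    fix z assume "z \<in> complex_triangle"
    then obtain r where "0 < r" "cball z r \<subseteq> complex_triangle"
      using open_complex_triangle open_contains_cball by metis
    then show "\<exists>r. has_local_degree (in_complex h) z r d" using d(2) by blast
  qed
  then show ?thesis using d(1) by blast
qed

lemma isCont_in_complex:
  assumes "homeomorphism triangle triangle h k" "z \<in> complex_triangle"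
  shows "isCont (in_complex h) z"
  using in_complex_homeomorphism(1)[OF assms(1)] assms(2) open_complex_triangle continuous_on_eq_continuous_at by blast

lemma triangle_degree_inverse:
  assumes hk: "homeomorphism triangle triangle h k" and "triangle_degree h 1"
  shows "triangle_degree k 1"
proof -
  have kh: "homeomorphism triangle triangle k h" using hk by (rule homeomorphism_symD)
  obtain e where e: "triangle_degree k e" using triangle_degree_exists[OF kh] by blast
  have z: "to_complex (1 / 2, 1 / 2) \<in> complex_triangle" by (simp add: of_complex_mem inner_triangle_def)
  then have hz: "in_complex h (to_complex (1 / 2, 1 / 2)) \<in> complex_triangle"
    using in_complex_homeomorphism(3)[OF hk] by blast
  obtain r s where "has_local_degree (in_complex h) (to_complex (1 / 2, 1 / 2)) r 1"
      "has_local_degree (in_complex k) (in_complex h (to_complex (1 / 2, 1 / 2))) s e"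
    using assms(2) e z hz unfolding triangle_degree_def by blast
  moreover have "in_complex k (in_complex h x) = x" if "x \<in> complex_triangle" for x
  proof -
    have "of_complex x \<in> triangle" using that of_complex_mem(3) inner_triangle_subset(2) by blast
    then have "k (h (of_complex x)) = of_complex x" using hk unfolding homeomorphism_def by blast
    then show ?thesis by (simp add: in_complex_def)
  qed
  ultimately have "e * 1 = 1"
    using local_degree_inverse[OF _ _ isCont_in_complex[OF hk z] open_complex_triangle z] by blast
  then show ?thesis using e by simp
qed

lemma homeomorphism_swap: "homeomorphism triangle triangle prod.swap prod.swap"
proof -
  have "prod.swap ` triangle = triangle"
  proof (intro subset_antisym subsetI)
    fix z :: plane assume "z \<in> triangle"
    then show "z \<in> prod.swap ` triangle" by (intro image_eqI[of _ _ "prod.swap z"]) (auto simp: triangle_def)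
  qed (auto simp: triangle_def)
  then show ?thesis
    by (auto simp: homeomorphism_def intro!: continuous_on_swap)
qed

text \<open>In complex coordinates the swap is z to i times the conjugate of z, a reflection. Hence
  every corner has a parametrization of degree 1, at the price of exchanging the roles of a and
  b.\<close>

lemma triangle_degree_swap:
  assumes "homeomorphism triangle triangle h k" "triangle_degree h d"
  shows "triangle_degree (h \<circ> prod.swap) (- d)"
  unfolding triangle_degree_def
proof
  fix z assume z: "z \<in> complex_triangle"
  have swap: "in_complex prod.swap = (\<lambda>z. \<i> * cnj z)"
    by (simp add: fun_eq_iff in_complex_def to_complex_def of_complex_def complex_eq_iff)
  have "in_complex prod.swap z \<in> complex_triangle"
    using in_complex_homeomorphism(3)[OF homeomorphism_swap] z by blast
  then obtain r where "has_local_degree (in_complex h) (in_complex prod.swap z) r d"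
    using assms(2) unfolding triangle_degree_def by blast
  moreover have "has_local_degree (in_complex prod.swap) z 1 (- 1)"
    unfolding swap by (rule has_local_degree_scale_cnj) simp_all
  ultimately obtain t where "has_local_degree (in_complex h \<circ> in_complex prod.swap) z t (d * - 1)"
    using has_local_degree_compose[OF _ _ isCont_in_complex[OF homeomorphism_swap z]] by blast
  moreover have "in_complex h \<circ> in_complex prod.swap = in_complex (h \<circ> prod.swap)"
    by (simp add: fun_eq_iff in_complex_def)
  ultimately show "\<exists>r. has_local_degree (in_complex (h \<circ> prod.swap)) z r (- d)" by auto
qed

lemma corner_swap:
  assumes "corner D F a b h"
  shows "corner D F b a (h \<circ> prod.swap)"
proof -
  obtain k where k: "homeomorphism triangle D h k" using assms by (auto simp: corner_def)
  have "homeomorphism triangle D (h \<circ> prod.swap) (prod.swap \<circ> k)"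
    by (rule homeomorphism_compose[OF homeomorphism_swap k])
  moreover have "(h \<circ> prod.swap) z \<in> F s \<longleftrightarrow> s = a \<and> snd z = 0 \<or> s = b \<and> fst z = 0" if z: "z \<in> half_open_triangle" for z s
  proof -
    have "prod.swap z \<in> half_open_triangle" using z by (simp add: half_open_triangle_def add.commute)
    then show ?thesis using assms unfolding corner_def by auto
  qed
  ultimately show ?thesis using assms unfolding corner_def by metis
qed

section \<open>Corner charts in complex coordinates\<close>

definition corner_param ::
  "(bit \<times> bit \<Rightarrow> plane set) \<Rightarrow> bit \<times> bit \<Rightarrow> bit \<times> bit \<Rightarrow> (plane \<Rightarrow> plane) \<Rightarrow> complex \<Rightarrow> ((bit \<times> bit) \<times> plane) set" where
  "corner_param F a b h z = corner_chart triangle F a b h (of_complex z)"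

text \<open>Corner parametrizations run from the plane to the surface, charts in the opposite
  direction.\<close>

lemma chart_inv_into:
  assumes "homeomorphic_map (top_of_set W) (subtopology X U) \<kappa>" "open W" "openin X U"
  shows "chart X U (inv_into W \<kappa>)" "inv_into W \<kappa> ` U = W"
proof -
  have U: "U \<subseteq> topspace X" using assms(3) by (rule openin_subset)
  have inj: "inj_on \<kappa> W" and im: "\<kappa> ` W = U"
    using homeomorphic_imp_injective_map[OF assms(1)] homeomorphic_imp_surjective_map[OF assms(1)] U by auto
  show inv: "inv_into W \<kappa> ` U = W" using inv_into_image_cancel[OF inj, of W] im by simp
  obtain g where g: "homeomorphic_maps (top_of_set W) (subtopology X U) \<kappa> g"
    using assms(1) homeomorphic_map_maps by blast
  have "homeomorphic_map (subtopology X U) (top_of_set W) (inv_into W \<kappa>)"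
  proof (rule homeomorphic_map_eq)
    show "homeomorphic_map (subtopology X U) (top_of_set W) g" using g homeomorphic_maps_map by blast
    fix x assume "x \<in> topspace (subtopology X U)"
    then have "x \<in> U" by simp
    then obtain w where "w \<in> W" "x = \<kappa> w" using im by blast
    then show "g x = inv_into W \<kappa> x" using g inj by (simp add: homeomorphic_maps_def)
  qed
  then show "chart X U (inv_into W \<kappa>)"
    unfolding chart_def inv using assms(2,3) by blast
qed

locale corner_at_triangle = corner_at triangle F a b h for F a b h
begin

lemma homeomorphic_map_corner_param:
  "homeomorphic_map (top_of_set complex_diamond) (subtopology (mirror_space triangle F) region) (corner_param F a b h)"
proof -
  have "homeomorphic_maps (top_of_set complex_diamond) (top_of_set open_diamond) of_complex to_complex"
    unfolding homeomorphic_maps_def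
    using continuous_of_complex continuous_to_complex of_complex_mem by (auto simp: continuous_map_in_subtopology)
  then have "homeomorphic_map (top_of_set complex_diamond) (top_of_set open_diamond) of_complex"
    using homeomorphic_maps_map by blast
  from homeomorphic_map_compose[OF this homeomorphic_map_corner_chart]
  show ?thesis by (simp add: corner_param_def[abs_def] o_def)
qed

lemma chart_corner: "chart (mirror_space triangle F) region (inv_into complex_diamond (corner_param F a b h))"
  "inv_into complex_diamond (corner_param F a b h) ` region = complex_diamond"
  by (rule chart_inv_into[OF homeomorphic_map_corner_param open_complex_diamond openin_region])+

lemma corner_param_turn:
  "z \<in> half_open_triangle \<Longrightarrow> corner_param F a b h (to_complex (turn a b g z)) = mirror_map triangle F (g, h z)"
  by (simp add: corner_param_def corner_chart_turn)

lemma inj_corner_param: "inj_on (corner_param F a b h) complex_diamond"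
  using homeomorphic_imp_injective_map[OF homeomorphic_map_corner_param] by simp

lemma inv_corner_param:
  assumes "z \<in> half_open_triangle"
  shows "inv_into complex_diamond (corner_param F a b h) (mirror_map triangle F (g, h z)) = to_complex (turn a b g z)"
  using inv_into_f_f[OF inj_corner_param, of "to_complex (turn a b g z)"] turn_mem[OF assms] corner_param_turn[OF assms]
  by (simp add: of_complex_mem)

end

lemma open_turned: "open {z. in_complex (turn a b g) z \<in> complex_triangle}"
proof -
  have "continuous_on UNIV (to_complex \<circ> (turn a b g \<circ> of_complex))"
    by (intro continuous_on_compose continuous_of_complex continuous_to_complex continuous_on_turn)
  then have "continuous_on UNIV (in_complex (turn a b g))" by (simp add: in_complex_def[abs_def] o_def)
  then show ?thesis using open_vimage[OF open_complex_triangle] by (simp add: vimage_def)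
qed

lemma continuous_in_complex_turn: "isCont (in_complex (turn a b g)) z"
proof -
  have "continuous_on UNIV (to_complex \<circ> (turn a b g \<circ> of_complex))"
    by (intro continuous_on_compose continuous_of_complex continuous_to_complex continuous_on_turn)
  then show ?thesis
    by (simp add: in_complex_def[abs_def] o_def continuous_on_eq_continuous_at)
qed

text \<open>Points off both axes are dense, and only there does a point of the diamond lie in the
  interior of a single copy.\<close>

lemma generic_point:
  fixes z :: complex
  assumes "0 < r"
  obtains z' where "z' \<in> ball z r" "Re z' \<noteq> 0" "Im z' \<noteq> 0"
proof -
  define z' where "z' = z + Complex (if 0 \<le> Re z then r / 3 else - r / 3) (if 0 \<le> Im z then r / 3 else - r / 3)"
  have "norm (z' - z) \<le> \<bar>Re (z' - z)\<bar> + \<bar>Im (z' - z)\<bar>" by (rule cmod_le)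
  also have "\<dots> < r" using assms by (simp add: z'_def)
  finally have "z' \<in> ball z r" by (simp add: dist_norm norm_minus_commute)
  moreover have "Re z' \<noteq> 0" "Im z' \<noteq> 0" using assms by (auto simp: z'_def)
  ultimately show ?thesis using that by blast
qed

text \<open>Off the axes a point lies in a single copy g, and the transition is the composite of
  \<open>turn a b g\<close>, h, the inverse of h' and \<open>turn a' b' g\<close>. The maps h and h'
  have degree 1 and the two turns have the same determinant, so the degree is 1. Since it is locally
  constant, it is 1 on the axes too.\<close>

lemma corner_transition_degree:
  assumes c1: "corner triangle F a b h" "triangle_degree h 1" and c2: "corner triangle F a' b' h'" "triangle_degree h' 1"
    and labels: "{a, b} = {a', b'}" and inner: "\<And>z s. z \<in> inner_triangle \<Longrightarrow> z \<notin> F s"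
  defines "U \<equiv> corner_at.region triangle F h" and "V \<equiv> corner_at.region triangle F h'"
    and "\<phi> \<equiv> inv_into complex_diamond (corner_param F a b h)" and "\<psi> \<equiv> inv_into complex_diamond (corner_param F a' b' h')"
  shows "orientation_preserving_on (\<phi> ` (U \<inter> V)) (\<psi> \<circ> inv_into U \<phi>)"
proof -
  interpret c1: corner_at_triangle F a b h
    by (rule corner_at_triangle.intro, rule corner_at.intro) (rule c1(1))
  interpret c2: corner_at_triangle F a' b' h'
    by (rule corner_at_triangle.intro, rule corner_at.intro) (rule c2(1))
  note ch = c1.chart_corner(1)[folded U_def \<phi>_def] c2.chart_corner(1)[folded V_def \<psi>_def]
  define \<tau> where "\<tau> = \<psi> \<circ> inv_into U \<phi>"
  define W where "W = \<phi> ` (U \<inter> V)"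
  have W: "open W" "continuous_on W \<tau>" "inj_on \<tau> W" "\<And>x. x \<in> U \<inter> V \<Longrightarrow> \<tau> (\<phi> x) = \<psi> x"
    unfolding W_def \<tau>_def by (rule chart_transition[OF ch])+
  have WD: "W \<subseteq> complex_diamond"
    using c1.chart_corner(2) unfolding W_def \<phi>_def U_def by blast
  obtain k where k: "homeomorphism triangle triangle h k" using c1(1) by (auto simp: corner_def)
  obtain k' where k': "homeomorphism triangle triangle h' k'" using c2(1) by (auto simp: corner_def)
  have kh': "homeomorphism triangle triangle k' h'" using k' by (rule homeomorphism_symD)
  have deg_k': "triangle_degree k' 1" by (rule triangle_degree_inverse[OF k' c2(2)])
  \<comment> \<open>Exchanging a and b exchanges the two characters and keeps their product.\<close>
  have sign: "flip_sign a b g = flip_sign a' b' g" for g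
    using labels by (auto simp: flip_sign_def doubleton_eq_iff)
  have generic: "\<exists>s. has_local_degree \<tau> z s 1" if z: "z \<in> W" "Re z \<noteq> 0" "Im z \<noteq> 0" for z
  proof -
    define g where "g = corner_sign a b (of_complex z)"
    define p where "p = corner_fold (of_complex z)"
    have p: "p \<in> inner_triangle" using z WD
      by (auto simp: p_def corner_fold_def of_complex_def inner_triangle_def complex_diamond_def)
    have z_eq: "z = to_complex (turn a b g p)"
      unfolding g_def p_def turn_corner_fold[OF c1.ab] by simp
    let ?N = "{z. in_complex (turn a b g) z \<in> complex_triangle}"
    have zN: "z \<in> ?N" unfolding z_eq using p by (simp add: in_complex_def of_complex_mem)
    have \<tau>_eq: "\<tau> x = (in_complex (turn a' b' g) \<circ> (in_complex k' \<circ> (in_complex h \<circ> in_complex (turn a b g)))) x" if x: "x \<in> ?N" for x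
    proof -
      define q where "q = turn a b g (of_complex x)"
      have q: "q \<in> inner_triangle" "to_complex (turn a b g q) = x"
        using x by (simp_all add: q_def in_complex_def of_complex_mem)
      then have hq: "h q \<in> inner_triangle" using in_complex_homeomorphism(4)[OF k] by blast
      then have k'hq: "k' (h q) \<in> inner_triangle" using in_complex_homeomorphism(4)[OF kh'] by blast
      have "h' (k' (h q)) = h q"
        using k' hq inner_triangle_subset(2) unfolding homeomorphism_def by blast
      \<comment> \<open>The same point of the surface, rewritten so that the second chart can be
        evaluated.\<close>
      then have pt: "mirror_map triangle F (g, h q) = mirror_map triangle F (g, h' (k' (h q)))" by simp
      have "mirror_map triangle F (g, h q) \<in> U"
        unfolding U_def c1.region_def using q(1) inner_triangle_subset(1) by blast
      moreover have "mirror_map triangle F (g, h q) \<in> V"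
        unfolding V_def c2.region_def pt using k'hq inner_triangle_subset(1) by blast
      moreover have "\<phi> (mirror_map triangle F (g, h q)) = x"
        unfolding \<phi>_def using c1.inv_corner_param[of q g] q inner_triangle_subset(1) by auto
      moreover have "\<psi> (mirror_map triangle F (g, h q)) = to_complex (turn a' b' g (k' (h q)))"
        unfolding \<psi>_def pt using c2.inv_corner_param[of "k' (h q)" g] k'hq inner_triangle_subset(1) by auto
      ultimately have "\<tau> x = to_complex (turn a' b' g (k' (h q)))"
        using W(4) by (metis IntI)
      then show ?thesis by (simp add: in_complex_def q_def)
    qed
    have t1: "has_local_degree (in_complex (turn a b g)) z 1 (flip_sign a b g)" by (rule has_local_degree_turn) simp
    let ?y1 = "in_complex (turn a b g) z"
    have y1: "?y1 \<in> complex_triangle" using zN by simp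
    then obtain r2 where t2: "has_local_degree (in_complex h) ?y1 r2 1" using c1(2) unfolding triangle_degree_def by blast
    obtain s2 where u2: "has_local_degree (in_complex h \<circ> in_complex (turn a b g)) z s2 (1 * flip_sign a b g)"
      using has_local_degree_compose[OF t1 t2 continuous_in_complex_turn] by blast
    have cont2: "isCont (in_complex h \<circ> in_complex (turn a b g)) z"
      by (rule continuous_at_compose[OF continuous_in_complex_turn isCont_in_complex[OF k y1]])
    let ?y2 = "(in_complex h \<circ> in_complex (turn a b g)) z"
    have y2: "?y2 \<in> complex_triangle" using in_complex_homeomorphism(3)[OF k] y1 by auto
    then obtain r3 where t3: "has_local_degree (in_complex k') ?y2 r3 1" using deg_k' unfolding triangle_degree_def by blast
    obtain s3 where u3: "has_local_degree (in_complex k' \<circ> (in_complex h \<circ> in_complex (turn a b g))) z s3 (1 * (1 * flip_sign a b g))"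
      using has_local_degree_compose[OF u2 t3 cont2] by blast
    have cont3: "isCont (in_complex k' \<circ> (in_complex h \<circ> in_complex (turn a b g))) z"
      by (rule continuous_at_compose[OF cont2 isCont_in_complex[OF kh' y2]])
    have t4: "has_local_degree (in_complex (turn a' b' g)) ((in_complex k' \<circ> (in_complex h \<circ> in_complex (turn a b g))) z) 1 (flip_sign a' b' g)"
      by (rule has_local_degree_turn) simp
    obtain s4 where "has_local_degree (in_complex (turn a' b' g) \<circ> (in_complex k' \<circ> (in_complex h \<circ> in_complex (turn a b g)))) z s4
        (flip_sign a' b' g * (1 * (1 * flip_sign a b g)))"
      using has_local_degree_compose[OF u3 t4 cont3] by blast
    from has_local_degree_cong[OF this open_turned zN, of \<tau>] \<tau>_eq
    obtain s where "has_local_degree \<tau> z s (flip_sign a' b' g * (1 * (1 * flip_sign a b g)))" by metis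
    moreover have "flip_sign a' b' g * (1 * (1 * flip_sign a b g)) = 1"
      using flip_sign_cases[of a b g] sign[of g] by auto
    ultimately show ?thesis by metis
  qed
  have "\<exists>s. has_local_degree \<tau> z s 1" if z: "z \<in> W" for z
  proof -
    obtain r where r: "0 < r" "ball z r \<subseteq> W" using W(1) z open_contains_ball by metis
    obtain d where d: "\<And>x t. \<lbrakk>0 < t; cball x t \<subseteq> ball z r\<rbrakk> \<Longrightarrow> has_local_degree \<tau> x t d"
      using has_local_degree_constant[of "ball z r" \<tau>] r(2) W(2,3) continuous_on_subset inj_on_subset
      by (metis connected_ball open_ball)
    obtain z' where z': "z' \<in> ball z r" "Re z' \<noteq> 0" "Im z' \<noteq> 0" using generic_point[OF r(1)] by metis
    then obtain s where s: "has_local_degree \<tau> z' s 1" using generic[of z'] r(2) by blast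
    obtain t where "0 < t" "cball z' t \<subseteq> ball z r"
      using z'(1) open_contains_cball[of "ball z r"] by (metis open_ball)
    from has_local_degree_unique[OF d[OF this] s] have "d = 1" .
    moreover have "has_local_degree \<tau> z (r / 2) d" by (rule d) (use r(1) in auto)
    ultimately show ?thesis by blast
  qed
  then show ?thesis
    using orientation_preserving_on_iff[OF W(1-3)] unfolding W_def \<tau>_def by blast
qed

text \<open>The atlas consists of the corner charts with parametrizations of degree 1. It is
  essential that all corners carry the same pair of labels, for then the determinants of the turns
  agree from chart to chart.\<close>

theorem mirror_space_orientable:
  assumes mirr: "mirrored triangle F" and inner: "\<And>z s. z \<in> inner_triangle \<Longrightarrow> z \<notin> F s"
    and cover: "\<And>p. p \<in> triangle \<Longrightarrow> \<exists>h a' b'. corner triangle F a' b' h \<and> {a', b'} = {a, b} \<and> p \<in> h ` half_open_triangle"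
  shows "orientable (mirror_space triangle F)"
proof -
  define \<A> where "\<A> = {(corner_at.region triangle F h, inv_into complex_diamond (corner_param F a' b' h)) | h a' b'.
      corner triangle F a' b' h \<and> {a', b'} = {a, b} \<and> triangle_degree h 1}"
  have A: "\<exists>h a' b'. U = corner_at.region triangle F h \<and> \<phi> = inv_into complex_diamond (corner_param F a' b' h) \<and>
      corner triangle F a' b' h \<and> {a', b'} = {a, b} \<and> triangle_degree h 1" if "(U, \<phi>) \<in> \<A>" for U \<phi>
    using that unfolding \<A>_def by blast
  have chart: "chart (mirror_space triangle F) U \<phi>" if "(U, \<phi>) \<in> \<A>" for U \<phi>
  proof -
    note U = that
    obtain h a' b' where *: "U = corner_at.region triangle F h" "\<phi> = inv_into complex_diamond (corner_param F a' b' h)"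
      "corner triangle F a' b' h" using A[OF U] by blast
    interpret corner_at_triangle F a' b' h
      by (rule corner_at_triangle.intro, rule corner_at.intro) (rule *(3))
    show ?thesis unfolding *(1,2) by (rule chart_corner(1))
  qed
  have "oriented_atlas (mirror_space triangle F) \<A>"
  proof (rule oriented_atlasI)
    show "(\<Union>(U, \<phi>)\<in>\<A>. U) = topspace (mirror_space triangle F)"
    proof (intro subset_antisym subsetI)
      fix x assume "x \<in> (\<Union>(U, \<phi>)\<in>\<A>. U)"
      then obtain U \<phi> where U: "(U, \<phi>) \<in> \<A>" "x \<in> U" by blast
      then show "x \<in> topspace (mirror_space triangle F)" using chartD(6)[OF chart[OF U(1)]] by blast
    next
      fix x assume "x \<in> topspace (mirror_space triangle F)"
      then obtain g p where p: "p \<in> triangle" "x = mirror_map triangle F (g, p)"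
        unfolding topspace_mirror_space by blast
      obtain h a' b' where h: "corner triangle F a' b' h" "{a', b'} = {a, b}" "p \<in> h ` half_open_triangle"
        using cover[OF p(1)] by blast
      have "\<exists>h a' b'. corner triangle F a' b' h \<and> {a', b'} = {a, b} \<and> triangle_degree h 1 \<and> p \<in> h ` half_open_triangle"
      proof -
        obtain k where k: "homeomorphism triangle triangle h k" using h(1) by (auto simp: corner_def)
        obtain d where d: "d = 1 \<or> d = - 1" "triangle_degree h d" using triangle_degree_exists[OF k] by blast
        show ?thesis
        proof (cases "d = 1")
          case True
          then show ?thesis using h d by blast
        next
          case False
          \<comment> \<open>A parametrization of degree -1 is precomposed with the swap. The labels
            are then exchanged, which the atlas permits because it fixes only the set of the two
            labels.\<close>
          then have deg: "triangle_degree (h \<circ> prod.swap) 1" using triangle_degree_swap[OF k d(2)] d(1) by simp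
          have swap: "prod.swap ` half_open_triangle = half_open_triangle"
          proof (intro subset_antisym subsetI)
            fix z assume "z \<in> half_open_triangle"
            then show "z \<in> prod.swap ` half_open_triangle"
              by (intro image_eqI[of _ _ "prod.swap z"]) (auto simp: half_open_triangle_def)
          qed (auto simp: half_open_triangle_def)
          have "p \<in> (h \<circ> prod.swap) ` half_open_triangle"
            unfolding image_comp[symmetric] swap by (rule h(3))
          moreover have "{b', a'} = {a, b}" using h(2) by (simp only: insert_commute)
          ultimately show ?thesis using corner_swap[OF h(1)] deg by blast
        qed
      qed
      then obtain h a' b' where cor: "corner triangle F a' b' h" "{a', b'} = {a, b}" "triangle_degree h 1" "p \<in> h ` half_open_triangle"
        by blast
      interpret corner_at_triangle F a' b' h
        by (rule corner_at_triangle.intro, rule corner_at.intro) (rule cor(1))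
      have "(region, inv_into complex_diamond (corner_param F a' b' h)) \<in> \<A>"
        unfolding \<A>_def mem_Collect_eq
        by (rule exI[of _ h], rule exI[of _ a'], rule exI[of _ b'], intro conjI refl cor(1-3))
      moreover have "x \<in> region" unfolding region_def p(2) using cor(4) by blast
      ultimately show "x \<in> (\<Union>(U, \<phi>)\<in>\<A>. U)" by blast
    qed
    fix U \<phi> V \<psi> assume UV: "(U, \<phi>) \<in> \<A>" "(V, \<psi>) \<in> \<A>"
    obtain h1 a1 b1 where 1: "U = corner_at.region triangle F h1" "\<phi> = inv_into complex_diamond (corner_param F a1 b1 h1)"
      "corner triangle F a1 b1 h1" "{a1, b1} = {a, b}" "triangle_degree h1 1" using A[OF UV(1)] by blast
    obtain h2 a2 b2 where 2: "V = corner_at.region triangle F h2" "\<psi> = inv_into complex_diamond (corner_param F a2 b2 h2)"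
      "corner triangle F a2 b2 h2" "{a2, b2} = {a, b}" "triangle_degree h2 1" using A[OF UV(2)] by blast
    show "orientation_preserving_on (\<phi> ` (U \<inter> V)) (\<psi> \<circ> inv_into U \<phi>)"
      unfolding 1(1,2) 2(1,2)
      by (rule corner_transition_degree[OF 1(3,5) 2(3,5) _ inner]) (use 1(4) 2(4) in simp_all)
  qed (rule chart)
  then show ?thesis by (auto simp: orientable_def)
qed

text \<open>
  Crossing an edge labelled c passes from the copy g to the copy g + c by a reflection. So in an oriented
  surface the sign of the copy g changes under adding any label, which is impossible for the labels a, b, a + b.
\<close>

theorem mirror_space_not_orientable:
  assumes c1: "corner triangle F a b h" and c2: "corner triangle F (a + b) d h'"
  shows "\<not> orientable (mirror_space triangle F)"
proof
  assume "orientable (mirror_space triangle F)"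
  then obtain \<A> where A: "oriented_atlas (mirror_space triangle F) \<A>" by (auto simp: orientable_def)
  define J where "J g z = mirror_map triangle F (g, of_complex z)" for g z
  have tri: "of_complex ` complex_triangle \<subseteq> triangle" using of_complex_mem(3) inner_triangle_subset(2) by blast
  define \<omega> where "\<omega> = to_complex (1 / 2, 1 / 2)"
  have \<omega>: "\<omega> \<in> complex_triangle" by (simp add: \<omega>_def of_complex_mem inner_triangle_def)
  \<comment> \<open>The sign of the interior of copy g in the given orientation.\<close>
  have "\<exists>\<sigma>. (\<sigma> = 1 \<or> \<sigma> = (- 1 :: int)) \<and> (\<forall>U \<phi> z. (U, \<phi>) \<in> \<A> \<longrightarrow> z \<in> complex_triangle \<longrightarrow> J g z \<in> U \<longrightarrow>
      (\<exists>r. has_local_degree (\<phi> \<circ> J g) z r \<sigma>))" for g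
  proof -
    have "continuous_map (top_of_set complex_triangle) (mirror_space triangle F) (mirror_map triangle F \<circ> (Pair g \<circ> of_complex))"
    proof (rule continuous_map_compose[OF _ quotient_imp_continuous_map[OF quotient_map_mirror_map]])
      show "continuous_map (top_of_set complex_triangle) (four_copies triangle) (Pair g \<circ> of_complex)"
        by (rule continuous_map_compose[OF _ continuous_map_component_injection]) (use continuous_of_complex tri in auto)
    qed
    then have cont: "continuous_map (top_of_set complex_triangle) (mirror_space triangle F) (J g)"
      by (simp add: o_def J_def[abs_def])
    have inj: "inj_on (J g) complex_triangle"
    proof (rule inj_onI)
      fix x y assume xy: "x \<in> complex_triangle" "y \<in> complex_triangle" "J g x = J g y"
      then have "of_complex x = of_complex y" using tri by (auto simp: J_def mirror_map_eq_iff image_subset_iff)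
      then show "x = y" by (metis to_of_complex(1))
    qed
    show ?thesis
      using oriented_atlas_sign[OF A open_complex_triangle connected_complex_triangle _ cont inj] \<omega> by (metis empty_iff)
  qed
  then obtain \<sigma> where \<sigma>: "\<And>g. \<sigma> g = 1 \<or> \<sigma> g = (- 1 :: int)"
    "\<And>g U \<phi> z. \<lbrakk>(U, \<phi>) \<in> \<A>; z \<in> complex_triangle; J g z \<in> U\<rbrakk> \<Longrightarrow> \<exists>r. has_local_degree (\<phi> \<circ> J g) z r (\<sigma> g)"
    by metis
  \<comment> \<open>One connected diamond meets all four copies at a corner and has a single sign t.
    Hence the signs of the copies follow the determinants of the turns up to a constant
    factor.\<close>
  have key: "\<exists>t. \<forall>g. \<sigma> g * flip_sign a b g = t" if c: "corner triangle F a b h" for a b h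
  proof -
    interpret corner_at_triangle F a b h
      by (rule corner_at_triangle.intro, rule corner_at.intro) (rule c)
    obtain k where k: "homeomorphism triangle triangle h k" using c by (auto simp: corner_def)
    obtain e where e: "e = 1 \<or> e = - 1" "triangle_degree h e" using triangle_degree_exists[OF k] by blast
    have cont: "continuous_map (top_of_set complex_diamond) (mirror_space triangle F) (corner_param F a b h)"
      using homeomorphic_imp_continuous_map[OF homeomorphic_map_corner_param] by (simp add: continuous_map_in_subtopology)
    have "0 \<in> complex_diamond" by (simp add: complex_diamond_def)
    then have ne: "complex_diamond \<noteq> {}" by blast
    obtain t where "t = 1 \<or> t = (- 1 :: int)"
      and t: "\<And>U \<phi> z. \<lbrakk>(U, \<phi>) \<in> \<A>; z \<in> complex_diamond; corner_param F a b h z \<in> U\<rbrakk> \<Longrightarrow>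
          \<exists>r. has_local_degree (\<phi> \<circ> corner_param F a b h) z r t"
        "\<And>z. z \<in> complex_diamond \<Longrightarrow> \<exists>U \<phi>. (U, \<phi>) \<in> \<A> \<and> corner_param F a b h z \<in> U"
      by (rule oriented_atlas_sign[OF A open_complex_diamond connected_complex_diamond ne cont inj_corner_param]) (rule that)
    have prod: "\<sigma> g * (e * flip_sign a b g) = t" for g
    proof -
      define z where "z = to_complex (turn a b g (1 / 2, 1 / 2))"
      have z\<omega>: "in_complex (turn a b g) z = \<omega>" by (simp add: z_def in_complex_def \<omega>_def)
      have "(1 / 2, 1 / 2) \<in> half_open_triangle" by (simp add: half_open_triangle_def)
      then have zD: "z \<in> complex_diamond" unfolding z_def of_complex_mem by (rule turn_mem)
      obtain U \<phi> where U: "(U, \<phi>) \<in> \<A>" "corner_param F a b h z \<in> U" using t(2)[OF zD] by blast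
      let ?N = "{z. in_complex (turn a b g) z \<in> complex_triangle}"
      have zN: "z \<in> ?N" using z\<omega> \<omega> by simp
      have eq: "corner_param F a b h x = J g (in_complex h (in_complex (turn a b g) x))" if "x \<in> ?N" for x
      proof -
        define q where "q = turn a b g (of_complex x)"
        have q: "q \<in> inner_triangle" "to_complex (turn a b g q) = x"
          using that by (simp_all add: q_def in_complex_def of_complex_mem)
        then have "corner_param F a b h x = mirror_map triangle F (g, h q)"
          using corner_param_turn[of q g] inner_triangle_subset(1) by auto
        then show ?thesis by (simp add: J_def in_complex_def q_def)
      qed
      have t1: "has_local_degree (in_complex (turn a b g)) z 1 (flip_sign a b g)" by (rule has_local_degree_turn) simp
      obtain r2 where t2: "has_local_degree (in_complex h) (in_complex (turn a b g) z) r2 e"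
        using e(2) \<omega> unfolding triangle_degree_def z\<omega> by blast
      obtain s2 where u2: "has_local_degree (in_complex h \<circ> in_complex (turn a b g)) z s2 (e * flip_sign a b g)"
        using has_local_degree_compose[OF t1 t2 continuous_in_complex_turn] by blast
      have cont2: "isCont (in_complex h \<circ> in_complex (turn a b g)) z"
        by (rule continuous_at_compose[OF continuous_in_complex_turn]) (use isCont_in_complex[OF k \<omega>] z\<omega> in simp)
      have y2: "(in_complex h \<circ> in_complex (turn a b g)) z \<in> complex_triangle"
        using in_complex_homeomorphism(3)[OF k] \<omega> z\<omega> by auto
      have "J g ((in_complex h \<circ> in_complex (turn a b g)) z) \<in> U" using U(2) eq[OF zN] by simp
      from \<sigma>(2)[OF U(1) y2 this]
      obtain r3 where t3: "has_local_degree (\<phi> \<circ> J g) ((in_complex h \<circ> in_complex (turn a b g)) z) r3 (\<sigma> g)" by blast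
      obtain s3 where "has_local_degree (\<phi> \<circ> J g \<circ> (in_complex h \<circ> in_complex (turn a b g))) z s3 (\<sigma> g * (e * flip_sign a b g))"
        using has_local_degree_compose[OF u2 t3 cont2] by blast
      from has_local_degree_cong[OF this open_turned zN, of "\<phi> \<circ> corner_param F a b h"] eq
      obtain s4 where "has_local_degree (\<phi> \<circ> corner_param F a b h) z s4 (\<sigma> g * (e * flip_sign a b g))" by auto
      moreover obtain r4 where "has_local_degree (\<phi> \<circ> corner_param F a b h) z r4 t" using t(1)[OF U(1) zD U(2)] by blast
      ultimately show ?thesis by (rule has_local_degree_unique)
    qed
    have "\<sigma> g * flip_sign a b g = e * t" for g using prod[of g] e(1) by (elim disjE) simp_all
    then show ?thesis by blast
  qed
  have ab: "a \<noteq> 0" "b \<noteq> 0" "a \<noteq> b" and d: "a + b \<noteq> 0" "d \<noteq> 0" "a + b \<noteq> d"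
    using c1 c2 by (auto simp: corner_def)
  \<comment> \<open>At the first corner a + b changes both coordinates, a rotation, so the copies 0
    and a + b have equal signs; at the second corner a + b is itself a label and acts as a
    reflection, so the signs are opposite.\<close>
  have "flip_sign a b 0 = 1" "flip_sign a b (a + b) = 1"
    using ab bit_pair_basis_neq[OF ab] by (simp_all add: flip_sign_def flip_def add.commute)
  then have "\<sigma> (a + b) = \<sigma> 0" using key[OF c1] by (metis mult.right_neutral)
  moreover have "flip_sign (a + b) d 0 = 1" "flip_sign (a + b) d (a + b) = - 1"
    using d bit_pair_basis_neq[OF d] by (simp_all add: flip_sign_def flip_def add.commute)
  then have "\<sigma> (a + b) = - \<sigma> 0" using key[OF c2] by (metis mult.right_neutral mult_minus1_right minus_minus)
  ultimately show False using \<sigma>(1)[of 0] by auto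
qed

section \<open>Surfaces of cyclic words\<close>

lemma glue_homeomorphic:
  assumes hom: "homeomorphic_maps X X' h k" and r: "\<And>x y. (x, y) \<in> r \<Longrightarrow> x \<in> topspace X \<and> y \<in> topspace X"
    and r': "r' = (\<lambda>(x, y). (h x, h y)) ` r"
  shows "glue X r homeomorphic_space glue X' r'"
proof (rule glue_homeomorphic_space[of X "glue X' r'" "glue_map X' r' \<circ> h"])
  have h: "homeomorphic_map X X' h" using hom homeomorphic_maps_map by blast
  show "quotient_map X (glue X' r') (glue_map X' r' \<circ> h)"
    by (rule quotient_map_compose[OF _ quotient_map_glue]) (use h in \<open>simp add: homeomorphic_map_def\<close>)
  have kh: "k (h x) = x" if "x \<in> topspace X" for x using hom that by (simp add: homeomorphic_maps_def)
  fix x y assume xy: "x \<in> topspace X" "y \<in> topspace X"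
  then have "h x \<in> topspace X'" "h y \<in> topspace X'" using homeomorphic_imp_surjective_map[OF h] by blast+
  then have "(glue_map X' r' \<circ> h) x = (glue_map X' r' \<circ> h) y \<longleftrightarrow> (h x, h y) \<in> (r' \<union> r'\<inverse>)\<^sup>*"
    by (simp add: glue_map_eq_iff)
  also have "\<dots> \<longleftrightarrow> (x, y) \<in> (r \<union> r\<inverse>)\<^sup>*"
  proof
    assume "(x, y) \<in> (r \<union> r\<inverse>)\<^sup>*"
    then show "(h x, h y) \<in> (r' \<union> r'\<inverse>)\<^sup>*"
    proof (induction rule: rtrancl_induct)
      case (step y z)
      have "(h y, h z) \<in> r' \<union> r'\<inverse>" using step.hyps(2) unfolding r' by force
      then show ?case using step.IH by (rule rtrancl_into_rtrancl[rotated])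
    qed simp
  next
    assume "(h x, h y) \<in> (r' \<union> r'\<inverse>)\<^sup>*"
    then have "(k (h x), k (h y)) \<in> (r \<union> r\<inverse>)\<^sup>*"
    proof (induction rule: rtrancl_induct)
      case (step y z)
      have pull: "(k p, k q) \<in> r" if "(p, q) \<in> r'" for p q
      proof -
        obtain u v where "(u, v) \<in> r" "p = h u" "q = h v" using \<open>(p, q) \<in> r'\<close> unfolding r' by force
        then show ?thesis using r kh by metis
      qed
      have "(k y, k z) \<in> r \<union> r\<inverse>" using step.hyps(2) pull by blast
      then show ?case using step.IH by (rule rtrancl_into_rtrancl[rotated])
    qed simp
    then show "(x, y) \<in> (r \<union> r\<inverse>)\<^sup>*" using kh xy by simp
  qed
  finally show "(glue_map X' r' \<circ> h) x = (glue_map X' r' \<circ> h) y \<longleftrightarrow> (x, y) \<in> (r \<union> r\<inverse>)\<^sup>*" .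
qed

text \<open>The second summand may change its type: the pieces split off are mirror spaces, while
  the torus and the projective plane live on other types.\<close>

lemma connected_sum_cong:
  fixes Z :: "'b topology" and Z' :: "'d topology"
  assumes "connected_sum Y Z X" "Z homeomorphic_space Z'" "X homeomorphic_space X'"
  shows "connected_sum Y Z' X'"
proof -
  obtain f g where fg: "embedding_map (top_of_set (cball (0 :: complex) 1)) Y f"
    "embedding_map (top_of_set (cball (0 :: complex) 1)) Z g"
    "X homeomorphic_space glue (disjoint_union (subtopology Y (- f ` ball 0 1)) (subtopology Z (- g ` ball 0 1)))
                   {(Inl (f u), Inr (g u)) | u. u \<in> sphere 0 1}"
    using assms(1) unfolding connected_sum_def by blast
  obtain h k where hk: "homeomorphic_maps Z Z' h k" using assms(2) by (auto simp: homeomorphic_space_def)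
  then have h: "homeomorphic_map Z Z' h" using homeomorphic_maps_map by blast
  have kh: "\<And>z. z \<in> topspace Z \<Longrightarrow> k (h z) = z" "\<And>z. z \<in> topspace Z' \<Longrightarrow> h (k z) = z"
    and hZ: "h ` topspace Z = topspace Z'"
    using hk homeomorphic_imp_surjective_map[OF h] by (auto simp: homeomorphic_maps_def)
  have inj: "inj_on h (topspace Z)" using homeomorphic_imp_injective_map[OF h] .
  define g' where "g' = h \<circ> g"
  have embed: "f ` cball 0 1 \<subseteq> topspace Y" "g ` cball 0 1 \<subseteq> topspace Z" "inj_on f (cball 0 1)" "inj_on g (cball 0 1)"
    using fg(1,2) unfolding embedding_map_def homeomorphic_eq_everything_map by auto
  have g'emb: "embedding_map (top_of_set (cball 0 1)) Z' g'"
    unfolding g'_def by (rule embedding_map_compose[OF fg(2)]) (use h surjective_embedding_map in blast)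
  define A where "A = subtopology Z (- g ` ball 0 1)"
  define A' where "A' = subtopology Z' (- g' ` ball 0 1)"
  have mem: "h z \<in> - g' ` ball 0 1 \<longleftrightarrow> z \<in> - g ` ball 0 1" if "z \<in> topspace Z" for z
  proof -
    have "g ` ball 0 1 \<subseteq> g ` cball 0 1" by (rule image_mono) simp
    then have "h z \<in> h ` (g ` ball 0 1) \<longleftrightarrow> z \<in> g ` ball 0 1"
      using inj_on_image_mem_iff[OF inj that] embed(2) by (meson order_trans)
    then show ?thesis by (simp add: g'_def image_comp)
  qed
  have hkA: "homeomorphic_maps A A' h k"
    unfolding A_def A'_def
  proof (rule homeomorphic_maps_subtopologies[OF hk])
    show "h ` (topspace Z \<inter> - g ` ball 0 1) = topspace Z' \<inter> - g' ` ball 0 1"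
    proof (intro subset_antisym subsetI)
      fix y assume "y \<in> topspace Z' \<inter> - g' ` ball 0 1"
      then have y: "y \<in> h ` topspace Z" "y \<in> - g' ` ball 0 1" using hZ by simp_all
      then obtain z where "z \<in> topspace Z" "y = h z" by (elim imageE)
      then have "z \<in> topspace Z \<inter> - g ` ball 0 1" using mem[of z] y(2) by simp
      then show "y \<in> h ` (topspace Z \<inter> - g ` ball 0 1)" using \<open>y = h z\<close> by (rule_tac image_eqI)
    next
      fix y assume "y \<in> h ` (topspace Z \<inter> - g ` ball 0 1)"
      then obtain z where "z \<in> topspace Z" "z \<in> - g ` ball 0 1" "y = h z" by blast
      then show "y \<in> topspace Z' \<inter> - g' ` ball 0 1" using mem[of z] hZ by simp blast
    qed
  qed
  let ?Y = "subtopology Y (- f ` ball 0 1)"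
  define H where "H = case_sum (Inl :: 'a \<Rightarrow> 'a + 'd) (Inr \<circ> h)"
  define H' where "H' = case_sum (Inl :: 'a \<Rightarrow> 'a + 'b) (Inr \<circ> k)"
  have "homeomorphic_maps (disjoint_union ?Y A) (disjoint_union ?Y A') H H'"
    unfolding homeomorphic_maps_def
  proof (intro conjI ballI)
    have "continuous_map A A' h" "continuous_map A' A k" using hkA by (simp_all add: homeomorphic_maps_def)
    then show "continuous_map (disjoint_union ?Y A) (disjoint_union ?Y A') H" "continuous_map (disjoint_union ?Y A') (disjoint_union ?Y A) H'"
      unfolding H_def H'_def
      by (auto intro!: continuous_map_disjoint_union continuous_map_Inl continuous_map_compose[OF _ continuous_map_Inr, unfolded o_def])
    show "H' (H x) = x" if "x \<in> topspace (disjoint_union ?Y A)" for x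
      using that kh by (auto simp: H_def H'_def A_def)
    show "H (H' x) = x" if "x \<in> topspace (disjoint_union ?Y A')" for x
      using that kh by (auto simp: H_def H'_def A'_def)
  qed
  then have "glue (disjoint_union ?Y A) {(Inl (f u), Inr (g u)) | u. u \<in> sphere 0 1} homeomorphic_space
    glue (disjoint_union ?Y A') {(Inl (f u), Inr (g' u)) | u. u \<in> sphere 0 1}"
  proof (rule glue_homeomorphic)
    \<comment> \<open>The boundary circle survives the removal of the open disc because the
      embedding is injective on the closed disc.\<close>
    have sph: "\<psi> u \<notin> \<psi> ` ball 0 1" if "inj_on \<psi> (cball 0 1)" "u \<in> sphere 0 1" for \<psi> :: "complex \<Rightarrow> 'z" and u
    proof
      assume "\<psi> u \<in> \<psi> ` ball 0 1"
      then obtain x where "x \<in> ball 0 1" "\<psi> u = \<psi> x" by blast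
      moreover from this have "u = x" using that by (intro inj_onD[OF that(1)]) auto
      ultimately show False using that(2) by simp
    qed
    fix x y :: "'a + 'b" assume "(x, y) \<in> {(Inl (f u), Inr (g u)) | u. u \<in> sphere 0 1}"
    then obtain u where u: "u \<in> sphere 0 1" "x = Inl (f u)" "y = Inr (g u)" by blast
    then have "u \<in> cball 0 1" by simp
    then show "x \<in> topspace (disjoint_union ?Y A) \<and> y \<in> topspace (disjoint_union ?Y A)"
      using u embed sph[OF embed(3) u(1)] sph[OF embed(4) u(1)] by (auto simp: A_def)
  qed (simp add: setcompr_eq_image image_image H_def g'_def)
  then have "X' homeomorphic_space glue (disjoint_union ?Y A') {(Inl (f u), Inr (g' u)) | u. u \<in> sphere 0 1}"
    by (rule homeomorphic_space_trans[OF homeomorphic_space_trans[OF iffD1[OF homeomorphic_space_sym assms(3)] fg(3)[folded A_def]]])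
  then show ?thesis
    unfolding connected_sum_def A'_def using fg(1) g'emb by blast
qed

text \<open>Each rule determines the resulting surface only up to homeomorphism, so a case
  distinction suffices.\<close>

lemma connected_sum_of_copies_homeomorphic:
  fixes X X' :: "'a topology"
  assumes "connected_sum_of_copies M n X" "X homeomorphic_space X'"
  shows "connected_sum_of_copies M n X'"
  using assms(1)
proof cases
  case empty
  then show ?thesis
    using assms(2) homeomorphic_space_sym homeomorphic_space_trans connected_sum_of_copies.empty by metis
next
  case single
  then show ?thesis
    using assms(2) homeomorphic_space_sym homeomorphic_space_trans connected_sum_of_copies.single by metis
next
  case (step n Y)
  then show ?thesis
    using connected_sum_cong[OF _ homeomorphic_space_refl assms(2)] connected_sum_of_copies.step by metis
qed

text \<open>The first summand keeps its form as a mirror space of the triangle; it has the type of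
  the whole surface, as the inductive definition of iterated sums demands, and it spells the shorter
  word to which an induction hypothesis applies.\<close>

lemma spells_connected_sum:
  assumes "spells D F (b # u @ [a] @ rev v)" "spells D' F' (b # u @ [a])" "spells D'' F'' (b # v @ [a])"
    and "mirror_space D'' F'' homeomorphic_space M" "u \<noteq> []" "v \<noteq> []" "a \<noteq> 0" "b \<noteq> 0" "a \<noteq> b"
  shows "connected_sum (mirror_space triangle (triangle_labels b a u)) M (mirror_space D F)"
proof (rule connected_sum_cong[OF mirror_space_connected_sum[OF assms(7-9,5,6)]])
  show "mirror_space triangle (triangle_labels b a v) homeomorphic_space M"
    using spells_unique[OF triangle_spells[OF assms(6)] assms(3)] assms(4) homeomorphic_space_trans by blast
  show "mirror_space trapezoid (trapezoid_labels b a u v) homeomorphic_space mirror_space D F"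
    by (rule spells_unique[OF trapezoid_spells[OF assms(5,6)] assms(1)])
qed

lemma spells_two_letters_torus:
  fixes a b :: "bit \<times> bit"
  assumes ab: "a \<noteq> 0" "b \<noteq> 0" "a \<noteq> b" and "1 \<le> m" "spells D F (concat (replicate m [b, a]))"
  shows "connected_sum_of_copies torus (m - 1) (mirror_space D F)"
  using assms(4,5)
proof (induction m arbitrary: D F rule: dec_induct)
  case base
  then have "spells D F [b, a]" by simp
  from spells_unique[OF this half_diamond_spells] mirror_space_sphere[OF ab]
  have "mirror_space D F homeomorphic_space top_of_set (sphere (0 :: real ^ 3) 1)" using homeomorphic_space_trans by blast
  then show ?case by (simp add: connected_sum_of_copies.empty)
next
  case (step m)
  show ?case
  \<comment> \<open>Two pairs of letters give the torus itself, not a sum with a sphere, since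
    iterated sums start from a single copy. Splitting therefore begins with three pairs.\<close>
  proof (cases "m = 1")
    case True
    then have "spells D F [b, a, b, a]" using step.prems by (simp add: numeral_2_eq_2)
    from spells_unique[OF this square_spells] mirror_space_torus[OF ab]
    have "mirror_space D F homeomorphic_space torus" using homeomorphic_space_trans by blast
    then show ?thesis using connected_sum_of_copies.single True by fastforce
  next
    case False
    then obtain j where j: "m = Suc (Suc j)" using step.hyps(1) by (metis One_nat_def Suc_le_D le_antisym not_less_eq_eq)
    \<comment> \<open>Chosen so that b, u, a is the word with m pairs; the additional pair is
      \<open>rev [a, b]\<close>.\<close>
    define u where "u = a # concat (replicate j [b, a]) @ [b]"
    have rep: "concat (replicate j [b, a]) @ [b, a] = [b, a] @ concat (replicate j [b, a])"
      by (induction j) auto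
    then have w: "concat (replicate m [b, a]) = b # u @ [a]" by (simp add: j u_def)
    have "concat (replicate (Suc m) [b, a]) = concat (replicate m [b, a]) @ [b, a]"
    proof -
      have "concat (replicate n [b, a]) @ [b, a] = [b, a] @ concat (replicate n [b, a])" for n by (induction n) auto
      then show ?thesis by simp
    qed
    then have w': "concat (replicate (Suc m) [b, a]) = b # u @ [a] @ rev [a, b]" unfolding w by simp
    have "u \<noteq> []" by (simp add: u_def)
    have sY: "spells triangle (triangle_labels b a u) (concat (replicate m [b, a]))"
      unfolding w by (rule triangle_spells) fact
    have "connected_sum (mirror_space triangle (triangle_labels b a u)) torus (mirror_space D F)"
    proof (rule spells_connected_sum)
      show "spells D F (b # u @ [a] @ rev [a, b])" using step.prems unfolding w' .
      show "spells triangle (triangle_labels b a u) (b # u @ [a])" using sY unfolding w .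
      show "spells unit_square (square_labels b a) (b # [a, b] @ [a])" using square_spells by simp
      show "mirror_space unit_square (square_labels b a) homeomorphic_space torus" by (rule mirror_space_torus[OF ab])
    qed (use ab \<open>u \<noteq> []\<close> in simp_all)
    moreover have "connected_sum_of_copies torus (m - 1) (mirror_space triangle (triangle_labels b a u))"
      by (rule step.IH[OF sY])
    ultimately have "connected_sum_of_copies torus (Suc (m - 1)) (mirror_space D F)"
      using connected_sum_of_copies.step j by (metis One_nat_def diff_Suc_1 le_add1 plus_1_eq_Suc)
    then show ?thesis using j by simp
  qed
qed

text \<open>The condition on the ends also excludes words with a single letter.\<close>

definition cyclically_alternating :: "'l list \<Rightarrow> bool" where
  "cyclically_alternating w \<longleftrightarrow> w \<noteq> [] \<and> distinct_adj w \<and> last w \<noteq> hd w"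

lemma cyclically_alternating_rotate1:
  assumes "cyclically_alternating (x # w)"
  shows "cyclically_alternating (w @ [x])"
  using assms unfolding cyclically_alternating_def distinct_adj_append_iff distinct_adj_Cons
  by (auto simp: hd_append)

lemma cyclically_alternating_append:
  "cyclically_alternating (u @ v) \<Longrightarrow> cyclically_alternating (v @ u)"
proof (induction u arbitrary: v)
  case (Cons x u)
  then have "cyclically_alternating ((u @ v) @ [x])" using cyclically_alternating_rotate1[of x "u @ v"] by simp
  then have "cyclically_alternating (u @ (v @ [x]))" by simp
  from Cons.IH[OF this] show ?case by simp
qed simp

lemma two_letter_word:
  assumes "cyclically_alternating (x # w)" "set (x # w) \<subseteq> {x, y}"
  shows "\<exists>m\<ge>1. x # w = concat (replicate m [x, y])"
  using assms
proof (induction "length w" arbitrary: w rule: less_induct)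
  case less
  then obtain z v where w: "w = z # v" by (cases w) (auto simp: cyclically_alternating_def)
  then have z: "z = y" "x \<noteq> y" using less.prems by (auto simp: cyclically_alternating_def)
  show ?case
  proof (cases v)
    case Nil
    then show ?thesis using w z by (intro exI[of _ 1]) simp
  next
    case (Cons c v')
    then have c: "c = x" using less.prems w z by (auto simp: cyclically_alternating_def)
    have "cyclically_alternating (x # v')"
      using less.prems(1) w Cons c by (auto simp: cyclically_alternating_def split: if_splits)
    then obtain m where "1 \<le> m" "x # v' = concat (replicate m [x, y])"
      using less.hyps[of v'] less.prems(2) w Cons c by auto
    then show ?thesis using w Cons c z by (intro exI[of _ "Suc m"]) simp
  qed
qed

text \<open>
  A letter whose neighbours differ and which occurs twice can be deleted. If every letter with different
  neighbours occurs only once, then the remaining letters alternate and a neighbour of that letter will do.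
\<close>

lemma deletable_letter:
  assumes w: "cyclically_alternating w" "card (set w) = 3" "4 \<le> length w"
  shows "\<exists>u v c. w = u @ [c] @ v \<and> cyclically_alternating (v @ u) \<and> c \<in> set (v @ u)"
proof (rule ccontr)
  assume no: "\<not> (\<exists>u v c. w = u @ [c] @ v \<and> cyclically_alternating (v @ u) \<and> c \<in> set (v @ u))"
  define n where "n = length w"
  have n: "4 \<le> n" "n \<noteq> 0" using w(3) by (auto simp: n_def)
  have rot: "cyclically_alternating (rotate i w)" for i
    unfolding rotate_drop_take by (rule cyclically_alternating_append) (simp add: w(1))
  \<comment> \<open>The assumption in rotated form: every occurrence of a letter has equal
    neighbours or is the only occurrence of that letter.\<close>
  have no': "last t = hd t \<or> c \<notin> set t" if ct: "rotate i w = c # t" for i c t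
  proof (rule ccontr)
    assume "\<not> (last t = hd t \<or> c \<notin> set t)"
    moreover have "cyclically_alternating (c # t)" using rot ct by metis
    ultimately have t: "cyclically_alternating t" "c \<in> set t"
      by (auto simp: cyclically_alternating_def distinct_adj_Cons)
    define u where "u = take (i mod n) w"
    define v where "v = drop (i mod n) w"
    have uv: "w = u @ v" "v @ u = c # t" using ct by (simp_all add: u_def v_def rotate_drop_take n_def)
    have "i mod n < n" using n by simp
    then have "v \<noteq> []" by (simp add: v_def n_def)
    then obtain v' where "v = c # v'" "t = v' @ u" using uv(2) by (cases v) auto
    then show False using no uv(1) t by auto
  qed
  \<comment> \<open>The right and left neighbours as indexed letters; adding n - 1 stands for
    subtracting 1 modulo n.\<close>
  have hl: "hd t = w ! (Suc i mod n)" "last t = w ! ((i + (n - 1)) mod n)" if "rotate i w = c # t" for i c t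
  proof -
    have len: "length t = n - 1" using that by (metis length_rotate length_Cons diff_Suc_1 n_def)
    then have "t \<noteq> []" using n by auto
    have "hd t = rotate i w ! 1" using \<open>t \<noteq> []\<close> by (simp add: that hd_conv_nth)
    moreover have "last t = rotate i w ! (n - 1)" using \<open>t \<noteq> []\<close> len n by (simp add: that last_conv_nth nth_Cons')
    moreover have "1 < length w" "n - 1 < length w" using n by (simp_all add: n_def)
    ultimately show "hd t = w ! (Suc i mod n)" "last t = w ! ((i + (n - 1)) mod n)"
      by (simp_all add: nth_rotate n_def add.commute)
  qed
  \<comment> \<open>If all letters had equal neighbours, letters at distance two would agree and at
    most two letters would occur.\<close>
  have "\<exists>i c t. rotate i w = c # t \<and> last t \<noteq> hd t"
  proof (rule ccontr)
    assume "\<nexists>i c t. rotate i w = c # t \<and> last t \<noteq> hd t"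
    then have same: "w ! (Suc i mod n) = w ! ((i + (n - 1)) mod n)" for i
      using hl by (metis list.exhaust rotate_is_Nil_conv list.size(3) n_def n(2))
    have "w ! i \<in> {w ! 0, w ! 1}" if "i < n" for i
      using that
    proof (induction i rule: less_induct)
      case (less i)
      show ?case
      proof (cases "i < 2")
        case True
        then have "i = 0 \<or> i = 1" by arith
        then show ?thesis by auto
      next
        case False
        then obtain j where j: "i = Suc (Suc j)" by (metis less_2_cases_iff not0_implies_Suc One_nat_def)
        have "w ! (Suc (Suc j) mod n) = w ! ((Suc j + (n - 1)) mod n)" by (rule same)
        also have "(Suc j + (n - 1)) mod n = j" using less.prems j n by simp
        finally have "w ! i = w ! j" using less.prems j by simp
        then show ?thesis using less.IH[of j] less.prems j by simp
      qed
    qed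
    then have "set w \<subseteq> {w ! 0, w ! 1}" by (metis in_set_conv_nth n_def subsetI)
    then have "card (set w) \<le> card {w ! 0, w ! 1}" by (intro card_mono) auto
    also have "\<dots> \<le> 2" by (simp add: card_insert_if)
    finally show False using w(2) by simp
  qed
  then obtain i c t where t: "rotate i w = c # t" "last t \<noteq> hd t" by blast
  then have c: "c \<notin> set t" using no' by blast
  have setw: "set w = insert c (set t)" using arg_cong[OF t(1), of set] by simp
  have "card (set t) = 2" using w(2) c unfolding setw by simp
  have len: "length t = n - 1" using t(1) by (metis length_rotate length_Cons diff_Suc_1 n_def)
  have "distinct_adj t" using rot[of i] unfolding t(1) by (auto simp: cyclically_alternating_def distinct_adj_Cons)
  \<comment> \<open>After the single c only two letters remain, so they alternate a, b, a. The a
    following c thus occurs again, and its neighbours c and b differ, contrary to the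
    assumption.\<close>
  obtain a b s where s: "t = a # b # s" "s \<noteq> []"
    using len n by (cases t; cases "tl t"; cases "tl (tl t)") auto
  have "a \<noteq> b" using \<open>distinct_adj t\<close> s by simp
  then have "{a, b} = set t" using \<open>card (set t) = 2\<close> s by (intro card_subset_eq) auto
  moreover have "hd s \<noteq> b" using \<open>distinct_adj t\<close> s by (auto simp: distinct_adj_Cons)
  moreover have "hd s \<in> set t" using s by simp
  ultimately have "a \<in> set s" using s(2) by (metis hd_in_set insertE singletonD)
  moreover have "rotate (Suc i) w = a # (b # s @ [c])" using t(1) s(1) by simp
  ultimately have "last (b # s @ [c]) = hd (b # s @ [c])" using no'[of "Suc i" a "b # s @ [c]"] by auto
  then show False using c s(1) by simp
qed

text \<open>The letter to be split off must occur elsewhere, for otherwise the shorter word would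
  have only two letters and describe an orientable surface, outside the range of the
  induction.\<close>

lemma spells_three_letters_projective_plane:
  fixes w :: "(bit \<times> bit) list"
  assumes "cyclically_alternating w" "card (set w) = 3" "0 \<notin> set w" "spells D F w"
  shows "connected_sum_of_copies projective_plane (length w - 2) (mirror_space D F)"
  using assms
proof (induction "length w" arbitrary: w D F rule: less_induct)
  case less
  have third: "set w = {a, b, a + b}" if "{a, b} \<subseteq> set w" "a \<noteq> b" for a b
  proof -
    have ab: "a \<noteq> 0" "b \<noteq> 0" using that less.prems(3) by auto
    have "set w \<subseteq> {a, b, a + b}"
    proof
      fix g assume "g \<in> set w"
      then have "g \<noteq> 0" using less.prems(3) by metis
      then show "g \<in> {a, b, a + b}" by (rule_tac bit_pair_basis_cases[OF ab that(2), of g]) simp_all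
    qed
    then show ?thesis
      using less.prems(2) that ab \<open>set w \<subseteq> {a, b, a + b}\<close> by (intro card_subset_eq) (auto simp: card_insert_if)
  qed
  have len: "3 \<le> length w" using less.prems(2) card_length[of w] by simp
  show ?case
  proof (cases "length w = 3")
    case True
    then obtain b c a where w: "w = [b, c, a]"
      by (cases w; cases "tl w"; cases "tl (tl w)") auto
    then have neq: "a \<noteq> 0" "b \<noteq> 0" "a \<noteq> b" "c \<noteq> a" "c \<noteq> b"
      using less.prems by (auto simp: cyclically_alternating_def)
    have "c = a + b" using third[of a b] neq w by auto
    then have "spells D F (b # [a + b] @ [a])" using less.prems(4) w by simp
    then have "mirror_space D F homeomorphic_space mirror_space triangle (triangle_labels b a [a + b])"
      by (rule spells_unique[OF _ triangle_spells]) simp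
    then have "mirror_space D F homeomorphic_space projective_plane"
      using mirror_space_projective_plane[OF neq(1-3)] homeomorphic_space_trans by blast
    then show ?thesis using connected_sum_of_copies.single True by fastforce
  next
    case False
    then obtain u v c where w: "w = u @ [c] @ v" "cyclically_alternating (v @ u)" "c \<in> set (v @ u)"
      using deletable_letter less.prems(1,2) len by (metis One_nat_def Suc_leI le_neq_implies_less numeral_3_eq_3 numeral_eq_Suc pred_numeral_simps(2) eval_nat_numeral(2) semiring_norm(26,27))
    define t where "t = v @ u"
    have t: "length t = length w - 1" "set t = set w" using w by (auto simp: t_def)
    have "2 \<le> length t" using len t by simp
    then obtain b s where "t = b # s" "s \<noteq> []" by (cases t; cases "tl t") auto
    then obtain q a where q: "t = b # q @ [a]" by (metis append_butlast_last_id)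
    have "q \<noteq> []" using q len t(1) False by auto
    have "spells D F ((u @ [c]) @ v)" using less.prems(4) w(1) by simp
    then have "spells D F (v @ u @ [c])" using spells_rotate by fastforce
    \<comment> \<open>The word is rotated so that c comes last; as a single letter it equals its
      reversal, which is the form needed for the splitting.\<close>
    moreover have "v @ u @ [c] = b # q @ [a] @ rev [c]" using arg_cong[OF q, of "\<lambda>t. t @ [c]"] by (simp add: t_def)
    ultimately have spDF: "spells D F (b # q @ [a] @ rev [c])" by simp
    have "cyclically_alternating (c # t)"
      using cyclically_alternating_append[of "u" "[c] @ v"] less.prems(1) w(1) by (simp add: t_def)
    then have "c \<noteq> a" "c \<noteq> b" using q by (auto simp: cyclically_alternating_def)
    have "a \<noteq> b" using w(2) q by (auto simp: cyclically_alternating_def t_def)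
    have "{a, b} \<subseteq> set w" using t(2) q by auto
    then have ab: "a \<noteq> 0" "b \<noteq> 0" using less.prems(3) by auto
    have "c \<in> set w" using w by simp
    then have c: "c = a + b" using third[OF \<open>{a, b} \<subseteq> set w\<close> \<open>a \<noteq> b\<close>] \<open>c \<noteq> a\<close> \<open>c \<noteq> b\<close> by auto
    have sp: "spells triangle (triangle_labels b a q) t" unfolding q by (rule triangle_spells) fact
    have "connected_sum (mirror_space triangle (triangle_labels b a q)) projective_plane (mirror_space D F)"
    proof (rule spells_connected_sum[OF spDF])
      show "spells triangle (triangle_labels b a q) (b # q @ [a])" using sp unfolding q .
      show "spells triangle (triangle_labels b a [c]) (b # [c] @ [a])" by (rule triangle_spells) simp
      show "mirror_space triangle (triangle_labels b a [c]) homeomorphic_space projective_plane"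
        unfolding c by (rule mirror_space_projective_plane) (use ab \<open>a \<noteq> b\<close> in simp_all)
    qed (use ab \<open>a \<noteq> b\<close> \<open>q \<noteq> []\<close> in simp_all)
    moreover have "connected_sum_of_copies projective_plane (length t - 2) (mirror_space triangle (triangle_labels b a q))"
      by (rule less.hyps) (use t len less.prems w(2) sp in \<open>auto simp: t_def[symmetric]\<close>)
    moreover have "1 \<le> length t - 2" "Suc (length t - 2) = length w - 2" using t(1) len False by auto
    ultimately show ?thesis using connected_sum_of_copies.step by metis
  qed
qed

section \<open>Corner charts along a boundary word\<close>

lemma spells_along_rotate_to:
  assumes "spells_along D F w \<gamma>" "i < length w" "p \<in> \<gamma> ` {real i..<real i + 1}"
  obtains \<delta> where "spells_along D F (rotate i w) \<delta>" "p \<in> \<delta> ` {0..<1}"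
proof -
  have "\<exists>\<delta>. spells_along D F (rotate i w) \<delta> \<and> p \<in> \<delta> ` {0..<1}"
    using assms
  proof (induction i arbitrary: w \<gamma>)
    case 0
    then show ?case by auto
  next
    case (Suc i)
    then obtain x v where w: "w = x # v" by (cases w) auto
    define \<delta> where "\<delta> t = (if t \<le> real (length v) then \<gamma> (t + 1) else \<gamma> (t - real (length v)))" for t
    have \<delta>: "spells_along D F (v @ [x]) \<delta>"
      using spells_along_rotate[of D F x v \<gamma>] Suc.prems(1) unfolding w \<delta>_def by simp
    obtain t where t: "t \<in> {real (Suc i)..<real (Suc i) + 1}" "p = \<gamma> t" using Suc.prems(3) by blast
    have "i < length v" using Suc.prems(2) w by simp
    then have "t - 1 \<le> real (length v)" "t - 1 \<in> {real i..<real i + 1}" using t by auto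
    moreover have "\<delta> (t - 1) = p" using calculation t by (simp add: \<delta>_def)
    ultimately have "p \<in> \<delta> ` {real i..<real i + 1}" by blast
    then obtain \<epsilon> where "spells_along D F (rotate i (v @ [x])) \<epsilon>" "p \<in> \<epsilon> ` {0..<1}"
      using Suc.IH[OF \<delta>] \<open>i < length v\<close> by auto
    moreover have "rotate (Suc i) w = rotate i (v @ [x])" by (simp add: w rotate1_rotate_swap)
    ultimately show ?case by auto
  qed
  then show thesis using that by blast
qed

text \<open>The corner is where the last letter meets the first. In the triangle model all other
  letters are on the hypotenuse, so the chart reaches along the first letter up to, but not
  including, its end.\<close>

lemma spells_along_corner:
  assumes sp: "spells_along D F (b # u @ [a]) \<gamma>" and u: "u \<noteq> []" and ab: "a \<noteq> 0" "b \<noteq> 0" "a \<noteq> b"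
  obtains h where "corner D F a b h" "\<gamma> ` {0..<1} \<subseteq> h ` half_open_triangle"
proof -
  obtain \<delta> where \<delta>: "spells_along triangle (triangle_labels b a u) (b # u @ [a]) \<delta>"
    "\<And>t. t \<in> {0..<1} \<Longrightarrow> snd (\<delta> t) = 0 \<and> 0 \<le> fst (\<delta> t) \<and> fst (\<delta> t) < 2"
    using triangle_spells_along[OF u] by metis
  obtain h k where hk: "homeomorphism triangle D h k" "\<And>s. F s = h ` triangle_labels b a u s"
    "\<And>t. t \<in> {0..real (length (b # u @ [a]))} \<Longrightarrow> h (\<delta> t) = \<gamma> t"
    using spells_along_homeomorphism[OF \<delta>(1) sp] by metis
  have inj: "inj_on h triangle" by (rule inj_on_inverseI[of _ k]) (use hk(1) in \<open>simp add: homeomorphism_def\<close>)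
  have "corner D F a b h"
    unfolding corner_def
  proof (intro conjI ballI allI ab exI[of _ k] hk(1))
    show "mirrored D F" by (rule spells_mirrored[OF spellsI[OF sp]])
    fix z s assume z: "z \<in> half_open_triangle"
    then have "z \<in> triangle" using z by (simp add: half_open_triangle_def triangle_def)
    have "h z \<in> F s \<longleftrightarrow> z \<in> triangle_labels b a u s"
      unfolding hk(2) by (rule inj_on_image_mem_iff[OF inj \<open>z \<in> triangle\<close>]) (simp add: triangle_labels_def)
    also have "\<dots> \<longleftrightarrow> s = b \<and> snd z = 0 \<or> s = a \<and> fst z = 0"
      using z \<open>z \<in> triangle\<close> unfolding triangle_labels_def half_open_triangle_def mem_Collect_eq by linarith
    finally show "h z \<in> F s \<longleftrightarrow> s = b \<and> snd z = 0 \<or> s = a \<and> fst z = 0" .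
  qed
  moreover have "\<gamma> ` {0..<1} \<subseteq> h ` half_open_triangle"
  proof
    fix p assume "p \<in> \<gamma> ` {0..<1}"
    then obtain t where t: "t \<in> {0..<1}" "p = \<gamma> t" by blast
    then have "p = h (\<delta> t)" using hk(3)[of t] by simp
    moreover have "\<delta> t \<in> half_open_triangle" using \<delta>(2)[OF t(1)] by (simp add: half_open_triangle_def)
    ultimately show "p \<in> h ` half_open_triangle" by blast
  qed
  ultimately show thesis by (rule that)
qed

text \<open>The triangle model needs a letter on the hypotenuse; for a word of length two the first
  letter is doubled and merged afterwards.\<close>

lemma spells_triangle:
  assumes "2 \<le> length w"
  shows "\<exists>F. spells triangle F w"
proof -
  obtain b v where bv: "w = b # v" "v \<noteq> []" using assms by (cases w; cases "tl w") auto
  then obtain u a where w: "w = b # u @ [a]" by (metis append_butlast_last_id)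
  show ?thesis
  proof (cases "u = []")
    case True
    have "spells triangle (triangle_labels b a [b]) (b # b # [a])" using triangle_spells[of "[b]" b a] by simp
    then have "spells triangle (triangle_labels b a [b]) w" unfolding w True append_Nil by (rule spells_merge)
    then show ?thesis by (rule exI[of "\<lambda>F. spells triangle F w"])
  next
    case False
    then show ?thesis unfolding w by (intro exI[of "\<lambda>F. spells triangle F (b # u @ [a])" "triangle_labels b a u"] triangle_spells)
  qed
qed

lemma cyclically_alternating_split:
  assumes "cyclically_alternating w" "c \<in> set w"
  obtains i u a where "rotate i w = c # u @ [a]" "a \<noteq> c" "i < length w" "w ! i = c"
proof -
  obtain i where i: "i < length w" "w ! i = c" using assms(2) by (meson in_set_conv_nth)
  have r: "cyclically_alternating (rotate i w)"
    unfolding rotate_drop_take by (rule cyclically_alternating_append) (simp add: assms(1))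
  have "rotate i w = c # (drop (Suc i) w @ take i w)"
    using i by (simp add: rotate_drop_take Cons_nth_drop_Suc[symmetric])
  moreover have "drop (Suc i) w @ take i w \<noteq> []" "last (drop (Suc i) w @ take i w) \<noteq> c"
    using r unfolding calculation cyclically_alternating_def by (auto split: if_splits)
  ultimately show thesis using that i by (metis append_butlast_last_id)
qed

text \<open>A boundary point lies on some letter, its end excluded, and is reached by the chart at
  the beginning of that letter. The labels at every corner are the only two available, so all corner
  charts have the same pair.\<close>

theorem spells_two_letters_orientable:
  assumes sp: "spells D F w" and w: "cyclically_alternating w" "set w = {a, b}" and ab: "a \<noteq> 0" "b \<noteq> 0" "a \<noteq> b"
  shows "orientable (mirror_space D F)"
proof -
  have "card (set w) = 2" using w ab by simp
  then have "2 \<le> length w" using card_length[of w] by simp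
  then obtain T where T: "spells triangle T w" using spells_triangle by blast
  then obtain \<gamma> where \<gamma>: "spells_along triangle T w \<gamma>" by (rule spellsE)
  have "orientable (mirror_space triangle T)"
  proof (rule mirror_space_orientable[where a = a and b = b])
    show "mirrored triangle T" by (rule spells_mirrored[OF T])
    have fr: "\<gamma> ` {0..real (length w)} = frontier triangle" "T = word_trace \<gamma> w"
      using \<gamma> by (simp_all add: spells_along_def)
    have "closed triangle" using \<open>mirrored triangle T\<close> by (simp add: mirrored_def compact_imp_closed)
    then have tri: "triangle = frontier triangle \<union> inner_triangle" "frontier triangle \<inter> inner_triangle = {}"
      using interior_triangle interior_subset[of triangle] by (auto simp: frontier_def)
    show "z \<notin> T s" if "z \<in> inner_triangle" for z s
      using tri(2) that word_trace_subset[of \<gamma> w s] fr by blast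
    have front: "\<exists>h a' b'. corner triangle T a' b' h \<and> {a', b'} = {a, b} \<and> p \<in> h ` half_open_triangle"
      if p: "p \<in> frontier triangle" for p
    proof -
      obtain t where t: "t \<in> {0..<real (length w)}" "p = \<gamma> t"
      proof -
        obtain t where t: "t \<in> {0..real (length w)}" "p = \<gamma> t" using p fr(1) by blast
        show thesis
        proof (cases "t = real (length w)")
          case True
          then have "p = \<gamma> 0" using t \<gamma> by (simp add: spells_along_def)
          then show thesis using that[of 0] \<open>2 \<le> length w\<close> by fastforce
        next
          case False
          then show thesis using that[of t] t by simp
        qed
      qed
      define i where "i = nat \<lfloor>t\<rfloor>"
      have i: "i < length w" "t \<in> {real i..<real i + 1}" using t(1) unfolding i_def by (auto, linarith+)
      obtain \<delta> where \<delta>: "spells_along triangle T (rotate i w) \<delta>" "p \<in> \<delta> ` {0..<1}"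
        using spells_along_rotate_to[OF \<gamma> i(1), of p] i(2) t(2) by blast
      have r: "cyclically_alternating (rotate i w)"
        unfolding rotate_drop_take by (rule cyclically_alternating_append) (simp add: w(1))
      obtain x v where xv: "rotate i w = x # v" using r by (cases "rotate i w") (auto simp: cyclically_alternating_def)
      then have "v \<noteq> []" "last v \<noteq> x" using r by (auto simp: cyclically_alternating_def split: if_splits)
      then obtain q y where q: "rotate i w = x # q @ [y]" "y \<noteq> x" using xv by (metis append_butlast_last_id)
      obtain \<tau> where \<tau>: "\<tau> \<in> {0..<1}" "p = \<delta> \<tau>" using \<delta>(2) by blast
      \<comment> \<open>A cut strictly between the point and the end of its letter: the point stays
        in the first half, and the second half is the additional letter needed at the
        corner.\<close>
      define m where "m = (\<tau> + 1) / 2"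
      have m: "0 < m" "m < 1" "\<tau> < m" using \<tau>(1) by (auto simp: m_def)
      obtain \<epsilon> where \<epsilon>: "spells_along triangle T (x # x # (q @ [y])) \<epsilon>" "\<epsilon> ` {0..<1} = \<delta> ` {0..<m}"
        using spells_along_subdivide[OF _ m(1,2), of triangle T x "q @ [y]" \<delta>] \<delta>(1) unfolding q(1) by metis
      have "p \<in> \<epsilon> ` {0..<1}" unfolding \<epsilon>(2) \<tau>(2) using \<tau>(1) m by (intro imageI) simp
      have xy: "{y, x} \<subseteq> set w" using arg_cong[OF q(1), of set] by simp
      then have "x = a \<or> x = b" "y = a \<or> y = b" unfolding w(2) by simp_all
      then have ne: "x \<noteq> 0" "y \<noteq> 0" using ab(1,2) by metis+
      obtain h where "corner triangle T y x h" "\<epsilon> ` {0..<1} \<subseteq> h ` half_open_triangle"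
        using spells_along_corner[of triangle T x "x # q" y \<epsilon>, OF _ _ ne(2,1) q(2)] \<epsilon>(1) by auto
      moreover have "{y, x} = {a, b}"
        unfolding doubleton_eq_iff using \<open>x = a \<or> x = b\<close> \<open>y = a \<or> y = b\<close> q(2) by meson
      ultimately show ?thesis
        using \<open>p \<in> \<epsilon> ` {0..<1}\<close> by (intro exI[of _ h] exI[of _ y] exI[of _ x] conjI) (simp_all add: subsetD)
    qed
    show "\<exists>h a' b'. corner triangle T a' b' h \<and> {a', b'} = {a, b} \<and> p \<in> h ` half_open_triangle"
      if p: "p \<in> triangle" for p
    proof (cases "p \<in> frontier triangle")
      case True
      then show ?thesis by (rule front)
    next
      case False
      \<comment> \<open>Homeomorphisms of the triangle preserve its interior, so an interior point
        lies in every corner chart.\<close>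
      then have "p \<in> inner_triangle" using tri p by blast
      have "\<gamma> 0 \<in> frontier triangle" unfolding fr(1)[symmetric] by (rule imageI) simp
      from front[OF this] obtain h a' b' where h: "corner triangle T a' b' h" "{a', b'} = {a, b}" by blast
      then obtain k where "homeomorphism triangle triangle h k" by (auto simp: corner_def)
      then have "h ` inner_triangle = inner_triangle" by (rule in_complex_homeomorphism(4))
      then have "p \<in> h ` half_open_triangle" using \<open>p \<in> inner_triangle\<close> inner_triangle_subset(1) by blast
      then show ?thesis using h by blast
    qed
  qed
  then show ?thesis using orientable_homeomorphic[OF spells_unique[OF T sp]] by blast
qed

text \<open>Each letter begins at a corner. The corner at the beginning of b provides a second label
  a; the third label must be a + b, and it begins at another corner.\<close>

theorem spells_three_letters_not_orientable:
  assumes sp: "spells D F w" and w: "cyclically_alternating w" "card (set w) = 3" "0 \<notin> set w"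
  shows "\<not> orientable (mirror_space D F)"
proof -
  have len: "3 \<le> length w" using card_length[of w] w(2) by simp
  then obtain T where T: "spells triangle T w" using spells_triangle[of w] by auto
  then obtain \<gamma> where \<gamma>: "spells_along triangle T w \<gamma>" by (rule spellsE)
  have corner: "\<exists>h a. corner triangle T a c h \<and> a \<in> set w \<and> a \<noteq> c" if "c \<in> set w" for c
  proof -
    obtain i u a where i: "rotate i w = c # u @ [a]" "a \<noteq> c" "i < length w"
      using cyclically_alternating_split[OF w(1) \<open>c \<in> set w\<close>] by metis
    obtain \<delta> where "spells_along triangle T (rotate i w) \<delta>"
      using spells_along_rotate_to[OF \<gamma> i(3), of "\<gamma> (real i)"] by fastforce
    moreover have "u \<noteq> []" using arg_cong[OF i(1), of length] len by auto
    moreover have "a \<in> set w" using arg_cong[OF i(1), of set] by simp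
    moreover from this have "a \<noteq> 0" "c \<noteq> 0" using w(3) that by metis+
    ultimately show ?thesis using spells_along_corner[of triangle T c u a] i by metis
  qed
  obtain b where b: "b \<in> set w" using len by (cases w) auto
  obtain h a where a: "corner triangle T a b h" "a \<in> set w" "a \<noteq> b" using corner[OF b] by blast
  have ab: "a \<noteq> 0" "b \<noteq> 0" using a b w(3) by metis+
  have "a + b \<in> set w"
  proof (rule ccontr)
    assume no: "a + b \<notin> set w"
    have "set w \<subseteq> {a, b}"
    proof
      fix g assume "g \<in> set w"
      then have "g \<noteq> 0" "g \<noteq> a + b" using w(3) no by metis+
      then show "g \<in> {a, b}" by (rule_tac bit_pair_basis_cases[OF ab a(3), of g]) simp_all
    qed
    then have "card (set w) \<le> card {a, b}" by (intro card_mono) auto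
    then show False using w(2) a(3) by simp
  qed
  from corner[OF this] obtain h' d where "corner triangle T d (a + b) h'" by blast
  from mirror_space_not_orientable[OF a(1) corner_swap[OF this]]
  show ?thesis using orientable_homeomorphic[OF spells_unique[OF sp T]] by blast
qed

section \<open>Lattice polygons\<close>

lemma open_segment_image_linepath:
  assumes "a \<noteq> b"
  shows "open_segment a b = linepath a b ` {0<..<1}"
  using assms unfolding open_segment_image_interval linepath_def by simp

text \<open>Without the point a the circle becomes a line, where an injective path has open image by
  invariance of domain. This rules out branching of the boundary along an edge and takes the place
  of an assumption that the edges do not cross.\<close>

lemma openin_circle_open_segment:
  fixes a b :: "'a::euclidean_space"
  assumes C: "C homeomorphic sphere (0 :: real \<times> real) 1" and ab: "a \<noteq> b" "closed_segment a b \<subseteq> C"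
  shows "openin (top_of_set C) (open_segment a b)"
proof -
  obtain f g where fg: "homeomorphism C (sphere (0 :: real \<times> real) 1) f g" using C by (auto simp: homeomorphic_def)
  have a: "a \<in> C" using ab by auto
  have inj: "inj_on f C" by (rule inj_on_inverseI[of _ g]) (use fg in \<open>simp add: homeomorphism_def\<close>)
  have "f ` (C - {a}) = sphere 0 1 - {f a}"
    using inj_on_image_set_diff[OF inj, of C "{a}"] a fg by (simp add: homeomorphism_def)
  moreover have "homeomorphism (C - {a}) (f ` (C - {a})) f g"
    by (rule homeomorphism_of_subsets[OF fg]) auto
  ultimately have "C - {a} homeomorphic sphere 0 1 - {f a}" by (metis homeomorphic_def)
  moreover have "f a \<in> sphere 0 1" using fg a by (auto simp: homeomorphism_def)
  then have "sphere (0 :: real \<times> real) 1 - {f a} homeomorphic (UNIV :: real set)"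
    by (intro homeomorphic_punctured_sphere_affine) simp_all
  ultimately have "C - {a} homeomorphic (UNIV :: real set)" by (rule homeomorphic_trans)
  then obtain k l where kl: "homeomorphism (C - {a}) (UNIV :: real set) k l" by (auto simp: homeomorphic_def)
  let ?O = "open_segment a b"
  have sub: "?O \<subseteq> C - {a}" using ab(2) by (auto simp: open_segment_def)
  have injk: "inj_on k (C - {a})" by (rule inj_on_inverseI[of _ l]) (use kl in \<open>simp add: homeomorphism_def\<close>)
  have "open ((k \<circ> linepath a b) ` {0<..<1})"
  proof (rule invariance_of_domain)
    show "continuous_on {0<..<1} (k \<circ> linepath a b)"
    proof (rule continuous_on_compose)
      show "continuous_on (linepath a b ` {0<..<1}) k"
        using continuous_on_subset[OF homeomorphism_cont1[OF kl] sub] open_segment_image_linepath[OF ab(1)] by simp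
    qed (rule continuous_on_linepath)
    show "inj_on (k \<circ> linepath a b) {0<..<1}"
    proof (rule comp_inj_on)
      show "inj_on (linepath a b) {0<..<1}" using inj_on_linepath[OF ab(1)] by (rule inj_on_subset) auto
      show "inj_on k (linepath a b ` {0<..<1})"
        using inj_on_subset[OF injk sub] open_segment_image_linepath[OF ab(1)] by simp
    qed
  qed simp
  then have "open (k ` ?O)" by (simp add: image_comp open_segment_image_linepath[OF ab(1)])
  then have "openin (top_of_set (C - {a})) ((C - {a}) \<inter> k -` (k ` ?O))"
    using continuous_openin_preimage_gen[of "C - {a}" k] kl by (simp add: homeomorphism_def)
  moreover have "(C - {a}) \<inter> k -` (k ` ?O) = ?O"
  proof (intro subset_antisym subsetI)
    fix x assume "x \<in> (C - {a}) \<inter> k -` (k ` ?O)"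
    then obtain y where "x \<in> C - {a}" "y \<in> ?O" "k x = k y" by blast
    then show "x \<in> ?O" using sub inj_onD[OF injk, of x y] by blast
  qed (use sub in blast)
  ultimately have "openin (top_of_set (C - {a})) ?O" by simp
  moreover have "openin (top_of_set C) (C - {a})" by (simp add: openin_delete)
  ultimately show ?thesis by (rule openin_trans)
qed

text \<open>With p as origin on the line, the quotient of the two coordinates tells whether p lies
  between the ends or one segment contains the other.\<close>

lemma collinear_segments_Un:
  fixes p d :: "'a::euclidean_space"
  assumes x: "x = p + \<mu> *\<^sub>R d" and y: "y = p + \<nu> *\<^sub>R d" and nz: "\<mu> \<noteq> 0" "\<nu> \<noteq> 0"
  shows "closed_segment x p \<union> closed_segment p y \<in> {closed_segment x y, closed_segment x p, closed_segment p y}"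
proof -
  have between: "p + \<alpha> *\<^sub>R d \<in> closed_segment p (p + \<beta> *\<^sub>R d)" if "0 \<le> \<alpha> / \<beta>" "\<alpha> / \<beta> \<le> 1" "\<beta> \<noteq> 0" for \<alpha> \<beta>
    unfolding in_segment using that by (intro exI[of _ "\<alpha> / \<beta>"]) (simp add: algebra_simps)
  consider "\<mu> / \<nu> < 0" | "0 \<le> \<mu> / \<nu>" "\<mu> / \<nu> \<le> 1" | "0 \<le> \<nu> / \<mu>" "\<nu> / \<mu> \<le> 1"
  proof -
    have "\<nu> / \<mu> = 1 / (\<mu> / \<nu>)" by simp
    moreover have "0 \<le> 1 / \<rho> \<and> 1 / \<rho> \<le> 1" if "1 < \<rho>" for \<rho> :: real using that by simp
    ultimately have "0 \<le> \<nu> / \<mu> \<and> \<nu> / \<mu> \<le> 1" if "1 < \<mu> / \<nu>" using that by metis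
    then show thesis using that by linarith
  qed
  then show ?thesis
  proof cases
    case 1
    have "p \<in> closed_segment x y"
      unfolding in_segment
    proof (intro exI[of _ "\<mu> / (\<mu> - \<nu>)"] conjI)
      have ne: "\<mu> - \<nu> \<noteq> 0" using 1 nz by auto
      show "0 \<le> \<mu> / (\<mu> - \<nu>)" "\<mu> / (\<mu> - \<nu>) \<le> 1" using 1 by (auto simp: divide_simps split: if_splits)
      have "(1 - \<mu> / (\<mu> - \<nu>)) * \<mu> + \<mu> / (\<mu> - \<nu>) * \<nu> = 0" using ne by (simp add: field_simps)
      moreover have "(1 - t) *\<^sub>R x + t *\<^sub>R y = p + ((1 - t) * \<mu> + t * \<nu>) *\<^sub>R d" for t
        by (simp add: x y algebra_simps)
      ultimately show "p = (1 - \<mu> / (\<mu> - \<nu>)) *\<^sub>R x + (\<mu> / (\<mu> - \<nu>)) *\<^sub>R y" by simp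
    qed
    then show ?thesis by (simp add: Un_closed_segment)
  next
    case 2
    then have "x \<in> closed_segment p y" unfolding x y using between nz by blast
    then have "closed_segment x p \<subseteq> closed_segment p y" by (simp add: subset_closed_segment)
    then show ?thesis by (simp add: Un_absorb1)
  next
    case 3
    then have "y \<in> closed_segment x p" unfolding x y using between nz by (metis closed_segment_commute)
    then have "closed_segment p y \<subseteq> closed_segment x p" by (simp add: subset_closed_segment)
    then show ?thesis by (simp add: Un_absorb2)
  qed
qed

text \<open>Unit time per edge, as required by \<open>spells_along\<close>.\<close>

definition polyline :: "(nat \<Rightarrow> 'a::real_normed_vector) \<Rightarrow> real \<Rightarrow> 'a" where
  "polyline v t = linepath (v (nat \<lfloor>t\<rfloor>)) (v (Suc (nat \<lfloor>t\<rfloor>))) (frac t)"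

lemma polyline_eq:
  assumes "t \<in> {real i..real i + 1}"
  shows "polyline v t = linepath (v i) (v (Suc i)) (t - real i)"
proof (cases "t = real i + 1")
  case True
  then have "t = real (Suc i)" by simp
  then have "nat \<lfloor>t\<rfloor> = Suc i" "frac t = 0" by (simp_all only: floor_of_nat nat_int frac_eq_0_iff Ints_of_nat)
  then show ?thesis unfolding polyline_def using True by (simp only: linepath_0' linepath_1') (simp add: linepath_1')
next
  case False
  then have "\<lfloor>t\<rfloor> = int i" using assms by (auto simp: floor_eq_iff)
  then show ?thesis by (simp add: polyline_def frac_def)
qed

lemma polyline_nat [simp]: "polyline v (real i) = v i"
  using polyline_eq[of "real i" i v] by (simp add: linepath_0')

lemma polyline_image: "polyline v ` {real i..real i + 1} = closed_segment (v i) (v (Suc i))"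
proof -
  have "polyline v ` {real i..real i + 1} = (\<lambda>t. linepath (v i) (v (Suc i)) (t - real i)) ` {real i..real i + 1}"
    by (rule image_cong[OF refl polyline_eq])
  also have "\<dots> = linepath (v i) (v (Suc i)) ` ((\<lambda>t. t - real i) ` {real i..real i + 1})" by (rule image_fun)
  also have "(\<lambda>t. t - real i) ` {real i..real i + 1} = {0..1}" using image_minus_const_atLeastAtMost'[of "real i" "real i" "real i + 1"] by simp
  finally show ?thesis by (simp add: linepath_image_01)
qed

lemma continuous_on_polyline: "continuous_on {0..real m} (polyline v)"
proof (induction m)
  case (Suc m)
  have "continuous_on {real m..real m + 1} (\<lambda>t. linepath (v m) (v (Suc m)) (t - real m))"
    unfolding linepath_def by (intro continuous_intros)
  then have "continuous_on {real m..real m + 1} (polyline v)"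
    by (rule continuous_on_cong[THEN iffD1, rotated -1]) (simp_all add: polyline_eq)
  from continuous_on_closed_Un[OF closed_atLeastAtMost closed_atLeastAtMost Suc.IH this]
  have "continuous_on ({0..real m} \<union> {real m..real m + 1}) (polyline v)" .
  also have "{0..real m} \<union> {real m..real m + 1} = {0..real (Suc m)}" by auto
  finally show ?case .
qed simp

lemma lattice_point_inject: "lattice_point p = lattice_point q \<longleftrightarrow> p = q"
  by (auto simp: lattice_point_def prod_eq_iff)

section \<open>The boundary of a lattice polygon as a simple closed curve\<close>

locale polygon =
  fixes P :: "(real \<times> real) set" and vs :: "(int \<times> int) list"
  assumes polygon: "lattice_polygon P vs"
begin

abbreviation n :: nat where "n \<equiv> length vs"

definition vertex :: "nat \<Rightarrow> real \<times> real" where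
  "vertex i = lattice_point (vs ! (i mod n))"

lemma edge_eq: "edge vs i = closed_segment (vertex i) (vertex (Suc i))"
  by (simp add: edge_def vertex_def)

lemma nonempty: "0 < n"
  using polygon by (simp add: lattice_polygon_def closed_polygonal_line_def)

lemma edge_mod: "edge vs (i mod n) = edge vs i" "edge vs (Suc (i mod n)) = edge vs (Suc i)"
  unfolding edge_def by (simp_all add: mod_Suc_eq mod_Suc_Suc_eq)

lemma vertex_eq_iff: "vertex i = vertex j \<longleftrightarrow> i mod n = j mod n"
  using polygon nonempty
  by (auto simp: vertex_def lattice_point_inject lattice_polygon_def closed_polygonal_line_def nth_eq_iff_index_eq)

lemma lattice_segment_edge: "lattice_segment (edge vs i)"
  using polygon nonempty edge_mod(1)[of i] unfolding lattice_polygon_def closed_polygonal_line_def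
  by (metis mod_less_divisor)

lemma not_lattice_segment_edges: "\<not> lattice_segment (edge vs i \<union> edge vs (Suc i))"
  using polygon nonempty edge_mod[of i] unfolding lattice_polygon_def closed_polygonal_line_def
  by (metis mod_less_divisor)

lemma lattice_segment_vertex: "vertex i \<noteq> vertex j \<Longrightarrow> lattice_segment (closed_segment (vertex i) (vertex j))"
  unfolding lattice_segment_def vertex_def lattice_point_inject
  by (rule exI[of _ "vs ! (i mod n)"], rule exI[of _ "vs ! (j mod n)"]) simp

lemma vertex_Suc_neq: "vertex i \<noteq> vertex (Suc i)"
proof
  assume "vertex i = vertex (Suc i)"
  then have "closed_segment (vertex i) (vertex (Suc i)) = {vertex i}" by simp
  moreover obtain p q where "p \<noteq> q" "edge vs i = closed_segment (lattice_point p) (lattice_point q)"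
    using lattice_segment_edge[of i] unfolding lattice_segment_def by metis
  ultimately show False unfolding edge_eq by (metis closed_segment_eq_sing lattice_point_inject)
qed

lemma frontier_eq: "frontier P = (\<Union>i<n. edge vs i)"
  using polygon by (simp add: lattice_polygon_def edges_def)

lemma edge_subset_frontier: "edge vs i \<subseteq> frontier P"
proof -
  have "edge vs (i mod n) \<subseteq> frontier P" unfolding frontier_eq using nonempty by (intro UN_upper) simp
  then show ?thesis by (simp add: edge_mod)
qed

lemma length_ge_3: "3 \<le> n"
proof (rule ccontr)
  assume "\<not> 3 \<le> n"
  then consider "n = 1" | "n = 2" using nonempty by linarith
  then show False
  proof cases
    case 1
    then show ?thesis using vertex_Suc_neq[of 0] by (simp add: vertex_eq_iff)
  next
    case 2
    then have "edge vs 0 = edge vs (Suc 0)"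
      by (simp add: edge_def closed_segment_commute)
    then show ?thesis using not_lattice_segment_edges[of 0] lattice_segment_edge[of 0] by simp
  qed
qed

lemma Suc_Suc_mod: "Suc (Suc i) mod n \<noteq> i mod n"
  using length_ge_3 by (auto simp: mod_eq_dvd_iff_nat dest!: dvd_imp_le)

lemma disc: "closed_disc P"
  using polygon by (simp add: lattice_polygon_def closed_disc_def)

lemma frontier_circle: "frontier P homeomorphic sphere (0 :: real \<times> real) 1"
proof -
  obtain f g where fg: "homeomorphism P (cball (0 :: real \<times> real) 1) f g"
    using disc by (auto simp: closed_disc_def homeomorphic_def)
  have "closed P" using closed_disc_compact[OF disc] by (rule compact_imp_closed)
  then have "f ` frontier P = sphere 0 1" using homeomorphism_frontier(2)[OF fg] by simp
  moreover have "frontier P \<subseteq> P" using \<open>closed P\<close> by (simp add: frontier_subset_closed)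
  ultimately have "homeomorphism (frontier P) (sphere 0 1) f g"
    using homeomorphism_of_subsets[OF fg] by blast
  then show ?thesis by (auto simp: homeomorphic_def)
qed

abbreviation open_edge :: "nat \<Rightarrow> (real \<times> real) set" where
  "open_edge i \<equiv> open_segment (vertex i) (vertex (Suc i))"

lemma openin_open_edge: "openin (top_of_set (frontier P)) (open_edge i)"
  by (rule openin_circle_open_segment[OF frontier_circle vertex_Suc_neq]) (use edge_subset_frontier in \<open>simp add: edge_eq\<close>)

text \<open>Near a point of an open edge the boundary contains nothing but that edge. So the two
  edges meeting at a vertex there would be collinear, and their union would be a segment, which a
  closed polygonal line forbids.\<close>

lemma vertex_notin_open_edge: "vertex j \<notin> open_edge i"
proof
  assume j: "vertex j \<in> open_edge i"
  \<comment> \<open>The index preceding j cyclically; adding n avoids a truncated subtraction at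
    0.\<close>
  define m where "m = j + n - 1"
  define p where "p = vertex (Suc m)"
  define d where "d = vertex (Suc i) - vertex i"
  have "Suc m = j + n" using nonempty by (simp add: m_def)
  then have "p = vertex j" by (simp add: p_def vertex_def)
  then have p: "p \<in> open_edge i" using j by simp
  obtain e where e: "0 < e" "\<And>q. q \<in> frontier P \<Longrightarrow> dist q p < e \<Longrightarrow> q \<in> open_edge i"
    using openin_open_edge[of i] p unfolding openin_euclidean_subtopology_iff by metis
  have collinear: "\<exists>\<mu>. \<mu> \<noteq> 0 \<and> q = p + \<mu> *\<^sub>R d" if q: "closed_segment p q \<subseteq> frontier P" "q \<noteq> p" for q
  proof -
    \<comment> \<open>Moves from p towards q by at most e / 2, so that z is still in the
      neighbourhood where the boundary is the open edge.\<close>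
    define t where "t = min 1 (e / (2 * dist q p))"
    have t: "0 < t" "t \<le> 1" "t * dist q p < e"
    proof -
      show "0 < t" "t \<le> 1" using e(1) q(2) by (simp_all add: t_def)
      have "t * dist q p \<le> e / (2 * dist q p) * dist q p" by (intro mult_right_mono) (simp_all add: t_def)
      also have "\<dots> = e / 2" using q(2) by simp
      finally show "t * dist q p < e" using e(1) by simp
    qed
    define z where "z = p + t *\<^sub>R (q - p)"
    have "z \<in> closed_segment p q"
      unfolding in_segment z_def using t by (intro exI[of _ t]) (simp add: algebra_simps)
    moreover have "dist z p < e" using t by (simp add: z_def dist_norm)
    ultimately have "z \<in> open_edge i" using e(2) q(1) by blast
    then obtain r s where "z = (1 - r) *\<^sub>R vertex i + r *\<^sub>R vertex (Suc i)" "p = (1 - s) *\<^sub>R vertex i + s *\<^sub>R vertex (Suc i)"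
      using p unfolding in_segment by blast
    moreover have "((1 - r) *\<^sub>R A + r *\<^sub>R B) - ((1 - s) *\<^sub>R A + s *\<^sub>R B) = (r - s) *\<^sub>R (B - A)" for A B :: "real \<times> real"
      by (simp add: algebra_simps)
    ultimately have "z - p = (r - s) *\<^sub>R d" unfolding d_def by metis
    then have "t *\<^sub>R (q - p) = (r - s) *\<^sub>R d" by (simp add: z_def)
    then have "q - p = ((r - s) / t) *\<^sub>R d" using t(1) by (metis divide_inverse_commute less_irrefl scaleR_scaleR left_inverse scaleR_one)
    then have "q = p + ((r - s) / t) *\<^sub>R d" by (simp add: algebra_simps)
    moreover have "(r - s) / t \<noteq> 0" using calculation q(2) by auto
    ultimately show ?thesis by blast
  qed
  have e1: "edge vs m = closed_segment (vertex m) p" "edge vs (Suc m) = closed_segment p (vertex (Suc (Suc m)))"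
    by (simp_all add: edge_eq p_def)
  obtain \<mu> where \<mu>: "\<mu> \<noteq> 0" "vertex m = p + \<mu> *\<^sub>R d"
    using collinear[of "vertex m"] edge_subset_frontier[of m] vertex_Suc_neq[of m] e1(1)
    by (auto simp: closed_segment_commute p_def)
  obtain \<nu> where \<nu>: "\<nu> \<noteq> 0" "vertex (Suc (Suc m)) = p + \<nu> *\<^sub>R d"
    using collinear[of "vertex (Suc (Suc m))"] edge_subset_frontier[of "Suc m"] vertex_Suc_neq[of "Suc m"] e1(2)
    by (auto simp: p_def)
  let ?U = "closed_segment (vertex m) p \<union> closed_segment p (vertex (Suc (Suc m)))"
  have "vertex m \<noteq> vertex (Suc (Suc m))"
    using Suc_Suc_mod[of m] unfolding vertex_eq_iff by simp
  then have "lattice_segment (closed_segment (vertex m) (vertex (Suc (Suc m))))" by (rule lattice_segment_vertex)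
  moreover have "lattice_segment (closed_segment (vertex m) p)" "lattice_segment (closed_segment p (vertex (Suc (Suc m))))"
    using lattice_segment_edge e1 by metis+
  ultimately have "lattice_segment ?U" using collinear_segments_Un[OF \<mu>(2) \<nu>(2) \<mu>(1) \<nu>(1)] by auto
  then show False using not_lattice_segment_edges[of m] e1 by simp
qed

text \<open>The intersection is open in the open edge j; it is also closed, because no end of edge i
  lies in an open edge. Connectedness does the rest.\<close>

lemma open_edge_subset:
  assumes "open_edge i \<inter> open_edge j \<noteq> {}"
  shows "open_edge j \<subseteq> open_edge i"
proof -
  have "open_edge j \<subseteq> frontier P"
    using edge_subset_frontier[of j] segment_open_subset_closed[of "vertex j" "vertex (Suc j)"] by (auto simp: edge_eq)
  then have "openin (top_of_set (open_edge j)) (open_edge j \<inter> open_edge i)"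
    using openin_open_edge[of i] openin_subtopology_Int2 by (metis inf.absorb_iff2 openin_open open_openin subtopology_subtopology openin_subtopology_Int)
  moreover have "open_edge j \<inter> open_edge i = open_edge j \<inter> edge vs i"
    using vertex_notin_open_edge unfolding edge_eq closed_segment_eq_open by auto
  then have "closedin (top_of_set (open_edge j)) (open_edge j \<inter> open_edge i)"
    by (simp add: edge_eq closedin_closed_Int)
  moreover have "connected (open_edge j)" by (rule convex_connected[OF convex_open_segment])
  ultimately have "open_edge j \<inter> open_edge i = open_edge j"
    using assms unfolding connected_clopen by blast
  then show ?thesis by blast
qed

text \<open>Overlapping open edges coincide and have the same ends. The ends cannot be in reversed
  order, since then two steps along the line would lead back to the start, although there are at
  least three vertices.\<close>

lemma open_edge_disjoint:
  assumes "open_edge i \<inter> open_edge j \<noteq> {}"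
  shows "i mod n = j mod n"
proof -
  have "open_edge i = open_edge j" using open_edge_subset[of i j] open_edge_subset[of j i] assms by blast
  then have "{vertex i, vertex (Suc i)} = {vertex j, vertex (Suc j)}" using open_segment_eq by (metis vertex_Suc_neq)
  then consider "vertex i = vertex j" | "vertex i = vertex (Suc j)" "vertex (Suc i) = vertex j"
    unfolding doubleton_eq_iff by blast
  then show ?thesis
  proof cases
    case 1
    then show ?thesis by (simp add: vertex_eq_iff)
  next
    case 2
    then have "Suc (Suc j) mod n = j mod n" unfolding vertex_eq_iff by (metis mod_Suc_eq)
    then show ?thesis using Suc_Suc_mod by simp
  qed
qed

end

context polygon
begin

text \<open>Integer parameters give vertices and all others give points of open edges; these never
  coincide, and different open edges are disjoint.\<close>

lemma polyline_inj: "inj_on (polyline vertex) {0..<real n}"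
proof (rule inj_onI)
  fix x y assume xy: "x \<in> {0..<real n}" "y \<in> {0..<real n}" and eq: "polyline vertex x = polyline vertex y"
  have at: "vertex (nat \<lfloor>t\<rfloor>) = polyline vertex t" if "frac t = 0" for t
    unfolding polyline_def that by (simp only: linepath_0')
  have inside: "polyline vertex t \<in> open_edge (nat \<lfloor>t\<rfloor>)" if "frac t \<noteq> 0" for t
  proof -
    have "frac t \<in> {0<..<1}" using that frac_lt_1[of t] frac_ge_0[of t] by (auto simp del: frac_ge_0)
    then show ?thesis unfolding open_segment_image_linepath[OF vertex_Suc_neq] polyline_def by (rule imageI)
  qed
  have bound: "nat \<lfloor>t\<rfloor> < n" "real (nat \<lfloor>t\<rfloor>) = of_int \<lfloor>t\<rfloor>" if "t \<in> {0..<real n}" for t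
    using that by (auto, linarith)
  have conclude: "x = y" if "nat \<lfloor>x\<rfloor> mod n = nat \<lfloor>y\<rfloor> mod n" "frac x = frac y"
    using that bound xy by (metis frac_def diff_eq_eq diff_add_cancel mod_less)
  show "x = y"
  proof (cases "frac x = 0")
    case True
    then have "vertex (nat \<lfloor>x\<rfloor>) = polyline vertex y" using at eq by simp
    then have "frac y = 0" using inside vertex_notin_open_edge by metis
    then show ?thesis using conclude True at eq vertex_eq_iff by metis
  next
    case False
    have "frac y \<noteq> 0"
    proof
      assume "frac y = 0"
      then have "polyline vertex x = vertex (nat \<lfloor>y\<rfloor>)" using at[of y] eq by simp
      then show False using inside[OF False] vertex_notin_open_edge by simp
    qed
    then have "open_edge (nat \<lfloor>x\<rfloor>) \<inter> open_edge (nat \<lfloor>y\<rfloor>) \<noteq> {}"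
      using inside[of x] inside[of y] False eq by auto
    then have mod: "nat \<lfloor>x\<rfloor> mod n = nat \<lfloor>y\<rfloor> mod n" by (rule open_edge_disjoint)
    then have "nat \<lfloor>x\<rfloor> = nat \<lfloor>y\<rfloor>" using bound xy by simp
    then have "linepath (vertex (nat \<lfloor>x\<rfloor>)) (vertex (Suc (nat \<lfloor>x\<rfloor>))) (frac x) = linepath (vertex (nat \<lfloor>x\<rfloor>)) (vertex (Suc (nat \<lfloor>x\<rfloor>))) (frac y)"
      using eq by (simp add: polyline_def)
    moreover have "frac t \<in> {0..1}" for t :: real using frac_lt_1[of t] by auto
    ultimately have "frac x = frac y" using inj_onD[OF inj_on_linepath[OF vertex_Suc_neq]] by blast
    then show ?thesis using conclude mod by blast
  qed
qed

definition word :: "(bit \<times> bit) list" where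
  "word = map (\<lambda>i. prod.swap (segment_parity (edge vs i))) [0..<n]"

definition labels :: "bit \<times> bit \<Rightarrow> (real \<times> real) set" where
  "labels s = \<Union> {e \<in> edges vs. prod.swap (segment_parity e) = s}"

lemma length_word: "length word = n" by (simp add: word_def)

lemma spells_polygon: "spells_along P labels word (polyline vertex)"
  unfolding spells_along_def length_word
proof (intro conjI disc polyline_inj continuous_on_polyline)
  show "word \<noteq> []" using nonempty length_word by auto
  show "polyline vertex (real n) = polyline vertex 0"
    using polyline_nat[of vertex 0] by (simp add: vertex_def)
  have "{0..real n} = (\<Union>i<n. {real i..real i + 1})"
  proof (intro subset_antisym subsetI)
    fix t assume t: "t \<in> {0..real n}"
    show "t \<in> (\<Union>i<n. {real i..real i + 1})"
    proof (cases "t = real n")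
      case True
      then show ?thesis using nonempty by (intro UN_I[of "n - 1"]) (auto simp: of_nat_diff)
    next
      case False
      then have "nat \<lfloor>t\<rfloor> < n" "t \<in> {real (nat \<lfloor>t\<rfloor>)..real (nat \<lfloor>t\<rfloor>) + 1}" using t by (auto, linarith+)
      then show ?thesis by blast
    qed
  next
    fix t assume "t \<in> (\<Union>i<n. {real i..real i + 1})"
    then obtain i where "i < n" "t \<in> {real i..real i + 1}" by blast
    then show "t \<in> {0..real n}" by auto
  qed
  then have "polyline vertex ` {0..real n} = (\<Union>i<n. polyline vertex ` {real i..real i + 1})" by (simp add: image_UN)
  then show "polyline vertex ` {0..real n} = frontier P"
    unfolding frontier_eq edge_eq polyline_image .
  show "labels = word_trace (polyline vertex) word"
  proof (rule ext)
    fix s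
    have "word_trace (polyline vertex) word s = (\<Union>i\<in>{i. i < n \<and> prod.swap (segment_parity (edge vs i)) = s}. edge vs i)"
      unfolding word_trace_def polyline_image edge_eq[symmetric] length_word by (rule SUP_cong) (auto simp: word_def)
    also have "\<dots> = labels s" unfolding labels_def edges_def by blast
    finally show "labels s = word_trace (polyline vertex) word s" by simp
  qed
qed

end

section \<open>Parities of segments\<close>

lemma of_int_bit: "(of_int k :: bit) = (if even k then 0 else 1)"
proof (cases "even k")
  case True
  then obtain c where "k = 2 * c" by (rule evenE)
  then show ?thesis by simp
next
  case False
  then obtain c where "k = 2 * c + 1" by (rule oddE)
  then show ?thesis by simp
qed

text \<open>The lattice points of the segment are p + k (a, b) with a primitive direction (a, b),
  whose parity is nonzero because a and b are not both even. Exactly two parities occur, and they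
  differ by that of (a, b).\<close>

lemma segment_parity_nonzero:
  assumes "p \<noteq> q"
  shows "segment_parity (closed_segment (lattice_point p) (lattice_point q)) \<noteq> 0"
proof -
  define dx where "dx = fst q - fst p"
  define dy where "dy = snd q - snd p"
  define g where "g = gcd dx dy"
  have "g \<noteq> 0" using assms by (auto simp: g_def dx_def dy_def prod_eq_iff)
  moreover have "0 \<le> g" by (simp add: g_def)
  ultimately have g: "1 \<le> g" by simp
  obtain a b where ab: "dx = a * g" "dy = b * g" "coprime a b"
    using gcd_coprime_exists[of dx dy] \<open>g \<noteq> 0\<close> unfolding g_def by metis
  let ?S = "{m. lattice_point m \<in> closed_segment (lattice_point p) (lattice_point q)}"
  define step where "step = parity (a, b)"
  have step: "step \<noteq> 0"
    using ab(3) by (auto simp: step_def parity_def of_int_bit zero_prod_def)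
  have add: "parity (fst p + k * a, snd p + k * b) = parity p + (if even k then 0 else step)" for k
    by (simp add: parity_def step_def zero_prod_def of_int_bit)
  have "parity ` ?S = {parity p, parity p + step}"
  proof (intro subset_antisym subsetI)
    fix c assume "c \<in> parity ` ?S"
    then obtain m where m: "c = parity m" "lattice_point m \<in> closed_segment (lattice_point p) (lattice_point q)" by blast
    then obtain u where u: "lattice_point m = (1 - u) *\<^sub>R lattice_point p + u *\<^sub>R lattice_point q"
      unfolding in_segment by blast
    define x where "x = fst m - fst p"
    define y where "y = snd m - snd p"
    have xy: "real_of_int x = u * real_of_int dx" "real_of_int y = u * real_of_int dy"
      using u by (simp_all add: x_def y_def dx_def dy_def lattice_point_def prod_eq_iff algebra_simps)
    have "real_of_int (x * b) = real_of_int (y * a)" by (simp add: xy ab)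
    then have cross: "x * b = y * a" by linarith
    \<comment> \<open>Bezout coefficients produce the integer multiple k: m - p is proportional to
      the primitive vector (a, b), hence an integer multiple of it.\<close>
    obtain s t where st: "s * a + t * b = 1"
      using bezout_int[of a b] ab(3) by (auto simp: coprime_iff_gcd_eq_1)
    define k where "k = s * x + t * y"
    have "k * a = x * (s * a + t * b)" "k * b = y * (s * a + t * b)"
      using cross by (simp_all add: k_def algebra_simps)
    then have "m = (fst p + k * a, snd p + k * b)" unfolding st by (simp add: x_def y_def prod_eq_iff)
    then show "c \<in> {parity p, parity p + step}" using m(1) add[of k] by simp
  next
    fix c assume "c \<in> {parity p, parity p + step}"
    moreover have "parity p \<in> parity ` ?S" by simp
    moreover have "parity p + step \<in> parity ` ?S"
    proof (rule image_eqI[of _ _ "(fst p + 1 * a, snd p + 1 * b)"])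
      show "parity p + step = parity (fst p + 1 * a, snd p + 1 * b)" unfolding add by simp
      have q: "real_of_int (fst q) = fst p + a * g" "real_of_int (snd q) = snd p + b * g"
        using ab(1,2) by (simp_all add: dx_def dy_def flip: of_int_mult of_int_add)
      have "lattice_point (fst p + 1 * a, snd p + 1 * b) \<in> closed_segment (lattice_point p) (lattice_point q)"
        unfolding in_segment
      proof (intro exI[of _ "1 / real_of_int g"] conjI)
        show "lattice_point (fst p + 1 * a, snd p + 1 * b) =
          (1 - 1 / real_of_int g) *\<^sub>R lattice_point p + (1 / real_of_int g) *\<^sub>R lattice_point q"
          using g by (simp add: lattice_point_def prod_eq_iff q field_simps)
      qed (use g in simp_all)
      then show "(fst p + 1 * a, snd p + 1 * b) \<in> ?S" by simp
    qed
    ultimately show "c \<in> parity ` ?S" by blast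
  qed
  then have "segment_parity (closed_segment (lattice_point p) (lattice_point q)) = parity p + (parity p + step)"
    using step by (simp add: segment_parity_def)
  then show ?thesis using step by (simp add: bit_pair_add_left_self)
qed

lemma reflect_reflect: "reflect g (reflect h p) = reflect (g + h) p"
  by (cases g; cases h; cases p) auto

lemma reflect_0: "reflect 0 p = p"
  by (cases p) (simp add: zero_prod_def)

lemma continuous_on_reflect: "continuous_on S (reflect g)"
proof -
  have "reflect g = (\<lambda>p. ((if fst g = 0 then 1 else - 1) * fst p, (if snd g = 0 then 1 else - 1) * snd p))"
    by (cases g) (auto simp: fun_eq_iff)
  then show ?thesis by (simp add: continuous_intros)
qed

context polygon
begin

lemma zero_notin_word: "0 \<notin> set word"
proof
  assume "0 \<in> set word"
  then obtain i where i: "prod.swap (segment_parity (edge vs i)) = 0" by (auto simp: word_def)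
  have "segment_parity (edge vs i) = 0" using arg_cong[OF i, of prod.swap] by (simp add: zero_prod_def)
  moreover obtain p q where "p \<noteq> q" "edge vs i = closed_segment (lattice_point p) (lattice_point q)"
    using lattice_segment_edge[of i] unfolding lattice_segment_def by metis
  ultimately show False using segment_parity_nonzero by metis
qed

lemma card_set_word: "card (segment_parity ` edges vs) = card (set word)"
proof -
  have "set word = prod.swap ` (segment_parity ` edges vs)" by (auto simp: word_def edges_def)
  moreover have "inj_on prod.swap (segment_parity ` edges vs)" by simp
  ultimately show ?thesis by (simp add: card_image)
qed

text \<open>Copy g is identified with P by its own reflection. The reflection by s in the gluing is
  exactly the difference between the reflections of the copies g and s + g, so the gluing becomes
  the identity on points.\<close>

lemma ambient_surface_mirror_space: "mirror_space P labels homeomorphic_space ambient_surface P vs"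
  unfolding mirror_space_def ambient_surface_def
proof (rule glue_homeomorphic)
  let ?h = "\<lambda>x. (fst x, reflect (fst x) (snd x))"
  show "homeomorphic_maps (four_copies P) (sum_topology (\<lambda>g. top_of_set (reflect g ` P)) UNIV) ?h ?h"
    unfolding homeomorphic_maps_def
  proof (intro conjI ballI)
    show "continuous_map (four_copies P) (sum_topology (\<lambda>g. top_of_set (reflect g ` P)) UNIV) ?h"
      unfolding continuous_map_sum_topology
    proof
      fix g :: "bit \<times> bit"
      have "continuous_map (top_of_set P) (top_of_set (reflect g ` P)) (reflect g)"
        by (simp add: continuous_on_reflect)
      from continuous_map_compose[OF this continuous_map_component_injection[of g UNIV "\<lambda>g. top_of_set (reflect g ` P)"]]
      show "continuous_map (top_of_set P) (sum_topology (\<lambda>g. top_of_set (reflect g ` P)) UNIV) (\<lambda>p. ?h (g, p))"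
        by (simp add: o_def)
    qed
    show "continuous_map (sum_topology (\<lambda>g. top_of_set (reflect g ` P)) UNIV) (four_copies P) ?h"
      unfolding continuous_map_sum_topology
    proof
      fix g :: "bit \<times> bit"
      have "continuous_map (top_of_set (reflect g ` P)) (top_of_set P) (reflect g)"
        by (auto simp: continuous_on_reflect reflect_reflect reflect_0 bit_pair_add_self)
      from continuous_map_compose[OF this continuous_map_component_injection[of g UNIV "\<lambda>g. top_of_set P"]]
      show "continuous_map (top_of_set (reflect g ` P)) (four_copies P) (\<lambda>p. ?h (g, p))"
        by (simp add: o_def)
    qed
  qed (simp_all add: reflect_reflect reflect_0 bit_pair_add_self)
  show "edge_gluing vs = (\<lambda>(x, y). (?h x, ?h y)) ` mirror_rel labels" (is "_ = ?H ` _")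
  proof (intro subset_antisym subsetI)
    fix z assume "z \<in> edge_gluing vs"
    then obtain g e p where z: "z = ((g, p), (prod.swap (segment_parity e) + g, reflect (prod.swap (segment_parity e)) p))"
      "e \<in> edges vs" "p \<in> reflect g ` e"
      unfolding edge_gluing_def by blast
    then obtain q where q: "q \<in> e" "p = reflect g q" by blast
    let ?s = "prod.swap (segment_parity e)"
    have "q \<in> labels ?s" unfolding labels_def using z(2) q(1) by blast
    then have "((g, q), (?s + g, q)) \<in> mirror_rel labels" unfolding mirror_rel_def by blast
    moreover have "z = ?H ((g, q), (?s + g, q))" by (simp add: z(1) q(2) reflect_reflect)
    ultimately show "z \<in> ?H ` mirror_rel labels" by (rule rev_image_eqI)
  next
    fix z assume "z \<in> ?H ` mirror_rel labels"
    then obtain x where x: "x \<in> mirror_rel labels" "z = ?H x" by blast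
    then obtain g s q where q: "x = ((g, q), (s + g, q))" "q \<in> labels s" unfolding mirror_rel_def by blast
    then obtain e where e: "e \<in> edges vs" "prod.swap (segment_parity e) = s" "q \<in> e" unfolding labels_def by blast
    have "z = ((g, reflect g q), (s + g, reflect s (reflect g q)))" by (simp add: x(2) q(1) reflect_reflect)
    moreover have "reflect g q \<in> reflect g ` e" using e(3) by (rule imageI)
    ultimately show "z \<in> edge_gluing vs" unfolding edge_gluing_def using e(1,2) by blast
  qed
  fix x y assume "(x, y) \<in> mirror_rel labels"
  then obtain g s p where "x = (g, p)" "y = (s + g, p)" "p \<in> labels s" unfolding mirror_rel_def by blast
  moreover have "labels s \<subseteq> P"
    using spells_mirrored[OF spellsI[OF spells_polygon]] by (simp add: mirrored_def)
  ultimately show "x \<in> topspace (four_copies P) \<and> y \<in> topspace (four_copies P)" by (simp add: subsetD)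
qed

end

section \<open>Broken edges\<close>

text \<open>Defined from the labelled sets alone. Thus the odd vertices can be computed from any
  word spelled by the boundary, in particular from the alternating one, whose letters are not the
  edges.\<close>

definition switch_points :: "('l \<Rightarrow> plane set) \<Rightarrow> plane set" where
  "switch_points F = {p. \<exists>s s'. s \<noteq> s' \<and> p \<in> F s \<and> p \<in> F s'}"

lemma word_traceI: "i < length w \<Longrightarrow> t \<in> {real i..real i + 1} \<Longrightarrow> \<gamma> t \<in> word_trace \<gamma> w (w ! i)"
  unfolding word_trace_def by blast

text \<open>Apart from its ends the curve is injective, so two letters share a point only if they
  are consecutive, or are the last and the first one, which meet at the closing point.\<close>

lemma switch_points_eq:
  assumes sp: "spells_along D F w \<gamma>"
  shows "switch_points F = (\<lambda>i. \<gamma> (real (Suc i))) ` {i. i < length w \<and> w ! i \<noteq> w ! (Suc i mod length w)}"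
    (is "_ = ?V")
proof (intro subset_antisym subsetI)
  let ?n = "length w"
  have F: "F = word_trace \<gamma> w" and close: "\<gamma> (real ?n) = \<gamma> 0" and ne: "w \<noteq> []"
    using sp by (simp_all add: spells_along_def)
  have half: "p \<in> ?V" if ik: "i < k" "k < ?n" "w ! i \<noteq> w ! k" and xy: "x \<in> {real i..real i + 1}" "y \<in> {real k..real k + 1}"
      "p = \<gamma> x" "p = \<gamma> y" for i k x y p
  proof -
    have ge: "real i + 1 \<le> real k" "real k + 1 \<le> real ?n" using ik by linarith+
    have "\<gamma> x = \<gamma> y" using xy by simp
    then consider "x = y" | "x = 0" "y = real ?n"
      using spells_along_eq_iff[OF sp, of x y] xy(1,2) ge by fastforce
    then show ?thesis
    proof cases
      case 1
      then have "x = real k" "real k = real (Suc i)" using xy(1,2) ge by auto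
      then have "k = Suc i" by linarith
      then show ?thesis using ik xy(3) \<open>x = real k\<close> by (intro image_eqI[of _ _ i]) auto
    next
      case 2
      then have "real i = 0" "real (Suc k) = real ?n" using xy(1,2) ge by auto
      then have "i = 0" "Suc k = ?n" by linarith+
      then show ?thesis using ik xy(4) 2 by (intro image_eqI[of _ _ k]) auto
    qed
  qed
  fix p assume "p \<in> switch_points F"
  then obtain s s' where s: "s \<noteq> s'" "p \<in> word_trace \<gamma> w s" "p \<in> word_trace \<gamma> w s'"
    unfolding switch_points_def F by blast
  then obtain i x k y where i: "i < ?n" "w ! i = s" "x \<in> {real i..real i + 1}" "p = \<gamma> x"
    and k: "k < ?n" "w ! k = s'" "y \<in> {real k..real k + 1}" "p = \<gamma> y"
    unfolding word_trace_def by blast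
  have "i \<noteq> k" using i(2) k(2) s(1) by blast
  then consider "i < k" | "k < i" by linarith
  then show "p \<in> ?V" using half[of i k x y p] half[of k i y x p] i k s(1) by cases simp_all
next
  let ?n = "length w"
  have F: "F = word_trace \<gamma> w" and close: "\<gamma> (real ?n) = \<gamma> 0" and ne: "w \<noteq> []"
    using sp by (simp_all add: spells_along_def)
  fix p assume "p \<in> ?V"
  then obtain i where i: "i < ?n" "w ! i \<noteq> w ! (Suc i mod ?n)" "p = \<gamma> (real (Suc i))" by blast
  have 1: "p \<in> F (w ! i)" unfolding F i(3) by (rule word_traceI[OF i(1)]) simp
  have 2: "p \<in> F (w ! (Suc i mod ?n))"
  proof (cases "Suc i < ?n")
    case True
    then show ?thesis unfolding F i(3) using word_traceI[of "Suc i" w "real (Suc i)" \<gamma>] by simp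
  next
    case False
    then have "Suc i = ?n" using i(1) by simp
    then show ?thesis unfolding F i(3) using word_traceI[of 0 w 0 \<gamma>] ne close by simp
  qed
  show "p \<in> switch_points F"
    unfolding switch_points_def mem_Collect_eq
    by (rule exI[of _ "w ! i"], rule exI[of _ "w ! (Suc i mod ?n)"]) (use 1 2 i(2) in blast)
qed

text \<open>The complement of one piece is a union of open pieces, so each piece is also closed and
  no connected set can properly contain it.\<close>

lemma components_eqI:
  assumes U: "\<Union>\<C> = S"
    and c: "\<And>X. X \<in> \<C> \<Longrightarrow> X \<noteq> {} \<and> connected X \<and> openin (top_of_set S) X"
    and d: "\<And>X Y. X \<in> \<C> \<Longrightarrow> Y \<in> \<C> \<Longrightarrow> X \<noteq> Y \<Longrightarrow> X \<inter> Y = {}"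
  shows "components S = \<C>"
proof -
  have comp: "X \<in> components S" if X: "X \<in> \<C>" for X
    unfolding in_components_maximal
  proof (intro conjI allI impI)
    show "X \<noteq> {}" "connected X" "X \<subseteq> S" using c[OF X] U X by auto
    fix d assume d': "d \<noteq> {} \<and> X \<subseteq> d \<and> d \<subseteq> S \<and> connected d"
    have "S - X = \<Union>(\<C> - {X})" using U d X by blast
    then have "openin (top_of_set S) (S - X)" using c by (auto intro!: openin_Union)
    then have "closedin (top_of_set S) X" using U X by (auto simp: closedin_def)
    then have "openin (top_of_set d) (d \<inter> X)" "closedin (top_of_set d) (d \<inter> X)"
      using c[OF X] d' by (auto intro: openin_subset_trans closedin_subset_trans simp: Int_absorb1)
    moreover have "d \<inter> X \<noteq> {}" using d' c[OF X] by blast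
    ultimately have "d \<inter> X = d" using d' connected_clopen by metis
    then show "d = X" using d' by blast
  qed
  show ?thesis
  proof (intro subset_antisym subsetI)
    fix Z assume Z: "Z \<in> components S"
    then obtain z where "z \<in> Z" "z \<in> S" using in_components_nonempty in_components_subset by fast
    then obtain X where "X \<in> \<C>" "z \<in> X" using U by blast
    then show "Z \<in> \<C>" using components_eq[OF Z comp] \<open>z \<in> Z\<close> by blast
  qed (rule comp)
qed

text \<open>Broken edges are closures of components, so it must also be excluded that different arcs
  have the same closure.\<close>

lemma card_closure_components:
  assumes sp: "spells_along D F w \<gamma>" and V: "V = (\<lambda>i. \<gamma> (real (Suc i))) ` {..<length w}"
  shows "card (closure ` components (frontier D - V)) = length w"
proof -
  let ?n = "length w"
  define arc where "arc i = \<gamma> ` {real i<..<real i + 1}" for i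
  have close: "\<gamma> (real ?n) = \<gamma> 0" and ne: "w \<noteq> []" and cont: "continuous_on {0..real ?n} \<gamma>"
    and fr: "\<gamma> ` {0..real ?n} = frontier D"
    using sp by (simp_all add: spells_along_def)
  have sub: "{real i..real i + 1} \<subseteq> {0..real ?n}" if "i < ?n" for i using that by auto
  have only: "x = y" if "\<gamma> x = \<gamma> y" "x \<in> {real i<..<real i + 1}" "i < ?n" "y \<in> {0..real ?n}" for x y i
  proof -
    have "0 < x" "x < real ?n" using that(2,3) by auto
    then show ?thesis using spells_along_eq_iff[OF sp, of x y] that by auto
  qed
  have V': "V = \<gamma> ` (real ` {0..?n})"
  proof (intro subset_antisym subsetI)
    fix p assume "p \<in> \<gamma> ` (real ` {0..?n})"
    then obtain j where j: "j \<le> ?n" "p = \<gamma> (real j)" by auto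
    show "p \<in> V"
    proof (cases j)
      case 0
      then have "p = \<gamma> (real (Suc (?n - 1)))" using close j ne by (simp add: of_nat_diff Suc_leI)
      then show ?thesis unfolding V using ne by (intro image_eqI[of _ _ "?n - 1"]) auto
    next
      case (Suc i)
      then show ?thesis unfolding V using j by auto
    qed
  next
    fix p assume "p \<in> V"
    then obtain i where i: "i < ?n" "p = \<gamma> (real (Suc i))" unfolding V by blast
    then have "real (Suc i) \<in> real ` {0..?n}" by (intro imageI) simp
    then show "p \<in> \<gamma> ` (real ` {0..?n})" unfolding i(2) by (rule imageI)
  qed
  have arcV: "arc i \<inter> V = {}" if "i < ?n" for i
  proof (rule ccontr)
    assume "arc i \<inter> V \<noteq> {}"
    then obtain p where p: "p \<in> arc i" "p \<in> V" by blast
    obtain x where x: "x \<in> {real i<..<real i + 1}" "p = \<gamma> x" using p(1) unfolding arc_def by blast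
    obtain j where j: "j \<le> ?n" "p = \<gamma> (real j)" using p(2) unfolding V' by auto
    have "\<gamma> x = \<gamma> (real j)" using x(2) j(2) by (rule subst)
    then have "x = real j" using only[OF _ x(1) that] j(1) by simp
    then show False using x(1) by auto
  qed
  have arcF: "arc i \<subseteq> frontier D" if "i < ?n" for i
    unfolding arc_def fr[symmetric]
    by (rule image_mono[OF subset_trans[OF greaterThanLessThan_subseteq_atLeastAtMost_iff[THEN iffD2] sub[OF that]]]) simp
  have comps: "components (frontier D - V) = arc ` {..<?n}"
  proof (rule components_eqI)
    show "\<Union>(arc ` {..<?n}) = frontier D - V"
    proof (intro subset_antisym subsetI)
      fix p assume p: "p \<in> frontier D - V"
      then obtain t where t: "t \<in> {0..real ?n}" "p = \<gamma> t" using fr by blast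
      define i where "i = nat \<lfloor>t\<rfloor>"
      have node: "t \<noteq> real j" if "j \<le> ?n" for j using p t that unfolding V' by auto
      have "t \<noteq> real ?n" by (rule node) simp
      then have i: "i < ?n" "real i \<le> t" "t < real i + 1" using t(1) unfolding i_def by (auto, linarith+)
      then have "t \<noteq> real i" by (intro node) simp
      then have "t \<in> {real i<..<real i + 1}" "i < ?n" using i by simp_all
      then show "p \<in> \<Union>(arc ` {..<?n})" unfolding t(2) arc_def by blast
    qed (use arcV arcF in blast)
    show "X \<inter> Y = {}" if "X \<in> arc ` {..<?n}" "Y \<in> arc ` {..<?n}" "X \<noteq> Y" for X Y
    proof -
      obtain i j where ij: "i < ?n" "X = arc i" "j < ?n" "Y = arc j" using \<open>X \<in> _\<close> \<open>Y \<in> _\<close> by blast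
      show ?thesis
      proof (rule ccontr)
        assume "X \<inter> Y \<noteq> {}"
        then obtain p where p: "p \<in> arc i" "p \<in> arc j" unfolding ij by blast
        obtain x where x: "x \<in> {real i<..<real i + 1}" "p = \<gamma> x" using p(1) unfolding arc_def by blast
        obtain y where y: "y \<in> {real j<..<real j + 1}" "p = \<gamma> y" using p(2) unfolding arc_def by blast
        have xy: "x \<in> {real i<..<real i + 1}" "y \<in> {real j<..<real j + 1}" "\<gamma> x = \<gamma> y"
          using x(1) y(1) trans[OF sym[OF x(2)] y(2)] .
        have "y \<in> {0..real ?n}" using sub[OF ij(3)] xy(2) by auto
        then have "x = y" using only[OF xy(3,1) ij(1)] by blast
        then have "i = j" using xy(1,2) by auto
        then show False using \<open>X \<noteq> Y\<close> ij by simp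
      qed
    qed
    fix X assume "X \<in> arc ` {..<?n}"
    then obtain i where i: "i < ?n" "X = arc i" by blast
    have "arc i \<noteq> {}" unfolding arc_def by simp
    moreover have "connected (arc i)"
      unfolding arc_def
      by (rule connected_continuous_image[OF continuous_on_subset[OF cont]]) (use i(1) in auto)
    moreover have "openin (top_of_set (frontier D - V)) (arc i)"
    proof -
      \<comment> \<open>The rest of the curve is a compact image, so its complement cuts out the arc
        as an open subset.\<close>
      define K where "K = \<gamma> ` ({0..real i} \<union> {real i + 1..real ?n})"
      have "compact K" unfolding K_def
        by (rule compact_continuous_image[OF continuous_on_subset[OF cont]]) (use i(1) in \<open>auto intro!: compact_Un\<close>)
      then have "open (- K)" by (simp add: compact_imp_closed open_Compl)
      moreover have "arc i = (frontier D - V) \<inter> - K"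
      proof (intro subset_antisym subsetI)
        fix p assume p: "p \<in> arc i"
        then obtain x where x: "x \<in> {real i<..<real i + 1}" "p = \<gamma> x" unfolding arc_def by blast
        have "p \<notin> K"
        proof
          assume "p \<in> K"
          then obtain y where y: "\<gamma> x = \<gamma> y" "y \<in> {0..real i} \<union> {real i + 1..real ?n}"
            unfolding K_def x(2) by (rule imageE)
          then have "y \<in> {0..real ?n}" using i(1) by auto
          then have "x = y" using only[OF y(1) x(1) i(1)] by blast
          then show False using x(1) y(2) by auto
        qed
        then show "p \<in> (frontier D - V) \<inter> - K" using p arcV[OF i(1)] arcF[OF i(1)] by blast
      next
        fix p assume p: "p \<in> (frontier D - V) \<inter> - K"
        then obtain t where t: "t \<in> {0..real ?n}" "p = \<gamma> t" using fr by blast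
        then have "t \<notin> {0..real i} \<union> {real i + 1..real ?n}" using p unfolding K_def by blast
        then have "t \<in> {real i<..<real i + 1}" using t(1) by auto
        then show "p \<in> arc i" unfolding arc_def t(2) by (rule imageI)
      qed
      ultimately show ?thesis by (simp add: openin_open_Int)
    qed
    ultimately show "X \<noteq> {} \<and> connected X \<and> openin (top_of_set (frontier D - V)) X" using i(2) by simp
  qed
  have closure_arc: "closure (arc i) = \<gamma> ` {real i..real i + 1}" if i: "i < ?n" for i
  proof (intro subset_antisym)
    have c: "continuous_on {real i..real i + 1} \<gamma>" by (rule continuous_on_subset[OF cont sub[OF i]])
    have "closed (\<gamma> ` {real i..real i + 1})" using compact_continuous_image[OF c] by (simp add: compact_imp_closed)
    then show "closure (arc i) \<subseteq> \<gamma> ` {real i..real i + 1}"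
      by (intro closure_minimal) (auto simp: arc_def)
    have "{real i..real i + 1} = closure {real i<..<real i + 1}" by simp
    then show "\<gamma> ` {real i..real i + 1} \<subseteq> closure (arc i)"
      using image_closure_subset[of "{real i<..<real i + 1}" \<gamma> "closure (arc i)"] c
      by (auto simp: arc_def closure_subset)
  qed
  have "inj_on (closure \<circ> arc) {..<?n}"
  proof (rule inj_onI)
    fix i j assume ij: "i \<in> {..<?n}" "j \<in> {..<?n}" "(closure \<circ> arc) i = (closure \<circ> arc) j"
    \<comment> \<open>The middle of an arc distinguishes its closure from all others, which share at
      most end points with it.\<close>
    have "\<gamma> (real i + 1 / 2) \<in> \<gamma> ` {real i..real i + 1}" by (intro imageI) simp
    also have "\<dots> = \<gamma> ` {real j..real j + 1}" using ij closure_arc by simp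
    finally obtain y where y: "\<gamma> (real i + 1 / 2) = \<gamma> y" "y \<in> {real j..real j + 1}" by blast
    have "real i + 1 / 2 = y" using only[OF y(1), of i] sub[of j] y(2) ij by auto
    then show "i = j" using y(2) by auto
  qed
  then have "card ((closure \<circ> arc) ` {..<?n}) = ?n" using card_image by fastforce
  then show ?thesis by (simp add: comps image_comp)
qed

text \<open>Equal neighbours, including the last and the first letter, are rotated to the front and
  merged; the word becomes shorter and keeps its set of letters. Two different letters ensure that
  it never shrinks to a single one.\<close>

lemma spells_cyclically_alternating:
  assumes "spells D F w" "2 \<le> card (set w)"
  obtains w' where "spells D F w'" "cyclically_alternating w'" "set w' = set w"
proof -
  have "\<exists>w'. spells D F w' \<and> cyclically_alternating w' \<and> set w' = set w"
    using assms
  proof (induction "length w" arbitrary: w rule: less_induct)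
    case less
    show ?case
    proof (cases "cyclically_alternating w")
      case True
      then show ?thesis using less.prems(1) by blast
    next
      case False
      have "\<exists>x t. spells D F (x # x # t) \<and> set (x # t) = set w \<and> length w = Suc (Suc (length t))"
      proof (cases "distinct_adj w")
        case True
        have "w \<noteq> []" using less.prems(2) by auto
        then have "last w = hd w" using True False by (simp add: cyclically_alternating_def)
        obtain x v where w: "w = x # v" using \<open>w \<noteq> []\<close> by (cases w) auto
        have "v \<noteq> []" using less.prems(2) w by auto
        then obtain u where u: "v = u @ [x]" using \<open>last w = hd w\<close> w by (metis append_butlast_last_id last_ConsR list.sel(1))
        have "spells D F ([x] @ (x # u))" by (rule spells_rotate) (use less.prems(1) w u in simp)
        then show ?thesis using w u by (intro exI[of _ x] exI[of _ u]) auto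
      next
        case False
        then obtain i where i: "Suc i < length w" "w ! i = w ! Suc i" by (auto simp: distinct_adj_conv_nth)
        define u where "u = take i w"
        define v where "v = drop (Suc (Suc i)) w"
        define x where "x = w ! i"
        have "w = u @ x # x # v"
          using id_take_nth_drop[of i w] Cons_nth_drop_Suc[of "Suc i" w] i unfolding u_def v_def x_def by simp
        moreover have "spells D F ((x # x # v) @ u)" by (rule spells_rotate) (use less.prems(1) calculation in simp)
        ultimately show ?thesis by (intro exI[of _ x] exI[of _ "v @ u"]) auto
      qed
      then obtain x t where t: "spells D F (x # x # t)" "set (x # t) = set w" "length w = Suc (Suc (length t))" by blast
      show ?thesis
        using less.hyps[of "x # t"] spells_merge[OF t(1)] less.prems(2) t(2,3) by simp
    qed
  qed
  then show thesis using that by blast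
qed

context polygon
begin

text \<open>In characteristic two the sum of two parities vanishes exactly if they are equal, and
  the swap of coordinates is injective.\<close>

lemma odd_vertices_eq: "odd_vertices vs = switch_points labels"
proof -
  have "odd_vertices vs = (\<lambda>i. vertex (Suc i)) `
      {i. i < n \<and> segment_parity (edge vs i) + segment_parity (edge vs (Suc i)) \<noteq> (0, 0)}"
    unfolding odd_vertices_def vertex_def by blast
  also have "\<dots> = (\<lambda>i. vertex (Suc i)) ` {i. i < n \<and> word ! i \<noteq> word ! (Suc i mod n)}"
  proof (rule arg_cong[of _ _ "image (\<lambda>i. vertex (Suc i))"], rule Collect_cong, rule conj_cong[OF refl])
    fix i assume "i < n"
    then have "word ! i = prod.swap (segment_parity (edge vs i))"
      "word ! (Suc i mod n) = prod.swap (segment_parity (edge vs (Suc i)))"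
      using nonempty edge_mod(1)[of "Suc i"] by (simp_all add: word_def)
    then show "segment_parity (edge vs i) + segment_parity (edge vs (Suc i)) \<noteq> (0, 0) \<longleftrightarrow> word ! i \<noteq> word ! (Suc i mod n)"
      by (simp add: zero_prod_def[symmetric] bit_pair_add_eq_0_iff inj_eq[OF inj_swap])
  qed
  also have "\<dots> = switch_points labels"
    unfolding switch_points_eq[OF spells_polygon] length_word polyline_nat ..
  finally show ?thesis .
qed

text \<open>With a single label there would be no odd vertices, and the whole boundary would be the
  only broken edge. In an alternating word every letter ends at a switch point, so its length is the
  number of broken edges.\<close>

lemma polygon_word:
  assumes "1 < card (broken_edges P vs)"
  obtains w where "spells P labels w" "cyclically_alternating w" "set w = set word" "length w = card (broken_edges P vs)"
proof -
  have "2 \<le> card (set word)"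
  proof (rule ccontr)
    assume "\<not> 2 \<le> card (set word)"
    then have "card (set word) \<le> 1" by simp
    then have "word ! i = word ! j" if "i < n" "j < n" for i j
      using that length_word by (metis List.finite_set card_le_Suc0_iff_eq One_nat_def nth_mem)
    then have "{i. i < n \<and> word ! i \<noteq> word ! (Suc i mod n)} = {}"
      using mod_less_divisor[OF nonempty] by blast
    then have "odd_vertices vs = {}"
      unfolding odd_vertices_eq switch_points_eq[OF spells_polygon] length_word by simp
    moreover have "connected (frontier P)"
      using spells_polygon unfolding spells_along_def by (metis connected_continuous_image connected_Icc)
    moreover have "frontier P \<noteq> {}" using spells_polygon unfolding spells_along_def by fastforce
    ultimately have "broken_edges P vs = {closure (frontier P)}"
      unfolding broken_edges_def by (simp add: components_eq_sing_iff[THEN iffD2])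
    then show False using assms by simp
  qed
  then obtain w where w: "spells P labels w" "cyclically_alternating w" "set w = set word"
    using spells_cyclically_alternating[OF spellsI[OF spells_polygon]] by blast
  obtain \<delta> where \<delta>: "spells_along P labels w \<delta>" using w(1) by (rule spellsE)
  have "w ! i \<noteq> w ! (Suc i mod length w)" if "i < length w" for i
  proof (cases "Suc i < length w")
    case True
    then show ?thesis using w(2) by (simp add: cyclically_alternating_def distinct_adj_nth)
  next
    case False
    then have "Suc i = length w" using that by simp
    moreover from this have "length w - 1 = i" "w \<noteq> []" by auto
    ultimately have "w ! i = last w" "w ! (Suc i mod length w) = hd w" by (simp_all add: last_conv_nth hd_conv_nth)
    then show ?thesis using w(2) by (simp add: cyclically_alternating_def)
  qed
  then have "odd_vertices vs = (\<lambda>i. \<delta> (real (Suc i))) ` {..<length w}"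
    unfolding odd_vertices_eq switch_points_eq[OF \<delta>] by (intro image_cong) auto
  then have "card (broken_edges P vs) = length w"
    unfolding broken_edges_def by (rule card_closure_components[OF \<delta>])
  then show thesis using that w by simp
qed

end

theorem proposition21:
  fixes P :: "(real \<times> real) set" and vs :: "(int \<times> int) list" and r :: nat
  assumes "lattice_polygon P vs"
    and "P \<subseteq> {0..} \<times> {0..}"
    and "r = card (broken_edges P vs)"
    and "r > 1"
  shows "(orientable (ambient_surface P vs) \<longleftrightarrow> card (segment_parity ` edges vs) = 2) \<and>
         (orientable (ambient_surface P vs) \<longrightarrow>
            even r \<and> connected_sum_of_copies torus (r div 2 - 1) (ambient_surface P vs)) \<and>
         (\<not> orientable (ambient_surface P vs) \<longrightarrow>
            connected_sum_of_copies projective_plane (r - 2) (ambient_surface P vs))"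
proof -
  interpret polygon P vs by unfold_locales (rule assms(1))
  obtain w where w: "spells P labels w" "cyclically_alternating w" "set w = set word" "length w = r"
    using polygon_word assms(3,4) by metis
  have nz: "0 \<notin> set w" using zero_notin_word w(3) by simp
  have card: "card (segment_parity ` edges vs) = card (set w)" using card_set_word w(3) by simp
  note iso = ambient_surface_mirror_space
  have "2 \<le> card (set w)"
  proof -
    have "{hd w, last w} \<subseteq> set w" "hd w \<noteq> last w" using w(2) by (auto simp: cyclically_alternating_def)
    then show ?thesis using card_mono[of "set w" "{hd w, last w}"] by simp
  qed
  moreover have "card (set w) \<le> 3"
  proof -
    have "set w \<subseteq> {(0, 1), (1, 0), (1, 1)}"
    proof
      fix g assume "g \<in> set w"
      then have "g \<noteq> (0, 0)" using nz by (metis zero_prod_def)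
      then show "g \<in> {(0, 1), (1, 0), (1, 1)}" by (cases g) (auto simp: bit_not_zero_iff)
    qed
    then have "card (set w) \<le> card {(0, 1), (1, 0), (1, 1 :: bit) :: bit \<times> bit}" by (intro card_mono) simp_all
    also have "\<dots> = 3" by simp
    finally show ?thesis .
  qed
  ultimately consider "card (set w) = 2" | "card (set w) = 3" by linarith
  then show ?thesis
  proof cases
    case 1
    obtain x v where xv: "w = x # v" using w(2) by (cases w) (auto simp: cyclically_alternating_def)
    define y where "y = last w"
    have y: "y \<noteq> x" "{y, x} \<subseteq> set w" using w(2) by (auto simp: y_def xv cyclically_alternating_def)
    then have set: "set w = {y, x}" using 1 card_subset_eq[of "set w" "{y, x}"] by simp
    have ne: "y \<noteq> 0" "x \<noteq> 0" using nz y(2) by auto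
    have "orientable (mirror_space P labels)" by (rule spells_two_letters_orientable[OF w(1,2) set ne y(1)])
    then have or: "orientable (ambient_surface P vs)" by (rule orientable_homeomorphic[OF iso])
    obtain m where m: "1 \<le> m" "w = concat (replicate m [x, y])"
      using two_letter_word[of x v y] w(2) set unfolding xv by auto
    \<comment> \<open>The number m of letter pairs links both sides: r = 2 m, and the number of tori
      is m - 1 = r / 2 - 1.\<close>
    have "length w = 2 * m" unfolding m(2) by (induction m) auto
    then have r: "r = 2 * m" using w(4) by simp
    have "connected_sum_of_copies torus (m - 1) (mirror_space P labels)"
      by (rule spells_two_letters_torus[OF ne y(1) m(1)]) (use w(1) m(2) in simp)
    then have "connected_sum_of_copies torus (m - 1) (ambient_surface P vs)"
      using iso by (rule connected_sum_of_copies_homeomorphic)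
    then show ?thesis using or r 1 card by simp
  next
    case 2
    have "\<not> orientable (mirror_space P labels)" by (rule spells_three_letters_not_orientable[OF w(1,2) 2 nz])
    then have nor: "\<not> orientable (ambient_surface P vs)"
      using orientable_homeomorphic iso homeomorphic_space_sym by metis
    have "connected_sum_of_copies projective_plane (r - 2) (mirror_space P labels)"
      using spells_three_letters_projective_plane[OF w(2) 2 nz w(1)] w(4) by simp
    then have "connected_sum_of_copies projective_plane (r - 2) (ambient_surface P vs)"
      using iso by (rule connected_sum_of_copies_homeomorphic)
    then show ?thesis using nor 2 card by simp
  qed
qed

end
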